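(* Let $H$ be a finite-dimensional Hopf algebra. The functor $$\mathfrak E'_R:\mathfrak{YD}^{ll}(H,\widehat H)\to{}^{\mathcal T_R(H)}\mathfrak{Alg},\qquad(X,\alpha,\beta)\mapsto(X,\gamma=(\mathrm{id}\otimes\beta)\alpha),\qquad f\mapsto f,$$ is an equivalence of categories. Moreover, the following assignments, all acting as the identity on morphisms, form a commutative square of equivalences of categories: $\mathfrak{YD}^{ll}(H,\widehat H)\to{}^{\mathcal T_R(H)}\mathfrak{Alg}$, $(X,\alpha,\beta)\mapsto(X,\gamma)$; ${}^{\mathcal T_R(H)}\mathfrak{Alg}\to\mathfrak{Alg}_{\mathcal D_R(H)}$, $(X,\gamma)\mapsto(X,\lhd_\gamma)$; $\mathfrak{YD}^{ll}(H,\widehat H)\to{}^H\mathfrak{YD}_H$, $(X,\alpha,\beta)\mapsto(X,\lhd_\beta,\alpha)$; and ${}^H\mathfrak{YD}_H\to\mathfrak{Alg}_{\mathcal D_R(H)}$, $(X,\lhd,\alpha)\mapsto(X,\cdot)$ with $x\cdot(\omega\bowtie h)=\mathbf p(x_{[-1]},\omega)\,(x_{[0]}\lhd h)$, where $\alpha(x)=x_{[-1]}^{\mathrm{op}}\otimes x_{[0]}$.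
   Context: $\Bbbk$ is a field, algebras are unital $\Bbbk$-algebras. $H$ has structure maps $\Delta,\varepsilon,S$ ($S$ bijective), with Sweedler notation; $\widehat H$ is the dual Hopf algebra (coproduct $\widehat\Delta$) and $\mathbf p(h,\theta)=\theta(h)$, with $\mathbf p(h,\theta\theta')=\mathbf p(h_{(1)},\theta)\mathbf p(h_{(2)},\theta')$, $\mathbf p(hh',\theta)=\mathbf p(h,\theta_{(1)})\mathbf p(h',\theta_{(2)})$. $H^{\mathrm{op}}$ is the Hopf algebra with opposite product (elements $h^{\mathrm{op}}$) and the same coproduct. For dual bases $(h_i)$, $(\widehat h_i)$, ${}^{\circ}U=\sum_ih_i^{\mathrm{op}}\otimes\widehat h_i\in H^{\mathrm{op}}\otimes\widehat H$, which is invertible. $\mathrm{Ad}(W)(z)=WzW^{-1}$; $\Sigma$ is the flip. Left coactions of a Hopf algebra $K$ on an algebra $X$ are coassociative and counital algebra homomorphisms $X\to K\otimes X$; right actions are right $K$-module algebra structures. $\mathfrak{Alg}_K$ is the category of right $K$-module algebras and ${}^K\mathfrak{Alg}$ that of left $K$-comodule algebras, with morphisms the algebra homomorphisms commuting with the (co)actions. Every left coaction $\gamma$ of $K$ induces the right action $x\lhd_\gamma\omega=(\omega\otimes\mathrm{id})(\gamma(x))$ of the dual Hopf algebra of $K$. $\mathfrak{YD}^{ll}(H,\widehat H)$: objects are triples $(X,\alpha,\beta)$ with left coactions $\alpha:X\to H^{\mathrm{op}}\otimes X$ of $H^{\mathrm{op}}$ and $\beta:X\to\widehat H\otimes X$ of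 $\widehat H$ such that $(\mathrm{id}\otimes\alpha)\beta=(\Sigma\otimes\mathrm{id}_X)(\mathrm{Ad}({}^{\circ}U)\otimes\mathrm{id}_X)(\mathrm{id}\otimes\beta)\alpha$; morphisms are algebra homomorphisms intertwining both coactions. ${}^H\mathfrak{YD}_H$: objects are triples $(X,\lhd,\alpha)$ with $\lhd$ a right action of $H$ and $\alpha:X\to H^{\mathrm{op}}\otimes X$, $\alpha(x)=x_{[-1]}^{\mathrm{op}}\otimes x_{[0]}$, a left coaction of $H^{\mathrm{op}}$ such that $x_{[-1]}h_{(1)}\otimes(x_{[0]}\lhd h_{(2)})=h_{(2)}(x\lhd h_{(1)})_{[-1]}\otimes(x\lhd h_{(1)})_{[0]}$; morphisms are algebra homomorphisms intertwining action and coaction. $x\lhd_\beta h=(\mathbf p(h,\cdot)\otimes\mathrm{id})(\beta(x))$. $\mathcal T_R(H)=H^{\mathrm{op}}\otimes\widehat H$ (Drinfeld codouble) is the Hopf algebra with the tensor product algebra structure and coproduct $(\mathrm{id}\otimes\Sigma\,\mathrm{Ad}({}^{\circ}U)\otimes\mathrm{id})(\Delta_{H^{\mathrm{op}}}\otimes\widehat\Delta)$. $\mathcal D_R(H)=\widehat H^{\mathrm{co}}\bowtie H$ (Radford's form of the Drinfeld double) is its dual Hopf algebra, with underlying space $\widehat H\otimes H$ and pairing $(\omega\bowtie h,\ g^{\mathrm{op}}\otimes\theta)\mapsto\mathbf p(g,\omega)\mathbf p(h,\theta)$. *)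

theory Defs
  imports "HOL-Algebra.Module"
begin

section \<open>Tensor products over a field\<close>

text \<open>
  A formal sum \<open>a\<^sub>1 \<otimes> b\<^sub>1 + \<dots> + a\<^sub>n \<otimes> b\<^sub>n\<close> is the list of the pairs \<open>(a\<^sub>i, b\<^sub>i)\<close>, and addition
  is concatenation.  The tensor product of \<open>A\<close> and \<open>B\<close> over \<open>k\<close> is the quotient of the formal sums
  by the congruence generated by commutativity of addition and by bilinearity of \<open>\<otimes>\<close>.
  Coefficients and signs are absorbed into the first factor.
\<close>

inductive tens_rel ::
  "'k ring \<Rightarrow> ('k, 'a, 'm) module_scheme \<Rightarrow> ('k, 'b, 'n) module_scheme \<Rightarrow>
    ('a \<times> 'b) list \<Rightarrow> ('a \<times> 'b) list \<Rightarrow> bool"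
  for k A B where
  refl: "set zs \<subseteq> carrier A \<times> carrier B \<Longrightarrow> tens_rel k A B zs zs"
| sym: "tens_rel k A B zs ws \<Longrightarrow> tens_rel k A B ws zs"
| trans: "tens_rel k A B zs ws \<Longrightarrow> tens_rel k A B ws vs \<Longrightarrow> tens_rel k A B zs vs"
| append: "tens_rel k A B zs zs' \<Longrightarrow> tens_rel k A B ws ws' \<Longrightarrow> tens_rel k A B (zs @ ws) (zs' @ ws')"
| comm: "set zs \<subseteq> carrier A \<times> carrier B \<Longrightarrow> set ws \<subseteq> carrier A \<times> carrier B \<Longrightarrow>
    tens_rel k A B (zs @ ws) (ws @ zs)"
| zero: "b \<in> carrier B \<Longrightarrow> tens_rel k A B [(\<zero>\<^bsub>A\<^esub>, b)] []"
| add_left: "a \<in> carrier A \<Longrightarrow> a' \<in> carrier A \<Longrightarrow> b \<in> carrier B \<Longrightarrow>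
    tens_rel k A B [(a \<oplus>\<^bsub>A\<^esub> a', b)] [(a, b), (a', b)]"
| add_right: "a \<in> carrier A \<Longrightarrow> b \<in> carrier B \<Longrightarrow> b' \<in> carrier B \<Longrightarrow>
    tens_rel k A B [(a, b \<oplus>\<^bsub>B\<^esub> b')] [(a, b), (a, b')]"
| smult: "c \<in> carrier k \<Longrightarrow> a \<in> carrier A \<Longrightarrow> b \<in> carrier B \<Longrightarrow>
    tens_rel k A B [(c \<odot>\<^bsub>A\<^esub> a, b)] [(a, c \<odot>\<^bsub>B\<^esub> b)]"

type_synonym ('a, 'b) tens = "('a \<times> 'b) list set"

definition tclass ::
  "'k ring \<Rightarrow> ('k, 'a, 'm) module_scheme \<Rightarrow> ('k, 'b, 'n) module_scheme \<Rightarrow>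
    ('a \<times> 'b) list \<Rightarrow> ('a, 'b) tens" where
  "tclass k A B zs = {ws. tens_rel k A B zs ws}"

definition tens ::
  "'k ring \<Rightarrow> ('k, 'a, 'm) module_scheme \<Rightarrow> ('k, 'b, 'n) module_scheme \<Rightarrow> 'a \<Rightarrow> 'b \<Rightarrow> ('a, 'b) tens" where
  "tens k A B a b = tclass k A B [(a, b)]"

text \<open>
  The vector space \<open>A \<otimes> B\<close> with the product \<open>(a \<otimes> b)(a' \<otimes> b') = aa' \<otimes> bb'\<close>.
\<close>

definition tensor ::
  "'k ring \<Rightarrow> ('k, 'a, 'm) module_scheme \<Rightarrow> ('k, 'b, 'n) module_scheme \<Rightarrow> ('k, ('a, 'b) tens) module" where
  "tensor k A B =
    \<lparr> carrier = tclass k A B ` {zs. set zs \<subseteq> carrier A \<times> carrier B},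
      mult = (\<lambda>Z W. \<Union>zs\<in>Z. \<Union>ws\<in>W.
        tclass k A B [(a \<otimes>\<^bsub>A\<^esub> a', b \<otimes>\<^bsub>B\<^esub> b'). (a, b) \<leftarrow> zs, (a', b') \<leftarrow> ws]),
      one = tens k A B \<one>\<^bsub>A\<^esub> \<one>\<^bsub>B\<^esub>,
      zero = tclass k A B [],
      add = (\<lambda>Z W. \<Union>zs\<in>Z. \<Union>ws\<in>W. tclass k A B (zs @ ws)),
      smult = (\<lambda>c Z. \<Union>zs\<in>Z. tclass k A B [(c \<odot>\<^bsub>A\<^esub> a, b). (a, b) \<leftarrow> zs]) \<rparr>"

text \<open>
  \<open>sweedler C z (\<lambda>a b. f a b)\<close> is the image of \<open>z \<in> A \<otimes> B\<close> under the linear map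
  \<open>A \<otimes> B \<rightarrow> C\<close> with \<open>a \<otimes> b \<mapsto> f a b\<close>, for bilinear \<open>f\<close>: the value of \<open>f z\<^sub>(\<^sub>1\<^sub>) z\<^sub>(\<^sub>2\<^sub>)\<close> in
  Sweedler notation.  It does not depend on the representative of \<open>z\<close>
  (lemma \<open>sweedler_tclass\<close> below).
\<close>

definition formal_eval :: "('c, 'm) ring_scheme \<Rightarrow> ('a \<Rightarrow> 'b \<Rightarrow> 'c) \<Rightarrow> ('a \<times> 'b) list \<Rightarrow> 'c" where
  "formal_eval C f zs = foldr (\<lambda>(a, b) s. f a b \<oplus>\<^bsub>C\<^esub> s) zs \<zero>\<^bsub>C\<^esub>"

definition sweedler :: "('c, 'm) ring_scheme \<Rightarrow> ('a, 'b) tens \<Rightarrow> ('a \<Rightarrow> 'b \<Rightarrow> 'c) \<Rightarrow> 'c" where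
  "sweedler C z f = the_elem (formal_eval C f ` z)"

lemma tens_rel_carrier:
  assumes "module k A" "module k B" "tens_rel k A B zs ws"
  shows "set zs \<subseteq> carrier A \<times> carrier B \<and> set ws \<subseteq> carrier A \<times> carrier B"
proof -
  interpret A: module k A by fact
  interpret B: module k B by fact
  show ?thesis using assms(3) by induction auto
qed

lemma sweedler_tclass:
  assumes "module k A" "module k B" "abelian_group C"
    and closed: "\<And>a b. a \<in> carrier A \<Longrightarrow> b \<in> carrier B \<Longrightarrow> f a b \<in> carrier C"
    and left: "\<And>a a' b. a \<in> carrier A \<Longrightarrow> a' \<in> carrier A \<Longrightarrow> b \<in> carrier B \<Longrightarrow>
      f (a \<oplus>\<^bsub>A\<^esub> a') b = f a b \<oplus>\<^bsub>C\<^esub> f a' b"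
    and right: "\<And>a b b'. a \<in> carrier A \<Longrightarrow> b \<in> carrier B \<Longrightarrow> b' \<in> carrier B \<Longrightarrow>
      f a (b \<oplus>\<^bsub>B\<^esub> b') = f a b \<oplus>\<^bsub>C\<^esub> f a b'"
    and balanced: "\<And>c a b. c \<in> carrier k \<Longrightarrow> a \<in> carrier A \<Longrightarrow> b \<in> carrier B \<Longrightarrow>
      f (c \<odot>\<^bsub>A\<^esub> a) b = f a (c \<odot>\<^bsub>B\<^esub> b)"
    and zs: "set zs \<subseteq> carrier A \<times> carrier B"
  shows "sweedler C (tclass k A B zs) f = formal_eval C f zs"
proof -
  interpret A: module k A by fact
  interpret B: module k B by fact
  interpret C: abelian_group C by fact
  have ev_closed: "formal_eval C f us \<in> carrier C" if "set us \<subseteq> carrier A \<times> carrier B" for us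
    using that by (induction us) (auto simp: formal_eval_def closed)
  have ev_append: "formal_eval C f (us @ vs) = formal_eval C f us \<oplus>\<^bsub>C\<^esub> formal_eval C f vs"
    if "set us \<subseteq> carrier A \<times> carrier B" "set vs \<subseteq> carrier A \<times> carrier B" for us vs
    using that(1)
  proof (induction us)
    case Nil
    then show ?case using ev_closed[OF that(2)] by (simp add: formal_eval_def)
  next
    case (Cons u us)
    then show ?case using ev_closed[OF that(2)] ev_closed[of us] closed
      by (cases u) (simp add: formal_eval_def C.a_assoc)
  qed
  have zero: "f \<zero>\<^bsub>A\<^esub> b = \<zero>\<^bsub>C\<^esub>" if "b \<in> carrier B" for b
    using left[of "\<zero>\<^bsub>A\<^esub>" "\<zero>\<^bsub>A\<^esub>" b] closed[of "\<zero>\<^bsub>A\<^esub>" b] that by simp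
  have rel: "formal_eval C f us = formal_eval C f vs" if "tens_rel k A B us vs" for us vs
    using that
  proof induction
    case (append us us' vs vs')
    then show ?case using tens_rel_carrier[OF assms(1,2)] by (metis ev_append)
  next
    case (comm us vs)
    then show ?case using C.a_comm ev_append ev_closed by presburger
  qed (auto simp: formal_eval_def zero left right balanced closed)
  have "formal_eval C f ` tclass k A B zs = {formal_eval C f zs}"
    using rel tens_rel.refl[OF zs] unfolding tclass_def by fastforce
  then show ?thesis by (simp add: sweedler_def)
qed

definition tmap ::
  "'k ring \<Rightarrow> ('k, 'c, 'm) module_scheme \<Rightarrow> ('k, 'd, 'n) module_scheme \<Rightarrow>
    ('a \<Rightarrow> 'c) \<Rightarrow> ('b \<Rightarrow> 'd) \<Rightarrow> ('a, 'b) tens \<Rightarrow> ('c, 'd) tens" where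
  "tmap k C D f g z = sweedler (tensor k C D) z (\<lambda>a b. tens k C D (f a) (g b))"

definition tflip ::
  "'k ring \<Rightarrow> ('k, 'a, 'm) module_scheme \<Rightarrow> ('k, 'b, 'n) module_scheme \<Rightarrow> ('a, 'b) tens \<Rightarrow> ('b, 'a) tens" where
  "tflip k A B z = sweedler (tensor k B A) z (\<lambda>a b. tens k B A b a)"

definition assoc_right ::
  "'k ring \<Rightarrow> ('k, 'a, 'm) module_scheme \<Rightarrow> ('k, 'b, 'n) module_scheme \<Rightarrow> ('k, 'c, 'o) module_scheme \<Rightarrow>
    (('a, 'b) tens, 'c) tens \<Rightarrow> ('a, ('b, 'c) tens) tens" where
  "assoc_right k A B C z =
    (let T = tensor k A (tensor k B C) in
     sweedler T z (\<lambda>w c. sweedler T w (\<lambda>a b. tens k A (tensor k B C) a (tens k B C b c))))"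

definition assoc_left ::
  "'k ring \<Rightarrow> ('k, 'a, 'm) module_scheme \<Rightarrow> ('k, 'b, 'n) module_scheme \<Rightarrow> ('k, 'c, 'o) module_scheme \<Rightarrow>
    ('a, ('b, 'c) tens) tens \<Rightarrow> (('a, 'b) tens, 'c) tens" where
  "assoc_left k A B C z =
    (let T = tensor k (tensor k A B) C in
     sweedler T z (\<lambda>a w. sweedler T w (\<lambda>b c. tens k (tensor k A B) C (tens k A B a b) c)))"


section \<open>Algebras and finite-dimensional vector spaces\<close>

text \<open>
  The locale \<open>algebra\<close> of the library is restricted to commutative algebras.
\<close>

locale k_algebra = module k A + ring A for k :: "'k ring" and A :: "('k, 'a, 'm) module_scheme" +
  assumes smult_mult_left: "\<lbrakk>c \<in> carrier k; x \<in> carrier A; y \<in> carrier A\<rbrakk> \<Longrightarrow>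
      (c \<odot>\<^bsub>A\<^esub> x) \<otimes>\<^bsub>A\<^esub> y = c \<odot>\<^bsub>A\<^esub> (x \<otimes>\<^bsub>A\<^esub> y)"
    and smult_mult_right: "\<lbrakk>c \<in> carrier k; x \<in> carrier A; y \<in> carrier A\<rbrakk> \<Longrightarrow>
      x \<otimes>\<^bsub>A\<^esub> (c \<odot>\<^bsub>A\<^esub> y) = c \<odot>\<^bsub>A\<^esub> (x \<otimes>\<^bsub>A\<^esub> y)"

definition linear_map ::
  "'k ring \<Rightarrow> ('k, 'a, 'm) module_scheme \<Rightarrow> ('k, 'b, 'n) module_scheme \<Rightarrow> ('a \<Rightarrow> 'b) \<Rightarrow> bool" where
  "linear_map k A B f \<longleftrightarrow> f \<in> carrier A \<rightarrow> carrier B \<and>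
    (\<forall>x\<in>carrier A. \<forall>y\<in>carrier A. f (x \<oplus>\<^bsub>A\<^esub> y) = f x \<oplus>\<^bsub>B\<^esub> f y) \<and>
    (\<forall>c\<in>carrier k. \<forall>x\<in>carrier A. f (c \<odot>\<^bsub>A\<^esub> x) = c \<odot>\<^bsub>B\<^esub> f x)"

definition linear_functional :: "'k ring \<Rightarrow> ('k, 'a, 'm) module_scheme \<Rightarrow> ('a \<Rightarrow> 'k) \<Rightarrow> bool" where
  "linear_functional k A f \<longleftrightarrow> f \<in> carrier A \<rightarrow> carrier k \<and>
    (\<forall>x\<in>carrier A. \<forall>y\<in>carrier A. f (x \<oplus>\<^bsub>A\<^esub> y) = f x \<oplus>\<^bsub>k\<^esub> f y) \<and>
    (\<forall>c\<in>carrier k. \<forall>x\<in>carrier A. f (c \<odot>\<^bsub>A\<^esub> x) = c \<otimes>\<^bsub>k\<^esub> f x)"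

definition algebra_hom ::
  "'k ring \<Rightarrow> ('k, 'a, 'm) module_scheme \<Rightarrow> ('k, 'b, 'n) module_scheme \<Rightarrow> ('a \<Rightarrow> 'b) \<Rightarrow> bool" where
  "algebra_hom k A B f \<longleftrightarrow> linear_map k A B f \<and> f \<in> ring_hom A B"

definition is_basis :: "'k ring \<Rightarrow> ('k, 'a, 'm) module_scheme \<Rightarrow> 'a set \<Rightarrow> bool" where
  "is_basis k V B \<longleftrightarrow> finite B \<and> B \<subseteq> carrier V \<and>
    (\<forall>x\<in>carrier V. \<exists>!c. c \<in> B \<rightarrow>\<^sub>E carrier k \<and> x = (\<Oplus>\<^bsub>V\<^esub>b\<in>B. c b \<odot>\<^bsub>V\<^esub> b))"

definition coordinate :: "'k ring \<Rightarrow> ('k, 'a, 'm) module_scheme \<Rightarrow> 'a set \<Rightarrow> 'a \<Rightarrow> 'a \<Rightarrow> 'k" where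
  "coordinate k V B b =
    (\<lambda>x\<in>carrier V. (THE c. c \<in> B \<rightarrow>\<^sub>E carrier k \<and> x = (\<Oplus>\<^bsub>V\<^esub>b'\<in>B. c b' \<odot>\<^bsub>V\<^esub> b')) b)"

definition finite_dimensional :: "'k ring \<Rightarrow> ('k, 'a, 'm) module_scheme \<Rightarrow> bool" where
  "finite_dimensional k V \<longleftrightarrow> (\<exists>B. is_basis k V B)"


section \<open>Hopf algebras and their duals\<close>

record ('k, 'a) bialg = "('k, 'a) module" +
  comult :: "'a \<Rightarrow> ('a, 'a) tens"
  counit :: "'a \<Rightarrow> 'k"

definition mk_bialg ::
  "('k, 'a, 'm) module_scheme \<Rightarrow> ('a \<Rightarrow> ('a, 'a) tens) \<Rightarrow> ('a \<Rightarrow> 'k) \<Rightarrow> ('k, 'a) bialg" where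
  "mk_bialg A \<Delta> \<epsilon> =
    \<lparr> carrier = carrier A, mult = mult A, one = one A, zero = zero A, add = add A, smult = smult A,
      comult = \<Delta>, counit = \<epsilon> \<rparr>"

definition bialgebra :: "'k ring \<Rightarrow> ('k, 'a) bialg \<Rightarrow> bool" where
  "bialgebra k H \<longleftrightarrow> k_algebra k H \<and>
    algebra_hom k H (tensor k H H) (comult H) \<and>
    linear_functional k H (counit H) \<and> counit H \<in> ring_hom H k \<and>
    (\<forall>h\<in>carrier H.
      assoc_right k H H H (tmap k (tensor k H H) H (comult H) id (comult H h)) =
        tmap k H (tensor k H H) id (comult H) (comult H h) \<and>
      sweedler H (comult H h) (\<lambda>a b. counit H a \<odot>\<^bsub>H\<^esub> b) = h \<and>
      sweedler H (comult H h) (\<lambda>a b. counit H b \<odot>\<^bsub>H\<^esub> a) = h)"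

definition is_antipode :: "'k ring \<Rightarrow> ('k, 'a) bialg \<Rightarrow> ('a \<Rightarrow> 'a) \<Rightarrow> bool" where
  "is_antipode k H S \<longleftrightarrow> linear_map k H H S \<and>
    (\<forall>h\<in>carrier H.
      sweedler H (comult H h) (\<lambda>a b. S a \<otimes>\<^bsub>H\<^esub> b) = counit H h \<odot>\<^bsub>H\<^esub> \<one>\<^bsub>H\<^esub> \<and>
      sweedler H (comult H h) (\<lambda>a b. a \<otimes>\<^bsub>H\<^esub> S b) = counit H h \<odot>\<^bsub>H\<^esub> \<one>\<^bsub>H\<^esub>)"

text \<open>
  The antipode is determined by the bialgebra, so it is not part of the record.
  It is required to be bijective.
\<close>

definition hopf_algebra :: "'k ring \<Rightarrow> ('k, 'a) bialg \<Rightarrow> bool" where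
  "hopf_algebra k H \<longleftrightarrow> bialgebra k H \<and>
    (\<exists>S. is_antipode k H S \<and> bij_betw S (carrier H) (carrier H))"

definition opp :: "('k, 'a) bialg \<Rightarrow> ('k, 'a) bialg" where
  "opp H = H\<lparr>mult := (\<lambda>x y. y \<otimes>\<^bsub>H\<^esub> x)\<rparr>"

text \<open>
  \<open>dual_along k K V P\<close> equips the vector space \<open>V\<close> with the structure dual to that of \<open>K\<close> along
  the pairing \<open>P\<close> of \<open>V\<close> with \<open>K\<close>:
  \<open>P(vv', x) = P(v, x\<^sub>(\<^sub>1\<^sub>)) P(v', x\<^sub>(\<^sub>2\<^sub>))\<close> and \<open>P(v, xx') = P(v\<^sub>(\<^sub>1\<^sub>), x) P(v\<^sub>(\<^sub>2\<^sub>), x')\<close>.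
  These equations have unique solutions when \<open>K\<close> is finite-dimensional and \<open>P\<close> identifies \<open>V\<close> with
  the space of all linear functionals on \<open>K\<close>.  The fields \<open>mult\<close> and \<open>one\<close> of \<open>V\<close> are not used.
\<close>

definition dual_along ::
  "'k ring \<Rightarrow> ('k, 'a) bialg \<Rightarrow> ('k, 'v, 'm) module_scheme \<Rightarrow> ('v \<Rightarrow> 'a \<Rightarrow> 'k) \<Rightarrow> ('k, 'v) bialg" where
  "dual_along k K V P = mk_bialg
    (V\<lparr>mult := (\<lambda>v v'. THE w. w \<in> carrier V \<and> (\<forall>x\<in>carrier K.
          P w x = sweedler k (comult K x) (\<lambda>x1 x2. P v x1 \<otimes>\<^bsub>k\<^esub> P v' x2))),
       one := (THE w. w \<in> carrier V \<and> (\<forall>x\<in>carrier K. P w x = counit K x))\<rparr>)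
    (\<lambda>v. THE z. z \<in> carrier (tensor k V V) \<and> (\<forall>x\<in>carrier K. \<forall>x'\<in>carrier K.
        P v (x \<otimes>\<^bsub>K\<^esub> x') = sweedler k z (\<lambda>v1 v2. P v1 x \<otimes>\<^bsub>k\<^esub> P v2 x')))
    (\<lambda>v. P v \<one>\<^bsub>K\<^esub>)"

definition functionals :: "'k ring \<Rightarrow> ('k, 'a, 'm) module_scheme \<Rightarrow> ('k, 'a \<Rightarrow> 'k) module" where
  "functionals k A =
    \<lparr> carrier = {\<theta> \<in> extensional (carrier A). linear_functional k A \<theta>},
      mult = undefined, one = undefined,
      zero = (\<lambda>x\<in>carrier A. \<zero>\<^bsub>k\<^esub>),
      add = (\<lambda>\<theta> \<theta>'. \<lambda>x\<in>carrier A. \<theta> x \<oplus>\<^bsub>k\<^esub> \<theta>' x),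
      smult = (\<lambda>c \<theta>. \<lambda>x\<in>carrier A. c \<otimes>\<^bsub>k\<^esub> \<theta> x) \<rparr>"

definition dual :: "'k ring \<Rightarrow> ('k, 'a) bialg \<Rightarrow> ('k, 'a \<Rightarrow> 'k) bialg" where
  "dual k H = dual_along k H (functionals k H) (\<lambda>\<theta> h. \<theta> h)"


section \<open>Drinfeld codouble and double\<close>

text \<open>
  The element \<open>\<Sum>\<^sub>i h\<^sub>i \<otimes> h\<^sub>i\<^sup>*\<close> for a basis \<open>(h\<^sub>i)\<close> of \<open>H\<close> and its dual basis; it does not depend
  on the choice of the basis.
\<close>

definition canonical_U :: "'k ring \<Rightarrow> ('k, 'a) bialg \<Rightarrow> ('a, 'a \<Rightarrow> 'k) tens" where
  "canonical_U k H =
    (let B = (SOME B. is_basis k H B) in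
     \<Oplus>\<^bsub>tensor k (opp H) (dual k H)\<^esub>b\<in>B. tens k (opp H) (dual k H) b (coordinate k H B b))"

definition Ad :: "('k, 'a, 'm) module_scheme \<Rightarrow> 'a \<Rightarrow> 'a \<Rightarrow> 'a" where
  "Ad A w z = w \<otimes>\<^bsub>A\<^esub> z \<otimes>\<^bsub>A\<^esub> inv\<^bsub>A\<^esub> w"

definition Ad_U :: "'k ring \<Rightarrow> ('k, 'a) bialg \<Rightarrow> ('a, 'a \<Rightarrow> 'k) tens \<Rightarrow> ('a, 'a \<Rightarrow> 'k) tens" where
  "Ad_U k H = Ad (tensor k (opp H) (dual k H)) (canonical_U k H)"

text \<open>
  In the coproduct, \<open>\<theta>'\<close> and \<open>g'\<close> are the legs of \<open>\<Sigma>(Ad(U)(g\<^sub>(\<^sub>2\<^sub>) \<otimes> \<theta>\<^sub>(\<^sub>1\<^sub>))) \<in> dual H \<otimes> opp H\<close>.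
  The counit is the tensor product of the counits.
\<close>

definition codouble :: "'k ring \<Rightarrow> ('k, 'a) bialg \<Rightarrow> ('k, ('a, 'a \<Rightarrow> 'k) tens) bialg" where
  "codouble k H =
    (let G = opp H; D = dual k H; T = tensor k G D; TT = tensor k T T in
     mk_bialg T
      (\<lambda>t. sweedler TT t (\<lambda>g \<theta>.
        sweedler TT (comult G g) (\<lambda>g1 g2.
        sweedler TT (comult D \<theta>) (\<lambda>\<theta>1 \<theta>2.
        sweedler TT (tflip k G D (Ad_U k H (tens k G D g2 \<theta>1))) (\<lambda>\<theta>' g'.
          tens k T T (tens k G D g1 \<theta>') (tens k G D g' \<theta>2))))))
      (\<lambda>t. sweedler k t (\<lambda>g \<theta>. counit G g \<otimes>\<^bsub>k\<^esub> counit D \<theta>)))"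

definition double_pairing ::
  "'k ring \<Rightarrow> ('a \<Rightarrow> 'k, 'a) tens \<Rightarrow> ('a, 'a \<Rightarrow> 'k) tens \<Rightarrow> 'k" where
  "double_pairing k d t =
    sweedler k d (\<lambda>\<omega> h. sweedler k t (\<lambda>g \<theta>. \<omega> g \<otimes>\<^bsub>k\<^esub> \<theta> h))"

definition double :: "'k ring \<Rightarrow> ('k, 'a) bialg \<Rightarrow> ('k, ('a \<Rightarrow> 'k, 'a) tens) bialg" where
  "double k H = dual_along k (codouble k H) (tensor k (dual k H) H) (double_pairing k)"


section \<open>Actions and coactions\<close>

definition left_coaction ::
  "'k ring \<Rightarrow> ('k, 'a) bialg \<Rightarrow> ('k, 'x) module \<Rightarrow> ('x \<Rightarrow> ('a, 'x) tens) \<Rightarrow> bool" where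
  "left_coaction k K X \<gamma> \<longleftrightarrow>
    \<gamma> \<in> extensional (carrier X) \<and> algebra_hom k X (tensor k K X) \<gamma> \<and>
    (\<forall>x\<in>carrier X.
      assoc_right k K K X (tmap k (tensor k K K) X (comult K) id (\<gamma> x)) =
        tmap k K (tensor k K X) id \<gamma> (\<gamma> x) \<and>
      sweedler X (\<gamma> x) (\<lambda>a y. counit K a \<odot>\<^bsub>X\<^esub> y) = x)"

definition right_action ::
  "'k ring \<Rightarrow> ('k, 'a) bialg \<Rightarrow> ('k, 'x) module \<Rightarrow> ('x \<Rightarrow> 'a \<Rightarrow> 'x) \<Rightarrow> bool" where
  "right_action k K X act \<longleftrightarrow>
    act \<in> extensional (carrier X) \<and>
    (\<forall>x\<in>carrier X. act x \<in> extensional (carrier K) \<and> linear_map k K X (act x)) \<and>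
    (\<forall>a\<in>carrier K. linear_map k X X (\<lambda>x. act x a)) \<and>
    (\<forall>x\<in>carrier X. act x \<one>\<^bsub>K\<^esub> = x) \<and>
    (\<forall>x\<in>carrier X. \<forall>a\<in>carrier K. \<forall>b\<in>carrier K. act x (a \<otimes>\<^bsub>K\<^esub> b) = act (act x a) b) \<and>
    (\<forall>a\<in>carrier K. act \<one>\<^bsub>X\<^esub> a = counit K a \<odot>\<^bsub>X\<^esub> \<one>\<^bsub>X\<^esub>) \<and>
    (\<forall>x\<in>carrier X. \<forall>y\<in>carrier X. \<forall>a\<in>carrier K.
      act (x \<otimes>\<^bsub>X\<^esub> y) a = sweedler X (comult K a) (\<lambda>a1 a2. act x a1 \<otimes>\<^bsub>X\<^esub> act y a2))"

text \<open>
  The right action \<open>x \<lhd> v = (P(v, \<cdot>) \<otimes> id)(\<gamma>(x))\<close> induced by a coaction of \<open>K\<close>, where the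
  elements \<open>v\<close> of the dual \<open>V\<close> are viewed as functionals on \<open>K\<close> through the pairing \<open>P\<close>.
\<close>

definition induced_action ::
  "('k, 'v) bialg \<Rightarrow> ('v \<Rightarrow> 'a \<Rightarrow> 'k) \<Rightarrow> ('k, 'x) module \<Rightarrow> ('x \<Rightarrow> ('a, 'x) tens) \<Rightarrow> ('x \<Rightarrow> 'v \<Rightarrow> 'x)" where
  "induced_action V P X \<gamma> =
    (\<lambda>x\<in>carrier X. \<lambda>v\<in>carrier V. sweedler X (\<gamma> x) (\<lambda>a y. P v a \<odot>\<^bsub>X\<^esub> y))"

definition commutes_coaction ::
  "'k ring \<Rightarrow> ('k, 'a) bialg \<Rightarrow> ('k, 'x) module \<Rightarrow> ('k, 'x) module \<Rightarrow>
    ('x \<Rightarrow> ('a, 'x) tens) \<Rightarrow> ('x \<Rightarrow> ('a, 'x) tens) \<Rightarrow> ('x \<Rightarrow> 'x) \<Rightarrow> bool" where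
  "commutes_coaction k K X Y \<gamma> \<gamma>' f \<longleftrightarrow> (\<forall>x\<in>carrier X. \<gamma>' (f x) = tmap k K Y id f (\<gamma> x))"

definition commutes_action ::
  "('k, 'a) bialg \<Rightarrow> ('k, 'x) module \<Rightarrow> ('x \<Rightarrow> 'a \<Rightarrow> 'x) \<Rightarrow> ('x \<Rightarrow> 'a \<Rightarrow> 'x) \<Rightarrow> ('x \<Rightarrow> 'x) \<Rightarrow> bool" where
  "commutes_action K X act act' f \<longleftrightarrow>
    (\<forall>x\<in>carrier X. \<forall>a\<in>carrier K. f (act x a) = act' (f x) a)"


section \<open>Categories\<close>

text \<open>
  Hom-sets are indexed by pairs of objects and need not be disjoint.
  \<open>Comp C x y z g f\<close> is the composite of \<open>f : x \<rightarrow> y\<close> and \<open>g : y \<rightarrow> z\<close>.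
\<close>

record ('o, 'm) cat =
  Obj :: "'o set"
  Hom :: "'o \<Rightarrow> 'o \<Rightarrow> 'm set"
  Idn :: "'o \<Rightarrow> 'm"
  Comp :: "'o \<Rightarrow> 'o \<Rightarrow> 'o \<Rightarrow> 'm \<Rightarrow> 'm \<Rightarrow> 'm"

definition category :: "('o, 'm) cat \<Rightarrow> bool" where
  "category C \<longleftrightarrow>
    (\<forall>x\<in>Obj C. Idn C x \<in> Hom C x x) \<and>
    (\<forall>x\<in>Obj C. \<forall>y\<in>Obj C. \<forall>z\<in>Obj C. \<forall>f\<in>Hom C x y. \<forall>g\<in>Hom C y z.
      Comp C x y z g f \<in> Hom C x z) \<and>
    (\<forall>x\<in>Obj C. \<forall>y\<in>Obj C. \<forall>f\<in>Hom C x y.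
      Comp C x x y f (Idn C x) = f \<and> Comp C x y y (Idn C y) f = f) \<and>
    (\<forall>w\<in>Obj C. \<forall>x\<in>Obj C. \<forall>y\<in>Obj C. \<forall>z\<in>Obj C.
      \<forall>f\<in>Hom C w x. \<forall>g\<in>Hom C x y. \<forall>h\<in>Hom C y z.
      Comp C w y z h (Comp C w x y g f) = Comp C w x z (Comp C x y z h g) f)"

record ('o, 'm, 'p, 'n) functor_data =
  omap :: "'o \<Rightarrow> 'p"
  mmap :: "'o \<Rightarrow> 'o \<Rightarrow> 'm \<Rightarrow> 'n"

definition is_functor :: "('o, 'm) cat \<Rightarrow> ('p, 'n) cat \<Rightarrow> ('o, 'm, 'p, 'n) functor_data \<Rightarrow> bool" where
  "is_functor C D F \<longleftrightarrow> category C \<and> category D \<and>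
    (\<forall>x\<in>Obj C. omap F x \<in> Obj D) \<and>
    (\<forall>x\<in>Obj C. \<forall>y\<in>Obj C. \<forall>f\<in>Hom C x y. mmap F x y f \<in> Hom D (omap F x) (omap F y)) \<and>
    (\<forall>x\<in>Obj C. mmap F x x (Idn C x) = Idn D (omap F x)) \<and>
    (\<forall>x\<in>Obj C. \<forall>y\<in>Obj C. \<forall>z\<in>Obj C. \<forall>f\<in>Hom C x y. \<forall>g\<in>Hom C y z.
      mmap F x z (Comp C x y z g f) =
        Comp D (omap F x) (omap F y) (omap F z) (mmap F y z g) (mmap F x y f))"

definition id_functor :: "('o, 'm, 'o, 'm) functor_data" where
  "id_functor = \<lparr> omap = (\<lambda>x. x), mmap = (\<lambda>x y f. f) \<rparr>"

definition comp_functor ::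
  "('p, 'n, 'q, 'l) functor_data \<Rightarrow> ('o, 'm, 'p, 'n) functor_data \<Rightarrow> ('o, 'm, 'q, 'l) functor_data" where
  "comp_functor G F =
    \<lparr> omap = (\<lambda>x. omap G (omap F x)),
      mmap = (\<lambda>x y f. mmap G (omap F x) (omap F y) (mmap F x y f)) \<rparr>"

definition functor_eq ::
  "('o, 'm) cat \<Rightarrow> ('o, 'm, 'p, 'n) functor_data \<Rightarrow> ('o, 'm, 'p, 'n) functor_data \<Rightarrow> bool" where
  "functor_eq C F G \<longleftrightarrow>
    (\<forall>x\<in>Obj C. omap F x = omap G x) \<and>
    (\<forall>x\<in>Obj C. \<forall>y\<in>Obj C. \<forall>f\<in>Hom C x y. mmap F x y f = mmap G x y f)"

definition is_iso :: "('o, 'm) cat \<Rightarrow> 'o \<Rightarrow> 'o \<Rightarrow> 'm \<Rightarrow> bool" where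
  "is_iso C x y f \<longleftrightarrow> f \<in> Hom C x y \<and>
    (\<exists>g\<in>Hom C y x. Comp C x y x g f = Idn C x \<and> Comp C y x y f g = Idn C y)"

definition naturally_isomorphic ::
  "('o, 'm) cat \<Rightarrow> ('p, 'n) cat \<Rightarrow>
    ('o, 'm, 'p, 'n) functor_data \<Rightarrow> ('o, 'm, 'p, 'n) functor_data \<Rightarrow> bool" where
  "naturally_isomorphic C D F G \<longleftrightarrow> (\<exists>\<eta>.
    (\<forall>x\<in>Obj C. is_iso D (omap F x) (omap G x) (\<eta> x)) \<and>
    (\<forall>x\<in>Obj C. \<forall>y\<in>Obj C. \<forall>f\<in>Hom C x y.
      Comp D (omap F x) (omap F y) (omap G y) (\<eta> y) (mmap F x y f) =
      Comp D (omap F x) (omap G x) (omap G y) (mmap G x y f) (\<eta> x)))"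

definition equivalence_of_categories ::
  "('o, 'm) cat \<Rightarrow> ('p, 'n) cat \<Rightarrow> ('o, 'm, 'p, 'n) functor_data \<Rightarrow> bool" where
  "equivalence_of_categories C D F \<longleftrightarrow> is_functor C D F \<and>
    (\<exists>G. is_functor D C G \<and>
      naturally_isomorphic C C (comp_functor G F) id_functor \<and>
      naturally_isomorphic D D (comp_functor F G) id_functor)"


section \<open>The four categories\<close>

text \<open>
  The objects of each category are the algebras with additional structure whose underlying set is
  a subset of a type \<open>'x\<close>.  Maps that serve as structure maps or morphisms are extensional, that
  is, \<open>undefined\<close> outside of the underlying set of their domain.
\<close>

definition structured_algebras ::
  "'k ring \<Rightarrow> 'o set \<Rightarrow> ('o \<Rightarrow> ('k, 'x) module) \<Rightarrow>
    ('o \<Rightarrow> 'o \<Rightarrow> ('x \<Rightarrow> 'x) \<Rightarrow> bool) \<Rightarrow> ('o, 'x \<Rightarrow> 'x) cat" where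
  "structured_algebras k Objs alg compatible =
    \<lparr> Obj = Objs,
      Hom = (\<lambda>M N. {f \<in> extensional (carrier (alg M)).
        algebra_hom k (alg M) (alg N) f \<and> compatible M N f}),
      Idn = (\<lambda>M. \<lambda>x\<in>carrier (alg M). x),
      Comp = (\<lambda>M N L g f. compose (carrier (alg M)) g f) \<rparr>"

type_synonym ('k, 'a, 'x) comod_alg = "('k, 'x) module \<times> ('x \<Rightarrow> ('a, 'x) tens)"
type_synonym ('k, 'a, 'x) mod_alg = "('k, 'x) module \<times> ('x \<Rightarrow> 'a \<Rightarrow> 'x)"
type_synonym ('k, 'a, 'x) yd_ll_alg =
  "('k, 'x) module \<times> ('x \<Rightarrow> ('a, 'x) tens) \<times> ('x \<Rightarrow> ('a \<Rightarrow> 'k, 'x) tens)"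
type_synonym ('k, 'a, 'x) yd_lr_alg =
  "('k, 'x) module \<times> ('x \<Rightarrow> 'a \<Rightarrow> 'x) \<times> ('x \<Rightarrow> ('a, 'x) tens)"

definition comodule_algebras ::
  "'k ring \<Rightarrow> ('k, 'a) bialg \<Rightarrow> (('k, 'a, 'x) comod_alg, 'x \<Rightarrow> 'x) cat" where
  "comodule_algebras k K = structured_algebras k
    {(X, \<gamma>). k_algebra k X \<and> left_coaction k K X \<gamma>}
    fst
    (\<lambda>(X, \<gamma>) (Y, \<gamma>') f. commutes_coaction k K X Y \<gamma> \<gamma>' f)"

definition module_algebras ::
  "'k ring \<Rightarrow> ('k, 'a) bialg \<Rightarrow> (('k, 'a, 'x) mod_alg, 'x \<Rightarrow> 'x) cat" where
  "module_algebras k K = structured_algebras k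
    {(X, act). k_algebra k X \<and> right_action k K X act}
    fst
    (\<lambda>(X, act) (Y, act') f. commutes_action K X act act' f)"

text \<open>
  \<open>(id \<otimes> \<beta>)\<alpha>\<close>, bracketed as a map from \<open>X\<close> to \<open>(opp H \<otimes> dual H) \<otimes> X\<close>.
\<close>

definition coact_twice ::
  "'k ring \<Rightarrow> ('k, 'a) bialg \<Rightarrow> ('k, 'x) module \<Rightarrow>
    ('x \<Rightarrow> ('a, 'x) tens) \<Rightarrow> ('x \<Rightarrow> ('a \<Rightarrow> 'k, 'x) tens) \<Rightarrow>
    'x \<Rightarrow> (('a, 'a \<Rightarrow> 'k) tens, 'x) tens" where
  "coact_twice k H X \<alpha> \<beta> =
    (\<lambda>x\<in>carrier X. assoc_left k (opp H) (dual k H) X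
      (tmap k (opp H) (tensor k (dual k H) X) id \<beta> (\<alpha> x)))"

definition yd_ll_condition ::
  "'k ring \<Rightarrow> ('k, 'a) bialg \<Rightarrow> ('k, 'x) module \<Rightarrow>
    ('x \<Rightarrow> ('a, 'x) tens) \<Rightarrow> ('x \<Rightarrow> ('a \<Rightarrow> 'k, 'x) tens) \<Rightarrow> bool" where
  "yd_ll_condition k H X \<alpha> \<beta> \<longleftrightarrow>
    (let G = opp H; D = dual k H in
     \<forall>x\<in>carrier X.
      tmap k D (tensor k G X) id \<alpha> (\<beta> x) =
      assoc_right k D G X
        (tmap k (tensor k D G) X (tflip k G D) id
          (tmap k (tensor k G D) X (Ad_U k H) id (coact_twice k H X \<alpha> \<beta> x))))"

definition yd_ll ::
  "'k ring \<Rightarrow> ('k, 'a) bialg \<Rightarrow> (('k, 'a, 'x) yd_ll_alg, 'x \<Rightarrow> 'x) cat" where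
  "yd_ll k H = structured_algebras k
    {(X, \<alpha>, \<beta>). k_algebra k X \<and> left_coaction k (opp H) X \<alpha> \<and> left_coaction k (dual k H) X \<beta> \<and>
      yd_ll_condition k H X \<alpha> \<beta>}
    fst
    (\<lambda>(X, \<alpha>, \<beta>) (Y, \<alpha>', \<beta>') f.
      commutes_coaction k (opp H) X Y \<alpha> \<alpha>' f \<and> commutes_coaction k (dual k H) X Y \<beta> \<beta>' f)"

text \<open>The products in the following condition are taken in \<open>H\<close>, not in \<open>opp H\<close>.\<close>

definition yd_lr_condition ::
  "'k ring \<Rightarrow> ('k, 'a) bialg \<Rightarrow> ('k, 'x) module \<Rightarrow>
    ('x \<Rightarrow> 'a \<Rightarrow> 'x) \<Rightarrow> ('x \<Rightarrow> ('a, 'x) tens) \<Rightarrow> bool" where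
  "yd_lr_condition k H X act \<alpha> \<longleftrightarrow>
    (let HX = tensor k H X in
     \<forall>x\<in>carrier X. \<forall>h\<in>carrier H.
      sweedler HX (\<alpha> x) (\<lambda>g y. sweedler HX (comult H h) (\<lambda>h1 h2.
        tens k H X (g \<otimes>\<^bsub>H\<^esub> h1) (act y h2))) =
      sweedler HX (comult H h) (\<lambda>h1 h2. sweedler HX (\<alpha> (act x h1)) (\<lambda>g y.
        tens k H X (h2 \<otimes>\<^bsub>H\<^esub> g) y)))"

definition yd_lr ::
  "'k ring \<Rightarrow> ('k, 'a) bialg \<Rightarrow> (('k, 'a, 'x) yd_lr_alg, 'x \<Rightarrow> 'x) cat" where
  "yd_lr k H = structured_algebras k
    {(X, act, \<alpha>). k_algebra k X \<and> right_action k H X act \<and> left_coaction k (opp H) X \<alpha> \<and>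
      yd_lr_condition k H X act \<alpha>}
    fst
    (\<lambda>(X, act, \<alpha>) (Y, act', \<alpha>') f.
      commutes_action H X act act' f \<and> commutes_coaction k (opp H) X Y \<alpha> \<alpha>' f)"


section \<open>The four functors\<close>

definition yd_ll_to_comodule ::
  "'k ring \<Rightarrow> ('k, 'a) bialg \<Rightarrow>
    (('k, 'a, 'x) yd_ll_alg, 'x \<Rightarrow> 'x, ('k, ('a, 'a \<Rightarrow> 'k) tens, 'x) comod_alg, 'x \<Rightarrow> 'x) functor_data" where
  "yd_ll_to_comodule k H =
    \<lparr> omap = (\<lambda>(X, \<alpha>, \<beta>). (X, coact_twice k H X \<alpha> \<beta>)), mmap = (\<lambda>M N f. f) \<rparr>"

definition comodule_to_module ::
  "'k ring \<Rightarrow> ('k, 'a) bialg \<Rightarrow>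
    (('k, ('a, 'a \<Rightarrow> 'k) tens, 'x) comod_alg, 'x \<Rightarrow> 'x,
     ('k, ('a \<Rightarrow> 'k, 'a) tens, 'x) mod_alg, 'x \<Rightarrow> 'x) functor_data" where
  "comodule_to_module k H =
    \<lparr> omap = (\<lambda>(X, \<gamma>). (X, induced_action (double k H) (double_pairing k) X \<gamma>)),
      mmap = (\<lambda>M N f. f) \<rparr>"

definition yd_ll_to_yd_lr ::
  "'k ring \<Rightarrow> ('k, 'a) bialg \<Rightarrow>
    (('k, 'a, 'x) yd_ll_alg, 'x \<Rightarrow> 'x, ('k, 'a, 'x) yd_lr_alg, 'x \<Rightarrow> 'x) functor_data" where
  "yd_ll_to_yd_lr k H =
    \<lparr> omap = (\<lambda>(X, \<alpha>, \<beta>). (X, induced_action H (\<lambda>h \<theta>. \<theta> h) X \<beta>, \<alpha>)), mmap = (\<lambda>M N f. f) \<rparr>"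

definition yd_lr_to_module ::
  "'k ring \<Rightarrow> ('k, 'a) bialg \<Rightarrow>
    (('k, 'a, 'x) yd_lr_alg, 'x \<Rightarrow> 'x, ('k, ('a \<Rightarrow> 'k, 'a) tens, 'x) mod_alg, 'x \<Rightarrow> 'x) functor_data" where
  "yd_lr_to_module k H =
    \<lparr> omap = (\<lambda>(X, act, \<alpha>).
        (X, \<lambda>x\<in>carrier X. \<lambda>d\<in>carrier (double k H).
          sweedler X d (\<lambda>\<omega> h. sweedler X (\<alpha> x) (\<lambda>g y. \<omega> g \<odot>\<^bsub>X\<^esub> act y h)))),
      mmap = (\<lambda>M N f. f) \<rparr>"

end

theory Submission
  imports Defs
begin

text \<open>
  Over a finite-dimensional space, coactions and actions carry the same information.  If \<open>P\<close> is a
  perfect pairing of \<open>V\<close> with \<open>K\<close>, a linear map \<open>\<gamma> : X \<rightarrow> K \<otimes> X\<close> is determined by its slices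
  \<open>x \<lhd> v = (P(v, \<cdot>) \<otimes> id)(\<gamma>(x))\<close>, and every bilinear map \<open>X \<times> V \<rightarrow> X\<close> arises in this way.  When the
  structure maps of \<open>V\<close> are the transposes of those of \<open>K\<close>, each clause in the definition of a
  comodule algebra over \<open>K\<close> turns into a clause in the definition of a module algebra over \<open>V\<close>
  (\<open>left_coaction_iff_right_action\<close>, \<open>commutes_coaction_iff_action\<close>).  This is used three times: for
  \<open>H\<close> acting where its dual coacts, for the dual of \<open>H\<^sup>o\<^sup>p\<close> acting where \<open>H\<^sup>o\<^sup>p\<close> coacts, and for the
  double acting where the codouble coacts.

  All four categories thereby become categories of actions.  Let \<open>\<rho>\<close> be the action of the dual of
  \<open>H\<^sup>o\<^sup>p\<close> that corresponds to \<open>\<alpha>\<close>, and \<open>\<lhd>\<close> the action of \<open>H\<close> that corresponds to \<open>\<beta>\<close>.  Pairing the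
  coaction \<open>(id \<otimes> \<beta>)\<alpha>\<close> with \<open>\<omega> \<bowtie> h\<close> gives \<open>x \<cdot> (\<omega> \<bowtie> h) = \<rho>(x, \<omega>) \<lhd> h\<close>, which is also what the fourth
  functor produces; so the square commutes (\<open>square\<close>).  What remains is that \<open>x \<cdot> (\<omega> \<bowtie> h)\<close> is an
  action of the double exactly if \<open>\<rho>\<close> and \<open>\<lhd>\<close> are actions that satisfy either of the
  Yetter-Drinfeld conditions.

  Let \<open>At\<close> be the transpose of \<open>Ad(U)\<close> under the pairing of the double with the codouble.
  Dualising the coproduct of the codouble gives the product
  \<open>(\<omega> \<bowtie> h)(\<omega>' \<bowtie> h') = \<Sum> \<omega>\<omega>'' \<bowtie> h''h'\<close>, where \<open>\<Sum> \<omega>'' \<bowtie> h'' = At(\<omega>' \<bowtie> h)\<close> (\<open>mult_double\<close>).  Since \<open>At\<close>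
  fixes the elements \<open>\<omega> \<bowtie> 1\<close> and \<open>\<epsilon> \<bowtie> h\<close> (\<open>At_left\<close>, \<open>At_right\<close>), these form two subalgebras, with
  \<open>(\<omega> \<bowtie> 1)(\<epsilon> \<bowtie> h) = \<omega> \<bowtie> h\<close> and \<open>(\<epsilon> \<bowtie> h)(\<omega> \<bowtie> 1) = At(\<omega> \<bowtie> h)\<close>.  Hence an action of the double is the same as a pair
  of actions with \<open>\<rho>(x \<lhd> h, \<omega>) = x \<cdot> At(\<omega> \<bowtie> h)\<close> (\<open>dot_action_right_action\<close>, \<open>action_of_double\<close>).

  Both Yetter-Drinfeld conditions say just this.  Pairing the condition on two coactions with \<open>h\<close>
  and \<open>\<omega>\<close> gives the equation at once (\<open>ll_condition_iff\<close>).  For the condition on an action and a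
  coaction, note that \<open>Ad(U)(t) U = U t\<close>; the transposes \<open>RU\<close> and \<open>LU\<close> of right and left
  multiplication by \<open>U\<close> are explicit, \<open>At \<circ> RU = LU\<close>, and \<open>RU\<close> is onto, so that the equation may be
  tested on the image of \<open>RU\<close>, where it is that condition (\<open>lr_condition_iff\<close>).

  The element \<open>U\<close> is invertible because \<open>H\<^sup>o\<^sup>p \<otimes> dual H\<close> is the convolution algebra of linear maps
  \<open>H \<rightarrow> H\<^sup>o\<^sup>p\<close>: there \<open>U\<close> is the identity map, and its inverse is the inverse antipode, by the antipode
  laws and \<open>S(ab) = S(b)S(a)\<close> (\<open>S_antimult\<close>).

  Finally, functors that act as the identity on morphisms and bijectively on objects, and that
  preserve and reflect the compatibility of algebra homomorphisms with the structure, are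
  equivalences (\<open>structure_iso\<close>).  For three functors the bijection on objects comes from the
  correspondences above; for \<open>(X, \<alpha>, \<beta>) \<mapsto> (X, (id \<otimes> \<beta>)\<alpha>)\<close> it follows from the commutative square.
\<close>

section \<open>Tensor products of modules\<close>

text \<open>
  The target carries only an addition, because the scalar multiplication of a tensor product is
  itself constructed from such a map.
\<close>

definition balanced ::
  "'k ring \<Rightarrow> ('k, 'a, 'm) module_scheme \<Rightarrow> ('k, 'b, 'n) module_scheme \<Rightarrow> ('c, 'l) ring_scheme \<Rightarrow>
    ('a \<Rightarrow> 'b \<Rightarrow> 'c) \<Rightarrow> bool" where
  "balanced k A B C f \<longleftrightarrow>
    (\<forall>a\<in>carrier A. \<forall>b\<in>carrier B. f a b \<in> carrier C) \<and>
    (\<forall>a\<in>carrier A. \<forall>a'\<in>carrier A. \<forall>b\<in>carrier B. f (a \<oplus>\<^bsub>A\<^esub> a') b = f a b \<oplus>\<^bsub>C\<^esub> f a' b) \<and>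
    (\<forall>a\<in>carrier A. \<forall>b\<in>carrier B. \<forall>b'\<in>carrier B. f a (b \<oplus>\<^bsub>B\<^esub> b') = f a b \<oplus>\<^bsub>C\<^esub> f a b') \<and>
    (\<forall>c\<in>carrier k. \<forall>a\<in>carrier A. \<forall>b\<in>carrier B. f (c \<odot>\<^bsub>A\<^esub> a) b = f a (c \<odot>\<^bsub>B\<^esub> b))"

lemma tclass_eqI: "tens_rel k A B zs ws \<Longrightarrow> tclass k A B zs = tclass k A B ws"
  unfolding tclass_def by (blast intro: tens_rel.sym tens_rel.trans)

context
  fixes k :: "'k ring" and A :: "('k, 'a, 'm) module_scheme" and B :: "('k, 'b, 'n) module_scheme"
  assumes A: "module k A" and B: "module k B"
begin

interpretation A: module k A by (fact A)
interpretation B: module k B by (fact B)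


lemma tclass_repE:
  assumes "Z \<in> carrier (tensor k A B)"
  obtains zs where "set zs \<subseteq> carrier A \<times> carrier B" "Z = tclass k A B zs"
  using assms by (auto simp: tensor_def)

lemma tclass_carrier: "set zs \<subseteq> carrier A \<times> carrier B \<Longrightarrow> tclass k A B zs \<in> carrier (tensor k A B)"
  by (auto simp: tensor_def)

lemma mem_tclassD:
  assumes "ws \<in> tclass k A B zs"
  shows "set ws \<subseteq> carrier A \<times> carrier B" "tclass k A B ws = tclass k A B zs"
  using assms tens_rel_carrier[OF A B] tclass_eqI unfolding tclass_def by fastforce+

lemma tclass_self: "set zs \<subseteq> carrier A \<times> carrier B \<Longrightarrow> zs \<in> tclass k A B zs"
  unfolding tclass_def by (simp add: tens_rel.refl)

lemma tclass_append:
  assumes "set zs \<subseteq> carrier A \<times> carrier B" "set ws \<subseteq> carrier A \<times> carrier B"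
  shows "tclass k A B zs \<oplus>\<^bsub>tensor k A B\<^esub> tclass k A B ws = tclass k A B (zs @ ws)"
proof -
  have eq: "tclass k A B (zs' @ ws') = tclass k A B (zs @ ws)"
    if "zs' \<in> tclass k A B zs" "ws' \<in> tclass k A B ws" for zs' ws'
    using that unfolding tclass_def mem_Collect_eq
    by (intro tclass_eqI[unfolded tclass_def] tens_rel.append) (erule tens_rel.sym)+
  have "(\<Union>zs'\<in>tclass k A B zs. \<Union>ws'\<in>tclass k A B ws. tclass k A B (zs' @ ws')) =
      (\<Union>zs'\<in>tclass k A B zs. \<Union>ws'\<in>tclass k A B ws. tclass k A B (zs @ ws))"
    by (intro SUP_cong[OF HOL.refl] eq)
  also have "\<dots> = tclass k A B (zs @ ws)"
    using tclass_self[OF assms(1)] tclass_self[OF assms(2)] by blast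
  finally show ?thesis by (simp add: tensor_def)
qed

lemma tens_closed: "a \<in> carrier A \<Longrightarrow> b \<in> carrier B \<Longrightarrow> tens k A B a b \<in> carrier (tensor k A B)"
  unfolding tens_def by (rule tclass_carrier) simp

lemma tens_add_left:
  "a \<in> carrier A \<Longrightarrow> a' \<in> carrier A \<Longrightarrow> b \<in> carrier B \<Longrightarrow>
    tens k A B (a \<oplus>\<^bsub>A\<^esub> a') b = tens k A B a b \<oplus>\<^bsub>tensor k A B\<^esub> tens k A B a' b"
  unfolding tens_def by (subst tclass_append) (auto intro!: tclass_eqI tens_rel.add_left)

lemma tens_add_right:
  "a \<in> carrier A \<Longrightarrow> b \<in> carrier B \<Longrightarrow> b' \<in> carrier B \<Longrightarrow>
    tens k A B a (b \<oplus>\<^bsub>B\<^esub> b') = tens k A B a b \<oplus>\<^bsub>tensor k A B\<^esub> tens k A B a b'"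
  unfolding tens_def by (subst tclass_append) (auto intro!: tclass_eqI tens_rel.add_right)

lemma tens_smult_balanced:
  "c \<in> carrier k \<Longrightarrow> a \<in> carrier A \<Longrightarrow> b \<in> carrier B \<Longrightarrow>
    tens k A B (c \<odot>\<^bsub>A\<^esub> a) b = tens k A B a (c \<odot>\<^bsub>B\<^esub> b)"
  unfolding tens_def by (auto intro!: tclass_eqI tens_rel.smult)

text \<open>
  Zero needs no case of its own, since the empty sum equals \<open>0 \<otimes> 0\<close>.
\<close>

lemma tensor_induct [consumes 1, case_names tens add]:
  assumes Z: "Z \<in> carrier (tensor k A B)"
    and tens: "\<And>a b. a \<in> carrier A \<Longrightarrow> b \<in> carrier B \<Longrightarrow> Q (tens k A B a b)"
    and add: "\<And>Z W. Z \<in> carrier (tensor k A B) \<Longrightarrow> W \<in> carrier (tensor k A B) \<Longrightarrow> Q Z \<Longrightarrow> Q W \<Longrightarrow>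
      Q (Z \<oplus>\<^bsub>tensor k A B\<^esub> W)"
  shows "Q Z"
proof -
  obtain zs where zs: "set zs \<subseteq> carrier A \<times> carrier B" and Z: "Z = tclass k A B zs"
    using Z by (rule tclass_repE)
  have "Q (tclass k A B zs)" using zs
  proof (induction zs)
    case Nil
    have "tclass k A B [] = tens k A B \<zero>\<^bsub>A\<^esub> \<zero>\<^bsub>B\<^esub>"
      unfolding tens_def by (rule tclass_eqI, rule tens_rel.sym, rule tens_rel.zero) simp
    then show ?case using tens by simp
  next
    case (Cons p zs)
    obtain a b where p: "p = (a, b)" "a \<in> carrier A" "b \<in> carrier B" using Cons.prems by (cases p) auto
    have "Q (tens k A B a b \<oplus>\<^bsub>tensor k A B\<^esub> tclass k A B zs)"
      using Cons p by (intro add tens tens_closed tclass_carrier) auto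
    also have "tens k A B a b \<oplus>\<^bsub>tensor k A B\<^esub> tclass k A B zs = tclass k A B (p # zs)"
      using Cons p unfolding tens_def by (subst tclass_append) auto
    finally show ?case .
  qed
  then show ?thesis using Z by simp
qed

lemma tensor_abelian_group: "abelian_group (tensor k A B)"
proof (rule abelian_groupI)
  have zero: "\<zero>\<^bsub>tensor k A B\<^esub> = tclass k A B []" by (simp add: tensor_def)
  fix x y z assume x: "x \<in> carrier (tensor k A B)" and y: "y \<in> carrier (tensor k A B)"
    and z: "z \<in> carrier (tensor k A B)"
  obtain xs where xs: "set xs \<subseteq> carrier A \<times> carrier B" "x = tclass k A B xs"
    using x by (rule tclass_repE)
  obtain ys where ys: "set ys \<subseteq> carrier A \<times> carrier B" "y = tclass k A B ys"
    using y by (rule tclass_repE)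
  obtain zs where zs: "set zs \<subseteq> carrier A \<times> carrier B" "z = tclass k A B zs"
    using z by (rule tclass_repE)
  show "x \<oplus>\<^bsub>tensor k A B\<^esub> y \<in> carrier (tensor k A B)"
    using xs ys by (auto simp: tclass_append intro!: tclass_carrier)
  show "x \<oplus>\<^bsub>tensor k A B\<^esub> y \<oplus>\<^bsub>tensor k A B\<^esub> z = x \<oplus>\<^bsub>tensor k A B\<^esub> (y \<oplus>\<^bsub>tensor k A B\<^esub> z)"
    using xs ys zs by (simp add: tclass_append)
  show "x \<oplus>\<^bsub>tensor k A B\<^esub> y = y \<oplus>\<^bsub>tensor k A B\<^esub> x"
    using xs ys by (auto simp: tclass_append intro!: tclass_eqI tens_rel.comm)
  show "\<zero>\<^bsub>tensor k A B\<^esub> \<oplus>\<^bsub>tensor k A B\<^esub> x = x"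
    using xs by (simp add: zero tclass_append)
next
  have zero: "\<zero>\<^bsub>tensor k A B\<^esub> = tclass k A B []" by (simp add: tensor_def)
  then show "\<zero>\<^bsub>tensor k A B\<^esub> \<in> carrier (tensor k A B)" by (simp add: tclass_carrier)
  fix x assume x: "x \<in> carrier (tensor k A B)"
  obtain xs where xs: "set xs \<subseteq> carrier A \<times> carrier B" "x = tclass k A B xs"
    using x by (rule tclass_repE)
  have "\<exists>ys. set ys \<subseteq> carrier A \<times> carrier B \<and> tens_rel k A B (ys @ xs) []" using xs(1)
  proof (induction xs)
    case Nil
    show ?case by (rule exI[of _ "[]"]) (auto intro: tens_rel.refl)
  next
    case (Cons p xs)
    then obtain ys where ys: "set ys \<subseteq> carrier A \<times> carrier B" "tens_rel k A B (ys @ xs) []" by auto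
    obtain a b where p: "p = (a, b)" "a \<in> carrier A" "b \<in> carrier B" using Cons.prems by (cases p) auto
    have "tens_rel k A B [(\<ominus>\<^bsub>A\<^esub> a \<oplus>\<^bsub>A\<^esub> a, b)] ([(\<ominus>\<^bsub>A\<^esub> a, b)] @ [(a, b)])"
      using p tens_rel.add_left[of "\<ominus>\<^bsub>A\<^esub> a" A a b B k] by simp
    then have 1: "tens_rel k A B ([(\<ominus>\<^bsub>A\<^esub> a, b)] @ [(a, b)]) []"
      using tens_rel.trans[OF tens_rel.sym] tens_rel.zero[of b B k A] p
      by (metis A.l_neg)
    have "tens_rel k A B (([(\<ominus>\<^bsub>A\<^esub> a, b)] @ ys) @ ([p] @ xs)) ((ys @ [(\<ominus>\<^bsub>A\<^esub> a, b)]) @ ([p] @ xs))"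
      using p ys Cons.prems by (intro tens_rel.append tens_rel.comm tens_rel.refl) auto
    moreover have "tens_rel k A B (ys @ (([(\<ominus>\<^bsub>A\<^esub> a, b)] @ [p]) @ xs)) (ys @ ([] @ xs))"
      using p ys Cons.prems 1 by (intro tens_rel.append tens_rel.refl) auto
    ultimately have "tens_rel k A B (((\<ominus>\<^bsub>A\<^esub> a, b) # ys) @ p # xs) []"
      using tens_rel.trans[OF tens_rel.trans ys(2)] by simp
    then show ?case using p ys by (intro exI[of _ "(\<ominus>\<^bsub>A\<^esub> a, b) # ys"]) auto
  qed
  then obtain ys where ys: "set ys \<subseteq> carrier A \<times> carrier B" "tens_rel k A B (ys @ xs) []" by blast
  then show "\<exists>y\<in>carrier (tensor k A B). y \<oplus>\<^bsub>tensor k A B\<^esub> x = \<zero>\<^bsub>tensor k A B\<^esub>"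
    using xs by (intro bexI[of _ "tclass k A B ys"])
      (auto simp: tclass_append zero tclass_carrier intro!: tclass_eqI)
qed

interpretation T: abelian_group "tensor k A B" by (fact tensor_abelian_group)

lemma sweedler_tclass_balanced:
  assumes "abelian_group C" "balanced k A B C f" "set zs \<subseteq> carrier A \<times> carrier B"
  shows "sweedler C (tclass k A B zs) f = formal_eval C f zs"
  using assms by (intro sweedler_tclass[OF A B]) (auto simp: balanced_def)

lemma formal_eval_closed:
  assumes "abelian_group C" "balanced k A B C f" "set zs \<subseteq> carrier A \<times> carrier B"
  shows "formal_eval C f zs \<in> carrier C"
proof -
  interpret C: abelian_group C by fact
  show ?thesis using assms(2,3) by (induction zs) (auto simp: formal_eval_def balanced_def)
qed

lemma formal_eval_append:
  assumes C: "abelian_group C" and f: "balanced k A B C f"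
    and zs: "set zs \<subseteq> carrier A \<times> carrier B" and ws: "set ws \<subseteq> carrier A \<times> carrier B"
  shows "formal_eval C f (zs @ ws) = formal_eval C f zs \<oplus>\<^bsub>C\<^esub> formal_eval C f ws"
proof -
  interpret C: abelian_group C by fact
  show ?thesis using zs
  proof (induction zs)
    case Nil
    then show ?case using formal_eval_closed[OF C f ws] by (simp add: formal_eval_def)
  next
    case (Cons z zs)
    then show ?case using formal_eval_closed[OF C f ws] formal_eval_closed[OF C f, of zs] f
      by (cases z) (simp add: formal_eval_def C.a_assoc balanced_def)
  qed
qed

lemma sweedler_closed_balanced:
  assumes "abelian_group C" "balanced k A B C f" "Z \<in> carrier (tensor k A B)"
  shows "sweedler C Z f \<in> carrier C"
  using assms(3) by (rule tclass_repE) (simp add: sweedler_tclass_balanced formal_eval_closed assms)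

lemma sweedler_add_balanced:
  assumes "abelian_group C" "balanced k A B C f"
    "Z \<in> carrier (tensor k A B)" "W \<in> carrier (tensor k A B)"
  shows "sweedler C (Z \<oplus>\<^bsub>tensor k A B\<^esub> W) f = sweedler C Z f \<oplus>\<^bsub>C\<^esub> sweedler C W f"
proof -
  obtain zs where zs: "set zs \<subseteq> carrier A \<times> carrier B" "Z = tclass k A B zs"
    using assms(3) by (rule tclass_repE)
  obtain ws where ws: "set ws \<subseteq> carrier A \<times> carrier B" "W = tclass k A B ws"
    using assms(4) by (rule tclass_repE)
  show ?thesis using zs ws assms(1,2)
    by (simp add: tclass_append sweedler_tclass_balanced formal_eval_append)
qed

lemma sweedler_tens_balanced:
  assumes "abelian_group C" "balanced k A B C f" "a \<in> carrier A" "b \<in> carrier B"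
  shows "sweedler C (tens k A B a b) f = f a b"
proof -
  interpret C: abelian_group C by fact
  show ?thesis unfolding tens_def using assms
    by (subst sweedler_tclass_balanced) (auto simp: formal_eval_def balanced_def)
qed

text \<open>
  Every representative of \<open>Z\<close> is a formal sum over the two carriers, so that only the values of \<open>f\<close>
  and \<open>g\<close> there matter.
\<close>

lemma sweedler_cong:
  assumes "Z \<in> carrier (tensor k A B)"
    and "\<And>a b. a \<in> carrier A \<Longrightarrow> b \<in> carrier B \<Longrightarrow> f a b = g a b"
  shows "sweedler C Z f = sweedler C Z g"
proof -
  have "formal_eval C f zs = formal_eval C g zs" if "set zs \<subseteq> carrier A \<times> carrier B" for zs
    using that by (induction zs) (auto simp: formal_eval_def assms(2))
  moreover have "set zs \<subseteq> carrier A \<times> carrier B" if "zs \<in> Z" for zs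
    using assms(1) that by (metis mem_tclassD(1) tclass_repE)
  ultimately have "formal_eval C f ` Z = formal_eval C g ` Z" by (intro image_cong) auto
  then show ?thesis by (simp add: sweedler_def)
qed

lemma balanced_scaled_tens:
  assumes c: "c \<in> carrier k"
  shows "balanced k A B (tensor k A B) (\<lambda>a b. tens k A B (c \<odot>\<^bsub>A\<^esub> a) b)"
  unfolding balanced_def
proof (intro conjI ballI)
  fix d a b assume d: "d \<in> carrier k" "a \<in> carrier A" "b \<in> carrier B"
  have "c \<odot>\<^bsub>A\<^esub> (d \<odot>\<^bsub>A\<^esub> a) = d \<odot>\<^bsub>A\<^esub> (c \<odot>\<^bsub>A\<^esub> a)"
    using c d by (metis A.smult_assoc1 A.R.m_comm)
  then show "tens k A B (c \<odot>\<^bsub>A\<^esub> (d \<odot>\<^bsub>A\<^esub> a)) b = tens k A B (c \<odot>\<^bsub>A\<^esub> a) (d \<odot>\<^bsub>B\<^esub> b)"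
    using c d tens_smult_balanced by simp
qed (use c in \<open>auto simp: A.smult_r_distr tens_add_left tens_add_right tens_closed\<close>)

text \<open>
  The scalar multiplication of the tensor product is itself a linear extension; this is why it does
  not depend on representatives.
\<close>

lemma smult_tensor:
  assumes c: "c \<in> carrier k" and Z: "Z \<in> carrier (tensor k A B)"
  shows "c \<odot>\<^bsub>tensor k A B\<^esub> Z = sweedler (tensor k A B) Z (\<lambda>a b. tens k A B (c \<odot>\<^bsub>A\<^esub> a) b)"
proof -
  let ?f = "\<lambda>a b. tens k A B (c \<odot>\<^bsub>A\<^esub> a) b"
  note bal = balanced_scaled_tens[OF c]
  have ev: "formal_eval (tensor k A B) ?f zs = tclass k A B [(c \<odot>\<^bsub>A\<^esub> a, b). (a, b) \<leftarrow> zs]"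
    if "set zs \<subseteq> carrier A \<times> carrier B" for zs
    using that
  proof (induction zs)
    case Nil
    then show ?case by (simp add: formal_eval_def tensor_def)
  next
    case (Cons p zs)
    have "set [(c \<odot>\<^bsub>A\<^esub> a, b). (a, b) \<leftarrow> zs] \<subseteq> carrier A \<times> carrier B" using Cons.prems c by auto
    then show ?case using Cons c
      by (cases p) (simp add: formal_eval_def tens_def tclass_append)
  qed
  have "tclass k A B [(c \<odot>\<^bsub>A\<^esub> a, b). (a, b) \<leftarrow> zs] = sweedler (tensor k A B) Z ?f" if "zs \<in> Z" for zs
    using that Z mem_tclassD[of zs] ev sweedler_tclass_balanced[OF T.abelian_group_axioms bal]
    by (metis tclass_repE)
  moreover have "Z \<noteq> {}" using Z tclass_self by (metis empty_iff tclass_repE)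
  ultimately show ?thesis by (simp add: tensor_def)
qed

lemma tensor_module: "module k (tensor k A B)"
proof -
  let ?T = "tensor k A B"
  note bal = balanced_scaled_tens
  have closed: "c \<odot>\<^bsub>?T\<^esub> Z \<in> carrier ?T" if "c \<in> carrier k" "Z \<in> carrier ?T" for c Z
    using that by (simp add: smult_tensor sweedler_closed_balanced[OF T.abelian_group_axioms bal])
  have add: "c \<odot>\<^bsub>?T\<^esub> (Z \<oplus>\<^bsub>?T\<^esub> W) = c \<odot>\<^bsub>?T\<^esub> Z \<oplus>\<^bsub>?T\<^esub> c \<odot>\<^bsub>?T\<^esub> W"
    if "c \<in> carrier k" "Z \<in> carrier ?T" "W \<in> carrier ?T" for c Z W
    using that by (simp add: smult_tensor sweedler_add_balanced[OF T.abelian_group_axioms bal])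
  have pure: "c \<odot>\<^bsub>?T\<^esub> tens k A B a b = tens k A B (c \<odot>\<^bsub>A\<^esub> a) b"
    if "c \<in> carrier k" "a \<in> carrier A" "b \<in> carrier B" for c a b
    using that
    by (simp add: smult_tensor tens_closed sweedler_tens_balanced[OF T.abelian_group_axioms bal])
  show ?thesis
  proof (rule moduleI)
    show "cring k" ..
    show "abelian_group ?T" ..
    show "c \<odot>\<^bsub>?T\<^esub> Z \<in> carrier ?T" if "c \<in> carrier k" "Z \<in> carrier ?T" for c Z
      using closed that .
    show "c \<odot>\<^bsub>?T\<^esub> (Z \<oplus>\<^bsub>?T\<^esub> W) = c \<odot>\<^bsub>?T\<^esub> Z \<oplus>\<^bsub>?T\<^esub> c \<odot>\<^bsub>?T\<^esub> W"
      if "c \<in> carrier k" "Z \<in> carrier ?T" "W \<in> carrier ?T" for c Z W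
      using add that .
    show "(c \<oplus>\<^bsub>k\<^esub> d) \<odot>\<^bsub>?T\<^esub> Z = c \<odot>\<^bsub>?T\<^esub> Z \<oplus>\<^bsub>?T\<^esub> d \<odot>\<^bsub>?T\<^esub> Z"
      if "c \<in> carrier k" "d \<in> carrier k" "Z \<in> carrier ?T" for c d Z
      using that(3,1,2)
      by (induction rule: tensor_induct)
        (simp_all add: pure A.smult_l_distr tens_add_left add closed T.a_ac)
    show "(c \<otimes>\<^bsub>k\<^esub> d) \<odot>\<^bsub>?T\<^esub> Z = c \<odot>\<^bsub>?T\<^esub> (d \<odot>\<^bsub>?T\<^esub> Z)"
      if "c \<in> carrier k" "d \<in> carrier k" "Z \<in> carrier ?T" for c d Z
      using that(3,1,2)
      by (induction rule: tensor_induct) (simp_all add: pure A.smult_assoc1 add closed)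
    show "\<one>\<^bsub>k\<^esub> \<odot>\<^bsub>?T\<^esub> Z = Z" if "Z \<in> carrier ?T" for Z
      using that by (induction rule: tensor_induct) (simp_all add: pure add closed)
  qed
qed

lemma smult_tens_left:
  assumes "c \<in> carrier k" "a \<in> carrier A" "b \<in> carrier B"
  shows "c \<odot>\<^bsub>tensor k A B\<^esub> tens k A B a b = tens k A B (c \<odot>\<^bsub>A\<^esub> a) b"
  using assms by (simp add: smult_tensor tens_closed
      sweedler_tens_balanced[OF T.abelian_group_axioms balanced_scaled_tens])

end

lemmas tensor_induction [consumes 3, case_names tens add] = tensor_induct

section \<open>Linear and bilinear maps\<close>

text \<open>
  The rules collected here reduce claims that a term depends linearly on a variable, that it is
  bilinear in two variables, or that it lies in a carrier, to the same claims about subterms.  In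
  a linear term the variable occurs once, which leaves one applicable rule at each step; so
  \<open>(rule lin | assumption)+\<close> settles such claims.
\<close>

named_theorems lin

text \<open>
  With the field as a module over itself, functionals are linear maps and fall under the same rules.
\<close>

definition kmod :: "'k ring \<Rightarrow> ('k, 'k) module" where
  "kmod k = \<lparr> carrier = carrier k, mult = mult k, one = one k, zero = zero k, add = add k,
    smult = mult k \<rparr>"

lemma kmod_simps [simp]:
  "carrier (kmod k) = carrier k" "mult (kmod k) = mult k" "one (kmod k) = one k"
  "zero (kmod k) = zero k" "add (kmod k) = add k" "smult (kmod k) = mult k"
  by (simp_all add: kmod_def)

lemma sweedler_kmod: "sweedler (kmod k) z f = sweedler k z f"
  by (simp add: sweedler_def formal_eval_def)

lemma module_kmod:
  assumes "cring k" shows "module k (kmod k)"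
proof -
  interpret cring k by fact
  have "abelian_group (kmod k)"
    by (rule abelian_groupI) (use l_neg in \<open>auto simp: a_assoc intro: a_comm\<close>)
  then show ?thesis
    by (intro moduleI) (auto simp: assms l_distr r_distr m_assoc)
qed

lemma linear_functional_kmod: "linear_functional k A f \<longleftrightarrow> linear_map k A (kmod k) f"
  by (simp add: linear_functional_def linear_map_def)

lemma linear_closed: "linear_map k A B f \<Longrightarrow> x \<in> carrier A \<Longrightarrow> f x \<in> carrier B"
  and linear_add: "linear_map k A B f \<Longrightarrow> x \<in> carrier A \<Longrightarrow> y \<in> carrier A \<Longrightarrow>
    f (x \<oplus>\<^bsub>A\<^esub> y) = f x \<oplus>\<^bsub>B\<^esub> f y"
  and linear_smult: "linear_map k A B f \<Longrightarrow> c \<in> carrier k \<Longrightarrow> x \<in> carrier A \<Longrightarrow>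
    f (c \<odot>\<^bsub>A\<^esub> x) = c \<odot>\<^bsub>B\<^esub> f x"
  by (auto simp: linear_map_def)

lemma linear_mapI:
  assumes "\<And>x. x \<in> carrier A \<Longrightarrow> f x \<in> carrier B"
    and "\<And>x y. x \<in> carrier A \<Longrightarrow> y \<in> carrier A \<Longrightarrow> f (x \<oplus>\<^bsub>A\<^esub> y) = f x \<oplus>\<^bsub>B\<^esub> f y"
    and "\<And>c x. c \<in> carrier k \<Longrightarrow> x \<in> carrier A \<Longrightarrow> f (c \<odot>\<^bsub>A\<^esub> x) = c \<odot>\<^bsub>B\<^esub> f x"
  shows "linear_map k A B f"
  using assms by (auto simp: linear_map_def)

lemma linear_cong:
  assumes "linear_map k A B f" "module k A" "\<And>x. x \<in> carrier A \<Longrightarrow> f x = g x"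
  shows "linear_map k A B g"
proof -
  interpret A: module k A by fact
  show ?thesis using assms(1,3) by (auto simp: linear_map_def Pi_def)
qed

lemma lin_comp: "linear_map k B C g \<Longrightarrow> linear_map k A B f \<Longrightarrow> linear_map k A C (\<lambda>x. g (f x))"
  by (intro linear_mapI) (simp_all add: linear_closed[of k A B f] linear_closed[of k B C g]
      linear_add[of k A B f] linear_add[of k B C g] linear_smult[of k A B f] linear_smult[of k B C g])

definition bilin ::
  "'k ring \<Rightarrow> ('k, 'a, 'm) module_scheme \<Rightarrow> ('k, 'b, 'n) module_scheme \<Rightarrow> ('k, 'c, 'l) module_scheme \<Rightarrow>
    ('a \<Rightarrow> 'b \<Rightarrow> 'c) \<Rightarrow> bool" where
  "bilin k A B C f \<longleftrightarrow> (\<forall>a\<in>carrier A. linear_map k B C (f a)) \<and>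
    (\<forall>b\<in>carrier B. linear_map k A C (\<lambda>a. f a b))"

lemma bilin_right: "bilin k A B C f \<Longrightarrow> a \<in> carrier A \<Longrightarrow> linear_map k B C (f a)"
  and bilin_left: "bilin k A B C f \<Longrightarrow> b \<in> carrier B \<Longrightarrow> linear_map k A C (\<lambda>a. f a b)"
  by (auto simp: bilin_def)

lemma bilin_closed: "bilin k A B C f \<Longrightarrow> a \<in> carrier A \<Longrightarrow> b \<in> carrier B \<Longrightarrow> f a b \<in> carrier C"
  by (auto dest: bilin_right linear_closed)

lemma bilin_balanced: "bilin k A B C f \<Longrightarrow> balanced k A B C f"
  unfolding bilin_def balanced_def linear_map_def by auto

lemma abelian_group_of_module: "module k C \<Longrightarrow> abelian_group C"
  by (rule module.axioms)

lemma cring_of_module: "module k C \<Longrightarrow> cring k"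
  by (rule module.axioms)

lemma sweedler_closed:
  assumes "Z \<in> carrier (tensor k A B)" "bilin k A B C f" "module k A" "module k B" "module k C"
  shows "sweedler C Z f \<in> carrier C"
  by (rule sweedler_closed_balanced[OF assms(3,4) abelian_group_of_module[OF assms(5)] bilin_balanced[OF assms(2)] assms(1)])

lemma sweedler_add:
  assumes "Z \<in> carrier (tensor k A B)" "W \<in> carrier (tensor k A B)"
    "bilin k A B C f" "module k A" "module k B" "module k C"
  shows "sweedler C (Z \<oplus>\<^bsub>tensor k A B\<^esub> W) f = sweedler C Z f \<oplus>\<^bsub>C\<^esub> sweedler C W f"
  by (rule sweedler_add_balanced[OF assms(4,5) abelian_group_of_module[OF assms(6)] bilin_balanced[OF assms(3)] assms(1,2)])

lemma sweedler_tens: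
  assumes "a \<in> carrier A" "b \<in> carrier B" "bilin k A B C f" "module k A" "module k B" "module k C"
  shows "sweedler C (tens k A B a b) f = f a b"
  by (rule sweedler_tens_balanced[OF assms(4,5) abelian_group_of_module[OF assms(6)] bilin_balanced[OF assms(3)] assms(1,2)])

lemma sweedler_smult:
  assumes Z: "Z \<in> carrier (tensor k A B)" and c: "c \<in> carrier k"
    and f: "bilin k A B C f" and A: "module k A" and B: "module k B" and C: "module k C"
  shows "sweedler C (c \<odot>\<^bsub>tensor k A B\<^esub> Z) f = c \<odot>\<^bsub>C\<^esub> sweedler C Z f"
  using A B Z
proof (induction rule: tensor_induction)
  case (tens a b)
  interpret A: module k A by fact
  have "sweedler C (c \<odot>\<^bsub>tensor k A B\<^esub> tens k A B a b) f = f (c \<odot>\<^bsub>A\<^esub> a) b"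
    using tens c f A B C by (simp add: smult_tens_left sweedler_tens)
  also have "\<dots> = c \<odot>\<^bsub>C\<^esub> f a b"
    using linear_smult[OF bilin_left[OF f tens(2)] c tens(1)] .
  finally show ?case using tens f A B C by (simp add: sweedler_tens)
next
  case (add Z W)
  interpret C: module k C by fact
  interpret T: module k "tensor k A B" by (rule tensor_module[OF A B])
  show ?case using add c f A B C
    by (simp add: T.smult_r_distr C.smult_r_distr sweedler_add sweedler_closed[of _ k A B])
qed

text \<open>
  Most identities below are proved with this: an element like \<open>\<Delta>(h)\<close>, which is rarely a pure tensor,
  is replaced by an arbitrary tensor, on which both sides are linear.
\<close>

lemma linear_ext:
  assumes F: "linear_map k (tensor k A B) C F" and G: "linear_map k (tensor k A B) C G"
    and eq: "\<And>a b. a \<in> carrier A \<Longrightarrow> b \<in> carrier B \<Longrightarrow> F (tens k A B a b) = G (tens k A B a b)"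
    and Z: "Z \<in> carrier (tensor k A B)" and A: "module k A" and B: "module k B"
  shows "F Z = G Z"
  using A B Z
  by (induction rule: tensor_induction) (simp_all add: eq linear_add[OF F] linear_add[OF G])

section \<open>Rules for recognising linear maps\<close>

lemma bilinI [lin]:
  assumes "\<And>a. a \<in> carrier A \<Longrightarrow> linear_map k B C (\<lambda>b. f a b)"
    and "\<And>b. b \<in> carrier B \<Longrightarrow> linear_map k A C (\<lambda>a. f a b)"
  shows "bilin k A B C f"
  using assms by (auto simp: bilin_def)

lemma lin_id [lin]: "linear_map k A A (\<lambda>x. x)" by (simp add: linear_map_def)

lemma lin_idf [lin]: "linear_map k A A id" by (simp add: linear_map_def)

lemmas lin_modules [lin] = tensor_module

lemmas lin_tens_closed [lin] = tens_closed

lemma lin_tens_left [lin]: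
  assumes "linear_map k D A f" "b \<in> carrier B" "module k A" "module k B"
  shows "linear_map k D (tensor k A B) (\<lambda>x. tens k A B (f x) b)"
  using assms
  by (intro linear_mapI)
    (simp_all add: linear_closed[OF assms(1)] linear_add[OF assms(1)] linear_smult[OF assms(1)]
      tens_add_left smult_tens_left tens_closed)

lemma smult_tens_right:
  assumes "module k A" "module k B" "c \<in> carrier k" "a \<in> carrier A" "b \<in> carrier B"
  shows "c \<odot>\<^bsub>tensor k A B\<^esub> tens k A B a b = tens k A B a (c \<odot>\<^bsub>B\<^esub> b)"
  using assms by (simp add: smult_tens_left tens_smult_balanced)

lemma lin_tens_right [lin]:
  assumes "linear_map k D B f" "a \<in> carrier A" "module k A" "module k B"
  shows "linear_map k D (tensor k A B) (\<lambda>x. tens k A B a (f x))"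
  using assms
  by (intro linear_mapI)
    (simp_all add: linear_closed[OF assms(1)] linear_add[OF assms(1)] linear_smult[OF assms(1)]
      tens_add_right smult_tens_right tens_closed)

lemma lin_sweedler_arg [lin]:
  assumes w: "linear_map k D (tensor k A B) w" and f: "bilin k A B C f"
    and "module k A" "module k B" "module k C"
  shows "linear_map k D C (\<lambda>x. sweedler C (w x) f)"
proof (rule linear_mapI)
  fix x y assume "x \<in> carrier D" "y \<in> carrier D"
  then show "sweedler C (w (x \<oplus>\<^bsub>D\<^esub> y)) f = sweedler C (w x) f \<oplus>\<^bsub>C\<^esub> sweedler C (w y) f"
    using assms by (simp add: linear_add[OF w] linear_closed[OF w] sweedler_add)
next
  fix c x assume "c \<in> carrier k" "x \<in> carrier D"
  then show "sweedler C (w (c \<odot>\<^bsub>D\<^esub> x)) f = c \<odot>\<^bsub>C\<^esub> sweedler C (w x) f"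
    using assms by (simp add: linear_smult[OF w] linear_closed[OF w] sweedler_smult)
qed (use assms linear_closed[OF w] sweedler_closed in metis)

lemma sweedler_linear:
  assumes g: "linear_map k C D g" and Z: "Z \<in> carrier (tensor k A B)" and f: "bilin k A B C f"
    and A: "module k A" and B: "module k B" and C: "module k C" and D: "module k D"
  shows "g (sweedler C Z f) = sweedler D Z (\<lambda>a b. g (f a b))"
proof -
  have gf: "bilin k A B D (\<lambda>a b. g (f a b))"
    using f g by (auto simp: bilin_def intro: lin_comp)
  have F: "linear_map k (tensor k A B) D (\<lambda>Z. g (sweedler C Z f))"
    by (rule lin_comp[OF g] assms lin)+
  have G: "linear_map k (tensor k A B) D (\<lambda>Z. sweedler D Z (\<lambda>a b. g (f a b)))"
    by (rule gf assms lin)+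
  show ?thesis
    by (rule linear_ext[OF F G _ Z A B])
      (simp add: sweedler_tens[OF _ _ f A B C] sweedler_tens[OF _ _ gf A B D])
qed

lemma lin_add [lin]:
  assumes f: "linear_map k A C f" and g: "linear_map k A C g" and C: "module k C"
  shows "linear_map k A C (\<lambda>x. f x \<oplus>\<^bsub>C\<^esub> g x)"
proof -
  interpret C: module k C by fact
  show ?thesis
    by (intro linear_mapI) (simp_all add: linear_closed[OF f] linear_add[OF f] linear_smult[OF f]
        linear_closed[OF g] linear_add[OF g] linear_smult[OF g] C.smult_r_distr C.a_ac)
qed

lemma sweedler_fun_add:
  assumes Z: "Z \<in> carrier (tensor k A B)" and f: "bilin k A B C f" and g: "bilin k A B C g"
    and A: "module k A" and B: "module k B" and C: "module k C"
  shows "sweedler C Z (\<lambda>a b. f a b \<oplus>\<^bsub>C\<^esub> g a b) = sweedler C Z f \<oplus>\<^bsub>C\<^esub> sweedler C Z g"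
    and "bilin k A B C (\<lambda>a b. f a b \<oplus>\<^bsub>C\<^esub> g a b)"
proof -
  interpret C: module k C by fact
  show fg: "bilin k A B C (\<lambda>a b. f a b \<oplus>\<^bsub>C\<^esub> g a b)"
    using f g by (auto simp: bilin_def intro: lin_add C)
  have closed: "f a b \<in> carrier C" "g a b \<in> carrier C" if "a \<in> carrier A" "b \<in> carrier B" for a b
    using that f g bilin_closed by metis+
  show "sweedler C Z (\<lambda>a b. f a b \<oplus>\<^bsub>C\<^esub> g a b) = sweedler C Z f \<oplus>\<^bsub>C\<^esub> sweedler C Z g"
    using A B Z
  proof (induction rule: tensor_induction)
    case (tens a b)
    then show ?case using assms fg by (simp add: sweedler_tens)
  next
    case (add Z W)
    then show ?case using assms fg
      by (simp add: sweedler_add C.a_ac sweedler_closed[of _ k A B])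
  qed
qed

text \<open>
  The usual step of a computation in Sweedler notation: a linear map is moved under the sum and
  evaluated there.
\<close>

lemma sweedler_push:
  assumes "linear_map k C D g" "Z \<in> carrier (tensor k A B)" "bilin k A B C f"
    and "module k A" "module k B" "module k C" "module k D"
    and "\<And>a b. a \<in> carrier A \<Longrightarrow> b \<in> carrier B \<Longrightarrow> g (f a b) = h a b"
  shows "g (sweedler C Z f) = sweedler D Z h"
  using sweedler_linear[OF assms(1-7)] sweedler_cong[OF assms(4,5,2,8)] by simp

lemma sweedler_fun_smult:
  assumes Z: "Z \<in> carrier (tensor k A B)" and f: "bilin k A B C f" and c: "c \<in> carrier k"
    and A: "module k A" and B: "module k B" and C: "module k C"
  shows "sweedler C Z (\<lambda>a b. c \<odot>\<^bsub>C\<^esub> f a b) = c \<odot>\<^bsub>C\<^esub> sweedler C Z f"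
proof -
  interpret C: module k C by fact
  have "linear_map k C C (\<lambda>x. c \<odot>\<^bsub>C\<^esub> x)"
    using c by (intro linear_mapI) (auto simp: C.smult_r_distr C.smult_assoc1[symmetric] C.R.m_comm)
  from sweedler_linear[OF this Z f A B C C] show ?thesis by simp
qed

lemma lin_sweedler_fun [lin]:
  assumes z: "z \<in> carrier (tensor k A B)" and f: "\<And>x. x \<in> carrier D \<Longrightarrow> bilin k A B C (f x)"
    and lin: "\<And>a b. a \<in> carrier A \<Longrightarrow> b \<in> carrier B \<Longrightarrow> linear_map k D C (\<lambda>x. f x a b)"
    and A: "module k A" and B: "module k B" and C: "module k C" and D: "module k D"
  shows "linear_map k D C (\<lambda>x. sweedler C z (f x))"
proof (rule linear_mapI)
  interpret D: module k D by fact
  show "sweedler C z (f x) \<in> carrier C" if "x \<in> carrier D" for x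
    using z f[OF that] A B C by (rule sweedler_closed)
  show "sweedler C z (f (x \<oplus>\<^bsub>D\<^esub> y)) = sweedler C z (f x) \<oplus>\<^bsub>C\<^esub> sweedler C z (f y)"
    if "x \<in> carrier D" "y \<in> carrier D" for x y
    unfolding sweedler_fun_add(1)[OF z f[OF that(1)] f[OF that(2)] A B C, symmetric]
    by (rule sweedler_cong[OF A B z]) (simp add: linear_add[OF lin] that)
  show "sweedler C z (f (c \<odot>\<^bsub>D\<^esub> x)) = c \<odot>\<^bsub>C\<^esub> sweedler C z (f x)"
    if "c \<in> carrier k" "x \<in> carrier D" for c x
    unfolding sweedler_fun_smult[OF z f[OF that(2)] that(1) A B C, symmetric]
    by (rule sweedler_cong[OF A B z]) (simp add: linear_smult[OF lin] that)
qed

lemma lin_smult_right [lin]: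
  assumes f: "linear_map k A B f" and "c \<in> carrier k" "module k B"
  shows "linear_map k A B (\<lambda>x. c \<odot>\<^bsub>B\<^esub> f x)"
proof -
  interpret B: module k B by fact
  show ?thesis using assms(2)
    by (intro linear_mapI) (auto simp: linear_closed[OF f] linear_add[OF f] linear_smult[OF f]
        B.smult_r_distr B.smult_assoc1[symmetric] B.R.m_comm)
qed

lemma lin_smult_left [lin]:
  assumes f: "linear_map k A (kmod k) f" and "b \<in> carrier B" "module k B"
  shows "linear_map k A B (\<lambda>x. f x \<odot>\<^bsub>B\<^esub> b)"
proof -
  interpret B: module k B by fact
  have [simp]: "f x \<in> carrier k" if "x \<in> carrier A" for x using linear_closed[OF f that] by simp
  show ?thesis using assms(2)
    by (intro linear_mapI) (auto simp: linear_add[OF f] linear_smult[OF f]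
        B.smult_l_distr B.smult_assoc1)
qed

lemma lin_kmult_left [lin]:
  assumes "linear_map k A (kmod k) f" "c \<in> carrier k" "module k (kmod k)"
  shows "linear_map k A (kmod k) (\<lambda>x. f x \<otimes>\<^bsub>k\<^esub> c)"
  using lin_smult_left[OF assms(1), of c "kmod k"] assms(2,3) by simp

lemma lin_kmult_right [lin]:
  assumes "linear_map k A (kmod k) f" "c \<in> carrier k" "module k (kmod k)"
  shows "linear_map k A (kmod k) (\<lambda>x. c \<otimes>\<^bsub>k\<^esub> f x)"
  using lin_smult_right[OF assms(1), of c] assms(2,3) by simp

lemma closed_smult [lin]: "c \<in> carrier k \<Longrightarrow> x \<in> carrier A \<Longrightarrow> module k A \<Longrightarrow> c \<odot>\<^bsub>A\<^esub> x \<in> carrier A"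
  by (rule module.smult_closed)

lemma closed_kmod [lin]: "x \<in> carrier k \<Longrightarrow> x \<in> carrier (kmod k)" by simp

lemma closed_kmult [lin]:
  "c \<in> carrier k \<Longrightarrow> d \<in> carrier k \<Longrightarrow> module k (kmod k) \<Longrightarrow> c \<otimes>\<^bsub>k\<^esub> d \<in> carrier k"
  using module.smult_closed[of k "kmod k"] by simp

lemma sweedler_closed_kmod [lin]:
  assumes "Z \<in> carrier (tensor k A B)" "bilin k A B (kmod k) f"
    "module k A" "module k B" "module k (kmod k)"
  shows "sweedler (kmod k) Z f \<in> carrier k"
  using sweedler_closed[OF assms] by simp

lemmas [lin] = sweedler_closed

lemma k_algebra_module: "k_algebra k A \<Longrightarrow> module k A"
  by (simp add: k_algebra_def)

lemma k_algebra_ring: "k_algebra k A \<Longrightarrow> ring A"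
  by (simp add: k_algebra_def)

lemma closed_mult [lin]: "x \<in> carrier A \<Longrightarrow> y \<in> carrier A \<Longrightarrow> k_algebra k A \<Longrightarrow> x \<otimes>\<^bsub>A\<^esub> y \<in> carrier A"
  by (metis k_algebra_ring ring.ring_simprules(5))

lemma closed_one [lin]: "k_algebra k A \<Longrightarrow> \<one>\<^bsub>A\<^esub> \<in> carrier A"
  by (metis k_algebra_ring ring.ring_simprules(6))

lemma lin_mult_left [lin]:
  assumes f: "linear_map k D A f" and a: "a \<in> carrier A" and A: "k_algebra k A"
  shows "linear_map k D A (\<lambda>x. f x \<otimes>\<^bsub>A\<^esub> a)"
proof -
  interpret A: k_algebra k A by fact
  show ?thesis using a
    by (intro linear_mapI) (auto simp: linear_closed[OF f] linear_add[OF f] linear_smult[OF f]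
        A.l_distr A.smult_mult_left)
qed

lemma lin_mult_right [lin]:
  assumes f: "linear_map k D A f" and a: "a \<in> carrier A" and A: "k_algebra k A"
  shows "linear_map k D A (\<lambda>x. a \<otimes>\<^bsub>A\<^esub> f x)"
proof -
  interpret A: k_algebra k A by fact
  show ?thesis using a
    by (intro linear_mapI) (auto simp: linear_closed[OF f] linear_add[OF f] linear_smult[OF f]
        A.r_distr A.smult_mult_right)
qed

lemma sweedler_swap:
  assumes z: "z \<in> carrier (tensor k A B)" and w: "w \<in> carrier (tensor k A' B')"
    and f: "\<And>a b. a \<in> carrier A \<Longrightarrow> b \<in> carrier B \<Longrightarrow> bilin k A' B' C (f a b)"
    and g: "\<And>c d. c \<in> carrier A' \<Longrightarrow> d \<in> carrier B' \<Longrightarrow> bilin k A B C (\<lambda>a b. f a b c d)"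
    and A: "module k A" and B: "module k B" and A': "module k A'" and B': "module k B'"
    and C: "module k C"
  shows "sweedler C z (\<lambda>a b. sweedler C w (f a b)) =
    sweedler C w (\<lambda>c d. sweedler C z (\<lambda>a b. f a b c d))"
proof -
  note f' = bilin_right[OF f] bilin_left[OF f] and g' = bilin_right[OF g] bilin_left[OF g]
  have bil: "bilin k A B C (\<lambda>a b. sweedler C w (f a b))"
    by (rule lin w f assms g' | assumption)+
  have lf: "linear_map k (tensor k A B) C (\<lambda>z. sweedler C z (\<lambda>a b. sweedler C w (f a b)))"
    by (rule lin bil assms | assumption)+
  have lg: "linear_map k (tensor k A B) C (\<lambda>z. sweedler C w (\<lambda>c d. sweedler C z (\<lambda>a b. f a b c d)))"
    by (rule lin_sweedler_fun w lin g f' assms | assumption)+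
  show ?thesis
  proof (rule linear_ext[OF lf lg _ z A B])
    fix a b assume ab: "a \<in> carrier A" "b \<in> carrier B"
    have "sweedler C (tens k A B a b) (\<lambda>a b. sweedler C w (f a b)) = sweedler C w (f a b)"
      by (rule sweedler_tens[OF ab bil A B C])
    also have "\<dots> = sweedler C w (\<lambda>c d. sweedler C (tens k A B a b) (\<lambda>a b. f a b c d))"
      by (rule sweedler_cong[OF A' B' w]) (rule sweedler_tens[OF ab g A B C, symmetric])
    finally show "sweedler C (tens k A B a b) (\<lambda>a b. sweedler C w (f a b)) =
        sweedler C w (\<lambda>c d. sweedler C (tens k A B a b) (\<lambda>a b. f a b c d))" .
  qed
qed

section \<open>Tensor products of algebras and of linear maps\<close>

lemma tensor_rep:
  assumes "module k A" "module k B" "Z \<in> carrier (tensor k A B)" "zs \<in> Z"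
  shows "set zs \<subseteq> carrier A \<times> carrier B \<and> tclass k A B zs = Z"
proof -
  obtain us where us: "set us \<subseteq> carrier A \<times> carrier B" "Z = tclass k A B us"
    using tclass_repE[OF assms(1-3)] .
  then show ?thesis using mem_tclassD[OF assms(1,2)] assms(4) by blast
qed

lemma tensor_nonempty:
  assumes "module k A" "module k B" "Z \<in> carrier (tensor k A B)"
  shows "Z \<noteq> {}"
proof -
  obtain us where us: "set us \<subseteq> carrier A \<times> carrier B" "Z = tclass k A B us"
    using tclass_repE[OF assms] .
  then show ?thesis using tclass_self[OF assms(1,2)] by blast
qed

text \<open>
  As for scalars, the product is an iterated linear extension, which makes it independent of
  representatives.
\<close>

lemma mult_tensor:
  assumes A: "k_algebra k A" and B: "k_algebra k B"
    and Z: "Z \<in> carrier (tensor k A B)" and W: "W \<in> carrier (tensor k A B)"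
  shows "Z \<otimes>\<^bsub>tensor k A B\<^esub> W = sweedler (tensor k A B) Z (\<lambda>a b. sweedler (tensor k A B) W
    (\<lambda>a' b'. tens k A B (a \<otimes>\<^bsub>A\<^esub> a') (b \<otimes>\<^bsub>B\<^esub> b')))"
proof -
  let ?T = "tensor k A B"
  let ?g = "\<lambda>a b a' b'. tens k A B (a \<otimes>\<^bsub>A\<^esub> a') (b \<otimes>\<^bsub>B\<^esub> b')"
  let ?row = "\<lambda>a b ws. map (\<lambda>(a', b'). (a \<otimes>\<^bsub>A\<^esub> a', b \<otimes>\<^bsub>B\<^esub> b')) ws"
  note mA = k_algebra_module[OF A] and mB = k_algebra_module[OF B]
  note mT = tensor_module[OF mA mB]
  note gT = abelian_group_of_module[OF mT]
  interpret A: ring A by (rule k_algebra_ring[OF A])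
  interpret B: ring B by (rule k_algebra_ring[OF B])
  have inner: "bilin k A B ?T (?g a b)" if "a \<in> carrier A" "b \<in> carrier B" for a b
    by (rule lin A B mA mB that | assumption)+
  have outer: "bilin k A B ?T (\<lambda>a b. sweedler ?T W (?g a b))"
    by (rule lin A B mA mB W | assumption)+
  have ev_inner: "formal_eval ?T (?g a b) ws = tclass k A B (?row a b ws)"
    if "set ws \<subseteq> carrier A \<times> carrier B" "a \<in> carrier A" "b \<in> carrier B" for a b ws
    using that
  proof (induction ws)
    case Nil
    then show ?case by (simp add: formal_eval_def tensor_def)
  next
    case (Cons p ws)
    have "set (?row a b ws) \<subseteq> carrier A \<times> carrier B" using Cons.prems by auto
    then show ?case using Cons
      by (cases p) (simp add: formal_eval_def tens_def tclass_append mA mB)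
  qed
  have eq: "tclass k A B (concat (map (\<lambda>(a, b). ?row a b ws) zs)) =
      sweedler ?T Z (\<lambda>a b. sweedler ?T W (?g a b))" if zs: "zs \<in> Z" and ws: "ws \<in> W" for zs ws
  proof -
    have Z': "set zs \<subseteq> carrier A \<times> carrier B" "tclass k A B zs = Z"
      using tensor_rep[OF mA mB Z zs] by auto
    have W': "set ws \<subseteq> carrier A \<times> carrier B" "tclass k A B ws = W"
      using tensor_rep[OF mA mB W ws] by auto
    have inner_eq: "sweedler ?T W (?g a b) = tclass k A B (?row a b ws)"
      if ab: "a \<in> carrier A" "b \<in> carrier B" for a b
      using sweedler_tclass_balanced[OF mA mB gT bilin_balanced[OF inner[OF ab]] W'(1)] W'(2)
        ev_inner[OF W'(1) ab] by simp
    have row: "set (?row a b ws) \<subseteq> carrier A \<times> carrier B" if "a \<in> carrier A" "b \<in> carrier B" for a b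
      using W'(1) that by auto
    have "formal_eval ?T (\<lambda>a b. sweedler ?T W (?g a b)) us =
        tclass k A B (concat (map (\<lambda>(a, b). ?row a b ws) us)) \<and>
        set (concat (map (\<lambda>(a, b). ?row a b ws) us)) \<subseteq> carrier A \<times> carrier B"
      if "set us \<subseteq> carrier A \<times> carrier B" for us
      using that
    proof (induction us)
      case Nil
      show ?case by (simp add: formal_eval_def tensor_def)
    next
      case (Cons p us)
      obtain a b where p: "p = (a, b)" "a \<in> carrier A" "b \<in> carrier B" using Cons.prems by (cases p) auto
      have us: "set us \<subseteq> carrier A \<times> carrier B" using Cons.prems by simp
      note IH = Cons.IH[OF us]
      note 1 = row[OF p(2,3)] and 2 = IH[THEN conjunct2]
      have 3: "set (concat (map (\<lambda>(a, b). ?row a b ws) (p # us))) \<subseteq> carrier A \<times> carrier B"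
        using 1 2 unfolding p(1) list.map concat.simps split set_append by (rule Un_least)
      have "formal_eval ?T (\<lambda>a b. sweedler ?T W (?g a b)) (p # us) =
          tclass k A B (?row a b ws) \<oplus>\<^bsub>?T\<^esub> tclass k A B (concat (map (\<lambda>(a, b). ?row a b ws) us))"
        using IH[THEN conjunct1] inner_eq[OF p(2,3)] p(1)
        by (simp only: formal_eval_def foldr.simps o_apply split)
      also have "\<dots> = tclass k A B (concat (map (\<lambda>(a, b). ?row a b ws) (p # us)))"
        unfolding tclass_append[OF mA mB 1 2] p(1) by simp
      finally show ?case using 3 by (rule conjI)
    qed
    from this[OF Z'(1), THEN conjunct1]
      sweedler_tclass_balanced[OF mA mB gT bilin_balanced[OF outer] Z'(1)] Z'(2)
    show ?thesis by simp
  qed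
  have "(\<Union>zs\<in>Z. \<Union>ws\<in>W. tclass k A B (concat (map (\<lambda>(a, b). ?row a b ws) zs))) =
      (\<Union>zs\<in>Z. \<Union>ws\<in>W. sweedler ?T Z (\<lambda>a b. sweedler ?T W (?g a b)))"
    by (intro SUP_cong[OF HOL.refl] eq)
  also have "\<dots> = sweedler ?T Z (\<lambda>a b. sweedler ?T W (?g a b))"
    using tensor_nonempty[OF mA mB Z] tensor_nonempty[OF mA mB W] by simp
  finally show ?thesis by (simp add: tensor_def)
qed

lemma k_algebraI:
  assumes A: "module k A"
    and closed: "\<And>x y. x \<in> carrier A \<Longrightarrow> y \<in> carrier A \<Longrightarrow> x \<otimes>\<^bsub>A\<^esub> y \<in> carrier A"
    and one: "\<one>\<^bsub>A\<^esub> \<in> carrier A"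
    and left: "\<And>y. y \<in> carrier A \<Longrightarrow> linear_map k A A (\<lambda>x. x \<otimes>\<^bsub>A\<^esub> y)"
    and right: "\<And>x. x \<in> carrier A \<Longrightarrow> linear_map k A A (\<lambda>y. x \<otimes>\<^bsub>A\<^esub> y)"
    and assoc: "\<And>x y z. x \<in> carrier A \<Longrightarrow> y \<in> carrier A \<Longrightarrow> z \<in> carrier A \<Longrightarrow>
      (x \<otimes>\<^bsub>A\<^esub> y) \<otimes>\<^bsub>A\<^esub> z = x \<otimes>\<^bsub>A\<^esub> (y \<otimes>\<^bsub>A\<^esub> z)"
    and unit: "\<And>x. x \<in> carrier A \<Longrightarrow> \<one>\<^bsub>A\<^esub> \<otimes>\<^bsub>A\<^esub> x = x" "\<And>x. x \<in> carrier A \<Longrightarrow> x \<otimes>\<^bsub>A\<^esub> \<one>\<^bsub>A\<^esub> = x"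
  shows "k_algebra k A"
proof -
  interpret A: module k A by fact
  have "monoid A" by (rule monoidI) (auto simp: closed one assoc unit)
  then have "ring A"
    by (intro ringI) (auto simp: linear_add[OF left] linear_add[OF right] A.abelian_group_axioms)
  then show ?thesis
    using A by (auto simp: k_algebra_def k_algebra_axioms_def linear_smult[OF left] linear_smult[OF right])
qed

context
  fixes k :: "'k ring" and A :: "('k, 'a, 'm) module_scheme" and B :: "('k, 'b, 'n) module_scheme"
  assumes A: "k_algebra k A" and B: "k_algebra k B"
begin

interpretation A: k_algebra k A by (fact A)
interpretation B: k_algebra k B by (fact B)

lemmas mA = k_algebra_module[OF A] and mB = k_algebra_module[OF B]

lemma tens_mult:
  assumes "a \<in> carrier A" "b \<in> carrier B" "a' \<in> carrier A" "b' \<in> carrier B"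
  shows "tens k A B a b \<otimes>\<^bsub>tensor k A B\<^esub> tens k A B a' b' = tens k A B (a \<otimes>\<^bsub>A\<^esub> a') (b \<otimes>\<^bsub>B\<^esub> b')"
proof -
  have t: "tens k A B a b \<in> carrier (tensor k A B)" "tens k A B a' b' \<in> carrier (tensor k A B)"
    using assms by (auto intro: tens_closed mA mB)
  have 1: "bilin k A B (tensor k A B) (\<lambda>a b. sweedler (tensor k A B) (tens k A B a' b')
      (\<lambda>a' b'. tens k A B (a \<otimes>\<^bsub>A\<^esub> a') (b \<otimes>\<^bsub>B\<^esub> b')))"
    by (rule lin A B mA mB t | assumption)+
  have 2: "bilin k A B (tensor k A B) (\<lambda>a' b'. tens k A B (a \<otimes>\<^bsub>A\<^esub> a') (b \<otimes>\<^bsub>B\<^esub> b'))"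
    by (rule lin A B mA mB assms | assumption)+
  show ?thesis
    unfolding mult_tensor[OF A B t]
    by (simp add: sweedler_tens[OF assms(1,2) 1 mA mB tensor_module[OF mA mB]]
        sweedler_tens[OF assms(3,4) 2 mA mB tensor_module[OF mA mB]])
qed

lemma tensor_algebra: "k_algebra k (tensor k A B)"
proof -
  let ?T = "tensor k A B"
  note mT = tensor_module[OF mA mB]
  interpret T: module k ?T by (rule mT)
  have left: "linear_map k ?T ?T (\<lambda>Z. Z \<otimes>\<^bsub>?T\<^esub> W)" if W: "W \<in> carrier ?T" for W
  proof (rule linear_cong[OF _ mT])
    show "linear_map k ?T ?T (\<lambda>Z. sweedler ?T Z (\<lambda>a b. sweedler ?T W
        (\<lambda>a' b'. tens k A B (a \<otimes>\<^bsub>A\<^esub> a') (b \<otimes>\<^bsub>B\<^esub> b'))))"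
      by (rule lin A B mA mB W | assumption)+
  qed (simp add: mult_tensor[OF A B _ W])
  have right: "linear_map k ?T ?T (\<lambda>W. Z \<otimes>\<^bsub>?T\<^esub> W)" if Z: "Z \<in> carrier ?T" for Z
  proof (rule linear_cong[OF _ mT])
    show "linear_map k ?T ?T (\<lambda>W. sweedler ?T Z (\<lambda>a b. sweedler ?T W
        (\<lambda>a' b'. tens k A B (a \<otimes>\<^bsub>A\<^esub> a') (b \<otimes>\<^bsub>B\<^esub> b'))))"
      by (rule lin A B mA mB Z | assumption)+
  qed (simp add: mult_tensor[OF A B Z])
  note distr = linear_add[OF left] linear_add[OF right]
  have closed: "Z \<otimes>\<^bsub>?T\<^esub> W \<in> carrier ?T" if "Z \<in> carrier ?T" "W \<in> carrier ?T" for Z W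
    using linear_closed[OF left[OF that(2)] that(1)] .
  note [simp] = closed distr tens_mult tens_closed[OF mA mB]
  have one: "\<one>\<^bsub>?T\<^esub> = tens k A B \<one>\<^bsub>A\<^esub> \<one>\<^bsub>B\<^esub>" by (simp add: tensor_def)
  have assoc1: "(tens k A B a b \<otimes>\<^bsub>?T\<^esub> tens k A B a' b') \<otimes>\<^bsub>?T\<^esub> Y =
      tens k A B a b \<otimes>\<^bsub>?T\<^esub> (tens k A B a' b' \<otimes>\<^bsub>?T\<^esub> Y)"
    if "a \<in> carrier A" "b \<in> carrier B" "a' \<in> carrier A" "b' \<in> carrier B" "Y \<in> carrier ?T" for a b a' b' Y
    using mA mB that(5) that(1-4) by (induction rule: tensor_induction) (auto simp: A.m_assoc B.m_assoc)
  have assoc2: "(tens k A B a b \<otimes>\<^bsub>?T\<^esub> W) \<otimes>\<^bsub>?T\<^esub> Y = tens k A B a b \<otimes>\<^bsub>?T\<^esub> (W \<otimes>\<^bsub>?T\<^esub> Y)"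
    if "a \<in> carrier A" "b \<in> carrier B" "W \<in> carrier ?T" "Y \<in> carrier ?T" for a b W Y
    using mA mB that(3) that(1,2,4)
    by (induction rule: tensor_induction) (auto simp: assoc1 simp del: tens_mult)
  have assoc3: "(Z \<otimes>\<^bsub>?T\<^esub> W) \<otimes>\<^bsub>?T\<^esub> Y = Z \<otimes>\<^bsub>?T\<^esub> (W \<otimes>\<^bsub>?T\<^esub> Y)"
    if "Z \<in> carrier ?T" "W \<in> carrier ?T" "Y \<in> carrier ?T" for Z W Y
    using mA mB that(1) that(2,3) by (induction rule: tensor_induction) (auto simp: assoc2)
  have unit: "\<one>\<^bsub>?T\<^esub> \<otimes>\<^bsub>?T\<^esub> Z = Z \<and> Z \<otimes>\<^bsub>?T\<^esub> \<one>\<^bsub>?T\<^esub> = Z" if "Z \<in> carrier ?T" for Z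
    using mA mB that by (induction rule: tensor_induction) (auto simp: one)
  show ?thesis
    by (rule k_algebraI[OF mT]) (use left right assoc3 unit in \<open>auto simp: one\<close>)
qed

end

lemmas [lin] = tensor_algebra

lemma one_tensor: "\<one>\<^bsub>tensor k A B\<^esub> = tens k A B \<one>\<^bsub>A\<^esub> \<one>\<^bsub>B\<^esub>" by (simp add: tensor_def)

lemma lin_tmap [lin]:
  assumes "linear_map k E (tensor k A B) w" "linear_map k A C f" "linear_map k B D g"
    and "module k A" "module k B" "module k C" "module k D"
  shows "linear_map k E (tensor k C D) (\<lambda>z. tmap k C D f g (w z))"
  unfolding tmap_def by (rule lin assms lin_comp[OF assms(2)] lin_comp[OF assms(3)]
      linear_closed[OF assms(2)] linear_closed[OF assms(3)] | assumption)+

lemma tmap_closed [lin]: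
  assumes "z \<in> carrier (tensor k A B)" "linear_map k A C f" "linear_map k B D g"
    and "module k A" "module k B" "module k C" "module k D"
  shows "tmap k C D f g z \<in> carrier (tensor k C D)"
  by (rule linear_closed[OF lin_tmap[OF lin_id assms(2-)] assms(1)])

lemma tmap_tens:
  assumes "a \<in> carrier A" "b \<in> carrier B" "linear_map k A C f" "linear_map k B D g"
    and "module k A" "module k B" "module k C" "module k D"
  shows "tmap k C D f g (tens k A B a b) = tens k C D (f a) (g b)"
  unfolding tmap_def
  by (rule sweedler_tens; (rule lin assms lin_comp[OF assms(3)] lin_comp[OF assms(4)]
      linear_closed[OF assms(3)] linear_closed[OF assms(4)] | assumption)+)

lemma lin_tflip [lin]:
  assumes "linear_map k E (tensor k A B) w" "module k A" "module k B"
  shows "linear_map k E (tensor k B A) (\<lambda>z. tflip k A B (w z))"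
  unfolding tflip_def by (rule lin assms | assumption)+

lemma tflip_closed [lin]:
  assumes "z \<in> carrier (tensor k A B)" "module k A" "module k B"
  shows "tflip k A B z \<in> carrier (tensor k B A)"
  by (rule linear_closed[OF lin_tflip[OF lin_id assms(2-)] assms(1)])

lemma tflip_tens:
  assumes "a \<in> carrier A" "b \<in> carrier B" "module k A" "module k B"
  shows "tflip k A B (tens k A B a b) = tens k B A b a"
  unfolding tflip_def by (rule sweedler_tens; (rule lin assms | assumption)+)

lemma lin_assoc_right [lin]:
  assumes "linear_map k E (tensor k (tensor k A B) C) w" "module k A" "module k B" "module k C"
  shows "linear_map k E (tensor k A (tensor k B C)) (\<lambda>z. assoc_right k A B C (w z))"
  unfolding assoc_right_def Let_def by (rule lin assms | assumption)+

lemma assoc_right_closed [lin]: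
  assumes "z \<in> carrier (tensor k (tensor k A B) C)" "module k A" "module k B" "module k C"
  shows "assoc_right k A B C z \<in> carrier (tensor k A (tensor k B C))"
  by (rule linear_closed[OF lin_assoc_right[OF lin_id assms(2-)] assms(1)])

lemma assoc_right_tens:
  assumes "w \<in> carrier (tensor k A B)" "c \<in> carrier C" "module k A" "module k B" "module k C"
  shows "assoc_right k A B C (tens k (tensor k A B) C w c) =
    sweedler (tensor k A (tensor k B C)) w (\<lambda>a b. tens k A (tensor k B C) a (tens k B C b c))"
  unfolding assoc_right_def Let_def by (rule sweedler_tens; (rule lin assms | assumption)+)

lemma lin_assoc_left [lin]:
  assumes "linear_map k E (tensor k A (tensor k B C)) w" "module k A" "module k B" "module k C"
  shows "linear_map k E (tensor k (tensor k A B) C) (\<lambda>z. assoc_left k A B C (w z))"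
  unfolding assoc_left_def Let_def by (rule lin assms | assumption)+

lemma assoc_left_closed [lin]:
  assumes "z \<in> carrier (tensor k A (tensor k B C))" "module k A" "module k B" "module k C"
  shows "assoc_left k A B C z \<in> carrier (tensor k (tensor k A B) C)"
  by (rule linear_closed[OF lin_assoc_left[OF lin_id assms(2-)] assms(1)])

lemma assoc_left_tens:
  assumes "a \<in> carrier A" "w \<in> carrier (tensor k B C)" "module k A" "module k B" "module k C"
  shows "assoc_left k A B C (tens k A (tensor k B C) a w) =
    sweedler (tensor k (tensor k A B) C) w (\<lambda>b c. tens k (tensor k A B) C (tens k A B a b) c)"
  unfolding assoc_left_def Let_def by (rule sweedler_tens; (rule lin assms | assumption)+)

text \<open>
  A tensor product, as a vector space, sees only the vector spaces of its factors.  One space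
  occurs below with several products: \<open>H\<close> and \<open>opp H\<close>, functionals with and without the structure of a
  dual bialgebra, a tensor product of algebras and the codouble on it.
\<close>

definition same_space ::
  "('k, 'a, 'm) module_scheme \<Rightarrow> ('k, 'a, 'n) module_scheme \<Rightarrow> bool" where
  "same_space A A' \<longleftrightarrow> carrier A = carrier A' \<and> add A = add A' \<and> zero A = zero A' \<and>
    smult A = smult A'"

lemma same_space_sym: "same_space A A' \<Longrightarrow> same_space A' A" by (simp add: same_space_def)

lemma tens_rel_same_spaceD:
  assumes "tens_rel k A B zs ws" and s: "same_space A A'" "same_space B B'"
  shows "tens_rel k A' B' zs ws"
  using assms(1)
proof induction
    case (trans zs ws vs)
    from trans.IH show ?case by (rule tens_rel.trans)
  next
    case (sym zs ws)
    from sym.IH show ?case by (rule tens_rel.sym)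
  next
    case (append zs zs' ws ws')
    from append.IH show ?case by (rule tens_rel.append)
  next
    case (refl zs)
    then show ?case using s by (intro tens_rel.refl) (simp add: same_space_def)
  next
    case (comm zs ws)
    then show ?case using s by (intro tens_rel.comm) (simp_all add: same_space_def)
  next
    case (zero b)
    have "tens_rel k A' B' [(\<zero>\<^bsub>A'\<^esub>, b)] []"
      using zero s by (intro tens_rel.zero) (simp add: same_space_def)
    then show ?case using s by (simp add: same_space_def)
  next
    case (add_left a a' b)
    have "tens_rel k A' B' [(a \<oplus>\<^bsub>A'\<^esub> a', b)] [(a, b), (a', b)]"
      using add_left s by (intro tens_rel.add_left) (simp_all add: same_space_def)
    then show ?case using s by (simp add: same_space_def)
  next
    case (add_right a b b')
    have "tens_rel k A' B' [(a, b \<oplus>\<^bsub>B'\<^esub> b')] [(a, b), (a, b')]"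
      using add_right s by (intro tens_rel.add_right) (simp_all add: same_space_def)
    then show ?case using s by (simp add: same_space_def)
  next
    case (smult c a b)
    have "tens_rel k A' B' [(c \<odot>\<^bsub>A'\<^esub> a, b)] [(a, c \<odot>\<^bsub>B'\<^esub> b)]"
      using smult s by (intro tens_rel.smult) (simp_all add: same_space_def)
    then show ?case using s by (simp add: same_space_def)
qed

lemma tens_rel_same_space:
  assumes "same_space A A'" "same_space B B'"
  shows "tens_rel k A B = tens_rel k A' B'"
  by (intro ext iffI)
    (erule tens_rel_same_spaceD[OF _ assms], erule tens_rel_same_spaceD[OF _ assms[THEN same_space_sym]])

lemma tclass_same_space: "same_space A A' \<Longrightarrow> same_space B B' \<Longrightarrow> tclass k A B = tclass k A' B'"
  unfolding tclass_def by (simp add: tens_rel_same_space[of A A' B B'])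

lemma tens_same_space: "same_space A A' \<Longrightarrow> same_space B B' \<Longrightarrow> tens k A B = tens k A' B'"
  unfolding tens_def by (simp add: tclass_same_space[of A A' B B'])

lemma tensor_same_space:
  assumes "same_space A A'" "same_space B B'"
  shows "same_space (tensor k A B) (tensor k A' B')"
proof -
  have "tclass k A B = tclass k A' B'" by (rule tclass_same_space[OF assms])
  then show ?thesis using assms unfolding same_space_def by (simp add: tensor_def)
qed

lemma module_same_space:
  assumes "same_space A A'" "module k A"
  shows "module k A'"
proof -
  interpret A: module k A by fact
  have eqs: "carrier A' = carrier A" "add A' = add A" "zero A' = zero A" "smult A' = smult A"
    using assms(1) by (simp_all add: same_space_def)
  have "abelian_group A'"
    by (rule abelian_groupI) (auto simp: eqs A.a_ac intro: A.l_neg)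
  then show ?thesis
    by (intro moduleI) (auto simp: eqs A.smult_l_distr A.smult_r_distr A.smult_assoc1 A.R.is_cring)
qed

lemma linear_same_space:
  assumes "same_space A A'" "same_space B B'"
  shows "linear_map k A B f \<longleftrightarrow> linear_map k A' B' f"
  using assms by (simp add: linear_map_def same_space_def)

lemma sweedler_same_space: "same_space C C' \<Longrightarrow> sweedler C z f = sweedler C' z f"
  by (simp add: sweedler_def formal_eval_def same_space_def)

section \<open>Perfect pairings\<close>

lemma kmod_module_of: "module k A \<Longrightarrow> module k (kmod k)"
  by (rule module_kmod) (rule cring_of_module)

definition slice ::
  "('k, 'x, 'm) module_scheme \<Rightarrow> ('v \<Rightarrow> 'a \<Rightarrow> 'k) \<Rightarrow> 'v \<Rightarrow> ('a, 'x) tens \<Rightarrow> 'x" where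
  "slice X P v z = sweedler X z (\<lambda>a y. P v a \<odot>\<^bsub>X\<^esub> y)"

text \<open>
  The tensor \<open>\<Omega>\<close> is \<open>\<Sum>\<^sub>i e\<^sub>i \<otimes> v\<^sub>i\<close> for dual bases \<open>(e\<^sub>i)\<close> and \<open>(v\<^sub>i)\<close> of \<open>K\<close> and \<open>V\<close>.  Keeping the dual
  bases as one tensor turns sums over them into Sweedler sums, for which the rules \<open>lin\<close> apply.
\<close>

locale perfect =
  fixes k :: "'k ring" and K :: "('k, 'a, 'm) module_scheme" and V :: "('k, 'v, 'n) module_scheme"
    and P :: "'v \<Rightarrow> 'a \<Rightarrow> 'k" and \<Omega> :: "('a, 'v) tens"
  assumes mK: "module k K" and mV: "module k V" and P: "bilin k V K (kmod k) P"
    and \<Omega>: "\<Omega> \<in> carrier (tensor k K V)"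
    and expand_left: "a \<in> carrier K \<Longrightarrow> sweedler K \<Omega> (\<lambda>e v. P v a \<odot>\<^bsub>K\<^esub> e) = a"
    and expand_right: "w \<in> carrier V \<Longrightarrow> sweedler V \<Omega> (\<lambda>e v. P w e \<odot>\<^bsub>V\<^esub> v) = w"
begin

lemma mk: "module k (kmod k)" by (rule kmod_module_of[OF mK])

lemmas [lin] = mK mV \<Omega> mk

lemma P_closed [lin]: "v \<in> carrier V \<Longrightarrow> a \<in> carrier K \<Longrightarrow> P v a \<in> carrier k"
  using bilin_closed[OF P] by simp

lemma lin_P_left [lin]: "linear_map k A V f \<Longrightarrow> a \<in> carrier K \<Longrightarrow> linear_map k A (kmod k) (\<lambda>x. P (f x) a)"
  by (rule lin_comp[OF bilin_left[OF P]])

lemma lin_P_right [lin]: "linear_map k A K f \<Longrightarrow> v \<in> carrier V \<Longrightarrow> linear_map k A (kmod k) (\<lambda>x. P v (f x))"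
  by (rule lin_comp[OF bilin_right[OF P]])

lemma contract_left:
  assumes "linear_map k K C \<phi>" "a \<in> carrier K" "module k C"
  shows "sweedler C \<Omega> (\<lambda>e v. P v a \<odot>\<^bsub>C\<^esub> \<phi> e) = \<phi> a"
proof -
  have "\<phi> (sweedler K \<Omega> (\<lambda>e v. P v a \<odot>\<^bsub>K\<^esub> e)) = sweedler C \<Omega> (\<lambda>e v. P v a \<odot>\<^bsub>C\<^esub> \<phi> e)"
    by (rule sweedler_push[OF assms(1) \<Omega>])
      ((rule assms lin | assumption)+, simp add: linear_smult[OF assms(1)] P_closed assms)
  then show ?thesis by (simp add: expand_left assms)
qed

lemma contract_right:
  assumes "linear_map k V C \<phi>" "w \<in> carrier V" "module k C"
  shows "sweedler C \<Omega> (\<lambda>e v. P w e \<odot>\<^bsub>C\<^esub> \<phi> v) = \<phi> w"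
proof -
  have "\<phi> (sweedler V \<Omega> (\<lambda>e v. P w e \<odot>\<^bsub>V\<^esub> v)) = sweedler C \<Omega> (\<lambda>e v. P w e \<odot>\<^bsub>C\<^esub> \<phi> v)"
    by (rule sweedler_push[OF assms(1) \<Omega>])
      ((rule assms lin | assumption)+, simp add: linear_smult[OF assms(1)] P_closed assms)
  then show ?thesis by (simp add: expand_right assms)
qed

lemma pairing_eqI:
  assumes "v \<in> carrier V" "w \<in> carrier V" "\<And>a. a \<in> carrier K \<Longrightarrow> P v a = P w a"
  shows "v = w"
proof -
  have "sweedler V \<Omega> (\<lambda>e u. P v e \<odot>\<^bsub>V\<^esub> u) = sweedler V \<Omega> (\<lambda>e u. P w e \<odot>\<^bsub>V\<^esub> u)"
    by (rule sweedler_cong[OF mK mV \<Omega>]) (simp add: assms)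
  then show ?thesis by (simp add: expand_right assms)
qed

text \<open>
  The functional \<open>\<phi>\<close> is represented by \<open>\<Sum>\<^sub>i \<phi>(e\<^sub>i) v\<^sub>i\<close>.
\<close>

lemma represent:
  assumes "linear_map k K (kmod k) \<phi>"
  shows "\<exists>w\<in>carrier V. \<forall>a\<in>carrier K. P w a = \<phi> a"
proof (intro bexI ballI)
  let ?w = "sweedler V \<Omega> (\<lambda>e v. \<phi> e \<odot>\<^bsub>V\<^esub> v)"
  have \<phi>: "\<phi> e \<in> carrier k" if "e \<in> carrier K" for e using linear_closed[OF assms that] by simp
  show "?w \<in> carrier V" by (rule lin lin_comp[OF assms] \<phi> | assumption)+
  fix a assume a: "a \<in> carrier K"
  interpret cring k by (rule cring_of_module[OF mK])
  have "P ?w a = sweedler (kmod k) \<Omega> (\<lambda>e v. P v a \<odot>\<^bsub>kmod k\<^esub> \<phi> e)"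
    by (rule sweedler_push[where g = "\<lambda>w. P w a", OF _ \<Omega>]; (rule lin lin_comp[OF assms] \<phi> a | assumption)?)
      (simp_all add: linear_smult[OF bilin_left[OF P a]] \<phi> m_comm P_closed a, (rule lin lin_comp[OF assms] \<phi> a | assumption)+)
  also have "\<dots> = \<phi> a" by (rule contract_left[OF assms a mk])
  finally show "P ?w a = \<phi> a" .
qed

lemma linear_by_pairing:
  assumes E: "module k E" and cl: "\<And>x. x \<in> carrier E \<Longrightarrow> F x \<in> carrier V"
    and ln: "\<And>a. a \<in> carrier K \<Longrightarrow> linear_map k E (kmod k) (\<lambda>x. P (F x) a)"
  shows "linear_map k E V F"
proof (rule linear_mapI[OF cl])
  interpret E: module k E by (rule E)
  interpret V: module k V by (rule mV)
  show "F (x \<oplus>\<^bsub>E\<^esub> y) = F x \<oplus>\<^bsub>V\<^esub> F y" if "x \<in> carrier E" "y \<in> carrier E" for x y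
    by (rule pairing_eqI) (simp_all add: that cl linear_add[OF ln] linear_add[OF bilin_left[OF P]])
  show "F (c \<odot>\<^bsub>E\<^esub> x) = c \<odot>\<^bsub>V\<^esub> F x" if "c \<in> carrier k" "x \<in> carrier E" for c x
    by (rule pairing_eqI) (simp_all add: that cl linear_smult[OF ln] linear_smult[OF bilin_left[OF P]])
qed

lemma transpose_exists:
  assumes f: "linear_map k K K f"
  shows "\<exists>F. linear_map k V V F \<and> (\<forall>v\<in>carrier V. \<forall>a\<in>carrier K. P (F v) a = P v (f a))"
proof -
  have "\<exists>w\<in>carrier V. \<forall>a\<in>carrier K. P w a = P v (f a)" if "v \<in> carrier V" for v
    by (rule represent) (rule that lin lin_comp[OF f])+
  then obtain F where F: "\<And>v. v \<in> carrier V \<Longrightarrow> F v \<in> carrier V"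
    "\<And>v a. v \<in> carrier V \<Longrightarrow> a \<in> carrier K \<Longrightarrow> P (F v) a = P v (f a)" by metis
  have "linear_map k V V F"
  proof (rule linear_by_pairing[OF mV F(1)])
    fix a assume a: "a \<in> carrier K"
    show "linear_map k V (kmod k) (\<lambda>v. P (F v) a)"
      by (rule linear_cong[OF _ mV, where f = "\<lambda>v. P v (f a)"])
        ((rule a lin linear_closed[OF f])+, simp add: F a)
  qed
  then show ?thesis using F by blast
qed

lemma lin_slice [lin]:
  assumes "linear_map k E (tensor k K X) f" "v \<in> carrier V" "module k X"
  shows "linear_map k E X (\<lambda>x. slice X P v (f x))"
  unfolding slice_def by (rule assms lin | assumption)+

lemma lin_slice_index [lin]:
  assumes "linear_map k E V f" "z \<in> carrier (tensor k K X)" "module k X" "module k E"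
  shows "linear_map k E X (\<lambda>v. slice X P (f v) z)"
  unfolding slice_def by (rule assms lin linear_closed[OF assms(1)] | assumption)+

lemma slice_closed [lin]:
  assumes "v \<in> carrier V" "z \<in> carrier (tensor k K X)" "module k X"
  shows "slice X P v z \<in> carrier X"
  by (rule linear_closed[OF lin_slice[OF lin_id assms(1,3)] assms(2)])

lemma slice_tens:
  assumes "v \<in> carrier V" "a \<in> carrier K" "x \<in> carrier X" "module k X"
  shows "slice X P v (tens k K X a x) = P v a \<odot>\<^bsub>X\<^esub> x"
  unfolding slice_def by (rule sweedler_tens; (rule assms lin | assumption)+)

lemma slice_expand:
  assumes z: "z \<in> carrier (tensor k K X)" and X: "module k X"
  shows "sweedler (tensor k K X) \<Omega> (\<lambda>e v. tens k K X e (slice X P v z)) = z"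
proof (rule linear_ext[OF _ lin_id _ z mK X])
  show "linear_map k (tensor k K X) (tensor k K X)
      (\<lambda>z. sweedler (tensor k K X) \<Omega> (\<lambda>e v. tens k K X e (slice X P v z)))"
    by (rule X lin | assumption)+
next
  fix a x assume ax: "a \<in> carrier K" "x \<in> carrier X"
  have "sweedler (tensor k K X) \<Omega> (\<lambda>e v. tens k K X e (slice X P v (tens k K X a x))) =
      sweedler (tensor k K X) \<Omega> (\<lambda>e v. P v a \<odot>\<^bsub>tensor k K X\<^esub> tens k K X e x)"
    by (rule sweedler_cong[OF mK mV \<Omega>]) (simp add: slice_tens ax X smult_tens_right mK P_closed)
  also have "\<dots> = tens k K X a x"
    by (rule contract_left; (rule ax X lin)+)
  finally show "sweedler (tensor k K X) \<Omega> (\<lambda>e v. tens k K X e (slice X P v (tens k K X a x))) =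
      tens k K X a x" .
qed

lemma slice_eqI:
  assumes "z \<in> carrier (tensor k K X)" "w \<in> carrier (tensor k K X)" "module k X"
    and "\<And>v. v \<in> carrier V \<Longrightarrow> slice X P v z = slice X P v w"
  shows "z = w"
proof -
  have "sweedler (tensor k K X) \<Omega> (\<lambda>e v. tens k K X e (slice X P v z)) =
      sweedler (tensor k K X) \<Omega> (\<lambda>e v. tens k K X e (slice X P v w))"
    by (rule sweedler_cong[OF mK mV \<Omega>]) (simp add: assms)
  then show ?thesis by (simp add: slice_expand assms)
qed

text \<open>
  A linear family \<open>\<phi>\<close> of slices is realised by the tensor \<open>\<Sum>\<^sub>i e\<^sub>i \<otimes> \<phi>(v\<^sub>i)\<close>; conversely, by
  \<open>slice_expand\<close>, a tensor is recovered from its slices.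
\<close>

lemma slice_build:
  assumes \<phi>: "linear_map k V X \<phi>" and X: "module k X" and w: "w \<in> carrier V"
  shows "slice X P w (sweedler (tensor k K X) \<Omega> (\<lambda>e v. tens k K X e (\<phi> v))) = \<phi> w"
proof -
  note \<phi>' = lin_comp[OF \<phi>] linear_closed[OF \<phi>]
  have "slice X P w (sweedler (tensor k K X) \<Omega> (\<lambda>e v. tens k K X e (\<phi> v))) =
      sweedler X \<Omega> (\<lambda>e v. P w e \<odot>\<^bsub>X\<^esub> \<phi> v)"
    by (rule sweedler_push[OF _ \<Omega>])
      ((rule X w \<phi>' lin slice_tens | assumption)+)
  also have "\<dots> = \<phi> w" by (rule contract_right[OF \<phi> w X])
  finally show ?thesis .
qed

lemma slice_tmap:
  assumes f: "linear_map k X Y f" and z: "z \<in> carrier (tensor k K X)" and v: "v \<in> carrier V"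
    and X: "module k X" and Y: "module k Y"
  shows "slice Y P v (tmap k K Y id f z) = f (slice X P v z)"
proof (rule linear_ext[OF _ _ _ z mK X])
  show "linear_map k (tensor k K X) Y (\<lambda>z. slice Y P v (tmap k K Y id f z))"
    by (rule v X Y f lin)+
  show "linear_map k (tensor k K X) Y (\<lambda>z. f (slice X P v z))"
    by (rule v X Y lin_comp[OF f] lin)+
  fix a x assume "a \<in> carrier K" "x \<in> carrier X"
  then show "slice Y P v (tmap k K Y id f (tens k K X a x)) = f (slice X P v (tens k K X a x))"
    by (simp add: tmap_tens lin_idf f mK X Y slice_tens v linear_closed[OF f] linear_smult[OF f] P_closed)
qed

end

definition pair_tensor ::
  "'k ring \<Rightarrow> ('v \<Rightarrow> 'a \<Rightarrow> 'k) \<Rightarrow> ('w \<Rightarrow> 'b \<Rightarrow> 'k) \<Rightarrow> ('v, 'w) tens \<Rightarrow> ('a, 'b) tens \<Rightarrow> 'k" where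
  "pair_tensor k P Q d t = sweedler (kmod k) d (\<lambda>v w. sweedler (kmod k) t (\<lambda>a b. P v a \<otimes>\<^bsub>k\<^esub> Q w b))"

text \<open>
  Dual bases of \<open>K \<otimes> L\<close> and \<open>V \<otimes> W\<close> are obtained from dual bases of the factors; after regrouping the
  legs, their tensor is \<open>\<Omega> \<otimes> \<Omega>'\<close>.
\<close>

definition canonical_tensor ::
  "'k ring \<Rightarrow> ('k, 'a, 'm) module_scheme \<Rightarrow> ('k, 'v, 'n) module_scheme \<Rightarrow>
    ('k, 'b, 'o) module_scheme \<Rightarrow> ('k, 'w, 'p) module_scheme \<Rightarrow>
    ('a, 'v) tens \<Rightarrow> ('b, 'w) tens \<Rightarrow> (('a, 'b) tens, ('v, 'w) tens) tens" where
  "canonical_tensor k K V L W \<Omega> \<Omega>' =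
    (let T = tensor k (tensor k K L) (tensor k V W) in
      sweedler T \<Omega> (\<lambda>a v. sweedler T \<Omega>' (\<lambda>b w.
        tens k (tensor k K L) (tensor k V W) (tens k K L a b) (tens k V W v w))))"

locale perfect2 = left: perfect k K V P \<Omega> + right: perfect k L W Q \<Omega>' for k :: "'k ring" and K V P \<Omega> L W Q \<Omega>'
begin

lemma lin_pair_tensor_left [lin]:
  assumes "linear_map k E (tensor k V W) f" "t \<in> carrier (tensor k K L)"
  shows "linear_map k E (kmod k) (\<lambda>x. pair_tensor k P Q (f x) t)"
  unfolding pair_tensor_def by (rule assms lin | assumption)+

lemma lin_pair_tensor_right [lin]:
  assumes "linear_map k E (tensor k K L) f" "d \<in> carrier (tensor k V W)" "module k E"
  shows "linear_map k E (kmod k) (\<lambda>x. pair_tensor k P Q d (f x))"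
  unfolding pair_tensor_def by (rule assms lin linear_closed[OF assms(1)] | assumption)+

lemma pair_tensor_closed [lin]:
  assumes "d \<in> carrier (tensor k V W)" "t \<in> carrier (tensor k K L)"
  shows "pair_tensor k P Q d t \<in> carrier k"
  unfolding pair_tensor_def by (rule assms lin | assumption)+

lemma pair_tensor_tens_left:
  assumes "v \<in> carrier V" "w \<in> carrier W" "t \<in> carrier (tensor k K L)"
  shows "pair_tensor k P Q (tens k V W v w) t = sweedler (kmod k) t (\<lambda>a b. P v a \<otimes>\<^bsub>k\<^esub> Q w b)"
  unfolding pair_tensor_def by (rule sweedler_tens; (rule assms lin | assumption)+)

lemma pair_tensor_tens:
  assumes "v \<in> carrier V" "w \<in> carrier W" "a \<in> carrier K" "b \<in> carrier L"
  shows "pair_tensor k P Q (tens k V W v w) (tens k K L a b) = P v a \<otimes>\<^bsub>k\<^esub> Q w b"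
  unfolding pair_tensor_tens_left[OF assms(1,2) tens_closed[OF left.mK right.mK assms(3,4)]]
  by (rule sweedler_tens; (rule assms lin | assumption)+)

lemma pair_tensor_tens_right:
  assumes "d \<in> carrier (tensor k V W)" "a \<in> carrier K" "b \<in> carrier L"
  shows "pair_tensor k P Q d (tens k K L a b) = sweedler (kmod k) d (\<lambda>v w. P v a \<otimes>\<^bsub>k\<^esub> Q w b)"
  unfolding pair_tensor_def
  by (rule sweedler_cong[OF left.mV right.mV assms(1)]) (rule sweedler_tens; (rule assms lin | assumption)+)

lemma perfect_tensor:
  "perfect k (tensor k K L) (tensor k V W) (pair_tensor k P Q) (canonical_tensor k K V L W \<Omega> \<Omega>')"
proof (rule perfect.intro)
  let ?KL = "tensor k K L" and ?VW = "tensor k V W" and ?PQ = "pair_tensor k P Q"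
  let ?T = "tensor k ?KL ?VW"
  show mKL: "module k ?KL" and mVW: "module k ?VW" by (rule lin)+
  show bil: "bilin k ?VW ?KL (kmod k) ?PQ" by (rule lin | assumption)+
  show "canonical_tensor k K V L W \<Omega> \<Omega>' \<in> carrier ?T"
    unfolding canonical_tensor_def Let_def by (rule lin | assumption)+
  have unfold: "sweedler C (canonical_tensor k K V L W \<Omega> \<Omega>') f =
      sweedler C \<Omega> (\<lambda>a v. sweedler C \<Omega>' (\<lambda>b w. f (tens k K L a b) (tens k V W v w)))"
    if f: "bilin k ?KL ?VW C f" and C: "module k C" for f and C :: "('k, 'z, 'y) module_scheme"
  proof -
    have l: "linear_map k ?T C (\<lambda>z. sweedler C z f)" by (rule f C lin)+
    show ?thesis unfolding canonical_tensor_def Let_def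
    proof (rule sweedler_push[OF l left.\<Omega>])
      fix a v assume 1: "a \<in> carrier K" "v \<in> carrier V"
      show "sweedler C (sweedler ?T \<Omega>' (\<lambda>b w. tens k ?KL ?VW (tens k K L a b) (tens k V W v w))) f =
          sweedler C \<Omega>' (\<lambda>b w. f (tens k K L a b) (tens k V W v w))"
        by (rule sweedler_push[OF l right.\<Omega>]; (rule f C 1 lin sweedler_tens | assumption)+)
    qed (rule C lin | assumption)+
  qed
  show "sweedler ?KL (canonical_tensor k K V L W \<Omega> \<Omega>') (\<lambda>e v. ?PQ v t \<odot>\<^bsub>?KL\<^esub> e) = t"
    if t: "t \<in> carrier ?KL" for t
  proof (rule linear_ext[OF _ lin_id _ t left.mK right.mK])
    show "linear_map k ?KL ?KL (\<lambda>t. sweedler ?KL (canonical_tensor k K V L W \<Omega> \<Omega>') (\<lambda>e v. ?PQ v t \<odot>\<^bsub>?KL\<^esub> e))"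
      unfolding canonical_tensor_def Let_def by (rule lin | assumption)+
    fix x y assume xy: "x \<in> carrier K" "y \<in> carrier L"
    have xyt: "tens k K L x y \<in> carrier ?KL" by (rule xy lin)+
    have bil: "bilin k ?KL ?VW ?KL (\<lambda>e v. ?PQ v (tens k K L x y) \<odot>\<^bsub>?KL\<^esub> e)"
      by (rule xyt lin | assumption)+
    interpret mod: module k ?KL by (rule mKL)
    have "sweedler ?KL (canonical_tensor k K V L W \<Omega> \<Omega>') (\<lambda>e v. ?PQ v (tens k K L x y) \<odot>\<^bsub>?KL\<^esub> e) =
      sweedler ?KL \<Omega> (\<lambda>a v. sweedler ?KL \<Omega>' (\<lambda>b w. ?PQ (tens k V W v w) (tens k K L x y) \<odot>\<^bsub>?KL\<^esub> tens k K L a b))"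
      by (rule unfold[OF bil mKL])
    also have "\<dots> = sweedler ?KL \<Omega> (\<lambda>a v. sweedler ?KL \<Omega>' (\<lambda>b w.
        Q w y \<odot>\<^bsub>?KL\<^esub> (P v x \<odot>\<^bsub>?KL\<^esub> tens k K L a b)))"
    proof (rule sweedler_cong[OF left.mK left.mV left.\<Omega>], rule sweedler_cong[OF right.mK right.mV right.\<Omega>])
      fix a v b w assume as: "a \<in> carrier K" "v \<in> carrier V" "b \<in> carrier L" "w \<in> carrier W"
      have c: "P v x \<in> carrier k" "Q w y \<in> carrier k" "tens k K L a b \<in> carrier ?KL"
        by (rule as xy lin)+
      show "?PQ (tens k V W v w) (tens k K L x y) \<odot>\<^bsub>?KL\<^esub> tens k K L a b =
          Q w y \<odot>\<^bsub>?KL\<^esub> (P v x \<odot>\<^bsub>?KL\<^esub> tens k K L a b)"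
        unfolding pair_tensor_tens[OF as(2,4) xy] using c
        by (simp add: mod.smult_assoc1[symmetric] mod.R.m_comm)
    qed
    also have "\<dots> = sweedler ?KL \<Omega> (\<lambda>a v. P v x \<odot>\<^bsub>?KL\<^esub> tens k K L a y)"
      by (rule sweedler_cong[OF left.mK left.mV left.\<Omega>], rule right.contract_left; (rule xy lin | assumption)+)
    also have "\<dots> = tens k K L x y"
      by (rule left.contract_left; (rule xy lin)+)
    finally show "sweedler ?KL (canonical_tensor k K V L W \<Omega> \<Omega>')
      (\<lambda>e v. ?PQ v (tens k K L x y) \<odot>\<^bsub>?KL\<^esub> e) = tens k K L x y" .
  qed
  show "sweedler ?VW (canonical_tensor k K V L W \<Omega> \<Omega>') (\<lambda>e v. ?PQ d e \<odot>\<^bsub>?VW\<^esub> v) = d"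
    if d: "d \<in> carrier ?VW" for d
  proof (rule linear_ext[OF _ lin_id _ d left.mV right.mV])
    show "linear_map k ?VW ?VW (\<lambda>d. sweedler ?VW (canonical_tensor k K V L W \<Omega> \<Omega>') (\<lambda>e v. ?PQ d e \<odot>\<^bsub>?VW\<^esub> v))"
      unfolding canonical_tensor_def Let_def by (rule lin | assumption)+
    fix x y assume xy: "x \<in> carrier V" "y \<in> carrier W"
    have xyt: "tens k V W x y \<in> carrier ?VW" by (rule xy lin)+
    have bil: "bilin k ?KL ?VW ?VW (\<lambda>e v. ?PQ (tens k V W x y) e \<odot>\<^bsub>?VW\<^esub> v)"
      by (rule xyt lin | assumption)+
    interpret mod: module k ?VW by (rule mVW)
    have "sweedler ?VW (canonical_tensor k K V L W \<Omega> \<Omega>') (\<lambda>e v. ?PQ (tens k V W x y) e \<odot>\<^bsub>?VW\<^esub> v) =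
      sweedler ?VW \<Omega> (\<lambda>a v. sweedler ?VW \<Omega>' (\<lambda>b w. ?PQ (tens k V W x y) (tens k K L a b) \<odot>\<^bsub>?VW\<^esub> tens k V W v w))"
      by (rule unfold[OF bil mVW])
    also have "\<dots> = sweedler ?VW \<Omega> (\<lambda>a v. sweedler ?VW \<Omega>' (\<lambda>b w.
        Q y b \<odot>\<^bsub>?VW\<^esub> (P x a \<odot>\<^bsub>?VW\<^esub> tens k V W v w)))"
    proof (rule sweedler_cong[OF left.mK left.mV left.\<Omega>], rule sweedler_cong[OF right.mK right.mV right.\<Omega>])
      fix a v b w assume as: "a \<in> carrier K" "v \<in> carrier V" "b \<in> carrier L" "w \<in> carrier W"
      have c: "P x a \<in> carrier k" "Q y b \<in> carrier k" "tens k V W v w \<in> carrier ?VW"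
        by (rule as xy lin)+
      show "?PQ (tens k V W x y) (tens k K L a b) \<odot>\<^bsub>?VW\<^esub> tens k V W v w =
          Q y b \<odot>\<^bsub>?VW\<^esub> (P x a \<odot>\<^bsub>?VW\<^esub> tens k V W v w)"
        unfolding pair_tensor_tens[OF xy as(1,3)] using c
        by (simp add: mod.smult_assoc1[symmetric] mod.R.m_comm)
    qed
    also have "\<dots> = sweedler ?VW \<Omega> (\<lambda>a v. P x a \<odot>\<^bsub>?VW\<^esub> tens k V W v y)"
      by (rule sweedler_cong[OF left.mK left.mV left.\<Omega>], rule right.contract_right; (rule xy lin | assumption)+)
    also have "\<dots> = tens k V W x y"
      by (rule left.contract_right; (rule xy lin)+)
    finally show "sweedler ?VW (canonical_tensor k K V L W \<Omega> \<Omega>')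
      (\<lambda>e v. ?PQ (tens k V W x y) e \<odot>\<^bsub>?VW\<^esub> v) = tens k V W x y" .
  qed
qed

end

lemma perfect_flip:
  fixes k :: "'k ring"
  assumes "perfect k K V P \<Omega>"
  shows "perfect k V K (\<lambda>a v. P v a) (tflip k K V \<Omega>)"
proof -
  interpret perfect k K V P \<Omega> by fact
  have unfold: "sweedler C (tflip k K V \<Omega>) f = sweedler C \<Omega> (\<lambda>a v. f v a)"
    if f: "bilin k V K C f" and C: "module k C" for f and C :: "('k, 'z, 'y) module_scheme"
  proof -
    have "sweedler C (tflip k K V \<Omega>) f = sweedler C \<Omega> (\<lambda>a v. sweedler C (tens k V K v a) f)"
      unfolding tflip_def by (rule sweedler_linear; (rule f C lin | assumption)+)
    also have "\<dots> = sweedler C \<Omega> (\<lambda>a v. f v a)"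
      by (rule sweedler_cong[OF mK mV \<Omega>], rule sweedler_tens; (rule f C lin | assumption)+)
    finally show ?thesis .
  qed
  show ?thesis
  proof (rule perfect.intro)
    show "module k V" "module k K" by (rule lin)+
    show "bilin k K V (kmod k) (\<lambda>a v. P v a)" by (rule lin | assumption)+
    show "tflip k K V \<Omega> \<in> carrier (tensor k V K)" by (rule lin)+
    show "sweedler V (tflip k K V \<Omega>) (\<lambda>v a. P w a \<odot>\<^bsub>V\<^esub> v) = w" if w: "w \<in> carrier V" for w
    proof -
      have "bilin k V K V (\<lambda>v a. P w a \<odot>\<^bsub>V\<^esub> v)" by (rule w lin | assumption)+
      from unfold[OF this mV] show ?thesis by (simp add: expand_right w)
    qed
    show "sweedler K (tflip k K V \<Omega>) (\<lambda>v e. P v a \<odot>\<^bsub>K\<^esub> e) = a" if a: "a \<in> carrier K" for a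
    proof -
      have "bilin k V K K (\<lambda>v e. P v a \<odot>\<^bsub>K\<^esub> e)" by (rule a lin | assumption)+
      from unfold[OF this mK] show ?thesis by (simp add: expand_left a)
    qed
  qed
qed

section \<open>Coactions and actions of the dual\<close>

lemma (in perfect2) tensor_pairing_eqI:
  assumes d: "d \<in> carrier (tensor k V W)" and d': "d' \<in> carrier (tensor k V W)"
    and eq: "\<And>a b. a \<in> carrier K \<Longrightarrow> b \<in> carrier L \<Longrightarrow>
      sweedler (kmod k) d (\<lambda>v w. P v a \<otimes>\<^bsub>k\<^esub> Q w b) = sweedler (kmod k) d' (\<lambda>v w. P v a \<otimes>\<^bsub>k\<^esub> Q w b)"
  shows "d = d'"
proof -
  interpret T: perfect k "tensor k K L" "tensor k V W" "pair_tensor k P Q"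
    "canonical_tensor k K V L W \<Omega> \<Omega>'" by (rule perfect_tensor)
  show ?thesis
  proof (rule T.pairing_eqI[OF d d'])
    fix t assume t: "t \<in> carrier (tensor k K L)"
    show "pair_tensor k P Q d t = pair_tensor k P Q d' t"
      by (rule linear_ext[OF _ _ _ t left.mK right.mK, of "kmod k"])
        ((rule d d' lin)+, simp add: pair_tensor_tens_right d d' eq)
  qed
qed

text \<open>
  Product and unit of \<open>V\<close> are the transposes of coproduct and counit of \<open>K\<close>, and conversely.  These
  four equations are what translates coactions of \<open>K\<close> into actions of \<open>V\<close>.
\<close>

locale dual_pair = perfect k K V P \<Omega>
  for k :: "'k ring" and K :: "('k, 'a) bialg" and V :: "('k, 'v) bialg" and P \<Omega> +
  assumes algK: "k_algebra k K"
    and comult_K: "linear_map k K (tensor k K K) (comult K)"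
    and counit_K: "linear_map k K (kmod k) (counit K)"
    and one_V: "\<one>\<^bsub>V\<^esub> \<in> carrier V"
    and mult_V: "\<lbrakk>v \<in> carrier V; w \<in> carrier V\<rbrakk> \<Longrightarrow> v \<otimes>\<^bsub>V\<^esub> w \<in> carrier V"
    and comult_V: "v \<in> carrier V \<Longrightarrow> comult V v \<in> carrier (tensor k V V)"
    and P_mult: "\<lbrakk>v \<in> carrier V; w \<in> carrier V; x \<in> carrier K\<rbrakk> \<Longrightarrow>
      P (v \<otimes>\<^bsub>V\<^esub> w) x = sweedler (kmod k) (comult K x) (\<lambda>x1 x2. P v x1 \<otimes>\<^bsub>k\<^esub> P w x2)"
    and P_one: "x \<in> carrier K \<Longrightarrow> P \<one>\<^bsub>V\<^esub> x = counit K x"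
    and P_comult: "\<lbrakk>v \<in> carrier V; x \<in> carrier K; y \<in> carrier K\<rbrakk> \<Longrightarrow>
      P v (x \<otimes>\<^bsub>K\<^esub> y) = sweedler (kmod k) (comult V v) (\<lambda>v1 v2. P v1 x \<otimes>\<^bsub>k\<^esub> P v2 y)"
    and counit_V: "v \<in> carrier V \<Longrightarrow> counit V v = P v \<one>\<^bsub>K\<^esub>"
begin

interpretation K2: perfect2 k K V P \<Omega> K V P \<Omega> ..

lemmas [lin] = algK one_V mult_V comult_V lin_comp[OF comult_K] linear_closed[OF comult_K]
  lin_comp[OF counit_K]

lemma counit_K_closed [lin]: "x \<in> carrier K \<Longrightarrow> counit K x \<in> carrier k"
  using linear_closed[OF counit_K] by simp

lemma counit_V_closed [lin]: "v \<in> carrier V \<Longrightarrow> counit V v \<in> carrier k"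
  by (simp add: counit_V, (rule lin | assumption)+)

lemma lin_mult_V_left:
  assumes w: "w \<in> carrier V" shows "linear_map k V V (\<lambda>v. v \<otimes>\<^bsub>V\<^esub> w)"
proof (rule linear_by_pairing[OF mV mult_V[OF _ w]])
  show "linear_map k V (kmod k) (\<lambda>v. P (v \<otimes>\<^bsub>V\<^esub> w) x)" if x: "x \<in> carrier K" for x
    by (rule linear_cong[OF _ mV, where f = "\<lambda>v. sweedler (kmod k) (comult K x) (\<lambda>x1 x2. P v x1 \<otimes>\<^bsub>k\<^esub> P w x2)"])
      ((rule x w lin | assumption)+, simp add: P_mult x w)
qed

lemma lin_mult_V_right:
  assumes v: "v \<in> carrier V" shows "linear_map k V V (\<lambda>w. v \<otimes>\<^bsub>V\<^esub> w)"
proof (rule linear_by_pairing[OF mV mult_V[OF v]])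
  show "linear_map k V (kmod k) (\<lambda>w. P (v \<otimes>\<^bsub>V\<^esub> w) x)" if x: "x \<in> carrier K" for x
    by (rule linear_cong[OF _ mV, where f = "\<lambda>w. sweedler (kmod k) (comult K x) (\<lambda>x1 x2. P v x1 \<otimes>\<^bsub>k\<^esub> P w x2)"])
      ((rule x v lin | assumption)+, simp add: P_mult x v)
qed

lemma comult_V_linear: "linear_map k V (tensor k V V) (comult V)"
proof -
  interpret T: perfect k "tensor k K K" "tensor k V V" "pair_tensor k P P"
    "canonical_tensor k K V K V \<Omega> \<Omega>" by (rule K2.perfect_tensor)
  show ?thesis
  proof (rule T.linear_by_pairing[OF mV comult_V])
    fix t assume t: "t \<in> carrier (tensor k K K)"
    have b: "bilin k K K (kmod k) (\<lambda>x y. P v (x \<otimes>\<^bsub>K\<^esub> y))" if "v \<in> carrier V" for v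
      by (rule that lin | assumption)+
    have "sweedler (kmod k) t (\<lambda>x y. P v (x \<otimes>\<^bsub>K\<^esub> y)) = pair_tensor k P P (comult V v) t"
      if v: "v \<in> carrier V" for v
      by (rule linear_ext[OF _ _ _ t mK mK, of "kmod k"])
        ((rule v b lin)+, simp add: K2.pair_tensor_tens_right comult_V v P_comult
          sweedler_tens[OF _ _ b[OF v] mK mK mk])
    then show "linear_map k V (kmod k) (\<lambda>v. pair_tensor k P P (comult V v) t)"
      by (rule linear_cong[OF _ mV, rotated]) (rule t lin | assumption)+
  qed
qed

lemma counit_V_linear: "linear_map k V (kmod k) (counit V)"
  by (rule linear_cong[OF _ mV, where f = "\<lambda>v. P v \<one>\<^bsub>K\<^esub>"]) ((rule lin)+, simp add: counit_V)

lemmas [lin] = lin_comp[OF comult_V_linear] lin_comp[OF counit_V_linear]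
  lin_comp[OF lin_mult_V_left] lin_comp[OF lin_mult_V_right]

text \<open>
  The equations are symmetric in \<open>K\<close> and \<open>V\<close>.  This lets \<open>H\<close> act where its dual coacts.
\<close>

lemma dual_pair_flip:
  assumes "k_algebra k V"
  shows "dual_pair k V K (\<lambda>a v. P v a) (tflip k K V \<Omega>)"
proof (rule dual_pair.intro)
  show "perfect k V K (\<lambda>a v. P v a) (tflip k K V \<Omega>)" by (rule perfect_flip) (rule perfect_axioms)
  interpret algebra: k_algebra k K by (rule algK)
  show "dual_pair_axioms k V K (\<lambda>a v. P v a)"
    by (rule dual_pair_axioms.intro)
      (simp_all add: assms comult_V_linear counit_V_linear linear_closed[OF comult_K]
        P_comult P_mult P_one counit_V)
qed

lemma slice_eq_iff:
  assumes "z \<in> carrier (tensor k K X)" "w \<in> carrier (tensor k K X)" "module k X"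
  shows "z = w \<longleftrightarrow> (\<forall>v\<in>carrier V. slice X P v z = slice X P v w)"
  using slice_eqI[OF assms] by metis

text \<open>
  On pure tensors this is the equation \<open>P(v, ab) = P(v\<^sub>(\<^sub>1\<^sub>), a) P(v\<^sub>(\<^sub>2\<^sub>), b)\<close>.
\<close>

lemma slice_mult:
  assumes v: "v \<in> carrier V" and z: "z \<in> carrier (tensor k K X)" and w: "w \<in> carrier (tensor k K X)"
    and X: "k_algebra k X"
  shows "slice X P v (z \<otimes>\<^bsub>tensor k K X\<^esub> w) =
    sweedler X (comult V v) (\<lambda>v1 v2. slice X P v1 z \<otimes>\<^bsub>X\<^esub> slice X P v2 w)"
proof -
  note mX = k_algebra_module[OF X]
  interpret X: k_algebra k X by (rule X)
  show ?thesis
  proof (rule linear_ext[OF _ _ _ z mK mX])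
    show "linear_map k (tensor k K X) X (\<lambda>z. slice X P v (z \<otimes>\<^bsub>tensor k K X\<^esub> w))"
      by (rule v w X mX lin)+
    show "linear_map k (tensor k K X) X
        (\<lambda>z. sweedler X (comult V v) (\<lambda>v1 v2. slice X P v1 z \<otimes>\<^bsub>X\<^esub> slice X P v2 w))"
      by (rule v w X mX lin | assumption)+
    fix a x assume ax: "a \<in> carrier K" "x \<in> carrier X"
    have t: "tens k K X a x \<in> carrier (tensor k K X)" by (rule ax mX lin)+
    show "slice X P v (tens k K X a x \<otimes>\<^bsub>tensor k K X\<^esub> w) =
      sweedler X (comult V v) (\<lambda>v1 v2. slice X P v1 (tens k K X a x) \<otimes>\<^bsub>X\<^esub> slice X P v2 w)"
    proof (rule linear_ext[OF _ _ _ w mK mX])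
      show "linear_map k (tensor k K X) X (\<lambda>w. slice X P v (tens k K X a x \<otimes>\<^bsub>tensor k K X\<^esub> w))"
        by (rule v t X mX lin)+
      show "linear_map k (tensor k K X) X
        (\<lambda>w. sweedler X (comult V v) (\<lambda>v1 v2. slice X P v1 (tens k K X a x) \<otimes>\<^bsub>X\<^esub> slice X P v2 w))"
        by (rule v t X mX lin | assumption)+
      fix b y assume bY: "b \<in> carrier K" "y \<in> carrier X"
      have ab: "a \<otimes>\<^bsub>K\<^esub> b \<in> carrier K" by (rule ax bY lin)+
      have xy: "x \<otimes>\<^bsub>X\<^esub> y \<in> carrier X" using ax bY by simp
      have l: "linear_map k (kmod k) X (\<lambda>c. c \<odot>\<^bsub>X\<^esub> (x \<otimes>\<^bsub>X\<^esub> y))" by (rule xy mX lin)+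
      have "P v (a \<otimes>\<^bsub>K\<^esub> b) \<odot>\<^bsub>X\<^esub> (x \<otimes>\<^bsub>X\<^esub> y) = sweedler X (comult V v)
          (\<lambda>v1 v2. slice X P v1 (tens k K X a x) \<otimes>\<^bsub>X\<^esub> slice X P v2 (tens k K X b y))"
        unfolding P_comult[OF v ax(1) bY(1)]
      proof (rule sweedler_push[OF l comult_V[OF v]])
        fix v1 v2 assume v12: "v1 \<in> carrier V" "v2 \<in> carrier V"
        have "P v1 a \<in> carrier k" "P v2 b \<in> carrier k" by (rule v12 ax bY lin)+
        then show "(P v1 a \<otimes>\<^bsub>k\<^esub> P v2 b) \<odot>\<^bsub>X\<^esub> (x \<otimes>\<^bsub>X\<^esub> y) =
            slice X P v1 (tens k K X a x) \<otimes>\<^bsub>X\<^esub> slice X P v2 (tens k K X b y)"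
          using v12 ax bY
          by (simp add: slice_tens mX X.smult_assoc1[symmetric] X.smult_mult_left X.smult_mult_right
              X.R.m_comm)
      qed (rule ax bY mX lin | assumption)+
      then show "slice X P v (tens k K X a x \<otimes>\<^bsub>tensor k K X\<^esub> tens k K X b y) =
        sweedler X (comult V v)
          (\<lambda>v1 v2. slice X P v1 (tens k K X a x) \<otimes>\<^bsub>X\<^esub> slice X P v2 (tens k K X b y))"
        using ax bY v ab xy by (simp add: tens_mult[OF algK X] slice_tens mX)
    qed
  qed
qed

lemma slice_one:
  assumes v: "v \<in> carrier V" and X: "k_algebra k X"
  shows "slice X P v \<one>\<^bsub>tensor k K X\<^esub> = counit V v \<odot>\<^bsub>X\<^esub> \<one>\<^bsub>X\<^esub>"
proof -
  interpret X: k_algebra k X by (rule X)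
  interpret K: k_algebra k K by (rule algK)
  show ?thesis by (simp add: one_tensor slice_tens v counit_V k_algebra_module[OF X])
qed

text \<open>
  On pure tensors this is the equation \<open>P(vw, a) = P(v, a\<^sub>(\<^sub>1\<^sub>)) P(w, a\<^sub>(\<^sub>2\<^sub>))\<close>.
\<close>

lemma slice_comult:
  assumes v: "v \<in> carrier V" "w \<in> carrier V" and z: "z \<in> carrier (tensor k K X)" and X: "module k X"
  shows "slice X P w (slice (tensor k K X) P v
      (assoc_right k K K X (tmap k (tensor k K K) X (comult K) id z))) = slice X P (v \<otimes>\<^bsub>V\<^esub> w) z"
proof (rule linear_ext[OF _ _ _ z mK X])
  show "linear_map k (tensor k K X) X (\<lambda>z. slice X P w (slice (tensor k K X) P v
      (assoc_right k K K X (tmap k (tensor k K K) X (comult K) id z))))"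
    by (rule v X comult_K lin)+
  show "linear_map k (tensor k K X) X (slice X P (v \<otimes>\<^bsub>V\<^esub> w))"
    by (rule v X lin)+
  fix a x assume ax: "a \<in> carrier K" "x \<in> carrier X"
  interpret X: module k X by (rule X)
  have a': "comult K a \<in> carrier (tensor k K K)" by (rule ax lin)+
  have l: "linear_map k (kmod k) X (\<lambda>c. c \<odot>\<^bsub>X\<^esub> x)" by (rule ax X lin)+
  have l2: "linear_map k (tensor k K (tensor k K X)) X (\<lambda>z. slice X P w (slice (tensor k K X) P v z))"
    by (rule v X lin)+
  have "slice X P w (slice (tensor k K X) P v (sweedler (tensor k K (tensor k K X)) (comult K a)
      (\<lambda>a1 a2. tens k K (tensor k K X) a1 (tens k K X a2 x)))) =
    sweedler X (comult K a) (\<lambda>a1 a2. (P v a1 \<otimes>\<^bsub>k\<^esub> P w a2) \<odot>\<^bsub>X\<^esub> x)"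
  proof (rule sweedler_push[OF l2 a'])
    fix a1 a2 assume a12: "a1 \<in> carrier K" "a2 \<in> carrier K"
    have c: "P v a1 \<in> carrier k" "P w a2 \<in> carrier k" by (rule a12 v lin)+
    have t: "tens k K X a2 x \<in> carrier (tensor k K X)" by (rule a12 ax X lin)+
    have lw: "linear_map k (tensor k K X) X (slice X P w)" by (rule v X lin)+
    show "slice X P w (slice (tensor k K X) P v (tens k K (tensor k K X) a1 (tens k K X a2 x))) =
        (P v a1 \<otimes>\<^bsub>k\<^esub> P w a2) \<odot>\<^bsub>X\<^esub> x"
      using a12 ax c t v
      by (simp add: slice_tens X lin_modules[OF mK X] linear_smult[OF lw] X.smult_assoc1)
  qed (rule ax X lin | assumption)+
  also have "\<dots> = P (v \<otimes>\<^bsub>V\<^esub> w) a \<odot>\<^bsub>X\<^esub> x"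
    unfolding P_mult[OF v ax(1)]
    by (rule sweedler_linear[OF l, symmetric]; (rule v ax X lin | assumption)+)
  finally show "slice X P w (slice (tensor k K X) P v
      (assoc_right k K K X (tmap k (tensor k K K) X (comult K) id (tens k K X a x)))) =
      slice X P (v \<otimes>\<^bsub>V\<^esub> w) (tens k K X a x)"
    using ax a' v by (simp add: tmap_tens[OF _ _ comult_K lin_idf mK X lin_modules[OF mK mK] X]
        assoc_right_tens mK X slice_tens mult_V)
qed

lemma induced_action_slice:
  "x \<in> carrier X \<Longrightarrow> v \<in> carrier V \<Longrightarrow> induced_action V P X \<gamma> x v = slice X P v (\<gamma> x)"
  by (simp add: induced_action_def slice_def)

text \<open>
  Slices separate the points of \<open>K \<otimes> X\<close>, so that every clause about \<open>\<gamma>\<close> may be tested on slices.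
  There, multiplicativity of \<open>\<gamma>\<close> becomes the product rule of the action, preservation of the unit
  its behaviour on the unit, coassociativity its associativity, and the counit law says that the
  unit of \<open>V\<close> acts trivially.
\<close>

lemma left_coaction_iff_right_action:
  assumes X: "k_algebra k X" and ext: "\<gamma> \<in> extensional (carrier X)"
    and ln: "linear_map k X (tensor k K X) \<gamma>"
  shows "left_coaction k K X \<gamma> \<longleftrightarrow> right_action k V X (induced_action V P X \<gamma>)"
proof -
  let ?KX = "tensor k K X" and ?act = "induced_action V P X \<gamma>"
  note mX = k_algebra_module[OF X]
  interpret X: k_algebra k X by (rule X)
  interpret KX: k_algebra k ?KX by (rule X lin)+
  note cl = linear_closed[OF ln] and lg = lin_comp[OF ln]
  have ac: "?act x v = slice X P v (\<gamma> x)" if "x \<in> carrier X" "v \<in> carrier V" for x v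
    using that by (rule induced_action_slice)
  have acl: "?act x v \<in> carrier X" if "x \<in> carrier X" "v \<in> carrier V" for x v
    using that by (simp add: ac slice_closed[OF _ cl mX])
  have mult: "(\<gamma> (x \<otimes>\<^bsub>X\<^esub> y) = \<gamma> x \<otimes>\<^bsub>?KX\<^esub> \<gamma> y) \<longleftrightarrow> (\<forall>v\<in>carrier V. ?act (x \<otimes>\<^bsub>X\<^esub> y) v =
      sweedler X (comult V v) (\<lambda>v1 v2. ?act x v1 \<otimes>\<^bsub>X\<^esub> ?act y v2))"
    if xy: "x \<in> carrier X" "y \<in> carrier X" for x y
  proof -
    have "slice X P v (\<gamma> x \<otimes>\<^bsub>?KX\<^esub> \<gamma> y) =
        sweedler X (comult V v) (\<lambda>v1 v2. ?act x v1 \<otimes>\<^bsub>X\<^esub> ?act y v2)" if v: "v \<in> carrier V" for v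
      unfolding slice_mult[OF v cl[OF xy(1)] cl[OF xy(2)] X]
      by (rule sweedler_cong[OF mV mV comult_V[OF v]]) (simp add: ac xy)
    then show ?thesis using xy
      by (simp add: slice_eq_iff[OF cl[OF X.m_closed[OF xy]] KX.m_closed[OF cl[OF xy(1)] cl[OF xy(2)]] mX] ac)
  qed
  have one: "\<gamma> \<one>\<^bsub>X\<^esub> = \<one>\<^bsub>?KX\<^esub> \<longleftrightarrow> (\<forall>v\<in>carrier V. ?act \<one>\<^bsub>X\<^esub> v = counit V v \<odot>\<^bsub>X\<^esub> \<one>\<^bsub>X\<^esub>)"
    by (simp add: slice_eq_iff[OF cl KX.one_closed mX] ac slice_one[OF _ X])
  have assoc: "assoc_right k K K X (tmap k (tensor k K K) X (comult K) id (\<gamma> x)) = tmap k K ?KX id \<gamma> (\<gamma> x)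
      \<longleftrightarrow> (\<forall>v\<in>carrier V. \<forall>w\<in>carrier V. ?act x (v \<otimes>\<^bsub>V\<^esub> w) = ?act (?act x v) w)"
    if x: "x \<in> carrier X" for x
  proof -
    note gx = cl[OF x]
    have L: "assoc_right k K K X (tmap k (tensor k K K) X (comult K) id (\<gamma> x)) \<in> carrier (tensor k K ?KX)"
      by (rule gx mX comult_K lin)+
    have R: "tmap k K ?KX id \<gamma> (\<gamma> x) \<in> carrier (tensor k K ?KX)"
      by (rule gx mX assms(3) lin)+
    have 1: "?act x (v \<otimes>\<^bsub>V\<^esub> w) = slice X P w (slice ?KX P v
        (assoc_right k K K X (tmap k (tensor k K K) X (comult K) id (\<gamma> x))))"
      if "v \<in> carrier V" "w \<in> carrier V" for v w
      using that x by (simp add: ac mult_V slice_comult[OF _ _ gx mX])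
    have 2: "?act (?act x v) w = slice X P w (slice ?KX P v (tmap k K ?KX id \<gamma> (\<gamma> x)))"
      if "v \<in> carrier V" "w \<in> carrier V" for v w
      using that x acl by (simp add: ac[symmetric] slice_tmap[OF ln gx _ mX lin_modules[OF mK mX]])
    show ?thesis
    proof
      assume "\<forall>v\<in>carrier V. \<forall>w\<in>carrier V. ?act x (v \<otimes>\<^bsub>V\<^esub> w) = ?act (?act x v) w"
      then show "assoc_right k K K X (tmap k (tensor k K K) X (comult K) id (\<gamma> x)) = tmap k K ?KX id \<gamma> (\<gamma> x)"
        by (intro slice_eqI[OF L R lin_modules[OF mK mX]] slice_eqI[OF _ _ mX])
          (simp_all add: 1[symmetric] 2[symmetric] slice_closed L R lin_modules[OF mK mX])
    qed (simp add: 1 2)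
  qed
  have counit: "sweedler X (\<gamma> x) (\<lambda>a y. counit K a \<odot>\<^bsub>X\<^esub> y) = ?act x \<one>\<^bsub>V\<^esub>" if x: "x \<in> carrier X" for x
    unfolding ac[OF x one_V] slice_def
    by (rule sweedler_cong[OF mK mX cl[OF x]]) (simp add: P_one)
  have lin_act: "linear_map k V X (?act x)" if x: "x \<in> carrier X" for x
    by (rule linear_cong[OF _ mV, where f = "\<lambda>v. slice X P v (\<gamma> x)"])
      ((rule cl x mX lin)+, simp add: ac x)
  have lin_act': "linear_map k X X (\<lambda>x. ?act x v)" if v: "v \<in> carrier V" for v
    by (rule linear_cong[OF _ mX, where f = "\<lambda>x. slice X P v (\<gamma> x)"])
      ((rule lg v mX lin)+, simp add: ac v)
  have ext': "?act \<in> extensional (carrier X)" "?act x \<in> extensional (carrier V)"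
    if "x \<in> carrier X" for x
    using that by (auto simp: induced_action_def)
  have ext0: "?act \<in> extensional (carrier X)" by (simp add: induced_action_def)
  show ?thesis
    unfolding left_coaction_def right_action_def algebra_hom_def ring_hom_def mem_Collect_eq
    using ext ln lin_act lin_act' ext' ext0 mult one assoc counit linear_add[OF ln] cl
    by (auto simp: Pi_iff)
qed

lemma coaction_of_action:
  assumes X: "k_algebra k X" and act: "right_action k V X act"
  shows "\<exists>\<gamma>\<in>extensional (carrier X). linear_map k X (tensor k K X) \<gamma> \<and> induced_action V P X \<gamma> = act"
proof (intro bexI conjI)
  let ?KX = "tensor k K X"
  let ?g = "\<lambda>x. sweedler ?KX \<Omega> (\<lambda>e v. tens k K X e (act x v))"
  let ?\<gamma> = "\<lambda>x\<in>carrier X. ?g x"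
  note mX = k_algebra_module[OF X]
  have a: "linear_map k V X (act x)" if "x \<in> carrier X" for x
    using act that by (simp add: right_action_def)
  have a': "linear_map k X X (\<lambda>x. act x v)" if "v \<in> carrier V" for v
    using act that by (simp add: right_action_def)
  show "?\<gamma> \<in> extensional (carrier X)" by simp
  have g: "linear_map k X ?KX ?g" by (rule mX a a' lin lin_comp[OF a] linear_closed[OF a] | assumption)+
  show "linear_map k X ?KX ?\<gamma>" by (rule linear_cong[OF g mX]) simp
  show "induced_action V P X ?\<gamma> = act"
  proof (intro ext)
    fix x v
    show "induced_action V P X ?\<gamma> x v = act x v"
    proof (cases "x \<in> carrier X")
      case x: True
      show ?thesis
      proof (cases "v \<in> carrier V")
        case v: True
        show ?thesis using induced_action_slice[OF x v] slice_build[OF a[OF x] mX v] x by simp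
      next
        case False
        then show ?thesis using act x by (auto simp: induced_action_def right_action_def extensional_def)
      qed
    next
      case False
      then show ?thesis using act by (auto simp: induced_action_def right_action_def extensional_def)
    qed
  qed
qed

lemma induced_action_inj:
  assumes X: "k_algebra k X" and "\<gamma> \<in> extensional (carrier X)" "\<gamma>' \<in> extensional (carrier X)"
    and ln: "linear_map k X (tensor k K X) \<gamma>" "linear_map k X (tensor k K X) \<gamma>'"
    and eq: "induced_action V P X \<gamma> = induced_action V P X \<gamma>'"
  shows "\<gamma> = \<gamma>'"
proof (rule extensionalityI[OF assms(2,3)])
  fix x assume x: "x \<in> carrier X"
  show "\<gamma> x = \<gamma>' x"
    by (rule slice_eqI[OF linear_closed[OF ln(1) x] linear_closed[OF ln(2) x] k_algebra_module[OF X]])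
      (simp add: induced_action_slice[OF x, symmetric] eq)
qed

text \<open>
  Slicing commutes with \<open>id \<otimes> f\<close>.
\<close>

lemma commutes_coaction_iff_action:
  assumes X: "module k X" and Y: "module k Y" and f: "linear_map k X Y f"
    and ln: "linear_map k X (tensor k K X) \<gamma>" "linear_map k Y (tensor k K Y) \<gamma>'"
  shows "commutes_coaction k K X Y \<gamma> \<gamma>' f \<longleftrightarrow>
    commutes_action V X (induced_action V P X \<gamma>) (induced_action V P Y \<gamma>') f"
proof -
  have "\<gamma>' (f x) = tmap k K Y id f (\<gamma> x) \<longleftrightarrow>
      (\<forall>v\<in>carrier V. f (slice X P v (\<gamma> x)) = slice Y P v (\<gamma>' (f x)))" if x: "x \<in> carrier X" for x
  proof -
    note gx = linear_closed[OF ln(1) x] and gfx = linear_closed[OF ln(2) linear_closed[OF f x]]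
    have t: "tmap k K Y id f (\<gamma> x) \<in> carrier (tensor k K Y)" by (rule gx X Y f lin)+
    show ?thesis
      using slice_tmap[OF f gx _ X Y] slice_eqI[OF gfx t Y] by metis
  qed
  then show ?thesis
    unfolding commutes_coaction_def commutes_action_def
    by (simp add: induced_action_slice linear_closed[OF f])
qed

end

section \<open>Dual bialgebras\<close>

lemma bilin_same_space:
  assumes "same_space A A'" "same_space B B'" "same_space C C'"
  shows "bilin k A B C f \<longleftrightarrow> bilin k A' B' C' f"
  using linear_same_space[OF assms(1,3)] linear_same_space[OF assms(2,3)] assms(1,2)
  unfolding bilin_def same_space_def by simp

lemma same_space_refl: "same_space A A" by (simp add: same_space_def)

lemma perfect_same_space:
  assumes pf: "perfect k K V P \<Omega>" and K: "same_space K K'" and V: "same_space V V'"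
  shows "perfect k K' V' P \<Omega>"
proof -
  interpret perfect k K V P \<Omega> by fact
  have c: "carrier K' = carrier K" "carrier V' = carrier V" "smult K' = smult K" "smult V' = smult V"
    using K V by (simp_all add: same_space_def)
  show ?thesis
  proof (rule perfect.intro)
    show "module k K'" by (rule module_same_space[OF K mK])
    show "module k V'" by (rule module_same_space[OF V mV])
    show "bilin k V' K' (kmod k) P"
      by (rule bilin_same_space[OF V K same_space_refl, THEN iffD1, OF P])
    show "\<Omega> \<in> carrier (tensor k K' V')"
      using \<Omega> tensor_same_space[OF K V] by (simp add: same_space_def)
    show "sweedler K' \<Omega> (\<lambda>e v. P v a \<odot>\<^bsub>K'\<^esub> e) = a" if "a \<in> carrier K'" for a
      using expand_left[of a] that by (simp add: c sweedler_same_space[OF K, symmetric])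
    show "sweedler V' \<Omega> (\<lambda>e v. P w e \<odot>\<^bsub>V'\<^esub> v) = w" if "w \<in> carrier V'" for w
      using expand_right[of w] that by (simp add: c sweedler_same_space[OF V, symmetric])
  qed
qed

lemma same_space_dual_along: "same_space V (dual_along k K V P)"
  by (simp add: same_space_def dual_along_def mk_bialg_def)

lemma the1_props:
  assumes "\<exists>!x. Q x" and "y = (THE x. Q x)"
  shows "Q y"
  using theI'[OF assms(1)] assms(2) by simp

text \<open>
  A perfect pairing represents every functional on \<open>K\<close> by one element of \<open>V\<close>, and every functional on
  \<open>K \<otimes> K\<close> by one element of \<open>V \<otimes> V\<close>.  Hence the descriptions that define \<open>dual_along\<close> have unique solutions.
\<close>

lemma dual_pair_dual_along:
  fixes K :: "('k, 'a) bialg"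
  assumes pf: "perfect k K V P \<Omega>" and K: "k_algebra k K"
    and comult: "linear_map k K (tensor k K K) (comult K)"
    and counit: "linear_map k K (kmod k) (counit K)"
  shows "dual_pair k K (dual_along k K V P) P \<Omega>"
proof -
  interpret perfect k K V P \<Omega> by (rule pf)
  interpret K2: perfect2 k K V P \<Omega> K V P \<Omega> ..
  interpret T: perfect k "tensor k K K" "tensor k V V" "pair_tensor k P P"
    "canonical_tensor k K V K V \<Omega> \<Omega>" by (rule K2.perfect_tensor)
  note ss = same_space_dual_along[of V k K P]
  let ?D = "dual_along k K V P"
  have [simp]: "carrier ?D = carrier V" using ss by (simp add: same_space_def)
  have cT: "carrier (tensor k ?D ?D) = carrier (tensor k V V)"
    using tensor_same_space[OF ss ss] by (simp add: same_space_def)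
  have D: "perfect k K ?D P \<Omega>" by (rule perfect_same_space[OF pf same_space_refl ss])
  have one: "\<one>\<^bsub>?D\<^esub> \<in> carrier V \<and> (\<forall>x\<in>carrier K. P \<one>\<^bsub>?D\<^esub> x = counit K x)"
  proof (rule the1_props[where Q = "\<lambda>w. w \<in> carrier V \<and> (\<forall>x\<in>carrier K. P w x = counit K x)"])
    show "\<exists>!w. w \<in> carrier V \<and> (\<forall>x\<in>carrier K. P w x = counit K x)"
      using represent[OF counit] pairing_eqI by (metis (no_types, lifting))
  qed (simp add: dual_along_def mk_bialg_def)
  have mult: "v \<otimes>\<^bsub>?D\<^esub> w \<in> carrier V \<and> (\<forall>x\<in>carrier K. P (v \<otimes>\<^bsub>?D\<^esub> w) x =
      sweedler k (comult K x) (\<lambda>x1 x2. P v x1 \<otimes>\<^bsub>k\<^esub> P w x2))" if v: "v \<in> carrier V" "w \<in> carrier V" for v w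
  proof (rule the1_props[where Q = "\<lambda>u. u \<in> carrier V \<and> (\<forall>x\<in>carrier K. P u x =
        sweedler k (comult K x) (\<lambda>x1 x2. P v x1 \<otimes>\<^bsub>k\<^esub> P w x2))"])
    have "linear_map k K (kmod k) (\<lambda>x. sweedler (kmod k) (comult K x) (\<lambda>x1 x2. P v x1 \<otimes>\<^bsub>k\<^esub> P w x2))"
      by (rule v comult lin | assumption)+
    from represent[OF this]
    show "\<exists>!u. u \<in> carrier V \<and> (\<forall>x\<in>carrier K. P u x =
        sweedler k (comult K x) (\<lambda>x1 x2. P v x1 \<otimes>\<^bsub>k\<^esub> P w x2))"
      unfolding sweedler_kmod using pairing_eqI by (metis (no_types, lifting))
  qed (simp add: dual_along_def mk_bialg_def)
  have comult_D: "comult ?D v \<in> carrier (tensor k V V) \<and> (\<forall>x\<in>carrier K. \<forall>y\<in>carrier K. P v (x \<otimes>\<^bsub>K\<^esub> y) =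
      sweedler k (comult ?D v) (\<lambda>v1 v2. P v1 x \<otimes>\<^bsub>k\<^esub> P v2 y))" if v: "v \<in> carrier V" for v
  proof (rule the1_props[where Q = "\<lambda>z. z \<in> carrier (tensor k V V) \<and>
      (\<forall>x\<in>carrier K. \<forall>y\<in>carrier K. P v (x \<otimes>\<^bsub>K\<^esub> y) =
        sweedler k z (\<lambda>v1 v2. P v1 x \<otimes>\<^bsub>k\<^esub> P v2 y))"])
    have l: "linear_map k (tensor k K K) (kmod k) (\<lambda>t. sweedler (kmod k) t (\<lambda>x y. P v (x \<otimes>\<^bsub>K\<^esub> y)))"
      by (rule v K lin | assumption)+
    obtain z where z: "z \<in> carrier (tensor k V V)" and eq: "\<And>t. t \<in> carrier (tensor k K K) \<Longrightarrow>
        pair_tensor k P P z t = sweedler (kmod k) t (\<lambda>x y. P v (x \<otimes>\<^bsub>K\<^esub> y))"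
      using T.represent[OF l] by blast
    have z': "P v (x \<otimes>\<^bsub>K\<^esub> y) = sweedler k z (\<lambda>v1 v2. P v1 x \<otimes>\<^bsub>k\<^esub> P v2 y)"
      if xy: "x \<in> carrier K" "y \<in> carrier K" for x y
    proof -
      have "sweedler (kmod k) (tens k K K x y) (\<lambda>x y. P v (x \<otimes>\<^bsub>K\<^esub> y)) = P v (x \<otimes>\<^bsub>K\<^esub> y)"
        by (rule sweedler_tens; (rule xy v K lin | assumption)+)
      then show ?thesis
        using eq[of "tens k K K x y"] K2.pair_tensor_tens_right[OF z xy] tens_closed[OF mK mK xy]
        by (simp add: sweedler_kmod)
    qed
    show "\<exists>!z. z \<in> carrier (tensor k V V) \<and> (\<forall>x\<in>carrier K. \<forall>y\<in>carrier K. P v (x \<otimes>\<^bsub>K\<^esub> y) =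
      sweedler k z (\<lambda>v1 v2. P v1 x \<otimes>\<^bsub>k\<^esub> P v2 y))"
    proof (rule ex1I[of _ z])
      show "z \<in> carrier (tensor k V V) \<and> (\<forall>x\<in>carrier K. \<forall>y\<in>carrier K. P v (x \<otimes>\<^bsub>K\<^esub> y) =
        sweedler k z (\<lambda>v1 v2. P v1 x \<otimes>\<^bsub>k\<^esub> P v2 y))" using z z' by simp
      fix z2 assume z2: "z2 \<in> carrier (tensor k V V) \<and> (\<forall>x\<in>carrier K. \<forall>y\<in>carrier K. P v (x \<otimes>\<^bsub>K\<^esub> y) =
        sweedler k z2 (\<lambda>v1 v2. P v1 x \<otimes>\<^bsub>k\<^esub> P v2 y))"
      show "z2 = z"
        by (rule K2.tensor_pairing_eqI) (use z z' z2 in \<open>simp_all add: sweedler_kmod\<close>)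
    qed
  qed (simp add: dual_along_def mk_bialg_def)
  show ?thesis
    by (rule dual_pair.intro[OF D], rule dual_pair_axioms.intro)
      (use one mult comult_D in \<open>simp_all add: K comult counit cT sweedler_kmod\<close>,
        simp add: dual_along_def mk_bialg_def)
qed

section \<open>Functionals on a finite-dimensional space\<close>

text \<open>
  Application of a functional under a name of its own: the rules \<open>lin\<close> for a pairing would match
  every application if the pairing were not a constant.
\<close>

definition ev :: "('a \<Rightarrow> 'k) \<Rightarrow> 'a \<Rightarrow> 'k" where "ev \<theta> h = \<theta> h"

lemma lam_ev: "(\<lambda>\<theta> h. \<theta> h) = ev" "(\<lambda>h \<theta>. \<theta> h) = (\<lambda>h \<theta>. ev \<theta> h)"
  by (simp_all add: ev_def fun_eq_iff)

lemma functional_ext: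
  assumes "\<theta> \<in> carrier (functionals k A)" "\<theta>' \<in> carrier (functionals k A)"
    and "\<And>x. x \<in> carrier A \<Longrightarrow> ev \<theta> x = ev \<theta>' x"
  shows "\<theta> = \<theta>'"
  using assms by (intro extensionalityI[of \<theta> "carrier A"]) (auto simp: functionals_def ev_def)

lemma functional_linear: "\<theta> \<in> carrier (functionals k A) \<Longrightarrow> linear_map k A (kmod k) (ev \<theta>)"
  by (simp add: functionals_def linear_functional_kmod ev_def[abs_def])

lemma functionalI:
  assumes "linear_map k A (kmod k) f" "module k A"
  shows "(\<lambda>x\<in>carrier A. f x) \<in> carrier (functionals k A)"
  using linear_cong[OF assms, of "\<lambda>x\<in>carrier A. f x"]
  by (simp add: functionals_def linear_functional_kmod)

lemma functionals_module:
  assumes A: "module k A"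
  shows "module k (functionals k A)"
proof -
  let ?F = "functionals k A"
  interpret A: module k A by (rule A)
  note mk = kmod_module_of[OF A]
  have c: "\<theta> x \<in> carrier k" if "\<theta> \<in> carrier ?F" "x \<in> carrier A" for \<theta> x
    using linear_closed[OF functional_linear[OF that(1)] that(2)] by (simp add: ev_def)
  have ev: "ev (\<theta> \<oplus>\<^bsub>?F\<^esub> \<theta>') x = ev \<theta> x \<oplus>\<^bsub>k\<^esub> ev \<theta>' x" "ev (a \<odot>\<^bsub>?F\<^esub> \<theta>) x = a \<otimes>\<^bsub>k\<^esub> ev \<theta> x"
    "ev \<zero>\<^bsub>?F\<^esub> x = \<zero>\<^bsub>k\<^esub>"
    if "x \<in> carrier A" for \<theta> \<theta>' x a
    using that by (simp_all add: ev_def functionals_def)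
  have evc: "ev \<theta> x \<in> carrier k" if "\<theta> \<in> carrier ?F" "x \<in> carrier A" for \<theta> x
    using c[OF that] by (simp add: ev_def)
  have add: "\<theta> \<oplus>\<^bsub>?F\<^esub> \<theta>' \<in> carrier ?F" if "\<theta> \<in> carrier ?F" "\<theta>' \<in> carrier ?F" for \<theta> \<theta>'
    using functionalI[OF lin_add[OF functional_linear[OF that(1)] functional_linear[OF that(2)] mk] A]
    by (simp add: functionals_def ev_def)
  have smult: "a \<odot>\<^bsub>?F\<^esub> \<theta> \<in> carrier ?F" if "a \<in> carrier k" "\<theta> \<in> carrier ?F" for \<theta> a
    using functionalI[OF lin_smult_right[OF functional_linear[OF that(2)] that(1) mk] A]
    by (simp add: functionals_def ev_def)
  have zero: "\<zero>\<^bsub>?F\<^esub> \<in> carrier ?F"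
    by (auto simp: functionals_def linear_functional_def)
  have neg: "\<exists>\<theta>'\<in>carrier ?F. \<theta>' \<oplus>\<^bsub>?F\<^esub> \<theta> = \<zero>\<^bsub>?F\<^esub>" if t: "\<theta> \<in> carrier ?F" for \<theta>
  proof (rule bexI[of _ "(\<ominus>\<^bsub>k\<^esub> \<one>\<^bsub>k\<^esub>) \<odot>\<^bsub>?F\<^esub> \<theta>"])
    show 1: "(\<ominus>\<^bsub>k\<^esub> \<one>\<^bsub>k\<^esub>) \<odot>\<^bsub>?F\<^esub> \<theta> \<in> carrier ?F" by (rule smult[OF _ t]) simp
    show "(\<ominus>\<^bsub>k\<^esub> \<one>\<^bsub>k\<^esub>) \<odot>\<^bsub>?F\<^esub> \<theta> \<oplus>\<^bsub>?F\<^esub> \<theta> = \<zero>\<^bsub>?F\<^esub>"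
      by (rule functional_ext[OF add[OF 1 t] zero]) (simp add: ev evc[OF t] A.R.l_minus A.R.l_neg)
  qed
  have "abelian_group ?F"
    by (rule abelian_groupI)
      (auto simp: add zero neg intro!: functional_ext[where k = k and A = A] simp: ev evc A.R.a_ac)
  then show ?thesis
    by (intro moduleI)
      (auto simp: add smult intro!: functional_ext[where k = k and A = A]
        simp: ev evc A.R.l_distr A.R.r_distr A.R.m_assoc A.R.is_cring)
qed

lemma bilin_ev:
  assumes A: "module k A"
  shows "bilin k (functionals k A) A (kmod k) ev"
proof (rule bilinI)
  show "linear_map k A (kmod k) (ev \<theta>)" if "\<theta> \<in> carrier (functionals k A)" for \<theta>
    by (rule functional_linear[OF that])
  show "linear_map k (functionals k A) (kmod k) (\<lambda>\<theta>. ev \<theta> x)" if x: "x \<in> carrier A" for x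
    using x linear_closed[OF functional_linear _]
    by (intro linear_mapI) (auto simp: ev_def functionals_def linear_functional_def)
qed

lemma linear_finsum:
  assumes f: "linear_map k A C f" and A: "module k A" and C: "module k C"
    and "finite I" "\<And>i. i \<in> I \<Longrightarrow> g i \<in> carrier A"
  shows "f (finsum A g I) = finsum C (\<lambda>i. f (g i)) I"
proof -
  interpret A: module k A by (rule A)
  interpret C: module k C by (rule C)
  have "f \<zero>\<^bsub>A\<^esub> = f (\<zero>\<^bsub>k\<^esub> \<odot>\<^bsub>A\<^esub> \<zero>\<^bsub>A\<^esub>)" by simp
  also have "\<dots> = \<zero>\<^bsub>C\<^esub>" by (subst linear_smult[OF f]) (auto simp: linear_closed[OF f])
  finally have zero: "f \<zero>\<^bsub>A\<^esub> = \<zero>\<^bsub>C\<^esub>" .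
  show ?thesis using assms(4,5)
  proof (induction I rule: finite_induct)
    case empty
    then show ?case by (simp add: zero)
  next
    case (insert i I)
    then show ?case
      by (simp add: linear_add[OF f] linear_closed[OF f] Pi_iff)
  qed
qed

text \<open>
  The tensor is \<open>\<Sum>\<^sub>b b \<otimes> b\<^sup>*\<close>.  The expansion \<open>\<theta> = \<Sum>\<^sub>b \<theta>(b) b\<^sup>*\<close> of a functional is checked on an element
  \<open>x = \<Sum>\<^sub>b b\<^sup>*(x) b\<close>.
\<close>

lemma basis_perfect:
  fixes k :: "'k ring"
  assumes A: "module k A" and B: "is_basis k A B"
  shows "perfect k A (functionals k A) ev
    (\<Oplus>\<^bsub>tensor k A (functionals k A)\<^esub>b\<in>B. tens k A (functionals k A) b (coordinate k A B b))"
proof -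
  let ?F = "functionals k A"
  interpret A: module k A by (rule A)
  note mF = functionals_module[OF A] and mk = kmod_module_of[OF A]
  interpret F: module k ?F by (rule mF)
  interpret M: module k "kmod k" by (rule mk)
  have fin: "finite B" and sub: "B \<subseteq> carrier A"
    and ex: "\<And>x. x \<in> carrier A \<Longrightarrow> \<exists>!c. c \<in> B \<rightarrow>\<^sub>E carrier k \<and> x = (\<Oplus>\<^bsub>A\<^esub>b\<in>B. c b \<odot>\<^bsub>A\<^esub> b)"
    using B by (auto simp: is_basis_def)
  define crd where "crd x = (THE c. c \<in> B \<rightarrow>\<^sub>E carrier k \<and> x = (\<Oplus>\<^bsub>A\<^esub>b\<in>B. c b \<odot>\<^bsub>A\<^esub> b))" for x
  have crd: "crd x \<in> B \<rightarrow>\<^sub>E carrier k" "x = (\<Oplus>\<^bsub>A\<^esub>b\<in>B. crd x b \<odot>\<^bsub>A\<^esub> b)" if "x \<in> carrier A" for x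
    using theI'[OF ex[OF that]] by (auto simp: crd_def)
  have crd_eq: "crd x b = c b"
    if "b \<in> B" "\<And>b. b \<in> B \<Longrightarrow> c b \<in> carrier k" "x = (\<Oplus>\<^bsub>A\<^esub>b\<in>B. c b \<odot>\<^bsub>A\<^esub> b)" for x c b
  proof -
    have x: "x \<in> carrier A" unfolding that(3) using sub that(2) by (intro A.finsum_closed) auto
    have r: "restrict c B \<in> B \<rightarrow>\<^sub>E carrier k" using that(2) by auto
    have "x = (\<Oplus>\<^bsub>A\<^esub>b\<in>B. restrict c B b \<odot>\<^bsub>A\<^esub> b)"
      unfolding that(3) by (rule A.finsum_cong') (use sub that(2) in auto)
    with r have "crd x = restrict c B"
      unfolding crd_def by (intro the1_equality[OF ex[OF x]]) (rule conjI)
    then show ?thesis using that(1) by simp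
  qed
  have crdk: "crd x b \<in> carrier k" if "x \<in> carrier A" "b \<in> B" for x b
    using crd(1)[OF that(1)] that(2) by auto
  have lin_crd: "linear_map k A (kmod k) (\<lambda>x. crd x b)" if b: "b \<in> B" for b
  proof (rule linear_mapI)
    show "crd x b \<in> carrier (kmod k)" if "x \<in> carrier A" for x using crdk that b by simp
    show "crd (x \<oplus>\<^bsub>A\<^esub> y) b = crd x b \<oplus>\<^bsub>kmod k\<^esub> crd y b" if xy: "x \<in> carrier A" "y \<in> carrier A" for x y
    proof -
      have "x \<oplus>\<^bsub>A\<^esub> y = (\<Oplus>\<^bsub>A\<^esub>b\<in>B. crd x b \<odot>\<^bsub>A\<^esub> b \<oplus>\<^bsub>A\<^esub> crd y b \<odot>\<^bsub>A\<^esub> b)"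
        using crd(2)[OF xy(1)] crd(2)[OF xy(2)]
        by (subst A.finsum_addf) (use crdk xy sub in auto)
      also have "\<dots> = (\<Oplus>\<^bsub>A\<^esub>b\<in>B. (crd x b \<oplus>\<^bsub>k\<^esub> crd y b) \<odot>\<^bsub>A\<^esub> b)"
        by (rule A.finsum_cong') (use crdk xy sub in \<open>auto simp: A.smult_l_distr\<close>)
      finally show ?thesis using crd_eq[OF b, of "\<lambda>b. crd x b \<oplus>\<^bsub>k\<^esub> crd y b"] crdk xy by simp
    qed
    show "crd (c \<odot>\<^bsub>A\<^esub> x) b = c \<odot>\<^bsub>kmod k\<^esub> crd x b" if cx: "c \<in> carrier k" "x \<in> carrier A" for c x
    proof -
      have "c \<odot>\<^bsub>A\<^esub> x = (\<Oplus>\<^bsub>A\<^esub>b\<in>B. c \<odot>\<^bsub>A\<^esub> (crd x b \<odot>\<^bsub>A\<^esub> b))"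
        using crd(2)[OF cx(2)] cx(1) fin
        by (subst A.finsum_smult_ldistr[symmetric]) (use crdk cx sub in auto)
      also have "\<dots> = (\<Oplus>\<^bsub>A\<^esub>b\<in>B. (c \<otimes>\<^bsub>k\<^esub> crd x b) \<odot>\<^bsub>A\<^esub> b)"
        by (rule A.finsum_cong') (use crdk cx sub in \<open>auto simp: A.smult_assoc1\<close>)
      finally show ?thesis using crd_eq[OF b, of "\<lambda>b. c \<otimes>\<^bsub>k\<^esub> crd x b"] crdk cx by simp
    qed
  qed
  have coord: "coordinate k A B b = (\<lambda>x\<in>carrier A. crd x b)" for b
    by (simp add: coordinate_def crd_def)
  have coordF: "coordinate k A B b \<in> carrier ?F" if "b \<in> B" for b
    unfolding coord by (rule functionalI[OF lin_crd[OF that] A])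
  have ev_coord: "ev (coordinate k A B b) x = crd x b" if "x \<in> carrier A" for b x
    using that by (simp add: ev_def coord)
  note evbil = bilin_ev[OF A]
  note evc = bilin_closed[OF evbil, simplified]
  note evlin = lin_comp[OF bilin_left[OF evbil]] lin_comp[OF bilin_right[OF evbil]]
  have sw: "sweedler C (\<Oplus>\<^bsub>tensor k A ?F\<^esub>b\<in>B. tens k A ?F b (coordinate k A B b)) f =
      (\<Oplus>\<^bsub>C\<^esub>b\<in>B. f b (coordinate k A B b))" if f: "bilin k A ?F C f" and C: "module k C"
    for f and C :: "('k, 'z, 'y) module_scheme"
  proof -
    interpret C: module k C by (rule C)
    have l: "linear_map k (tensor k A ?F) C (\<lambda>z. sweedler C z f)" by (rule f A C mF lin)+
    have "sweedler C (\<Oplus>\<^bsub>tensor k A ?F\<^esub>b\<in>B. tens k A ?F b (coordinate k A B b)) f =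
        (\<Oplus>\<^bsub>C\<^esub>b\<in>B. sweedler C (tens k A ?F b (coordinate k A B b)) f)"
      by (rule linear_finsum[OF l tensor_module[OF A mF] C fin])
        (use sub coordF in \<open>auto intro: tens_closed[OF A mF]\<close>)
    also have "\<dots> = (\<Oplus>\<^bsub>C\<^esub>b\<in>B. f b (coordinate k A B b))"
      by (rule C.finsum_cong') (use sub coordF bilin_closed[OF f] in \<open>auto simp: sweedler_tens[OF _ _ f A mF C]\<close>)
    finally show ?thesis .
  qed
  show ?thesis
  proof (rule perfect.intro)
    show "module k A" "module k ?F" "bilin k ?F A (kmod k) ev" by (rule A mF evbil)+
    interpret T: module k "tensor k A ?F" by (rule tensor_module[OF A mF])
    show "(\<Oplus>\<^bsub>tensor k A ?F\<^esub>b\<in>B. tens k A ?F b (coordinate k A B b)) \<in> carrier (tensor k A ?F)"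
      using sub coordF by (intro T.finsum_closed) (auto intro: tens_closed[OF A mF])
    show "sweedler A (\<Oplus>\<^bsub>tensor k A ?F\<^esub>b\<in>B. tens k A ?F b (coordinate k A B b)) (\<lambda>e v. ev v a \<odot>\<^bsub>A\<^esub> e) = a"
      if a: "a \<in> carrier A" for a
    proof -
      have "bilin k A ?F A (\<lambda>e v. ev v a \<odot>\<^bsub>A\<^esub> e)" by (rule evlin evc A mF mk a lin | assumption)+
      from sw[OF this A] show ?thesis using crd(2)[OF a] by (simp add: ev_coord[OF a])
    qed
    show "sweedler ?F (\<Oplus>\<^bsub>tensor k A ?F\<^esub>b\<in>B. tens k A ?F b (coordinate k A B b)) (\<lambda>e v. ev w e \<odot>\<^bsub>?F\<^esub> v) = w"
      if w: "w \<in> carrier ?F" for w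
    proof -
      have "bilin k A ?F ?F (\<lambda>e v. ev w e \<odot>\<^bsub>?F\<^esub> v)" by (rule evlin evc A mF mk w lin | assumption)+
      note 1 = sw[OF this mF]
      have "(\<Oplus>\<^bsub>?F\<^esub>b\<in>B. ev w b \<odot>\<^bsub>?F\<^esub> coordinate k A B b) = w"
      proof (rule functional_ext[OF _ w])
        show "(\<Oplus>\<^bsub>?F\<^esub>b\<in>B. ev w b \<odot>\<^bsub>?F\<^esub> coordinate k A B b) \<in> carrier ?F"
          using sub coordF evc[OF w] by (intro F.finsum_closed) auto
        fix x assume x: "x \<in> carrier A"
        have "ev (\<Oplus>\<^bsub>?F\<^esub>b\<in>B. ev w b \<odot>\<^bsub>?F\<^esub> coordinate k A B b) x =
            (\<Oplus>\<^bsub>kmod k\<^esub>b\<in>B. ev (ev w b \<odot>\<^bsub>?F\<^esub> coordinate k A B b) x)"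
          by (rule linear_finsum[OF bilin_left[OF evbil x] mF mk fin])
            (use sub coordF evc[OF w] in auto)
        also have "\<dots> = (\<Oplus>\<^bsub>kmod k\<^esub>b\<in>B. ev w (crd x b \<odot>\<^bsub>A\<^esub> b))"
        proof (rule M.finsum_cong')
          show "(\<lambda>b. ev w (crd x b \<odot>\<^bsub>A\<^esub> b)) \<in> B \<rightarrow> carrier (kmod k)"
            using sub crdk[OF x] evc[OF w] by auto
          fix b assume b: "b \<in> B"
          have b': "b \<in> carrier A" using b sub by auto
          have "ev (ev w b \<odot>\<^bsub>?F\<^esub> coordinate k A B b) x = ev w b \<otimes>\<^bsub>k\<^esub> crd x b"
            using linear_smult[OF bilin_left[OF evbil x] evc[OF w b'] coordF[OF b]] ev_coord[OF x] by simp
          also have "\<dots> = ev w (crd x b \<odot>\<^bsub>A\<^esub> b)"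
            using linear_smult[OF bilin_right[OF evbil w] crdk[OF x b] b'] evc[OF w b'] crdk[OF x b]
            by (simp add: A.R.m_comm)
          finally show "ev (ev w b \<odot>\<^bsub>?F\<^esub> coordinate k A B b) x = ev w (crd x b \<odot>\<^bsub>A\<^esub> b)" .
        qed simp
        also have "\<dots> = ev w (\<Oplus>\<^bsub>A\<^esub>b\<in>B. crd x b \<odot>\<^bsub>A\<^esub> b)"
          by (rule linear_finsum[OF bilin_right[OF evbil w] A mk fin, symmetric]) (use sub crdk[OF x] in auto)
        finally show "ev (\<Oplus>\<^bsub>?F\<^esub>b\<in>B. ev w b \<odot>\<^bsub>?F\<^esub> coordinate k A B b) x = ev w x"
          using crd(2)[OF x] by simp
      qed
      then show ?thesis using 1 by simp
    qed
  qed
qed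

section \<open>Finite-dimensional Hopf algebras\<close>

lemma opp_simps:
  "carrier (opp H) = carrier H" "zero (opp H) = zero H" "add (opp H) = add H" "one (opp H) = one H"
  "smult (opp H) = smult H" "comult (opp H) = comult H" "counit (opp H) = counit H"
  "x \<otimes>\<^bsub>opp H\<^esub> y = y \<otimes>\<^bsub>H\<^esub> x"
  by (simp_all add: opp_def)

lemma same_space_opp: "same_space H (opp H)" by (simp add: same_space_def opp_simps)

lemma k_algebra_opp:
  assumes "k_algebra k H"
  shows "k_algebra k (opp H)"
proof -
  interpret k_algebra k H by fact
  show ?thesis
  proof (rule k_algebraI)
    show "module k (opp H)" by (rule module_same_space[OF same_space_opp]) (rule k_algebra_module[OF assms])
    show "linear_map k (opp H) (opp H) (\<lambda>x. x \<otimes>\<^bsub>opp H\<^esub> y)" if "y \<in> carrier (opp H)" for y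
      unfolding opp_simps(8)
      by (rule linear_same_space[OF same_space_opp same_space_opp, THEN iffD1])
        (use that lin_mult_right[OF lin_id _ assms] in \<open>simp add: opp_simps\<close>)
    show "linear_map k (opp H) (opp H) (\<lambda>y. x \<otimes>\<^bsub>opp H\<^esub> y)" if "x \<in> carrier (opp H)" for x
      unfolding opp_simps(8)
      by (rule linear_same_space[OF same_space_opp same_space_opp, THEN iffD1])
        (use that lin_mult_left[OF lin_id _ assms] in \<open>simp add: opp_simps\<close>)
  qed (auto simp: opp_simps m_assoc)
qed

text \<open>
  The same map as \<open>ev\<close>.  The second name keeps the rules for the pairing of functionals with \<open>opp H\<close>
  apart from those for the pairing with \<open>H\<close>.
\<close>

definition evG :: "('a \<Rightarrow> 'k) \<Rightarrow> 'a \<Rightarrow> 'k" where "evG \<theta> g = \<theta> g"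

lemma functionals_opp: "functionals k (opp H) = functionals k H"
  by (simp add: functionals_def opp_simps linear_functional_def)

text \<open>
  In this locale \<open>D\<close> is the dual of \<open>H\<close> and \<open>D'\<close> the dual of \<open>G = opp H\<close>.  Both live on the space of
  functionals and have the same product, but opposite coproducts.  The functionals \<open>\<omega>\<close> in
  \<open>\<omega> \<bowtie> h\<close> are taken from \<open>D'\<close>, because they act through the coaction of \<open>G\<close>.
\<close>

locale fd_hopf =
  fixes k :: "'k ring" and H :: "('k, 'h) bialg"
  assumes hopf: "hopf_algebra k H" and fd: "finite_dimensional k H"
begin

abbreviation "G \<equiv> opp H"
abbreviation "D \<equiv> dual k H"
abbreviation "D' \<equiv> dual k (opp H)"
abbreviation "U \<equiv> canonical_U k H"
abbreviation "evH \<equiv> (\<lambda>h \<theta>. ev \<theta> h)"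
abbreviation kmult (infixl "\<cdot>" 70) where "a \<cdot> b \<equiv> a \<otimes>\<^bsub>k\<^esub> b"
abbreviation "ksw \<equiv> sweedler (kmod k)"

lemma bialg: "bialgebra k H" using hopf by (simp add: hopf_algebra_def)

lemma algH: "k_algebra k H" using bialg by (simp add: bialgebra_def)
lemma mH: "module k H" by (rule k_algebra_module[OF algH])
lemma mF: "module k (functionals k H)" by (rule functionals_module[OF mH])

lemma comult_H: "linear_map k H (tensor k H H) (comult H)"
  using bialg by (simp add: bialgebra_def algebra_hom_def)
lemma counit_H: "linear_map k H (kmod k) (counit H)"
  using bialg by (simp add: bialgebra_def linear_functional_kmod)
lemma comult_H_closed: "h \<in> carrier H \<Longrightarrow> comult H h \<in> carrier (tensor k H H)"
  by (rule linear_closed[OF comult_H])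
lemma comult_mult: "a \<in> carrier H \<Longrightarrow> b \<in> carrier H \<Longrightarrow>
    comult H (a \<otimes>\<^bsub>H\<^esub> b) = comult H a \<otimes>\<^bsub>tensor k H H\<^esub> comult H b"
  using bialg by (auto simp: bialgebra_def algebra_hom_def ring_hom_def)
lemma comult_one: "comult H \<one>\<^bsub>H\<^esub> = tens k H H \<one>\<^bsub>H\<^esub> \<one>\<^bsub>H\<^esub>"
  using bialg by (auto simp: bialgebra_def algebra_hom_def ring_hom_def one_tensor)
lemma counit_mult: "a \<in> carrier H \<Longrightarrow> b \<in> carrier H \<Longrightarrow>
    counit H (a \<otimes>\<^bsub>H\<^esub> b) = counit H a \<cdot> counit H b"
  using bialg by (auto simp: bialgebra_def ring_hom_def)
lemma counit_one: "counit H \<one>\<^bsub>H\<^esub> = \<one>\<^bsub>k\<^esub>"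
  using bialg by (auto simp: bialgebra_def ring_hom_def)
lemma counit_left: "h \<in> carrier H \<Longrightarrow> sweedler H (comult H h) (\<lambda>a b. counit H a \<odot>\<^bsub>H\<^esub> b) = h"
  and counit_right: "h \<in> carrier H \<Longrightarrow> sweedler H (comult H h) (\<lambda>a b. counit H b \<odot>\<^bsub>H\<^esub> a) = h"
  using bialg by (auto simp: bialgebra_def)
lemma coassoc_H: "h \<in> carrier H \<Longrightarrow>
    assoc_right k H H H (tmap k (tensor k H H) H (comult H) id (comult H h)) =
    tmap k H (tensor k H H) id (comult H) (comult H h)"
  using bialg by (auto simp: bialgebra_def)

text \<open>
  Both sides are the values of the linear map induced by \<open>f\<close> on the two sides of coassociativity.
\<close>

lemma sweedler_coassoc:
  assumes h: "h \<in> carrier H" and C: "module k C"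
    and f1: "\<And>b c. b \<in> carrier H \<Longrightarrow> c \<in> carrier H \<Longrightarrow> linear_map k H C (\<lambda>a. f a b c)"
    and f2: "\<And>a c. a \<in> carrier H \<Longrightarrow> c \<in> carrier H \<Longrightarrow> linear_map k H C (\<lambda>b. f a b c)"
    and f3: "\<And>a b. a \<in> carrier H \<Longrightarrow> b \<in> carrier H \<Longrightarrow> linear_map k H C (\<lambda>c. f a b c)"
  shows "sweedler C (comult H h) (\<lambda>a c. sweedler C (comult H a) (\<lambda>a1 a2. f a1 a2 c)) =
    sweedler C (comult H h) (\<lambda>a b. sweedler C (comult H b) (\<lambda>b1 b2. f a b1 b2))"
proof -
  note f = f1 f2 f3
  note ch = comult_H_closed[OF h]
  note cl = lin_comp[OF comult_H] comult_H_closed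
  let ?T = "tensor k H (tensor k H H)"
  let ?L = "\<lambda>z. sweedler C z (\<lambda>a w. sweedler C w (f a))"
  have bil: "bilin k H (tensor k H H) C (\<lambda>a w. sweedler C w (f a))"
    by (rule f mH C lin | assumption)+
  have L: "linear_map k ?T C ?L" by (rule bil mH C lin)+
  have 1: "?L (assoc_right k H H H (tmap k (tensor k H H) H (comult H) id (comult H h))) =
      sweedler C (comult H h) (\<lambda>a c. sweedler C (comult H a) (\<lambda>a1 a2. f a1 a2 c))"
  proof (rule linear_ext[OF _ _ _ ch mH mH])
    show "linear_map k (tensor k H H) C
        (\<lambda>z. ?L (assoc_right k H H H (tmap k (tensor k H H) H (comult H) id z)))"
      by (rule bil mH C comult_H lin)+
    show l2: "linear_map k (tensor k H H) C
        (\<lambda>z. sweedler C z (\<lambda>a c. sweedler C (comult H a) (\<lambda>a1 a2. f a1 a2 c)))"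
      by (rule f mH C cl lin | assumption)+
    fix a c assume ac: "a \<in> carrier H" "c \<in> carrier H"
    note ca = comult_H_closed[OF ac(1)]
    have b2: "bilin k H H C (\<lambda>a c. sweedler C (comult H a) (\<lambda>a1 a2. f a1 a2 c))"
      by (rule f mH C cl lin | assumption)+
    have "?L (sweedler ?T (comult H a) (\<lambda>a1 a2. tens k H (tensor k H H) a1 (tens k H H a2 c))) =
        sweedler C (comult H a) (\<lambda>a1 a2. f a1 a2 c)"
    proof (rule sweedler_push[OF L ca])
      fix a1 a2 assume a: "a1 \<in> carrier H" "a2 \<in> carrier H"
      have "bilin k H H C (f a1)" by (rule f a lin | assumption)+
      then show "?L (tens k H (tensor k H H) a1 (tens k H H a2 c)) = f a1 a2 c"
        using a ac by (simp add: sweedler_tens[OF _ _ bil mH lin_modules[OF mH mH] C] tens_closed mH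
            sweedler_tens[OF _ _ _ mH mH C])
    qed (rule ac ca C mH lin | assumption)+
    then show "?L (assoc_right k H H H (tmap k (tensor k H H) H (comult H) id (tens k H H a c))) =
        sweedler C (tens k H H a c) (\<lambda>a c. sweedler C (comult H a) (\<lambda>a1 a2. f a1 a2 c))"
      using ac ca by (simp add: tmap_tens[OF _ _ comult_H lin_idf mH mH lin_modules[OF mH mH] mH]
          assoc_right_tens mH sweedler_tens[OF ac b2 mH mH C])
  qed
  have 2: "?L (tmap k H (tensor k H H) id (comult H) (comult H h)) =
      sweedler C (comult H h) (\<lambda>a b. sweedler C (comult H b) (\<lambda>b1 b2. f a b1 b2))"
  proof (rule linear_ext[OF _ _ _ ch mH mH])
    show "linear_map k (tensor k H H) C (\<lambda>z. ?L (tmap k H (tensor k H H) id (comult H) z))"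
      by (rule bil mH C comult_H lin)+
    show l2: "linear_map k (tensor k H H) C
        (\<lambda>z. sweedler C z (\<lambda>a b. sweedler C (comult H b) (\<lambda>b1 b2. f a b1 b2)))"
      by (rule f mH C cl lin | assumption)+
    fix a b assume ab: "a \<in> carrier H" "b \<in> carrier H"
    have b2: "bilin k H H C (\<lambda>a b. sweedler C (comult H b) (\<lambda>b1 b2. f a b1 b2))"
      by (rule f mH C cl lin | assumption)+
    show "?L (tmap k H (tensor k H H) id (comult H) (tens k H H a b)) =
        sweedler C (tens k H H a b) (\<lambda>a b. sweedler C (comult H b) (\<lambda>b1 b2. f a b1 b2))"
      using ab comult_H_closed[OF ab(2)]
      by (simp add: tmap_tens[OF _ _ lin_idf comult_H mH mH mH lin_modules[OF mH mH]]
          sweedler_tens[OF _ _ bil mH lin_modules[OF mH mH] C] sweedler_tens[OF ab b2 mH mH C])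
  qed
  show ?thesis using 1 2 coassoc_H[OF h] by simp
qed

lemma perfect_H: "perfect k H (functionals k H) ev U"
proof -
  have B: "is_basis k H (SOME B. is_basis k H B)"
    using fd unfolding finite_dimensional_def by (rule someI_ex)
  have s: "same_space (dual k H) (functionals k H)"
    unfolding dual_def by (rule same_space_sym[OF same_space_dual_along])
  have t: "same_space (tensor k (opp H) (dual k H)) (tensor k H (functionals k H))"
    by (rule tensor_same_space[OF same_space_sym[OF same_space_opp] s])
  have "U = (\<Oplus>\<^bsub>tensor k H (functionals k H)\<^esub>b\<in>(SOME B. is_basis k H B).
      tens k H (functionals k H) b (coordinate k H (SOME B. is_basis k H B) b))"
    using t unfolding canonical_U_def Let_def tens_same_space[OF same_space_sym[OF same_space_opp] s]
    by (simp add: finsum_def same_space_def)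
  then show ?thesis using basis_perfect[OF mH B] by simp
qed

sublocale HD: dual_pair k H D ev U
  unfolding dual_def lam_ev by (rule dual_pair_dual_along[OF perfect_H algH comult_H counit_H])

lemma alg_dual: "k_algebra k D"
proof (rule k_algebraI[OF HD.mV HD.mult_V HD.one_V HD.lin_mult_V_left HD.lin_mult_V_right])
  interpret k: module k "kmod k" by (rule HD.mk)
  have evl: "linear_map k H (kmod k) (ev \<theta>)" if "\<theta> \<in> carrier D" for \<theta>
    by (rule bilin_right[OF HD.P that])
  fix x y z assume xyz: "x \<in> carrier D" "y \<in> carrier D" "z \<in> carrier D"
  show "x \<otimes>\<^bsub>D\<^esub> y \<otimes>\<^bsub>D\<^esub> z = x \<otimes>\<^bsub>D\<^esub> (y \<otimes>\<^bsub>D\<^esub> z)"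
  proof (rule HD.pairing_eqI)
    show "x \<otimes>\<^bsub>D\<^esub> y \<otimes>\<^bsub>D\<^esub> z \<in> carrier D" "x \<otimes>\<^bsub>D\<^esub> (y \<otimes>\<^bsub>D\<^esub> z) \<in> carrier D"
      by (rule xyz lin)+
    fix h assume h: "h \<in> carrier H"
    note ch = comult_H_closed[OF h]
    have xy: "x \<otimes>\<^bsub>D\<^esub> y \<in> carrier D" "y \<otimes>\<^bsub>D\<^esub> z \<in> carrier D" by (rule xyz lin)+
    have "ev (x \<otimes>\<^bsub>D\<^esub> y \<otimes>\<^bsub>D\<^esub> z) h = ksw (comult H h)
        (\<lambda>a c. ksw (comult H a) (\<lambda>a1 a2. (ev x a1 \<cdot> ev y a2) \<cdot> ev z c))"
      unfolding HD.P_mult[OF xy(1) xyz(3) h]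
    proof (rule sweedler_cong[OF mH mH ch])
      fix a c assume ac: "a \<in> carrier H" "c \<in> carrier H"
      show "ev (x \<otimes>\<^bsub>D\<^esub> y) a \<cdot> ev z c =
          ksw (comult H a) (\<lambda>a1 a2. (ev x a1 \<cdot> ev y a2) \<cdot> ev z c)"
        unfolding HD.P_mult[OF xyz(1,2) ac(1)]
        by (rule sweedler_linear[where g = "\<lambda>u. u \<cdot> ev z c"]; (rule xyz ac lin | assumption)+)
    qed
    also have "\<dots> = ksw (comult H h)
        (\<lambda>a b. ksw (comult H b) (\<lambda>b1 b2. (ev x a \<cdot> ev y b1) \<cdot> ev z b2))"
      by (rule sweedler_coassoc[OF h]; (rule xyz lin | assumption)+)
    also have "\<dots> = ev (x \<otimes>\<^bsub>D\<^esub> (y \<otimes>\<^bsub>D\<^esub> z)) h"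
      unfolding HD.P_mult[OF xyz(1) xy(2) h]
    proof (rule sweedler_cong[OF mH mH ch, symmetric])
      fix a b assume ab: "a \<in> carrier H" "b \<in> carrier H"
      show "ev x a \<cdot> ev (y \<otimes>\<^bsub>D\<^esub> z) b =
          ksw (comult H b) (\<lambda>b1 b2. (ev x a \<cdot> ev y b1) \<cdot> ev z b2)"
        unfolding HD.P_mult[OF xyz(2,3) ab(2)]
        by (rule sweedler_push[where g = "\<lambda>u. ev x a \<cdot> u", OF _ comult_H_closed[OF ab(2)]])
          ((rule xyz ab lin | assumption)+, use HD.P_closed xyz ab in \<open>simp add: k.R.m_assoc\<close>)
    qed
    finally show "ev (x \<otimes>\<^bsub>D\<^esub> y \<otimes>\<^bsub>D\<^esub> z) h = ev (x \<otimes>\<^bsub>D\<^esub> (y \<otimes>\<^bsub>D\<^esub> z)) h" .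
  qed
next
  interpret k: module k "kmod k" by (rule HD.mk)
  fix x assume x: "x \<in> carrier D"
  have evl: "linear_map k H (kmod k) (ev x)" by (rule bilin_right[OF HD.P x])
  show "\<one>\<^bsub>D\<^esub> \<otimes>\<^bsub>D\<^esub> x = x"
  proof (rule HD.pairing_eqI[OF HD.mult_V[OF HD.one_V x] x])
    fix h assume h: "h \<in> carrier H"
    have "ev x (sweedler H (comult H h) (\<lambda>a b. counit H a \<odot>\<^bsub>H\<^esub> b)) = ev (\<one>\<^bsub>D\<^esub> \<otimes>\<^bsub>D\<^esub> x) h"
      unfolding HD.P_mult[OF HD.one_V x h]
      by (rule sweedler_push[OF evl comult_H_closed[OF h]])
        ((rule h lin | assumption)+, simp add: linear_smult[OF evl] HD.counit_K_closed HD.P_one)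
    then show "ev (\<one>\<^bsub>D\<^esub> \<otimes>\<^bsub>D\<^esub> x) h = ev x h" by (simp add: counit_left h)
  qed
  show "x \<otimes>\<^bsub>D\<^esub> \<one>\<^bsub>D\<^esub> = x"
  proof (rule HD.pairing_eqI[OF HD.mult_V[OF x HD.one_V] x])
    fix h assume h: "h \<in> carrier H"
    have "ev x (sweedler H (comult H h) (\<lambda>a b. counit H b \<odot>\<^bsub>H\<^esub> a)) = ev (x \<otimes>\<^bsub>D\<^esub> \<one>\<^bsub>D\<^esub>) h"
      unfolding HD.P_mult[OF x HD.one_V h]
      by (rule sweedler_push[OF evl comult_H_closed[OF h]])
        ((rule h lin | assumption)+,
          use HD.P_closed[OF x] in \<open>simp add: linear_smult[OF evl] HD.counit_K_closed HD.P_one k.R.m_comm\<close>)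
    then show "ev (x \<otimes>\<^bsub>D\<^esub> \<one>\<^bsub>D\<^esub>) h = ev x h" by (simp add: counit_right h)
  qed
qed

sublocale DH: dual_pair k D H evH "tflip k H D U"
  by (rule HD.dual_pair_flip[OF alg_dual])

section \<open>The antipode reverses products\<close>

definition S :: "'h \<Rightarrow> 'h" where
  "S = (SOME S. is_antipode k H S \<and> bij_betw S (carrier H) (carrier H))"

lemma S: "is_antipode k H S" "bij_betw S (carrier H) (carrier H)"
proof -
  have "\<exists>S. is_antipode k H S \<and> bij_betw S (carrier H) (carrier H)"
    using hopf by (simp add: hopf_algebra_def)
  from someI_ex[OF this] show "is_antipode k H S" "bij_betw S (carrier H) (carrier H)"
    unfolding S_def by auto
qed

lemma S_linear: "linear_map k H H S" using S(1) by (simp add: is_antipode_def)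
lemma S_left: "h \<in> carrier H \<Longrightarrow>
    sweedler H (comult H h) (\<lambda>a b. S a \<otimes>\<^bsub>H\<^esub> b) = counit H h \<odot>\<^bsub>H\<^esub> \<one>\<^bsub>H\<^esub>"
  and S_right: "h \<in> carrier H \<Longrightarrow>
    sweedler H (comult H h) (\<lambda>a b. a \<otimes>\<^bsub>H\<^esub> S b) = counit H h \<odot>\<^bsub>H\<^esub> \<one>\<^bsub>H\<^esub>"
  using S(1) by (auto simp: is_antipode_def)

lemmas S_lin [lin] = lin_comp[OF S_linear] linear_closed[OF S_linear]

text \<open>
  Bilinear maps \<open>H \<times> H \<rightarrow> H\<close> form an algebra under convolution, which is realised as
  \<open>dual H \<otimes> (dual H \<otimes> H)\<close>; the value of \<open>z\<close> at \<open>(a, b)\<close> is \<open>conv2 z a b\<close>.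
\<close>

abbreviation "conv2 z a b \<equiv> slice H evH b (slice (tensor k D H) evH a z)"

lemma conv2_exists:
  assumes f: "bilin k H H H f"
  shows "\<exists>z\<in>carrier (tensor k D (tensor k D H)). \<forall>a\<in>carrier H. \<forall>b\<in>carrier H. conv2 z a b = f a b"
proof (intro bexI ballI)
  let ?\<Omega> = "tflip k H D U"
  let ?g = "\<lambda>a. sweedler (tensor k D H) ?\<Omega> (\<lambda>\<theta> b. tens k D H \<theta> (f a b))"
  let ?z = "sweedler (tensor k D (tensor k D H)) ?\<Omega> (\<lambda>\<theta> a. tens k D (tensor k D H) \<theta> (?g a))"
  note f' = bilin_right[OF f] bilin_left[OF f] bilin_closed[OF f]
  have f3: "linear_map k H H (\<lambda>x. f a x)" if "a \<in> carrier H" for a by (rule bilin_right[OF f that])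
  have g: "linear_map k H (tensor k D H) ?g" by (rule f' lin | assumption)+
  show "?z \<in> carrier (tensor k D (tensor k D H))"
    by (rule lin g lin_comp[OF g] linear_closed[OF g] | assumption)+
  fix a b assume ab: "a \<in> carrier H" "b \<in> carrier H"
  have "slice (tensor k D H) evH a ?z = ?g a"
    by (rule DH.slice_build[OF g _ ab(1)]) (rule lin)+
  then show "conv2 ?z a b = f a b"
    using DH.slice_build[OF f3[OF ab(1)] mH ab(2)] by simp
qed

lemma conv2_mult:
  assumes z: "z \<in> carrier (tensor k D (tensor k D H))" and w: "w \<in> carrier (tensor k D (tensor k D H))"
    and a: "a \<in> carrier H" and b: "b \<in> carrier H"
  shows "conv2 (z \<otimes>\<^bsub>tensor k D (tensor k D H)\<^esub> w) a b =
    sweedler H (comult H a) (\<lambda>a1 a2. sweedler H (comult H b) (\<lambda>b1 b2. conv2 z a1 b1 \<otimes>\<^bsub>H\<^esub> conv2 w a2 b2))"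
proof -
  let ?P = evH and ?X = "tensor k D H"
  have X: "k_algebra k ?X" by (rule algH lin)+
  note mX = k_algebra_module[OF X]
  have l: "linear_map k ?X H (slice H ?P b)" by (rule b lin)+
  have "slice H ?P b (sweedler ?X (comult H a) (\<lambda>a1 a2. slice ?X ?P a1 z \<otimes>\<^bsub>?X\<^esub> slice ?X ?P a2 w)) =
    sweedler H (comult H a) (\<lambda>a1 a2. sweedler H (comult H b) (\<lambda>b1 b2. conv2 z a1 b1 \<otimes>\<^bsub>H\<^esub> conv2 w a2 b2))"
    by (rule sweedler_push[OF l comult_H_closed[OF a]])
      (rule DH.slice_mult[OF b _ _ algH] z w a X mX algH lin | assumption)+
  then show ?thesis by (simp add: DH.slice_mult[OF a z w X])
qed

lemma conv2_one:
  assumes "a \<in> carrier H" "b \<in> carrier H"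
  shows "conv2 \<one>\<^bsub>tensor k D (tensor k D H)\<^esub> a b = counit H a \<odot>\<^bsub>H\<^esub> (counit H b \<odot>\<^bsub>H\<^esub> \<one>\<^bsub>H\<^esub>)"
proof -
  have X: "k_algebra k (tensor k D H)" by (rule algH lin)+
  have l: "linear_map k (tensor k D H) H (slice H evH b)" by (rule assms lin)+
  have 1: "\<one>\<^bsub>tensor k D H\<^esub> \<in> carrier (tensor k D H)" by (rule X lin)+
  show ?thesis
    using assms by (simp add: DH.slice_one[OF _ X] DH.slice_one[OF _ algH] linear_smult[OF l] 1 HD.counit_K_closed)
qed

lemma conv2_eqI:
  assumes "z \<in> carrier (tensor k D (tensor k D H))" "w \<in> carrier (tensor k D (tensor k D H))"
    and "\<And>a b. a \<in> carrier H \<Longrightarrow> b \<in> carrier H \<Longrightarrow> conv2 z a b = conv2 w a b"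
  shows "z = w"
  by (rule DH.slice_eqI[OF assms(1,2)], (rule lin)+, rule DH.slice_eqI; (rule assms lin | assumption)+)

text \<open>
  In the convolution algebra of bilinear maps, \<open>(a, b) \<mapsto> S(ab)\<close> is a left inverse and
  \<open>(a, b) \<mapsto> S(b)S(a)\<close> a right inverse of the multiplication \<open>(a, b) \<mapsto> ab\<close>, so that the two coincide.
\<close>

lemma S_antimult:
  assumes ab: "a \<in> carrier H" "b \<in> carrier H"
  shows "S (a \<otimes>\<^bsub>H\<^esub> b) = S b \<otimes>\<^bsub>H\<^esub> S a"
proof -
  let ?Z = "tensor k D (tensor k D H)"
  interpret H: k_algebra k H by (rule algH)
  interpret Z: k_algebra k ?Z by (rule algH lin)+
  obtain p where p: "p \<in> carrier ?Z" "\<And>a b. a \<in> carrier H \<Longrightarrow> b \<in> carrier H \<Longrightarrow> conv2 p a b = S (a \<otimes>\<^bsub>H\<^esub> b)"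
  proof -
    have "bilin k H H H (\<lambda>a b. S (a \<otimes>\<^bsub>H\<^esub> b))" by (rule lin | assumption)+
    from conv2_exists[OF this] that show thesis by blast
  qed
  obtain q where q: "q \<in> carrier ?Z" "\<And>a b. a \<in> carrier H \<Longrightarrow> b \<in> carrier H \<Longrightarrow> conv2 q a b = S b \<otimes>\<^bsub>H\<^esub> S a"
  proof -
    have "bilin k H H H (\<lambda>a b. S b \<otimes>\<^bsub>H\<^esub> S a)" by (rule lin | assumption)+
    from conv2_exists[OF this] that show thesis by blast
  qed
  obtain m where m: "m \<in> carrier ?Z" "\<And>a b. a \<in> carrier H \<Longrightarrow> b \<in> carrier H \<Longrightarrow> conv2 m a b = a \<otimes>\<^bsub>H\<^esub> b"
  proof -
    have "bilin k H H H (\<lambda>a b. a \<otimes>\<^bsub>H\<^esub> b)" by (rule lin | assumption)+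
    from conv2_exists[OF this] that show thesis by blast
  qed
  \<comment> \<open>As \<open>\<Delta>\<close> is multiplicative, this is the antipode law for the element \<open>ab\<close>.\<close>
  have pm: "p \<otimes>\<^bsub>?Z\<^esub> m = \<one>\<^bsub>?Z\<^esub>"
  proof (rule conv2_eqI)
    fix a b assume ab: "a \<in> carrier H" "b \<in> carrier H"
    note ca = comult_H_closed[OF ab(1)] and cb = comult_H_closed[OF ab(2)]
    let ?f = "\<lambda>x y. S x \<otimes>\<^bsub>H\<^esub> y"
    have f: "bilin k H H H ?f" by (rule lin | assumption)+
    have lf: "linear_map k (tensor k H H) H (\<lambda>z. sweedler H z ?f)" by (rule f lin)+
    have "sweedler H (comult H a \<otimes>\<^bsub>tensor k H H\<^esub> comult H b) ?f = conv2 (p \<otimes>\<^bsub>?Z\<^esub> m) a b"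
      unfolding mult_tensor[OF algH algH ca cb] conv2_mult[OF p(1) m(1) ab]
    proof (rule sweedler_push[OF lf ca])
      fix a1 a2 assume 1: "a1 \<in> carrier H" "a2 \<in> carrier H"
      show "sweedler H (sweedler (tensor k H H) (comult H b) (\<lambda>b1 b2. tens k H H (a1 \<otimes>\<^bsub>H\<^esub> b1) (a2 \<otimes>\<^bsub>H\<^esub> b2))) ?f =
          sweedler H (comult H b) (\<lambda>b1 b2. conv2 p a1 b1 \<otimes>\<^bsub>H\<^esub> conv2 m a2 b2)"
        by (rule sweedler_push[OF lf cb])
          ((rule 1 lin | assumption)+, simp add: 1 p(2) m(2) sweedler_tens[OF _ _ f mH mH mH])
    qed (rule cb lin | assumption)+
    then have "conv2 (p \<otimes>\<^bsub>?Z\<^esub> m) a b = sweedler H (comult H a \<otimes>\<^bsub>tensor k H H\<^esub> comult H b) ?f" ..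
    also have "\<dots> = counit H (a \<otimes>\<^bsub>H\<^esub> b) \<odot>\<^bsub>H\<^esub> \<one>\<^bsub>H\<^esub>"
      using ab by (simp add: comult_mult[symmetric] S_left)
    finally show "conv2 (p \<otimes>\<^bsub>?Z\<^esub> m) a b = conv2 \<one>\<^bsub>?Z\<^esub> a b"
      using ab by (simp add: conv2_one counit_mult H.smult_assoc1 HD.counit_K_closed)
  qed (use p m in auto)
  \<comment> \<open>The antipode law for \<open>b\<close> contracts the two inner factors, then that for \<open>a\<close> the outer ones.\<close>
  have mq: "m \<otimes>\<^bsub>?Z\<^esub> q = \<one>\<^bsub>?Z\<^esub>"
  proof (rule conv2_eqI)
    fix a b assume ab: "a \<in> carrier H" "b \<in> carrier H"
    note ca = comult_H_closed[OF ab(1)] and cb = comult_H_closed[OF ab(2)]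
    have "conv2 (m \<otimes>\<^bsub>?Z\<^esub> q) a b = sweedler H (comult H a) (\<lambda>a1 a2. sweedler H (comult H b)
        (\<lambda>b1 b2. (a1 \<otimes>\<^bsub>H\<^esub> (b1 \<otimes>\<^bsub>H\<^esub> S b2)) \<otimes>\<^bsub>H\<^esub> S a2))"
      unfolding conv2_mult[OF m(1) q(1) ab]
      by (rule sweedler_cong[OF mH mH ca], rule sweedler_cong[OF mH mH cb])
        (simp add: m(2) q(2) linear_closed[OF S_linear] H.m_assoc)
    also have "\<dots> = sweedler H (comult H a) (\<lambda>a1 a2. (a1 \<otimes>\<^bsub>H\<^esub> (counit H b \<odot>\<^bsub>H\<^esub> \<one>\<^bsub>H\<^esub>)) \<otimes>\<^bsub>H\<^esub> S a2)"
      unfolding S_right[OF ab(2), symmetric]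
      by (rule sweedler_cong[OF mH mH ca], rule sweedler_linear[where g = "\<lambda>u. (_ \<otimes>\<^bsub>H\<^esub> u) \<otimes>\<^bsub>H\<^esub> S _", symmetric];
          (rule cb lin | assumption)+)
    also have "\<dots> = sweedler H (comult H a) (\<lambda>a1 a2. counit H b \<odot>\<^bsub>H\<^esub> (a1 \<otimes>\<^bsub>H\<^esub> S a2))"
      by (rule sweedler_cong[OF mH mH ca])
        (simp add: H.smult_mult_left H.smult_mult_right HD.counit_K_closed ab linear_closed[OF S_linear])
    also have "\<dots> = counit H b \<odot>\<^bsub>H\<^esub> (counit H a \<odot>\<^bsub>H\<^esub> \<one>\<^bsub>H\<^esub>)"
      unfolding S_right[OF ab(1), symmetric]
      by (rule sweedler_fun_smult; (rule ca ab lin | assumption)+)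
    finally show "conv2 (m \<otimes>\<^bsub>?Z\<^esub> q) a b = conv2 \<one>\<^bsub>?Z\<^esub> a b"
      using ab by (simp add: conv2_one H.smult_assoc1[symmetric] HD.counit_K_closed H.R.m_comm)
  qed (use q m in auto)
  have "p = q" using Z.inv_unique[OF pm mq] p q m by simp
  then show ?thesis using p(2)[OF ab] q(2)[OF ab] by simp
qed

lemma S_one: "S \<one>\<^bsub>H\<^esub> = \<one>\<^bsub>H\<^esub>"
proof -
  interpret H: k_algebra k H by (rule algH)
  have f: "bilin k H H H (\<lambda>a b. S a \<otimes>\<^bsub>H\<^esub> b)" by (rule lin | assumption)+
  have "S \<one>\<^bsub>H\<^esub> \<otimes>\<^bsub>H\<^esub> \<one>\<^bsub>H\<^esub> = sweedler H (comult H \<one>\<^bsub>H\<^esub>) (\<lambda>a b. S a \<otimes>\<^bsub>H\<^esub> b)"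
    unfolding comult_one by (rule sweedler_tens[symmetric, OF _ _ f mH mH mH]) simp_all
  also have "\<dots> = \<one>\<^bsub>H\<^esub>" by (simp add: S_left counit_one)
  finally show ?thesis by (simp add: linear_closed[OF S_linear])
qed

text \<open>
  The inverse of the antipode is the antipode of \<open>opp H\<close>: as \<open>S\<close> reverses products, it maps the
  antipode laws for \<open>S'\<close> in \<open>opp H\<close> to those for \<open>S\<close> in \<open>H\<close>.
\<close>

definition S' :: "'h \<Rightarrow> 'h" where "S' = inv_into (carrier H) S"

lemma S'_closed [lin]: "h \<in> carrier H \<Longrightarrow> S' h \<in> carrier H"
  unfolding S'_def using S(2) by (metis bij_betw_def inv_into_into)

lemma S_S': "h \<in> carrier H \<Longrightarrow> S (S' h) = h"
  unfolding S'_def using S(2) by (meson bij_betw_inv_into_right)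

lemma S_inj: "a \<in> carrier H \<Longrightarrow> b \<in> carrier H \<Longrightarrow> S a = S b \<Longrightarrow> a = b"
  using S(2) by (meson bij_betw_def inj_onD)

lemma S'_linear: "linear_map k H H S'"
proof -
  interpret H: k_algebra k H by (rule algH)
  show ?thesis
    by (rule linear_mapI; (rule S'_closed | rule S_inj); assumption?)
      (simp_all add: S'_closed S_S' linear_add[OF S_linear] linear_smult[OF S_linear])
qed

lemmas [lin] = lin_comp[OF S'_linear]

lemma S'_left:
  assumes h: "h \<in> carrier H"
  shows "sweedler H (comult H h) (\<lambda>a b. S' b \<otimes>\<^bsub>H\<^esub> a) = counit H h \<odot>\<^bsub>H\<^esub> \<one>\<^bsub>H\<^esub>"
proof (rule S_inj)
  interpret H: k_algebra k H by (rule algH)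
  note ch = comult_H_closed[OF h]
  show "sweedler H (comult H h) (\<lambda>a b. S' b \<otimes>\<^bsub>H\<^esub> a) \<in> carrier H" by (rule h lin | assumption)+
  show "counit H h \<odot>\<^bsub>H\<^esub> \<one>\<^bsub>H\<^esub> \<in> carrier H" by (rule h lin)+
  have "S (sweedler H (comult H h) (\<lambda>a b. S' b \<otimes>\<^bsub>H\<^esub> a)) = sweedler H (comult H h) (\<lambda>a b. S a \<otimes>\<^bsub>H\<^esub> b)"
    by (rule sweedler_push[OF S_linear ch])
      ((rule lin | assumption)+, simp add: S_antimult S'_closed S_S')
  then show "S (sweedler H (comult H h) (\<lambda>a b. S' b \<otimes>\<^bsub>H\<^esub> a)) = S (counit H h \<odot>\<^bsub>H\<^esub> \<one>\<^bsub>H\<^esub>)"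
    using h by (simp add: S_left linear_smult[OF S_linear] HD.counit_K_closed S_one)
qed

lemma S'_right:
  assumes h: "h \<in> carrier H"
  shows "sweedler H (comult H h) (\<lambda>a b. b \<otimes>\<^bsub>H\<^esub> S' a) = counit H h \<odot>\<^bsub>H\<^esub> \<one>\<^bsub>H\<^esub>"
proof (rule S_inj)
  interpret H: k_algebra k H by (rule algH)
  note ch = comult_H_closed[OF h]
  show "sweedler H (comult H h) (\<lambda>a b. b \<otimes>\<^bsub>H\<^esub> S' a) \<in> carrier H" by (rule h lin | assumption)+
  show "counit H h \<odot>\<^bsub>H\<^esub> \<one>\<^bsub>H\<^esub> \<in> carrier H" by (rule h lin)+
  have "S (sweedler H (comult H h) (\<lambda>a b. b \<otimes>\<^bsub>H\<^esub> S' a)) = sweedler H (comult H h) (\<lambda>a b. a \<otimes>\<^bsub>H\<^esub> S b)"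
    by (rule sweedler_push[OF S_linear ch])
      ((rule lin | assumption)+, simp add: S_antimult S'_closed S_S')
  then show "S (sweedler H (comult H h) (\<lambda>a b. b \<otimes>\<^bsub>H\<^esub> S' a)) = S (counit H h \<odot>\<^bsub>H\<^esub> \<one>\<^bsub>H\<^esub>)"
    using h by (simp add: S_right linear_smult[OF S_linear] HD.counit_K_closed S_one)
qed

end

section \<open>The canonical element is invertible\<close>

lemma sweedler_tens_id:
  assumes "z \<in> carrier (tensor k A B)" "module k A" "module k B"
  shows "sweedler (tensor k A B) z (tens k A B) = z"
proof (rule linear_ext[OF _ lin_id _ assms])
  have b: "bilin k A B (tensor k A B) (tens k A B)" by (rule assms lin | assumption)+
  show "linear_map k (tensor k A B) (tensor k A B) (\<lambda>z. sweedler (tensor k A B) z (tens k A B))"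
    by (rule b assms lin)+
  show "sweedler (tensor k A B) (tens k A B a b') (tens k A B) = tens k A B a b'"
    if "a \<in> carrier A" "b' \<in> carrier B" for a b'
    by (rule sweedler_tens[OF that b assms(2,3) lin_modules[OF assms(2,3)]])
qed

lemma tflip_tflip:
  assumes "z \<in> carrier (tensor k A B)" "module k A" "module k B"
  shows "tflip k B A (tflip k A B z) = z"
  by (rule linear_ext[OF _ lin_id _ assms]) ((rule assms lin)+, simp add: tflip_tens assms)

lemma tflip_mult:
  assumes z: "z \<in> carrier (tensor k A B)" and w: "w \<in> carrier (tensor k A B)"
    and A: "k_algebra k A" and B: "k_algebra k B"
  shows "tflip k A B (z \<otimes>\<^bsub>tensor k A B\<^esub> w) = tflip k A B z \<otimes>\<^bsub>tensor k B A\<^esub> tflip k A B w"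
proof -
  note m = k_algebra_module[OF A] k_algebra_module[OF B]
  interpret A: k_algebra k A by (rule A)
  interpret B: k_algebra k B by (rule B)
  show ?thesis
  proof (rule linear_ext[OF _ _ _ z m])
    show "linear_map k (tensor k A B) (tensor k B A) (\<lambda>z. tflip k A B (z \<otimes>\<^bsub>tensor k A B\<^esub> w))"
      by (rule w m A B lin)+
    show "linear_map k (tensor k A B) (tensor k B A) (\<lambda>z. tflip k A B z \<otimes>\<^bsub>tensor k B A\<^esub> tflip k A B w)"
      by (rule w m A B lin)+
    fix a b assume ab: "a \<in> carrier A" "b \<in> carrier B"
    note t = tens_closed[OF m ab]
    show "tflip k A B (tens k A B a b \<otimes>\<^bsub>tensor k A B\<^esub> w) =
        tflip k A B (tens k A B a b) \<otimes>\<^bsub>tensor k B A\<^esub> tflip k A B w"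
    proof (rule linear_ext[OF _ _ _ w m])
      show "linear_map k (tensor k A B) (tensor k B A) (\<lambda>w. tflip k A B (tens k A B a b \<otimes>\<^bsub>tensor k A B\<^esub> w))"
        by (rule t m A B lin)+
      show "linear_map k (tensor k A B) (tensor k B A)
          (\<lambda>w. tflip k A B (tens k A B a b) \<otimes>\<^bsub>tensor k B A\<^esub> tflip k A B w)"
        by (rule t m A B lin)+
    qed (simp add: ab tens_mult A B tflip_tens m)
  qed
qed

lemma k_algebra_mk_bialg:
  assumes "k_algebra k A"
  shows "k_algebra k (mk_bialg A \<Delta> \<epsilon>)"
proof -
  interpret k_algebra k A by fact
  have s: "same_space A (mk_bialg A \<Delta> \<epsilon>)" by (simp add: same_space_def mk_bialg_def)
  have c: "carrier (mk_bialg A \<Delta> \<epsilon>) = carrier A" "mult (mk_bialg A \<Delta> \<epsilon>) = mult A"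
    "one (mk_bialg A \<Delta> \<epsilon>) = one A" by (simp_all add: mk_bialg_def)
  show ?thesis
    by (rule k_algebraI, rule module_same_space[OF s k_algebra_module[OF assms]])
      (auto simp: c m_assoc intro!: linear_same_space[OF s s, THEN iffD1]
        lin_mult_left[OF lin_id _ assms] lin_mult_right[OF lin_id _ assms])
qed

context fd_hopf
begin

lemma sweedler_G: "sweedler G z f = sweedler H z f"
  by (rule sweedler_same_space[OF same_space_opp, symmetric])

lemma algG: "k_algebra k G" by (rule k_algebra_opp[OF algH])

lemma same_D: "same_space D' D"
  unfolding dual_def functionals_opp
  using same_space_dual_along[of "functionals k H" k G "\<lambda>\<theta> h. \<theta> h"]
    same_space_dual_along[of "functionals k H" k H "\<lambda>\<theta> h. \<theta> h"]
  by (simp add: same_space_def)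

lemma comult_G: "linear_map k G (tensor k G G) (comult G)"
  unfolding opp_simps
  by (rule linear_same_space[OF same_space_opp tensor_same_space[OF same_space_opp same_space_opp], THEN iffD1])
    (rule comult_H)

lemma counit_G: "linear_map k G (kmod k) (counit G)"
  unfolding opp_simps
  by (rule linear_same_space[OF same_space_opp same_space_refl, THEN iffD1]) (rule counit_H)

sublocale GD: dual_pair k G D' evG U
proof -
  have e: "evG = (\<lambda>\<theta> h. \<theta> h)" "evG = (ev :: ('h \<Rightarrow> 'k) \<Rightarrow> 'h \<Rightarrow> 'k)"
    by (simp_all add: fun_eq_iff ev_def evG_def)
  have "perfect k G (functionals k G) evG U"
    unfolding e(2) functionals_opp by (rule perfect_same_space[OF perfect_H same_space_opp same_space_refl])
  from dual_pair_dual_along[OF this algG comult_G counit_G]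
  show "dual_pair k G D' evG U" by (simp add: dual_def e(1))
qed

sublocale TV: perfect2 k G D' evG U D H evH "tflip k H D U" ..

abbreviation "T \<equiv> tensor k G D"
abbreviation "V \<equiv> tensor k D' H"
abbreviation "PP \<equiv> pair_tensor k evG evH"
abbreviation "\<Theta> \<equiv> canonical_tensor k G D' D H U (tflip k H D U)"

sublocale VV: perfect k T V PP \<Theta> by (rule TV.perfect_tensor)

abbreviation bowtie (infixl "\<bowtie>" 75) where "\<omega> \<bowtie> h \<equiv> tens k D' H \<omega> h"

lemma double_pairing_eq: "double_pairing k = PP"
  by (simp add: fun_eq_iff double_pairing_def pair_tensor_def sweedler_kmod ev_def evG_def)

lemma algT [lin]: "k_algebra k T" by (rule lin)+

lemma U_closed [lin]: "U \<in> carrier T"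
  using HD.\<Omega> tensor_same_space[OF same_space_opp same_space_refl, of k H D] by (simp add: same_space_def)

text \<open>
  The algebra \<open>T = opp H \<otimes> dual H\<close> is the algebra of linear maps from \<open>H\<close> to \<open>opp H\<close> under convolution;
  the map given by \<open>t\<close> has the value \<open>ev2 h t\<close> at \<open>h\<close>.
\<close>

definition ev2 :: "'h \<Rightarrow> ('h, 'h \<Rightarrow> 'k) tens \<Rightarrow> 'h" where
  "ev2 h t = slice G evH h (tflip k G D t)"

lemma ev2_lin [lin]: "linear_map k E T f \<Longrightarrow> h \<in> carrier H \<Longrightarrow> linear_map k E G (\<lambda>x. ev2 h (f x))"
  unfolding ev2_def by (rule lin | assumption)+

lemma ev2_lin_index [lin]:
  assumes "linear_map k E H f" "t \<in> carrier T" "module k E"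
  shows "linear_map k E G (\<lambda>x. ev2 (f x) t)"
  unfolding ev2_def by (rule assms lin)+

lemma ev2_closed [lin]: "h \<in> carrier H \<Longrightarrow> t \<in> carrier T \<Longrightarrow> ev2 h t \<in> carrier G"
  unfolding ev2_def by (rule lin | assumption)+

lemma ev2_mult:
  assumes "h \<in> carrier H" "t \<in> carrier T" "u \<in> carrier T"
  shows "ev2 h (t \<otimes>\<^bsub>T\<^esub> u) = sweedler G (comult H h) (\<lambda>h1 h2. ev2 h1 t \<otimes>\<^bsub>G\<^esub> ev2 h2 u)"
proof -
  have "tflip k G D t \<in> carrier (tensor k D G)" "tflip k G D u \<in> carrier (tensor k D G)"
    by (rule assms lin)+
  then show ?thesis
    unfolding ev2_def tflip_mult[OF assms(2,3) algG alg_dual] by (rule DH.slice_mult[OF assms(1) _ _ algG])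
qed

lemma ev2_one:
  assumes "h \<in> carrier H"
  shows "ev2 h \<one>\<^bsub>T\<^esub> = counit H h \<odot>\<^bsub>G\<^esub> \<one>\<^bsub>G\<^esub>"
proof -
  interpret G: k_algebra k G by (rule algG)
  interpret D: k_algebra k D by (rule alg_dual)
  have "tflip k G D \<one>\<^bsub>T\<^esub> = \<one>\<^bsub>tensor k D G\<^esub>"
    unfolding one_tensor by (rule tflip_tens) (simp_all add: k_algebra_module[OF algG] HD.mV)
  then show ?thesis unfolding ev2_def using DH.slice_one[OF assms algG] by simp
qed

lemma ev2_eqI:
  assumes "t \<in> carrier T" "u \<in> carrier T" "\<And>h. h \<in> carrier H \<Longrightarrow> ev2 h t = ev2 h u"
  shows "t = u"
proof -
  have "tflip k G D t = tflip k G D u"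
    by (rule DH.slice_eqI) ((rule assms lin)+, simp add: ev2_def[symmetric] assms)
  then show ?thesis using tflip_tflip[OF assms(1) GD.mK HD.mV] tflip_tflip[OF assms(2) GD.mK HD.mV] by metis
qed

lemma ev2_tens: "g \<in> carrier G \<Longrightarrow> \<theta> \<in> carrier D \<Longrightarrow> h \<in> carrier H \<Longrightarrow>
    ev2 h (tens k G D g \<theta>) = ev \<theta> h \<odot>\<^bsub>G\<^esub> g"
  unfolding ev2_def by (simp add: tflip_tens GD.mK HD.mV DH.slice_tens)

lemma PP_tens_left:
  assumes \<omega>: "\<omega> \<in> carrier D'" and h: "h \<in> carrier H" and t: "t \<in> carrier T"
  shows "PP (\<omega> \<bowtie> h) t = evG \<omega> (ev2 h t)"
proof (rule linear_ext[OF _ _ _ t GD.mK HD.mV])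
  interpret k: module k "kmod k" by (rule HD.mk)
  have d: "\<omega> \<bowtie> h \<in> carrier V" by (rule \<omega> h lin)+
  show "linear_map k T (kmod k) (PP (\<omega> \<bowtie> h))" by (rule d lin)+
  show "linear_map k T (kmod k) (\<lambda>t. evG \<omega> (ev2 h t))" by (rule \<omega> h lin)+
  fix g \<theta> assume gt: "g \<in> carrier G" "\<theta> \<in> carrier D"
  have "evG \<omega> (ev \<theta> h \<odot>\<^bsub>G\<^esub> g) = ev \<theta> h \<cdot> evG \<omega> g"
    using linear_smult[OF bilin_right[OF GD.P \<omega>] HD.P_closed[OF gt(2) h] gt(1)] by simp
  then show "PP (\<omega> \<bowtie> h) (tens k G D g \<theta>) = evG \<omega> (ev2 h (tens k G D g \<theta>))"
    using HD.P_closed[OF gt(2) h] GD.P_closed[OF \<omega> gt(1)]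
    by (simp add: TV.pair_tensor_tens[OF \<omega> h gt] ev2_tens gt h k.R.m_comm)
qed

lemma id_HG: "linear_map k E H f \<Longrightarrow> linear_map k E G f"
  using linear_same_space[OF same_space_refl same_space_opp] by blast

lemma ev2_element:
  assumes \<phi>: "linear_map k H G \<phi>" and h: "h \<in> carrier H"
  shows "ev2 h (sweedler T U (\<lambda>e v. tens k G D (\<phi> e) v)) = \<phi> h"
proof -
  note \<phi>' = lin_comp[OF \<phi>] linear_closed[OF \<phi>]
  have "ev2 h (sweedler T U (\<lambda>e v. tens k G D (\<phi> e) v)) = sweedler G U (\<lambda>e v. ev v h \<odot>\<^bsub>G\<^esub> \<phi> e)"
    by (rule sweedler_push[where g = "ev2 h", OF _ HD.\<Omega>])
      ((rule h \<phi>' lin | assumption)+, simp add: ev2_tens h linear_closed[OF \<phi>])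
  also have "\<dots> = \<phi> h" by (rule HD.contract_left[OF \<phi> h GD.mK])
  finally show ?thesis .
qed

lemma ev2_U:
  assumes h: "h \<in> carrier H" shows "ev2 h U = h"
  using ev2_element[OF id_HG[OF lin_id] h] sweedler_tens_id[OF U_closed GD.mK HD.mV] by simp

text \<open>
  As a linear map from \<open>H\<close> to \<open>opp H\<close>, the canonical element \<open>U\<close> is the identity (\<open>ev2_U\<close>).  Its
  convolution inverse is the antipode of \<open>opp H\<close>.
\<close>

definition U' :: "('h, 'h \<Rightarrow> 'k) tens" where "U' = sweedler T U (\<lambda>e v. tens k G D (S' e) v)"

lemma ev2_U': "h \<in> carrier H \<Longrightarrow> ev2 h U' = S' h"
  unfolding U'_def by (rule ev2_element[OF id_HG[OF S'_linear]])

lemma U'_closed [lin]: "U' \<in> carrier T"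
proof -
  note S'G = id_HG[OF S'_linear]
  show ?thesis unfolding U'_def
    by (rule HD.\<Omega> linear_closed[OF S'G] lin_comp[OF S'G] lin | assumption)+
qed

lemma U_U': "U \<otimes>\<^bsub>T\<^esub> U' = \<one>\<^bsub>T\<^esub>"
proof (rule ev2_eqI)
  fix h assume h: "h \<in> carrier H"
  have "ev2 h (U \<otimes>\<^bsub>T\<^esub> U') = sweedler G (comult H h) (\<lambda>a b. S' b \<otimes>\<^bsub>H\<^esub> a)"
    unfolding ev2_mult[OF h U_closed U'_closed]
    by (rule sweedler_cong[OF mH mH comult_H_closed[OF h]]) (simp add: ev2_U ev2_U' opp_simps)
  then show "ev2 h (U \<otimes>\<^bsub>T\<^esub> U') = ev2 h \<one>\<^bsub>T\<^esub>"
    using S'_left[OF h] by (simp add: ev2_one[OF h] sweedler_G, simp add: opp_simps)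
qed (rule lin)+

lemma U'_U: "U' \<otimes>\<^bsub>T\<^esub> U = \<one>\<^bsub>T\<^esub>"
proof (rule ev2_eqI)
  fix h assume h: "h \<in> carrier H"
  have "ev2 h (U' \<otimes>\<^bsub>T\<^esub> U) = sweedler G (comult H h) (\<lambda>a b. b \<otimes>\<^bsub>H\<^esub> S' a)"
    unfolding ev2_mult[OF h U'_closed U_closed]
    by (rule sweedler_cong[OF mH mH comult_H_closed[OF h]]) (simp add: ev2_U ev2_U' opp_simps)
  then show "ev2 h (U' \<otimes>\<^bsub>T\<^esub> U) = ev2 h \<one>\<^bsub>T\<^esub>"
    using S'_right[OF h] by (simp add: ev2_one[OF h] sweedler_G, simp add: opp_simps)
qed (rule lin)+

lemma Ad_U_eq: "Ad_U k H t = (U \<otimes>\<^bsub>T\<^esub> t) \<otimes>\<^bsub>T\<^esub> U'"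
proof -
  interpret T: k_algebra k T by (rule algT)
  show ?thesis
    by (simp add: Ad_U_def Ad_def T.inv_char[OF U_closed U'_closed U_U' U'_U])
qed

lemma Ad_U_linear: "linear_map k T T (Ad_U k H)"
  unfolding Ad_U_eq[abs_def] by (rule lin)+

lemmas [lin] = lin_comp[OF Ad_U_linear] linear_closed[OF Ad_U_linear]

lemma Ad_U_U: "t \<in> carrier T \<Longrightarrow> Ad_U k H t \<otimes>\<^bsub>T\<^esub> U = U \<otimes>\<^bsub>T\<^esub> t"
proof -
  assume t: "t \<in> carrier T"
  interpret T: k_algebra k T by (rule algT)
  show ?thesis using t U_closed U'_closed by (simp add: Ad_U_eq T.m_assoc U'_U)
qed

section \<open>Multiplication by the canonical element and its transposes\<close>

text \<open>
  In terms of the product of \<open>H\<close> these are the functionals \<open>g \<mapsto> \<omega>(hg)\<close> and \<open>g \<mapsto> \<omega>(gh)\<close>.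
\<close>

definition lact :: "('h \<Rightarrow> 'k) \<Rightarrow> 'h \<Rightarrow> ('h \<Rightarrow> 'k)" where
  "lact \<omega> h = (\<lambda>g\<in>carrier G. evG \<omega> (g \<otimes>\<^bsub>G\<^esub> h))"

definition ract :: "('h \<Rightarrow> 'k) \<Rightarrow> 'h \<Rightarrow> ('h \<Rightarrow> 'k)" where
  "ract \<omega> h = (\<lambda>g\<in>carrier G. evG \<omega> (h \<otimes>\<^bsub>G\<^esub> g))"

lemma carrier_G: "h \<in> carrier H \<Longrightarrow> h \<in> carrier G" by (simp add: opp_simps)

lemma carrier_D': "carrier D' = carrier (functionals k G)"
  unfolding dual_def using same_space_dual_along[of "functionals k G" k G "\<lambda>\<theta> h. \<theta> h"]
  by (simp add: same_space_def)

lemma lact_closed [lin]: "\<omega> \<in> carrier D' \<Longrightarrow> h \<in> carrier H \<Longrightarrow> lact \<omega> h \<in> carrier D'"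
  unfolding lact_def carrier_D' by (rule functionalI; (rule lin carrier_G | simp add: carrier_D')+)

lemma ract_closed [lin]: "\<omega> \<in> carrier D' \<Longrightarrow> h \<in> carrier H \<Longrightarrow> ract \<omega> h \<in> carrier D'"
  unfolding ract_def carrier_D' by (rule functionalI; (rule lin carrier_G | simp add: carrier_D')+)

lemma evG_lact: "g \<in> carrier G \<Longrightarrow> evG (lact \<omega> h) g = evG \<omega> (g \<otimes>\<^bsub>G\<^esub> h)"
  and evG_ract: "g \<in> carrier G \<Longrightarrow> evG (ract \<omega> h) g = evG \<omega> (h \<otimes>\<^bsub>G\<^esub> g)"
  by (simp_all add: lact_def ract_def evG_def)

lemma lact_lin1:
  assumes h: "h \<in> carrier H" shows "linear_map k D' D' (\<lambda>\<omega>. lact \<omega> h)"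
proof (rule GD.linear_by_pairing[OF GD.mV lact_closed[OF _ h]])
  show "linear_map k D' (kmod k) (\<lambda>\<omega>. evG (lact \<omega> h) g)" if "g \<in> carrier G" for g
    unfolding evG_lact[OF that] by (rule h that lin carrier_G)+
qed

lemma lact_lin2:
  assumes "\<omega> \<in> carrier D'" shows "linear_map k H D' (lact \<omega>)"
proof (rule GD.linear_by_pairing[OF mH lact_closed[OF assms]])
  show "linear_map k H (kmod k) (\<lambda>h. evG (lact \<omega> h) g)" if "g \<in> carrier G" for g
    unfolding evG_lact[OF that] by (rule assms that lin_mult_right[OF id_HG] lin)+
qed

lemma ract_lin1:
  assumes h: "h \<in> carrier H" shows "linear_map k D' D' (\<lambda>\<omega>. ract \<omega> h)"
proof (rule GD.linear_by_pairing[OF GD.mV ract_closed[OF _ h]])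
  show "linear_map k D' (kmod k) (\<lambda>\<omega>. evG (ract \<omega> h) g)" if "g \<in> carrier G" for g
    unfolding evG_ract[OF that] by (rule h that lin carrier_G)+
qed

lemma ract_lin2:
  assumes "\<omega> \<in> carrier D'" shows "linear_map k H D' (ract \<omega>)"
proof (rule GD.linear_by_pairing[OF mH ract_closed[OF assms]])
  show "linear_map k H (kmod k) (\<lambda>h. evG (ract \<omega> h) g)" if "g \<in> carrier G" for g
    unfolding evG_ract[OF that] by (rule assms that lin_mult_left[OF id_HG] lin)+
qed

lemmas [lin] = lin_comp[OF lact_lin1] lin_comp[OF lact_lin2] lin_comp[OF ract_lin1] lin_comp[OF ract_lin2]

text \<open>
  The transposes of right and left multiplication by \<open>U\<close> on \<open>T\<close> (\<open>PP_RU\<close>, \<open>PP_LU\<close>).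
\<close>

definition RU :: "('h \<Rightarrow> 'k, 'h) tens \<Rightarrow> ('h \<Rightarrow> 'k, 'h) tens" where
  "RU d = sweedler V d (\<lambda>\<omega> h. sweedler V (comult H h) (\<lambda>h1 h2. lact \<omega> h2 \<bowtie> h1))"

definition LU :: "('h \<Rightarrow> 'k, 'h) tens \<Rightarrow> ('h \<Rightarrow> 'k, 'h) tens" where
  "LU d = sweedler V d (\<lambda>\<omega> h. sweedler V (comult H h) (\<lambda>h1 h2. ract \<omega> h1 \<bowtie> h2))"

lemma RU_bilin: "bilin k D' H V (\<lambda>\<omega> h. sweedler V (comult H h) (\<lambda>h1 h2. lact \<omega> h2 \<bowtie> h1))"
  by (rule lin | assumption)+
lemma LU_bilin: "bilin k D' H V (\<lambda>\<omega> h. sweedler V (comult H h) (\<lambda>h1 h2. ract \<omega> h1 \<bowtie> h2))"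
  by (rule lin | assumption)+

lemma RU_linear: "linear_map k V V RU" unfolding RU_def[abs_def] by (rule RU_bilin lin)+
lemma LU_linear: "linear_map k V V LU" unfolding LU_def[abs_def] by (rule LU_bilin lin)+

lemmas [lin] = lin_comp[OF RU_linear] linear_closed[OF RU_linear] lin_comp[OF LU_linear] linear_closed[OF LU_linear]

lemma RU_tens: "\<omega> \<in> carrier D' \<Longrightarrow> h \<in> carrier H \<Longrightarrow> RU (\<omega> \<bowtie> h) =
    sweedler V (comult H h) (\<lambda>h1 h2. lact \<omega> h2 \<bowtie> h1)"
  unfolding RU_def by (rule sweedler_tens[OF _ _ RU_bilin GD.mV mH VV.mV])
lemma LU_tens: "\<omega> \<in> carrier D' \<Longrightarrow> h \<in> carrier H \<Longrightarrow> LU (\<omega> \<bowtie> h) =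
    sweedler V (comult H h) (\<lambda>h1 h2. ract \<omega> h1 \<bowtie> h2)"
  unfolding LU_def by (rule sweedler_tens[OF _ _ LU_bilin GD.mV mH VV.mV])

lemma PP_RU:
  assumes d: "d \<in> carrier V" and t: "t \<in> carrier T"
  shows "PP (RU d) t = PP d (t \<otimes>\<^bsub>T\<^esub> U)"
proof (rule linear_ext[OF _ _ _ d GD.mV mH])
  have tU: "t \<otimes>\<^bsub>T\<^esub> U \<in> carrier T" by (rule t lin)+
  show "linear_map k V (kmod k) (\<lambda>d. PP (RU d) t)" by (rule t lin)+
  show "linear_map k V (kmod k) (\<lambda>d. PP d (t \<otimes>\<^bsub>T\<^esub> U))" by (rule tU lin)+
  fix \<omega> h assume wh: "\<omega> \<in> carrier D'" "h \<in> carrier H"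
  note ch = comult_H_closed[OF wh(2)]
  have "PP (RU (\<omega> \<bowtie> h)) t = ksw (comult H h) (\<lambda>h1 h2. evG \<omega> (ev2 h1 t \<otimes>\<^bsub>G\<^esub> ev2 h2 U))"
    unfolding RU_tens[OF wh]
    by (rule sweedler_push[where g = "\<lambda>d. PP d t", OF _ ch])
      ((rule wh t lin | assumption)+, simp add: PP_tens_left lact_closed wh t evG_lact ev2_closed ev2_U)
  also have "\<dots> = evG \<omega> (ev2 h (t \<otimes>\<^bsub>T\<^esub> U))"
    unfolding ev2_mult[OF wh(2) t U_closed]
    by (rule sweedler_linear[symmetric, where g = "evG \<omega>"]; (rule wh t lin | assumption)+)
  finally show "PP (RU (\<omega> \<bowtie> h)) t = PP (\<omega> \<bowtie> h) (t \<otimes>\<^bsub>T\<^esub> U)" by (simp add: PP_tens_left wh tU)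
qed

lemma PP_LU:
  assumes d: "d \<in> carrier V" and t: "t \<in> carrier T"
  shows "PP (LU d) t = PP d (U \<otimes>\<^bsub>T\<^esub> t)"
proof (rule linear_ext[OF _ _ _ d GD.mV mH])
  have tU: "U \<otimes>\<^bsub>T\<^esub> t \<in> carrier T" by (rule t lin)+
  show "linear_map k V (kmod k) (\<lambda>d. PP (LU d) t)" by (rule t lin)+
  show "linear_map k V (kmod k) (\<lambda>d. PP d (U \<otimes>\<^bsub>T\<^esub> t))" by (rule tU lin)+
  fix \<omega> h assume wh: "\<omega> \<in> carrier D'" "h \<in> carrier H"
  note ch = comult_H_closed[OF wh(2)]
  have "PP (LU (\<omega> \<bowtie> h)) t = ksw (comult H h) (\<lambda>h1 h2. evG \<omega> (ev2 h1 U \<otimes>\<^bsub>G\<^esub> ev2 h2 t))"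
    unfolding LU_tens[OF wh]
    by (rule sweedler_push[where g = "\<lambda>d. PP d t", OF _ ch])
      ((rule wh t lin | assumption)+, simp add: PP_tens_left ract_closed wh t evG_ract ev2_closed ev2_U)
  also have "\<dots> = evG \<omega> (ev2 h (U \<otimes>\<^bsub>T\<^esub> t))"
    unfolding ev2_mult[OF wh(2) U_closed t]
    by (rule sweedler_linear[symmetric, where g = "evG \<omega>"]; (rule wh t lin | assumption)+)
  finally show "PP (LU (\<omega> \<bowtie> h)) t = PP (\<omega> \<bowtie> h) (U \<otimes>\<^bsub>T\<^esub> t)" by (simp add: PP_tens_left wh tU)
qed

text \<open>
  The transpose of \<open>Ad(U)\<close>.
\<close>

definition At :: "('h \<Rightarrow> 'k, 'h) tens \<Rightarrow> ('h \<Rightarrow> 'k, 'h) tens" where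
  "At = (SOME F. linear_map k V V F \<and> (\<forall>d\<in>carrier V. \<forall>t\<in>carrier T. PP (F d) t = PP d (Ad_U k H t)))"

lemma At_linear: "linear_map k V V At"
  and PP_At: "d \<in> carrier V \<Longrightarrow> t \<in> carrier T \<Longrightarrow> PP (At d) t = PP d (Ad_U k H t)"
  using someI_ex[OF VV.transpose_exists[OF Ad_U_linear]] unfolding At_def by auto

lemmas [lin] = lin_comp[OF At_linear] linear_closed[OF At_linear]

text \<open>
  This is the transpose of the equation \<open>Ad(U)(t) U = U t\<close>.
\<close>

lemma At_RU: "d \<in> carrier V \<Longrightarrow> At (RU d) = LU d"
proof (rule VV.pairing_eqI)
  assume d: "d \<in> carrier V"
  show "At (RU d) \<in> carrier V" "LU d \<in> carrier V" by (rule d lin)+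
  fix t assume t: "t \<in> carrier T"
  have c: "RU d \<in> carrier V" "Ad_U k H t \<in> carrier T" by (rule d t lin)+
  show "PP (At (RU d)) t = PP (LU d) t" using c d t by (simp add: PP_At PP_RU PP_LU Ad_U_U)
qed

text \<open>
  A preimage comes from the transpose of right multiplication by the inverse of \<open>U\<close>.
\<close>

lemma RU_surj:
  assumes d: "d \<in> carrier V"
  shows "\<exists>d'\<in>carrier V. RU d' = d"
proof -
  interpret T: k_algebra k T by (rule algT)
  have "linear_map k T T (\<lambda>t. t \<otimes>\<^bsub>T\<^esub> U')" by (rule lin)+
  from VV.transpose_exists[OF this] obtain F where F: "linear_map k V V F"
    "\<And>d t. d \<in> carrier V \<Longrightarrow> t \<in> carrier T \<Longrightarrow> PP (F d) t = PP d (t \<otimes>\<^bsub>T\<^esub> U')" by blast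
  have Fd: "F d \<in> carrier V" by (rule linear_closed[OF F(1) d])
  have "RU (F d) = d"
    by (rule VV.pairing_eqI)
      (use Fd d U_closed U'_closed linear_closed[OF RU_linear] in
        \<open>simp_all add: PP_RU F(2) T.m_assoc U_U'\<close>)
  then show ?thesis using Fd by blast
qed

text \<open>
  Both \<open>RU\<close> and \<open>LU\<close> fix \<open>\<omega> \<bowtie> 1\<close>, because \<open>\<Delta>(1) = 1 \<otimes> 1\<close>; so \<open>At_RU\<close> applies.
\<close>

lemma At_left:
  assumes \<omega>: "\<omega> \<in> carrier D'"
  shows "At (\<omega> \<bowtie> \<one>\<^bsub>H\<^esub>) = \<omega> \<bowtie> \<one>\<^bsub>H\<^esub>"
proof -
  interpret G: k_algebra k G by (rule algG)
  interpret H: k_algebra k H by (rule algH)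
  have o: "\<one>\<^bsub>H\<^esub> = \<one>\<^bsub>G\<^esub>" by (simp add: opp_simps)
  have "lact \<omega> \<one>\<^bsub>H\<^esub> = \<omega>" "ract \<omega> \<one>\<^bsub>H\<^esub> = \<omega>"
    by (rule GD.pairing_eqI; (rule \<omega> lin | simp add: evG_lact evG_ract o)+)+
  moreover have b: "bilin k H H V (\<lambda>h1 h2. lact \<omega> h2 \<bowtie> h1)"
    "bilin k H H V (\<lambda>h1 h2. ract \<omega> h1 \<bowtie> h2)" by (rule \<omega> lin | assumption)+
  ultimately have "RU (\<omega> \<bowtie> \<one>\<^bsub>H\<^esub>) = \<omega> \<bowtie> \<one>\<^bsub>H\<^esub>" "LU (\<omega> \<bowtie> \<one>\<^bsub>H\<^esub>) = \<omega> \<bowtie> \<one>\<^bsub>H\<^esub>"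
    using \<omega> by (simp_all add: RU_tens LU_tens comult_one sweedler_tens[OF _ _ b(1) mH mH VV.mV]
        sweedler_tens[OF _ _ b(2) mH mH VV.mV])
  moreover have "\<omega> \<bowtie> \<one>\<^bsub>H\<^esub> \<in> carrier V" by (rule \<omega> algH lin)+
  ultimately show ?thesis using At_RU by metis
qed

text \<open>
  As the counit \<open>\<epsilon>\<close> is multiplicative, translating it by \<open>h\<close> gives \<open>\<epsilon>(h) \<epsilon>\<close>, and by the counit laws both
  \<open>RU\<close> and \<open>LU\<close> fix \<open>\<epsilon> \<bowtie> h\<close>.
\<close>

lemma At_right:
  assumes h: "h \<in> carrier H"
  shows "At (\<one>\<^bsub>D'\<^esub> \<bowtie> h) = \<one>\<^bsub>D'\<^esub> \<bowtie> h"
proof -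
  interpret D: module k D' by (rule GD.mV)
  interpret k: module k "kmod k" by (rule HD.mk)
  note o = GD.one_V
  have c: "counit H x \<in> carrier k" if "x \<in> carrier H" for x by (rule HD.counit_K_closed[OF that])
  have sm: "evG (a \<odot>\<^bsub>D'\<^esub> \<one>\<^bsub>D'\<^esub>) g = a \<cdot> counit H g" if "a \<in> carrier k" "g \<in> carrier G" for a g
    using linear_smult[OF bilin_left[OF GD.P that(2)] that(1) o] GD.P_one[OF that(2)] by (simp add: opp_simps)
  have l: "lact \<one>\<^bsub>D'\<^esub> x = counit H x \<odot>\<^bsub>D'\<^esub> \<one>\<^bsub>D'\<^esub>" "ract \<one>\<^bsub>D'\<^esub> x = counit H x \<odot>\<^bsub>D'\<^esub> \<one>\<^bsub>D'\<^esub>"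
    if x: "x \<in> carrier H" for x
  proof -
    have cg: "x \<otimes>\<^bsub>G\<^esub> g \<in> carrier G" "g \<otimes>\<^bsub>G\<^esub> x \<in> carrier G" if "g \<in> carrier G" for g
      by (rule that carrier_G[OF x] lin)+
    show "lact \<one>\<^bsub>D'\<^esub> x = counit H x \<odot>\<^bsub>D'\<^esub> \<one>\<^bsub>D'\<^esub>"
      by (rule GD.pairing_eqI[OF lact_closed[OF o x]])
        (use x o c cg in \<open>simp_all add: evG_lact sm GD.P_one, simp add: opp_simps counit_mult\<close>)
    show "ract \<one>\<^bsub>D'\<^esub> x = counit H x \<odot>\<^bsub>D'\<^esub> \<one>\<^bsub>D'\<^esub>"
      by (rule GD.pairing_eqI[OF ract_closed[OF o x]])
        (use x o c cg in \<open>simp_all add: evG_ract sm GD.P_one, simp add: opp_simps counit_mult D.R.m_comm\<close>)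
  qed
  note ch = comult_H_closed[OF h]
  have t: "linear_map k H V (tens k D' H \<one>\<^bsub>D'\<^esub>)" by (rule lin)+
  have "\<one>\<^bsub>D'\<^esub> \<bowtie> (sweedler H (comult H h) (\<lambda>h1 h2. counit H h2 \<odot>\<^bsub>H\<^esub> h1)) = RU (\<one>\<^bsub>D'\<^esub> \<bowtie> h)"
    unfolding RU_tens[OF o h] by (rule sweedler_push[OF t ch])
      ((rule lin | assumption)+, simp add: l c o tens_smult_balanced[OF GD.mV mH])
  then have R: "RU (\<one>\<^bsub>D'\<^esub> \<bowtie> h) = \<one>\<^bsub>D'\<^esub> \<bowtie> h" by (simp add: counit_right h)
  have "\<one>\<^bsub>D'\<^esub> \<bowtie> (sweedler H (comult H h) (\<lambda>h1 h2. counit H h1 \<odot>\<^bsub>H\<^esub> h2)) = LU (\<one>\<^bsub>D'\<^esub> \<bowtie> h)"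
    unfolding LU_tens[OF o h] by (rule sweedler_push[OF t ch])
      ((rule lin | assumption)+, simp add: l c o tens_smult_balanced[OF GD.mV mH])
  then have L: "LU (\<one>\<^bsub>D'\<^esub> \<bowtie> h) = \<one>\<^bsub>D'\<^esub> \<bowtie> h" by (simp add: counit_left h)
  have "\<one>\<^bsub>D'\<^esub> \<bowtie> h \<in> carrier V" by (rule h lin)+
  from At_RU[OF this] show ?thesis by (simp add: R L)
qed

end

context fd_hopf
begin

section \<open>The structure of the double\<close>

abbreviation "Kc \<equiv> codouble k H"
abbreviation "Vd \<equiv> double k H"
abbreviation "TT \<equiv> tensor k T T"

lemma comult_Kc: "comult Kc t = sweedler TT t (\<lambda>g \<theta>. sweedler TT (comult G g) (\<lambda>g1 g2.
    sweedler TT (comult D \<theta>) (\<lambda>\<theta>1 \<theta>2.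
      sweedler TT (tflip k G D (Ad_U k H (tens k G D g2 \<theta>1))) (\<lambda>\<theta>' g'.
        tens k T T (tens k G D g1 \<theta>') (tens k G D g' \<theta>2)))))"
  by (simp add: codouble_def Let_def mk_bialg_def)

lemma counit_Kc: "counit Kc t = ksw t (\<lambda>g \<theta>. counit G g \<cdot> counit D \<theta>)"
  by (simp add: codouble_def Let_def mk_bialg_def sweedler_kmod)

lemma comult_Kc_bilin: "bilin k G D TT (\<lambda>g \<theta>. sweedler TT (comult G g) (\<lambda>g1 g2.
    sweedler TT (comult D \<theta>) (\<lambda>\<theta>1 \<theta>2.
      sweedler TT (tflip k G D (Ad_U k H (tens k G D g2 \<theta>1))) (\<lambda>\<theta>' g'.
        tens k T T (tens k G D g1 \<theta>') (tens k G D g' \<theta>2)))))"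
  by (rule lin | assumption)+

lemma comult_Kc_linear: "linear_map k T TT (comult Kc)"
  unfolding comult_Kc[abs_def] by (rule comult_Kc_bilin lin)+

lemma comult_Kc_tens: "g \<in> carrier G \<Longrightarrow> \<theta> \<in> carrier D \<Longrightarrow> comult Kc (tens k G D g \<theta>) =
    sweedler TT (comult G g) (\<lambda>g1 g2. sweedler TT (comult D \<theta>) (\<lambda>\<theta>1 \<theta>2.
      sweedler TT (tflip k G D (Ad_U k H (tens k G D g2 \<theta>1))) (\<lambda>\<theta>' g'.
        tens k T T (tens k G D g1 \<theta>') (tens k G D g' \<theta>2))))"
  unfolding comult_Kc by (rule sweedler_tens[OF _ _ comult_Kc_bilin]) (rule lin | assumption)+

lemma counit_Kc_linear: "linear_map k T (kmod k) (counit Kc)"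
  unfolding counit_Kc[abs_def] by (rule lin | assumption)+

lemma same_Kc: "same_space T Kc"
  by (simp add: same_space_def codouble_def mk_bialg_def Let_def)

lemma same_TT: "same_space TT (tensor k Kc Kc)"
  by (rule tensor_same_space[OF same_Kc same_Kc])

lemma same_V: "same_space V (tensor k D H)"
  by (rule tensor_same_space[OF same_D same_space_refl])

lemma same_Vd: "same_space V Vd"
  using same_V same_space_dual_along[of "tensor k D H" k Kc "double_pairing k"]
  by (simp add: same_space_def double_def)

sublocale DB: dual_pair k Kc Vd PP \<Theta>
proof -
  have 1: "perfect k Kc (tensor k D H) PP \<Theta>"
    by (rule perfect_same_space[OF VV.perfect_axioms same_Kc same_V])
  have 2: "k_algebra k Kc"
    unfolding codouble_def Let_def by (rule k_algebra_mk_bialg) (rule lin)+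
  have 3: "linear_map k Kc (tensor k Kc Kc) (comult Kc)"
    by (rule linear_same_space[OF same_Kc same_TT, THEN iffD1, OF comult_Kc_linear])
  have 4: "linear_map k Kc (kmod k) (counit Kc)"
    by (rule linear_same_space[OF same_Kc same_space_refl, THEN iffD1, OF counit_Kc_linear])
  show "dual_pair k Kc Vd PP \<Theta>"
    using dual_pair_dual_along[OF 1 2 3 4] by (simp add: double_def double_pairing_eq)
qed

lemma cKc: "carrier Kc = carrier T" and cVd: "carrier Vd = carrier V"
  and cTT: "carrier (tensor k Kc Kc) = carrier TT" and oKc: "one Kc = one T" and mKc: "mult Kc = mult T"
  and cVV: "carrier (tensor k Vd Vd) = carrier (tensor k V V)"
  using same_Kc same_Vd same_TT tensor_same_space[OF same_Vd same_Vd, of k]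
  by (simp_all add: same_space_def, simp_all add: codouble_def mk_bialg_def Let_def)

text \<open>
  The two inner legs in the coproduct of the codouble are paired with \<open>h\<close> and \<open>\<omega>\<close>; the outer legs
  contribute the scalars \<open>a\<close> and \<open>b\<close>.
\<close>

lemma contract_flip:
  assumes z: "z \<in> carrier T" and as: "\<omega> \<in> carrier D'" "h \<in> carrier H" "a \<in> carrier k" "b \<in> carrier k"
  shows "ksw (tflip k G D z) (\<lambda>\<theta>' g'. (a \<cdot> ev \<theta>' h) \<cdot> (evG \<omega> g' \<cdot> b)) =
    (a \<cdot> b) \<cdot> PP (\<omega> \<bowtie> h) z"
proof (rule linear_ext[OF _ _ _ z GD.mK HD.mV])
  interpret k: module k "kmod k" by (rule HD.mk)
  have b: "bilin k D G (kmod k) (\<lambda>\<theta>' g'. (a \<cdot> ev \<theta>' h) \<cdot> (evG \<omega> g' \<cdot> b))"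
    by (rule as lin | assumption)+
  show "linear_map k T (kmod k) (\<lambda>z. ksw (tflip k G D z)
      (\<lambda>\<theta>' g'. (a \<cdot> ev \<theta>' h) \<cdot> (evG \<omega> g' \<cdot> b)))"
    by (rule b lin)+
  show "linear_map k T (kmod k) (\<lambda>z. (a \<cdot> b) \<cdot> PP (\<omega> \<bowtie> h) z)"
    by (rule as lin | assumption)+
  fix g \<theta> assume gt: "g \<in> carrier G" "\<theta> \<in> carrier D"
  have c: "ev \<theta> h \<in> carrier k" "evG \<omega> g \<in> carrier k" by (rule gt as lin)+
  show "ksw (tflip k G D (tens k G D g \<theta>))
      (\<lambda>\<theta>' g'. (a \<cdot> ev \<theta>' h) \<cdot> (evG \<omega> g' \<cdot> b)) =
      (a \<cdot> b) \<cdot> PP (\<omega> \<bowtie> h) (tens k G D g \<theta>)"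
    unfolding tflip_tens[OF gt GD.mK HD.mV] sweedler_tens[OF gt(2,1) b HD.mV GD.mK HD.mk]
      TV.pair_tensor_tens[OF as(1,2) gt]
    using c as by (simp add: k.R.m_ac)
qed

lemma PP_mult_double:
  assumes as: "\<omega> \<in> carrier D'" "h \<in> carrier H" "\<omega>' \<in> carrier D'" "h' \<in> carrier H"
    and gt: "g \<in> carrier G" "\<theta> \<in> carrier D"
  shows "PP (\<omega> \<bowtie> h \<otimes>\<^bsub>Vd\<^esub> \<omega>' \<bowtie> h') (tens k G D g \<theta>) =
    ksw (comult G g) (\<lambda>g1 g2. ksw (comult D \<theta>) (\<lambda>\<theta>1 \<theta>2.
      (evG \<omega> g1 \<cdot> ev \<theta>2 h') \<cdot> PP (At (\<omega>' \<bowtie> h)) (tens k G D g2 \<theta>1)))"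
proof -
  let ?v = "\<omega> \<bowtie> h" and ?w = "\<omega>' \<bowtie> h'"
  let ?F = "\<lambda>t u. PP ?v t \<cdot> PP ?w u"
  let ?in = "\<lambda>g1 \<theta>2 \<theta>' g'. tens k T T (tens k G D g1 \<theta>') (tens k G D g' \<theta>2)"
  let ?z = "\<lambda>g2 \<theta>1. Ad_U k H (tens k G D g2 \<theta>1)"
  have v: "?v \<in> carrier V" "?w \<in> carrier V" by (rule as lin)+
  have t: "tens k G D g \<theta> \<in> carrier T" by (rule gt lin)+
  note cg = GD.comult_K[THEN linear_closed, OF gt(1)] and ct = HD.comult_V[OF gt(2)]
  have F: "bilin k T T (kmod k) ?F" by (rule v lin | assumption)+
  have lF: "linear_map k TT (kmod k) (\<lambda>z. ksw z ?F)" by (rule F lin)+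
  have z: "?z g2 \<theta>1 \<in> carrier T" if "g2 \<in> carrier G" "\<theta>1 \<in> carrier D" for g2 \<theta>1
    by (rule that lin)+
  have "ksw (comult Kc (tens k G D g \<theta>)) ?F = ksw (comult G g) (\<lambda>g1 g2. ksw (comult D \<theta>)
      (\<lambda>\<theta>1 \<theta>2. (evG \<omega> g1 \<cdot> ev \<theta>2 h') \<cdot> PP (At (\<omega>' \<bowtie> h)) (tens k G D g2 \<theta>1)))"
    unfolding comult_Kc_tens[OF gt]
  proof (rule sweedler_push[OF lF cg])
    fix g1 g2 assume 1: "g1 \<in> carrier G" "g2 \<in> carrier G"
    show "ksw (sweedler TT (comult D \<theta>) (\<lambda>\<theta>1 \<theta>2. sweedler TT (tflip k G D (?z g2 \<theta>1)) (?in g1 \<theta>2))) ?F =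
      ksw (comult D \<theta>) (\<lambda>\<theta>1 \<theta>2. (evG \<omega> g1 \<cdot> ev \<theta>2 h') \<cdot> PP (At (\<omega>' \<bowtie> h)) (tens k G D g2 \<theta>1))"
    proof (rule sweedler_push[OF lF ct])
      fix \<theta>1 \<theta>2 assume 2: "\<theta>1 \<in> carrier D" "\<theta>2 \<in> carrier D"
      have "ksw (sweedler TT (tflip k G D (?z g2 \<theta>1)) (?in g1 \<theta>2)) ?F = ksw (tflip k G D (?z g2 \<theta>1))
          (\<lambda>\<theta>' g'. (evG \<omega> g1 \<cdot> ev \<theta>' h) \<cdot> (evG \<omega>' g' \<cdot> ev \<theta>2 h'))"
        by (rule sweedler_push[OF lF, where A = D and B = G])
          ((rule 1 2 lin | assumption)+, subst sweedler_tens[OF _ _ F],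
            (rule 1 2 lin | assumption)+, simp add: TV.pair_tensor_tens as 1 2)
      also have "\<dots> = (evG \<omega> g1 \<cdot> ev \<theta>2 h') \<cdot> PP (\<omega>' \<bowtie> h) (?z g2 \<theta>1)"
        by (rule contract_flip[OF z[OF 1(2) 2(1)]]; (rule 1 2 as lin)+)
      also have "PP (\<omega>' \<bowtie> h) (?z g2 \<theta>1) = PP (At (\<omega>' \<bowtie> h)) (tens k G D g2 \<theta>1)"
        by (rule PP_At[symmetric]; (rule 1 2 as lin)+)
      finally show "ksw (sweedler TT (tflip k G D (?z g2 \<theta>1)) (?in g1 \<theta>2)) ?F =
        (evG \<omega> g1 \<cdot> ev \<theta>2 h') \<cdot> PP (At (\<omega>' \<bowtie> h)) (tens k G D g2 \<theta>1)" .
    qed (rule 1 lin | assumption)+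
  qed (rule gt lin | assumption)+
  then show ?thesis using DB.P_mult[of ?v ?w "tens k G D g \<theta>"] by (simp add: cKc cVd v t)
qed

text \<open>
  The right-hand side is the one of \<open>PP_mult_double\<close> with \<open>At (\<omega>' \<bowtie> h)\<close> generalised to an arbitrary \<open>d\<close>,
  in which both sides are linear.
\<close>

lemma PP_insert:
  assumes d: "d \<in> carrier V" and as: "\<omega> \<in> carrier D'" "h' \<in> carrier H"
    and gt: "g \<in> carrier G" "\<theta> \<in> carrier D"
  shows "PP (sweedler V d (\<lambda>\<omega>2 h2. (\<omega> \<otimes>\<^bsub>D'\<^esub> \<omega>2) \<bowtie> (h2 \<otimes>\<^bsub>H\<^esub> h'))) (tens k G D g \<theta>) =
    ksw (comult G g) (\<lambda>g1 g2. ksw (comult D \<theta>) (\<lambda>\<theta>1 \<theta>2.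
      (evG \<omega> g1 \<cdot> ev \<theta>2 h') \<cdot> PP d (tens k G D g2 \<theta>1)))"
proof (rule linear_ext[OF _ _ _ d GD.mV mH])
  interpret k: module k "kmod k" by (rule HD.mk)
  have t: "tens k G D g \<theta> \<in> carrier T" by (rule gt lin)+
  note cg = GD.comult_K[THEN linear_closed, OF gt(1)] and ct = HD.comult_V[OF gt(2)]
  have b: "bilin k D' H V (\<lambda>\<omega>2 h2. (\<omega> \<otimes>\<^bsub>D'\<^esub> \<omega>2) \<bowtie> (h2 \<otimes>\<^bsub>H\<^esub> h'))"
    by (rule as lin | assumption)+
  show "linear_map k V (kmod k) (\<lambda>d. PP (sweedler V d
      (\<lambda>\<omega>2 h2. (\<omega> \<otimes>\<^bsub>D'\<^esub> \<omega>2) \<bowtie> (h2 \<otimes>\<^bsub>H\<^esub> h'))) (tens k G D g \<theta>))"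
    by (rule t b lin)+
  show "linear_map k V (kmod k) (\<lambda>d. ksw (comult G g) (\<lambda>g1 g2. ksw (comult D \<theta>)
      (\<lambda>\<theta>1 \<theta>2. (evG \<omega> g1 \<cdot> ev \<theta>2 h') \<cdot> PP d (tens k G D g2 \<theta>1))))"
    by (rule gt as lin | assumption)+
  fix \<omega>2 h2 assume 2: "\<omega>2 \<in> carrier D'" "h2 \<in> carrier H"
  have hh: "h2 \<otimes>\<^bsub>H\<^esub> h' \<in> carrier H" and ww: "\<omega> \<otimes>\<^bsub>D'\<^esub> \<omega>2 \<in> carrier D'" by (rule as 2 lin)+
  have "evG (\<omega> \<otimes>\<^bsub>D'\<^esub> \<omega>2) g \<cdot> ev \<theta> (h2 \<otimes>\<^bsub>H\<^esub> h') = ksw (comult G g) (\<lambda>g1 g2. ksw (comult D \<theta>) (\<lambda>\<theta>1 \<theta>2.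
      (evG \<omega> g1 \<cdot> ev \<theta>2 h') \<cdot> PP (\<omega>2 \<bowtie> h2) (tens k G D g2 \<theta>1)))"
    unfolding GD.P_mult[OF as(1) 2(1) gt(1)]
  proof (rule sweedler_push[where g = "\<lambda>u. u \<cdot> ev \<theta> (h2 \<otimes>\<^bsub>H\<^esub> h')", OF _ cg])
    fix g1 g2 assume 1: "g1 \<in> carrier G" "g2 \<in> carrier G"
    have c: "evG \<omega> g1 \<in> carrier k" "evG \<omega>2 g2 \<in> carrier k" by (rule 1 as 2 lin)+
    show "(evG \<omega> g1 \<cdot> evG \<omega>2 g2) \<cdot> ev \<theta> (h2 \<otimes>\<^bsub>H\<^esub> h') = ksw (comult D \<theta>) (\<lambda>\<theta>1 \<theta>2.
        (evG \<omega> g1 \<cdot> ev \<theta>2 h') \<cdot> PP (\<omega>2 \<bowtie> h2) (tens k G D g2 \<theta>1))"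
      unfolding HD.P_comult[OF gt(2) 2(2) as(2)]
    proof (rule sweedler_push[where g = "\<lambda>u. (evG \<omega> g1 \<cdot> evG \<omega>2 g2) \<cdot> u", OF _ ct])
      fix \<theta>1 \<theta>2 assume 3: "\<theta>1 \<in> carrier D" "\<theta>2 \<in> carrier D"
      have "ev \<theta>1 h2 \<in> carrier k" "ev \<theta>2 h' \<in> carrier k" by (rule 3 as 2 lin)+
      then show "(evG \<omega> g1 \<cdot> evG \<omega>2 g2) \<cdot> (ev \<theta>1 h2 \<cdot> ev \<theta>2 h') =
          (evG \<omega> g1 \<cdot> ev \<theta>2 h') \<cdot> PP (\<omega>2 \<bowtie> h2) (tens k G D g2 \<theta>1)"
        using c by (simp add: TV.pair_tensor_tens[OF 2 1(2) 3(1)] k.R.m_ac)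
    qed (rule 1 as 2 lin | assumption)+
  qed (rule hh gt as 2 lin | assumption)+
  then show "PP (sweedler V (\<omega>2 \<bowtie> h2) (\<lambda>\<omega>2 h2. (\<omega> \<otimes>\<^bsub>D'\<^esub> \<omega>2) \<bowtie> (h2 \<otimes>\<^bsub>H\<^esub> h'))) (tens k G D g \<theta>) =
    ksw (comult G g) (\<lambda>g1 g2. ksw (comult D \<theta>) (\<lambda>\<theta>1 \<theta>2.
      (evG \<omega> g1 \<cdot> ev \<theta>2 h') \<cdot> PP (\<omega>2 \<bowtie> h2) (tens k G D g2 \<theta>1)))"
    by (simp add: sweedler_tens[OF 2 b GD.mV mH VV.mV] TV.pair_tensor_tens[OF ww hh gt])
qed

text \<open>
  In the coproduct of the codouble, \<open>Ad(U)\<close> is applied to the legs that are then paired with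
  \<open>\<omega>'\<close> and \<open>h\<close>; dually, \<open>At\<close> is applied to \<open>\<omega>' \<bowtie> h\<close> before the two outer factors are multiplied on.
\<close>

lemma mult_double:
  assumes as: "\<omega> \<in> carrier D'" "h \<in> carrier H" "\<omega>' \<in> carrier D'" "h' \<in> carrier H"
  shows "\<omega> \<bowtie> h \<otimes>\<^bsub>Vd\<^esub> \<omega>' \<bowtie> h' =
    sweedler V (At (\<omega>' \<bowtie> h)) (\<lambda>\<omega>2 h2. (\<omega> \<otimes>\<^bsub>D'\<^esub> \<omega>2) \<bowtie> (h2 \<otimes>\<^bsub>H\<^esub> h'))"
proof (rule VV.pairing_eqI)
  have v: "\<omega> \<bowtie> h \<in> carrier V" "\<omega>' \<bowtie> h' \<in> carrier V" by (rule as lin)+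
  have a: "At (\<omega>' \<bowtie> h) \<in> carrier V" by (rule as lin)+
  show l: "\<omega> \<bowtie> h \<otimes>\<^bsub>Vd\<^esub> \<omega>' \<bowtie> h' \<in> carrier V"
    using DB.mult_V v by (simp add: cVd)
  show r: "sweedler V (At (\<omega>' \<bowtie> h)) (\<lambda>\<omega>2 h2. (\<omega> \<otimes>\<^bsub>D'\<^esub> \<omega>2) \<bowtie> (h2 \<otimes>\<^bsub>H\<^esub> h')) \<in> carrier V"
    by (rule a as lin | assumption)+
  fix t assume t: "t \<in> carrier T"
  show "PP (\<omega> \<bowtie> h \<otimes>\<^bsub>Vd\<^esub> \<omega>' \<bowtie> h') t =
    PP (sweedler V (At (\<omega>' \<bowtie> h)) (\<lambda>\<omega>2 h2. (\<omega> \<otimes>\<^bsub>D'\<^esub> \<omega>2) \<bowtie> (h2 \<otimes>\<^bsub>H\<^esub> h'))) t"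
    by (rule linear_ext[OF VV.lin_P_right[OF lin_id l] VV.lin_P_right[OF lin_id r] _ t GD.mK HD.mV])
      (simp add: PP_mult_double[OF as] PP_insert[OF a as(1,4)])
qed

text \<open>
  The codouble has the product of a tensor product of algebras, so that the coproduct of the double
  is taken factor by factor.
\<close>

lemma comult_double:
  assumes as: "\<omega> \<in> carrier D'" "h \<in> carrier H"
  shows "comult Vd (\<omega> \<bowtie> h) = sweedler (tensor k V V) (comult D' \<omega>) (\<lambda>\<omega>1 \<omega>2.
    sweedler (tensor k V V) (comult H h) (\<lambda>h1 h2. tens k V V (\<omega>1 \<bowtie> h1) (\<omega>2 \<bowtie> h2)))"
    (is "_ = ?rhs")
proof -
  interpret V2: perfect2 k T V PP \<Theta> T V PP \<Theta> ..
  have v: "\<omega> \<bowtie> h \<in> carrier V" by (rule as lin)+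
  note cw = GD.comult_V[OF as(1)] and ch = comult_H_closed[OF as(2)]
  show ?thesis
  proof (rule V2.tensor_pairing_eqI)
    show "comult Vd (\<omega> \<bowtie> h) \<in> carrier (tensor k V V)" using DB.comult_V v by (simp add: cVd cVV)
    show "?rhs \<in> carrier (tensor k V V)" by (rule as lin | assumption)+
    fix t u assume tu: "t \<in> carrier T" "u \<in> carrier T"
    have b: "bilin k V V (kmod k) (\<lambda>v w. PP v t \<cdot> PP w u)" by (rule tu lin | assumption)+
    have l: "linear_map k (tensor k V V) (kmod k) (\<lambda>z. ksw z (\<lambda>v w. PP v t \<cdot> PP w u))"
      by (rule b lin)+
    have tut: "t \<otimes>\<^bsub>T\<^esub> u \<in> carrier T" by (rule tu lin)+
    have "ksw (comult Vd (\<omega> \<bowtie> h)) (\<lambda>v w. PP v t \<cdot> PP w u) =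
        evG \<omega> (sweedler G (comult H h) (\<lambda>h1 h2. ev2 h1 t \<otimes>\<^bsub>G\<^esub> ev2 h2 u))"
      using DB.P_comult[of "\<omega> \<bowtie> h" t u] v tu
      by (simp add: cVd cKc mKc PP_tens_left[OF as tut] ev2_mult[OF as(2) tu])
    also have "\<dots> = ksw (comult H h) (\<lambda>h1 h2. ksw (comult D' \<omega>)
        (\<lambda>\<omega>1 \<omega>2. evG \<omega>1 (ev2 h1 t) \<cdot> evG \<omega>2 (ev2 h2 u)))"
      by (rule sweedler_push[where g = "evG \<omega>", OF _ ch]; (rule tu as lin GD.P_comult | assumption)+)
    also have "\<dots> = ksw (comult D' \<omega>) (\<lambda>\<omega>1 \<omega>2. ksw (comult H h)
        (\<lambda>h1 h2. evG \<omega>1 (ev2 h1 t) \<cdot> evG \<omega>2 (ev2 h2 u)))"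
      by (rule sweedler_swap; (rule tu as lin | assumption)+)
    also have "\<dots> = ksw ?rhs (\<lambda>v w. PP v t \<cdot> PP w u)"
    proof (rule HOL.sym, rule sweedler_push[OF l cw])
      fix \<omega>1 \<omega>2 assume 1: "\<omega>1 \<in> carrier D'" "\<omega>2 \<in> carrier D'"
      show "ksw (sweedler (tensor k V V) (comult H h) (\<lambda>h1 h2. tens k V V (\<omega>1 \<bowtie> h1) (\<omega>2 \<bowtie> h2)))
          (\<lambda>v w. PP v t \<cdot> PP w u) =
        ksw (comult H h) (\<lambda>h1 h2. evG \<omega>1 (ev2 h1 t) \<cdot> evG \<omega>2 (ev2 h2 u))"
        by (rule sweedler_push[OF l ch])
          ((rule 1 lin | assumption)+, subst sweedler_tens[OF _ _ b],
            (rule 1 lin | assumption)+, simp add: PP_tens_left 1 tu)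
    qed (rule as lin | assumption)+
    finally show "ksw (comult Vd (\<omega> \<bowtie> h)) (\<lambda>v w. PP v t \<cdot> PP w u) =
      ksw ?rhs (\<lambda>v w. PP v t \<cdot> PP w u)" .
  qed
qed

lemma one_double: "\<one>\<^bsub>Vd\<^esub> = \<one>\<^bsub>D'\<^esub> \<bowtie> \<one>\<^bsub>H\<^esub>"
proof (rule VV.pairing_eqI)
  interpret k: module k "kmod k" by (rule HD.mk)
  interpret H: k_algebra k H by (rule algH)
  show "\<one>\<^bsub>Vd\<^esub> \<in> carrier V" using DB.one_V by (simp add: cVd)
  show c: "\<one>\<^bsub>D'\<^esub> \<bowtie> \<one>\<^bsub>H\<^esub> \<in> carrier V" by (rule algH lin)+
  fix t assume t: "t \<in> carrier T"
  have "PP \<one>\<^bsub>Vd\<^esub> t = counit Kc t" using DB.P_one t by (simp add: cKc)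
  also have "counit Kc t = PP (\<one>\<^bsub>D'\<^esub> \<bowtie> \<one>\<^bsub>H\<^esub>) t"
  proof (rule linear_ext[OF counit_Kc_linear VV.lin_P_right[OF lin_id c] _ t GD.mK HD.mV])
    fix g \<theta> assume gt: "g \<in> carrier G" "\<theta> \<in> carrier D"
    have "bilin k G D (kmod k) (\<lambda>g \<theta>. counit G g \<cdot> counit D \<theta>)" by (rule lin | assumption)+
    then show "counit Kc (tens k G D g \<theta>) = PP (\<one>\<^bsub>D'\<^esub> \<bowtie> \<one>\<^bsub>H\<^esub>) (tens k G D g \<theta>)"
      unfolding counit_Kc using gt
      by (simp add: sweedler_tens[OF gt _ GD.mK HD.mV HD.mk] TV.pair_tensor_tens GD.one_V GD.P_one HD.counit_V)
  qed
  finally show "PP \<one>\<^bsub>Vd\<^esub> t = PP (\<one>\<^bsub>D'\<^esub> \<bowtie> \<one>\<^bsub>H\<^esub>) t" .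
qed

lemma counit_double:
  assumes as: "\<omega> \<in> carrier D'" "h \<in> carrier H"
  shows "counit Vd (\<omega> \<bowtie> h) = counit D' \<omega> \<cdot> counit H h"
proof -
  interpret k: module k "kmod k" by (rule HD.mk)
  interpret G: k_algebra k G by (rule algG)
  have 1: "\<one>\<^bsub>T\<^esub> \<in> carrier T" by (rule lin)+
  have v: "\<omega> \<bowtie> h \<in> carrier Vd" unfolding cVd by (rule as lin)+
  have c: "counit H h \<in> carrier k" "evG \<omega> \<one>\<^bsub>G\<^esub> \<in> carrier k"
    using HD.counit_K_closed[OF as(2)] GD.P_closed[OF as(1) G.one_closed] by auto
  have "counit Vd (\<omega> \<bowtie> h) = evG \<omega> (counit H h \<odot>\<^bsub>G\<^esub> \<one>\<^bsub>G\<^esub>)"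
    by (simp add: DB.counit_V[OF v] oKc PP_tens_left[OF as 1] ev2_one[OF as(2)])
  also have "\<dots> = counit H h \<cdot> evG \<omega> \<one>\<^bsub>G\<^esub>"
    using linear_smult[OF bilin_right[OF GD.P as(1)] c(1)] by simp
  finally show ?thesis using c by (simp add: GD.counit_V[OF as(1)] k.R.m_comm)
qed

end

section \<open>Yetter-Drinfeld conditions and actions of the double\<close>

lemma right_actionD:
  assumes "right_action k K X act"
  shows "x \<in> carrier X \<Longrightarrow> linear_map k K X (act x)"
    and "a \<in> carrier K \<Longrightarrow> linear_map k X X (\<lambda>x. act x a)"
    and "x \<in> carrier X \<Longrightarrow> act x \<one>\<^bsub>K\<^esub> = x"
    and "x \<in> carrier X \<Longrightarrow> a \<in> carrier K \<Longrightarrow> b \<in> carrier K \<Longrightarrow> act x (a \<otimes>\<^bsub>K\<^esub> b) = act (act x a) b"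
    and "a \<in> carrier K \<Longrightarrow> act \<one>\<^bsub>X\<^esub> a = counit K a \<odot>\<^bsub>X\<^esub> \<one>\<^bsub>X\<^esub>"
    and "x \<in> carrier X \<Longrightarrow> y \<in> carrier X \<Longrightarrow> a \<in> carrier K \<Longrightarrow>
      act (x \<otimes>\<^bsub>X\<^esub> y) a = sweedler X (comult K a) (\<lambda>a1 a2. act x a1 \<otimes>\<^bsub>X\<^esub> act y a2)"
    and "act \<in> extensional (carrier X)" and "x \<in> carrier X \<Longrightarrow> act x \<in> extensional (carrier K)"
    and "x \<in> carrier X \<Longrightarrow> a \<in> carrier K \<Longrightarrow> act x a \<in> carrier X"
proof -
  show "x \<in> carrier X \<Longrightarrow> a \<in> carrier K \<Longrightarrow> act x a \<in> carrier X"
    using assms linear_closed unfolding right_action_def by metis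
qed (use assms in \<open>simp_all add: right_action_def\<close>)

context fd_hopf
begin

definition dot ::
  "('k, 'x) module \<Rightarrow> ('x \<Rightarrow> ('h \<Rightarrow> 'k) \<Rightarrow> 'x) \<Rightarrow> ('x \<Rightarrow> 'h \<Rightarrow> 'x) \<Rightarrow> 'x \<Rightarrow> ('h \<Rightarrow> 'k, 'h) tens \<Rightarrow> 'x" where
  "dot X \<rho> act x d = sweedler X d (\<lambda>\<omega> h. act (\<rho> x \<omega>) h)"

text \<open>
  The common form of both Yetter-Drinfeld conditions: how the action of \<open>H\<close> is followed by that of
  the dual of \<open>opp H\<close>.
\<close>

definition yd_condition ::
  "('k, 'x) module \<Rightarrow> ('x \<Rightarrow> ('h \<Rightarrow> 'k) \<Rightarrow> 'x) \<Rightarrow> ('x \<Rightarrow> 'h \<Rightarrow> 'x) \<Rightarrow> bool" where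
  "yd_condition X \<rho> act \<longleftrightarrow> (\<forall>x\<in>carrier X. \<forall>h\<in>carrier H. \<forall>\<omega>\<in>carrier D'.
    \<rho> (act x h) \<omega> = dot X \<rho> act x (At (\<omega> \<bowtie> h)))"

lemma coact_twice_linear:
  assumes X: "k_algebra k X" and \<alpha>: "linear_map k X (tensor k G X) \<alpha>" and \<beta>: "linear_map k X (tensor k D X) \<beta>"
  shows "linear_map k X (tensor k T X) (coact_twice k H X \<alpha> \<beta>)"
proof (rule linear_cong)
  note mX = k_algebra_module[OF X]
  show "linear_map k X (tensor k T X) (\<lambda>x. assoc_left k G D X (tmap k G (tensor k D X) id \<beta> (\<alpha> x)))"
    by (rule mX \<alpha> \<beta> lin)+
  show "module k X" by (rule mX)
qed (simp add: coact_twice_def)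

lemma slice_coact_twice:
  assumes X: "k_algebra k X" and \<alpha>: "linear_map k X (tensor k G X) \<alpha>" and \<beta>: "linear_map k X (tensor k D X) \<beta>"
    and d: "d \<in> carrier V" and x: "x \<in> carrier X"
  shows "slice X PP d (coact_twice k H X \<alpha> \<beta> x) =
    sweedler X d (\<lambda>\<omega> h. slice X evH h (\<beta> (slice X evG \<omega> (\<alpha> x))))"
proof -
  note mX = k_algebra_module[OF X]
  interpret X: k_algebra k X by (rule X)
  note ax = linear_closed[OF \<alpha> x]
  note cl = linear_closed[OF \<beta>] lin_comp[OF \<beta>]
  note cx = linear_closed[OF coact_twice_linear[OF X \<alpha> \<beta>] x]
  have mDX: "module k (tensor k D X)" and mTX: "module k (tensor k T X)" by (rule mX lin)+
  have b: "bilin k D' H X (\<lambda>\<omega> h. slice X evH h (\<beta> (slice X evG \<omega> (\<alpha> x))))"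
    by (rule ax cl mX lin | assumption)+
  have pure: "slice X PP (\<omega> \<bowtie> h) (assoc_left k G D X (tmap k G (tensor k D X) id \<beta> z)) =
      slice X evH h (\<beta> (slice X evG \<omega> z))"
    if wh: "\<omega> \<in> carrier D'" "h \<in> carrier H" and z: "z \<in> carrier (tensor k G X)" for \<omega> h z
  proof (rule linear_ext[OF _ _ _ z GD.mK mX])
    have v: "\<omega> \<bowtie> h \<in> carrier V" by (rule wh lin)+
    show "linear_map k (tensor k G X) X
        (\<lambda>z. slice X PP (\<omega> \<bowtie> h) (assoc_left k G D X (tmap k G (tensor k D X) id \<beta> z)))"
      by (rule v mX \<beta> lin)+
    show "linear_map k (tensor k G X) X (\<lambda>z. slice X evH h (\<beta> (slice X evG \<omega> z)))"
      by (rule wh mX cl lin)+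
    fix g y assume gy: "g \<in> carrier G" "y \<in> carrier X"
    note By = linear_closed[OF \<beta> gy(2)]
    have lv: "linear_map k (tensor k T X) X (slice X PP (\<omega> \<bowtie> h))" by (rule v mX lin)+
    have c: "evG \<omega> g \<in> carrier k" by (rule wh gy lin)+
    have "slice X PP (\<omega> \<bowtie> h) (sweedler (tensor k T X) (\<beta> y) (\<lambda>\<theta> y'. tens k T X (tens k G D g \<theta>) y')) =
        sweedler X (\<beta> y) (\<lambda>\<theta> y'. evG \<omega> g \<odot>\<^bsub>X\<^esub> (ev \<theta> h \<odot>\<^bsub>X\<^esub> y'))"
    proof (rule sweedler_push[OF lv By])
      fix \<theta> y' assume ty: "\<theta> \<in> carrier D" "y' \<in> carrier X"
      have t: "tens k G D g \<theta> \<in> carrier T" and c': "ev \<theta> h \<in> carrier k" by (rule gy wh ty lin)+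
      show "slice X PP (\<omega> \<bowtie> h) (tens k T X (tens k G D g \<theta>) y') = evG \<omega> g \<odot>\<^bsub>X\<^esub> (ev \<theta> h \<odot>\<^bsub>X\<^esub> y')"
        using c c' by (simp add: VV.slice_tens[OF v t ty(2) mX] TV.pair_tensor_tens wh gy ty X.smult_assoc1)
    qed (rule gy mX lin | assumption)+
    also have "\<dots> = evG \<omega> g \<odot>\<^bsub>X\<^esub> slice X evH h (\<beta> y)"
      unfolding slice_def by (rule sweedler_fun_smult[OF By]; (rule c wh mX lin | assumption)+)
    also have "\<dots> = slice X evH h (\<beta> (evG \<omega> g \<odot>\<^bsub>X\<^esub> y))"
    proof -
      have "linear_map k X X (\<lambda>y. slice X evH h (\<beta> y))" by (rule wh mX cl lin)+
      from linear_smult[OF this c gy(2)] show ?thesis by simp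
    qed
    finally show "slice X PP (\<omega> \<bowtie> h) (assoc_left k G D X (tmap k G (tensor k D X) id \<beta> (tens k G X g y))) =
        slice X evH h (\<beta> (slice X evG \<omega> (tens k G X g y)))"
      using gy By by (simp add: tmap_tens[OF _ _ lin_idf \<beta> GD.mK mX GD.mK mDX] assoc_left_tens
          GD.mK HD.mV mX GD.slice_tens wh)
  qed
  show ?thesis
  proof (rule linear_ext[OF _ _ _ d GD.mV mH])
    show "linear_map k V X (\<lambda>d. slice X PP d (coact_twice k H X \<alpha> \<beta> x))"
      by (rule cx mX lin)+
    show "linear_map k V X (\<lambda>d. sweedler X d (\<lambda>\<omega> h. slice X evH h (\<beta> (slice X evG \<omega> (\<alpha> x)))))"
      by (rule b mX lin)+
    fix \<omega> h assume wh: "\<omega> \<in> carrier D'" "h \<in> carrier H"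
    show "slice X PP (\<omega> \<bowtie> h) (coact_twice k H X \<alpha> \<beta> x) =
        sweedler X (\<omega> \<bowtie> h) (\<lambda>\<omega> h. slice X evH h (\<beta> (slice X evG \<omega> (\<alpha> x))))"
      using pure[OF wh ax] x by (simp add: sweedler_tens[OF wh b GD.mV mH mX] coact_twice_def)
  qed
qed

text \<open>
  Pairing undoes the flip, and \<open>Ad(U)\<close> is moved to the other side of the pairing.
\<close>

lemma slice_twisted:
  assumes X: "module k X" and wh: "\<omega> \<in> carrier D'" "h \<in> carrier H" and z: "z \<in> carrier (tensor k T X)"
  shows "slice X evG \<omega> (slice (tensor k G X) evH h (assoc_right k D G X
      (tmap k (tensor k D G) X (tflip k G D) id (tmap k T X (Ad_U k H) id z)))) =
    slice X PP (At (\<omega> \<bowtie> h)) z"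
proof (rule linear_ext[OF _ _ _ z VV.mK X])
  interpret X: module k X by (rule X)
  have v: "\<omega> \<bowtie> h \<in> carrier V" and Av: "At (\<omega> \<bowtie> h) \<in> carrier V" by (rule wh lin)+
  have fl: "linear_map k T (tensor k D G) (tflip k G D)" by (rule lin)+
  have mGX: "module k (tensor k G X)" and mDG: "module k (tensor k D G)" by (rule X lin)+
  show "linear_map k (tensor k T X) X (\<lambda>z. slice X evG \<omega> (slice (tensor k G X) evH h (assoc_right k D G X
      (tmap k (tensor k D G) X (tflip k G D) id (tmap k T X (Ad_U k H) id z)))))"
    by (rule wh X fl Ad_U_linear lin)+
  show "linear_map k (tensor k T X) X (slice X PP (At (\<omega> \<bowtie> h)))"
    by (rule Av X lin)+
  fix t y assume ty: "t \<in> carrier T" "y \<in> carrier X"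
  \<comment> \<open>The values of \<open>Ad(U)\<close> are rarely pure tensors; so the flip is treated for arbitrary \<open>u\<close>.\<close>
  have flip: "slice X evG \<omega> (slice (tensor k G X) evH h (assoc_right k D G X
      (tens k (tensor k D G) X (tflip k G D u) y))) = PP (\<omega> \<bowtie> h) u \<odot>\<^bsub>X\<^esub> y"
    if u: "u \<in> carrier T" for u
  proof (rule linear_ext[OF _ _ _ u GD.mK HD.mV])
    show "linear_map k T X (\<lambda>u. slice X evG \<omega> (slice (tensor k G X) evH h (assoc_right k D G X
        (tens k (tensor k D G) X (tflip k G D u) y))))" by (rule wh X ty lin)+
    show "linear_map k T X (\<lambda>u. PP (\<omega> \<bowtie> h) u \<odot>\<^bsub>X\<^esub> y)" by (rule v X ty lin)+
    fix g \<theta> assume gt: "g \<in> carrier G" "\<theta> \<in> carrier D"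
    have b: "bilin k D G (tensor k D (tensor k G X)) (\<lambda>a b. tens k D (tensor k G X) a (tens k G X b y))"
      by (rule ty X lin | assumption)+
    have dg: "tens k D G \<theta> g \<in> carrier (tensor k D G)" and gy: "tens k G X g y \<in> carrier (tensor k G X)"
      by (rule gt X ty lin)+
    have c: "ev \<theta> h \<in> carrier k" "evG \<omega> g \<in> carrier k" by (rule gt wh lin)+
    have m3: "module k (tensor k D (tensor k G X))" by (rule X lin)+
    have "assoc_right k D G X (tens k (tensor k D G) X (tflip k G D (tens k G D g \<theta>)) y) =
        tens k D (tensor k G X) \<theta> (tens k G X g y)"
      using gt ty dg by (simp add: tflip_tens GD.mK HD.mV assoc_right_tens X sweedler_tens[OF _ _ b HD.mV GD.mK m3])
    moreover have "slice X evG \<omega> (ev \<theta> h \<odot>\<^bsub>tensor k G X\<^esub> tens k G X g y) = ev \<theta> h \<odot>\<^bsub>X\<^esub> (evG \<omega> g \<odot>\<^bsub>X\<^esub> y)"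
    proof -
      have "linear_map k (tensor k G X) X (slice X evG \<omega>)" by (rule wh X lin)+
      from linear_smult[OF this c(1) gy] show ?thesis using wh gt ty by (simp add: GD.slice_tens X)
    qed
    ultimately show "slice X evG \<omega> (slice (tensor k G X) evH h (assoc_right k D G X
        (tens k (tensor k D G) X (tflip k G D (tens k G D g \<theta>)) y))) =
        PP (\<omega> \<bowtie> h) (tens k G D g \<theta>) \<odot>\<^bsub>X\<^esub> y"
      using gt wh ty gy c
      by (simp add: DH.slice_tens[OF _ _ _ mGX] TV.pair_tensor_tens X.smult_assoc1[symmetric] X.R.m_comm)
  qed
  have At: "Ad_U k H t \<in> carrier T" by (rule ty lin)+
  have "tmap k (tensor k D G) X (tflip k G D) id (tmap k T X (Ad_U k H) id (tens k T X t y)) =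
      tens k (tensor k D G) X (tflip k G D (Ad_U k H t)) y"
    using ty At by (simp add: tmap_tens[OF _ _ Ad_U_linear lin_idf VV.mK X VV.mK X]
        tmap_tens[OF _ _ fl lin_idf VV.mK X mDG X])
  then show "slice X evG \<omega> (slice (tensor k G X) evH h (assoc_right k D G X
      (tmap k (tensor k D G) X (tflip k G D) id (tmap k T X (Ad_U k H) id (tens k T X t y))))) =
      slice X PP (At (\<omega> \<bowtie> h)) (tens k T X t y)"
    by (simp add: flip At VV.slice_tens[OF Av ty X] PP_At[OF v ty(1)])
qed

text \<open>
  Both sides of the condition live in \<open>D \<otimes> (G \<otimes> X)\<close> and are determined by their slices along \<open>h\<close> and
  then \<open>\<omega>\<close>.
\<close>

lemma ll_condition_iff:
  assumes X: "k_algebra k X" and \<alpha>: "linear_map k X (tensor k G X) \<alpha>" and \<beta>: "linear_map k X (tensor k D X) \<beta>"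
  shows "yd_ll_condition k H X \<alpha> \<beta> \<longleftrightarrow>
    yd_condition X (induced_action D' evG X \<alpha>) (induced_action H evH X \<beta>)"
proof -
  note mX = k_algebra_module[OF X]
  let ?\<rho> = "induced_action D' evG X \<alpha>" and ?act = "induced_action H evH X \<beta>"
  let ?L = "\<lambda>x. tmap k D (tensor k G X) id \<alpha> (\<beta> x)"
  let ?R = "\<lambda>x. assoc_right k D G X (tmap k (tensor k D G) X (tflip k G D) id
      (tmap k T X (Ad_U k H) id (coact_twice k H X \<alpha> \<beta> x)))"
  have mGX: "module k (tensor k G X)" by (rule mX lin)+
  have fl: "linear_map k T (tensor k D G) (tflip k G D)" by (rule lin)+
  have "?L x = ?R x \<longleftrightarrow> (\<forall>h\<in>carrier H. \<forall>\<omega>\<in>carrier D'.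
      ?\<rho> (?act x h) \<omega> = dot X ?\<rho> ?act x (At (\<omega> \<bowtie> h)))" if x: "x \<in> carrier X" for x
  proof -
    note bx = linear_closed[OF \<beta> x]
    note cx = linear_closed[OF coact_twice_linear[OF X \<alpha> \<beta>] x]
    have L: "?L x \<in> carrier (tensor k D (tensor k G X))" by (rule bx \<alpha> mX lin)+
    have R: "?R x \<in> carrier (tensor k D (tensor k G X))" by (rule cx fl Ad_U_linear mX lin)+
    have 1: "slice X evG \<omega> (slice (tensor k G X) evH h (?L x)) = ?\<rho> (?act x h) \<omega>"
      if "\<omega> \<in> carrier D'" "h \<in> carrier H" for \<omega> h
    proof -
      have "slice X evH h (\<beta> x) \<in> carrier X" by (rule that bx mX lin)+
      then show ?thesis
        using that x by (simp add: DH.slice_tmap[OF \<alpha> bx that(2) mX mGX] DH.induced_action_slice GD.induced_action_slice)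
    qed
    have 2: "slice X evG \<omega> (slice (tensor k G X) evH h (?R x)) = dot X ?\<rho> ?act x (At (\<omega> \<bowtie> h))"
      if wh: "\<omega> \<in> carrier D'" "h \<in> carrier H" for \<omega> h
    proof -
      have Av: "At (\<omega> \<bowtie> h) \<in> carrier V" by (rule wh lin)+
      have "slice X evG \<omega> (slice (tensor k G X) evH h (?R x)) =
          sweedler X (At (\<omega> \<bowtie> h)) (\<lambda>\<omega> h. slice X evH h (\<beta> (slice X evG \<omega> (\<alpha> x))))"
        by (simp add: slice_twisted[OF mX wh cx] slice_coact_twice[OF X \<alpha> \<beta> Av x])
      also have "\<dots> = dot X ?\<rho> ?act x (At (\<omega> \<bowtie> h))"
        unfolding dot_def
      proof (rule sweedler_cong[OF GD.mV mH Av])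
        fix \<omega> h assume 3: "\<omega> \<in> carrier D'" "h \<in> carrier H"
        have "slice X evG \<omega> (\<alpha> x) \<in> carrier X" by (rule 3 linear_closed[OF \<alpha> x] mX lin)+
        then show "slice X evH h (\<beta> (slice X evG \<omega> (\<alpha> x))) = ?act (?\<rho> x \<omega>) h"
          using 3 x by (simp add: DH.induced_action_slice GD.induced_action_slice)
      qed
      finally show ?thesis .
    qed
    have "?L x = ?R x \<longleftrightarrow> (\<forall>h\<in>carrier H. \<forall>\<omega>\<in>carrier D'.
        slice X evG \<omega> (slice (tensor k G X) evH h (?L x)) = slice X evG \<omega> (slice (tensor k G X) evH h (?R x)))"
      unfolding DH.slice_eq_iff[OF L R mGX]
      by (intro ball_cong HOL.refl GD.slice_eq_iff DH.slice_closed L R mX mGX)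
    then show ?thesis by (simp add: 1 2)
  qed
  then show ?thesis by (simp add: yd_ll_condition_def yd_condition_def Let_def)
qed

lemma dot_bilin:
  assumes X: "k_algebra k X" and \<rho>: "right_action k D' X \<rho>" and act: "right_action k H X act"
    and x: "x \<in> carrier X"
  shows "bilin k D' H X (\<lambda>\<omega> h. act (\<rho> x \<omega>) h)"
proof (rule bilinI)
  note r = right_actionD[OF \<rho>] and a = right_actionD[OF act]
  show "linear_map k H X (\<lambda>h. act (\<rho> x \<omega>) h)" if "\<omega> \<in> carrier D'" for \<omega>
    by (rule a(1)[OF r(9)[OF x that]])
  show "linear_map k D' X (\<lambda>\<omega>. act (\<rho> x \<omega>) h)" if "h \<in> carrier H" for h
    by (rule lin_comp[OF a(2)[OF that] r(1)[OF x]])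
qed

lemma dot_linear:
  assumes X: "k_algebra k X" and \<rho>: "right_action k D' X \<rho>" and act: "right_action k H X act"
  shows "x \<in> carrier X \<Longrightarrow> linear_map k V X (dot X \<rho> act x)"
    and "d \<in> carrier V \<Longrightarrow> linear_map k X X (\<lambda>x. dot X \<rho> act x d)"
proof -
  note mX = k_algebra_module[OF X]
  note b = dot_bilin[OF assms]
  note r = right_actionD[OF \<rho>] and a = right_actionD[OF act]
  show "x \<in> carrier X \<Longrightarrow> linear_map k V X (dot X \<rho> act x)"
    unfolding dot_def[abs_def] by (rule b mX lin | assumption)+
  show "d \<in> carrier V \<Longrightarrow> linear_map k X X (\<lambda>x. dot X \<rho> act x d)"
    unfolding dot_def by (rule lin_comp[OF a(2)] r(2) b mX lin | assumption)+
qed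

lemma dot_tens:
  assumes "k_algebra k X" "right_action k D' X \<rho>" "right_action k H X act" "x \<in> carrier X"
    "\<omega> \<in> carrier D'" "h \<in> carrier H"
  shows "dot X \<rho> act x (\<omega> \<bowtie> h) = act (\<rho> x \<omega>) h"
  unfolding dot_def
  by (rule sweedler_tens[OF assms(5,6) dot_bilin[OF assms(1-4)] GD.mV mH k_algebra_module[OF assms(1)]])

text \<open>
  Slicing the two sides along \<open>\<omega>\<close> gives \<open>x \<cdot> LU(\<omega> \<bowtie> h)\<close> and \<open>E x (RU (\<omega> \<bowtie> h))\<close>, where \<open>E x\<close> extends
  \<open>\<omega> \<bowtie> h \<mapsto> \<rho>(x \<lhd> h, \<omega>)\<close> linearly.  Since \<open>LU = At \<circ> RU\<close> and \<open>RU\<close> is onto, they agree for all \<open>\<omega>\<close> and \<open>h\<close> if and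
  only if \<open>E x = x \<cdot> At(_)\<close>.
\<close>

lemma lr_condition_iff:
  assumes X: "k_algebra k X" and \<alpha>: "linear_map k X (tensor k G X) \<alpha>"
    and \<rho>: "right_action k D' X (induced_action D' evG X \<alpha>)" and act: "right_action k H X act"
  shows "yd_lr_condition k H X act \<alpha> \<longleftrightarrow> yd_condition X (induced_action D' evG X \<alpha>) act"
proof -
  note mX = k_algebra_module[OF X]
  let ?\<rho> = "induced_action D' evG X \<alpha>"
  let ?GX = "tensor k G X"
  note r = right_actionD[OF \<rho>] and a = right_actionD[OF act]
  have rs: "?\<rho> x \<omega> = slice X evG \<omega> (\<alpha> x)" if "x \<in> carrier X" "\<omega> \<in> carrier D'" for x \<omega>
    using that by (rule GD.induced_action_slice)
  note al = linear_closed[OF \<alpha>] lin_comp[OF \<alpha>] a(9) lin_comp[OF a(1)] lin_comp[OF a(2)]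
    lin_mult_left[OF id_HG[OF lin_id]] lin_mult_right[OF id_HG[OF lin_id]]
  \<comment> \<open>The condition compares elements of \<open>H \<otimes> X\<close>; as a space this is \<open>G \<otimes> X\<close>, where slices along \<open>\<omega>\<close> are available.\<close>
  have sHX: "same_space (tensor k H X) ?GX" by (rule tensor_same_space[OF same_space_opp same_space_refl])
  let ?l = "\<lambda>x h. sweedler ?GX (\<alpha> x) (\<lambda>g y. sweedler ?GX (comult H h) (\<lambda>h1 h2.
      tens k G X (h1 \<otimes>\<^bsub>G\<^esub> g) (act y h2)))"
  let ?r = "\<lambda>x h. sweedler ?GX (comult H h) (\<lambda>h1 h2. sweedler ?GX (\<alpha> (act x h1)) (\<lambda>g y.
      tens k G X (g \<otimes>\<^bsub>G\<^esub> h2) y))"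
  have sw: "sweedler (tensor k H X) z f = sweedler ?GX z f"
    for z :: "('z, 'y) tens" and f by (rule sweedler_same_space[OF sHX])
  have tH: "tens k H X = tens k G X" by (rule tens_same_space[OF same_space_opp same_space_refl])
  have lr: "yd_lr_condition k H X act \<alpha> \<longleftrightarrow> (\<forall>x\<in>carrier X. \<forall>h\<in>carrier H. ?l x h = ?r x h)"
    unfolding yd_lr_condition_def Let_def by (simp only: opp_simps(8) sw tH)
  \<comment> \<open>A linear extension is needed because \<open>E x\<close> is evaluated at \<open>RU (\<omega> \<bowtie> h)\<close>, which is rarely a pure tensor.\<close>
  define E where "E x d = sweedler X d (\<lambda>\<omega> h. ?\<rho> (act x h) \<omega>)" for x d
  have E_bilin: "bilin k D' H X (\<lambda>\<omega> h. ?\<rho> (act x h) \<omega>)" if "x \<in> carrier X" for x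
  proof (rule bilinI)
    show "linear_map k H X (\<lambda>h. ?\<rho> (act x h) \<omega>)" if "\<omega> \<in> carrier D'" for \<omega>
      by (rule lin_comp[OF r(2)[OF that] a(1)[OF \<open>x \<in> carrier X\<close>]])
    show "linear_map k D' X (\<lambda>\<omega>. ?\<rho> (act x h) \<omega>)" if "h \<in> carrier H" for h
      by (rule r(1)[OF a(9)[OF \<open>x \<in> carrier X\<close> that]])
  qed
  have E_linear: "linear_map k V X (E x)" if "x \<in> carrier X" for x
    unfolding E_def[abs_def] by (rule that E_bilin mX lin)+
  note D_linear = dot_linear(1)[OF X \<rho> act]
  have left: "slice X evG \<omega> (?l x h) = dot X ?\<rho> act x (LU (\<omega> \<bowtie> h))"
    if x: "x \<in> carrier X" and h: "h \<in> carrier H" and \<omega>: "\<omega> \<in> carrier D'" for x h \<omega>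
  proof -
    note ax = linear_closed[OF \<alpha> x] and ch = comult_H_closed[OF h]
    have ls: "linear_map k ?GX X (slice X evG \<omega>)" by (rule \<omega> mX lin)+
    have "slice X evG \<omega> (?l x h) = sweedler X (\<alpha> x) (\<lambda>g y. sweedler X (comult H h) (\<lambda>h1 h2.
        evG \<omega> (h1 \<otimes>\<^bsub>G\<^esub> g) \<odot>\<^bsub>X\<^esub> act y h2))"
    proof (rule sweedler_push[OF ls ax])
      fix g y assume 1: "g \<in> carrier G" "y \<in> carrier X"
      show "slice X evG \<omega> (sweedler ?GX (comult H h) (\<lambda>h1 h2. tens k G X (h1 \<otimes>\<^bsub>G\<^esub> g) (act y h2))) =
          sweedler X (comult H h) (\<lambda>h1 h2. evG \<omega> (h1 \<otimes>\<^bsub>G\<^esub> g) \<odot>\<^bsub>X\<^esub> act y h2)"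
        by (rule sweedler_push[OF ls ch];
            (rule GD.slice_tens \<omega> al 1 mX lin | assumption | (rule carrier_G, assumption))+)
    qed (rule al h mX lin | assumption | (rule carrier_G, assumption))+
    also have "\<dots> = sweedler X (comult H h) (\<lambda>h1 h2. sweedler X (\<alpha> x) (\<lambda>g y.
        evG \<omega> (h1 \<otimes>\<^bsub>G\<^esub> g) \<odot>\<^bsub>X\<^esub> act y h2))"
      by (rule sweedler_swap[OF ax ch]; (rule \<omega> al mX lin | assumption | (rule carrier_G, assumption))+)
    also have "\<dots> = sweedler X (comult H h) (\<lambda>h1 h2. dot X ?\<rho> act x (ract \<omega> h1 \<bowtie> h2))"
    proof (rule sweedler_cong[OF mH mH ch])
      fix h1 h2 assume 1: "h1 \<in> carrier H" "h2 \<in> carrier H"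
      note rc = ract_closed[OF \<omega> 1(1)]
      have la: "linear_map k X X (\<lambda>y. act y h2)" by (rule a(2)[OF 1(2)])
      have "dot X ?\<rho> act x (ract \<omega> h1 \<bowtie> h2) = act (sweedler X (\<alpha> x) (\<lambda>g y. evG (ract \<omega> h1) g \<odot>\<^bsub>X\<^esub> y)) h2"
        unfolding dot_tens[OF X \<rho> act x rc 1(2)] rs[OF x rc] slice_def ..
      also have "\<dots> = sweedler X (\<alpha> x) (\<lambda>g y. evG \<omega> (h1 \<otimes>\<^bsub>G\<^esub> g) \<odot>\<^bsub>X\<^esub> act y h2)"
        by (rule sweedler_push[OF la ax])
          ((rule rc mX lin | assumption)+, simp add: linear_smult[OF la] GD.P_closed[OF rc] evG_ract[symmetric])
      finally show "sweedler X (\<alpha> x) (\<lambda>g y. evG \<omega> (h1 \<otimes>\<^bsub>G\<^esub> g) \<odot>\<^bsub>X\<^esub> act y h2) =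
          dot X ?\<rho> act x (ract \<omega> h1 \<bowtie> h2)" by simp
    qed
    also have "\<dots> = dot X ?\<rho> act x (LU (\<omega> \<bowtie> h))"
      unfolding LU_tens[OF \<omega> h]
      by (rule sweedler_linear[OF D_linear[OF x] ch, symmetric]; (rule \<omega> mX lin | assumption)+)
    finally show ?thesis .
  qed
  have right: "slice X evG \<omega> (?r x h) = E x (RU (\<omega> \<bowtie> h))"
    if x: "x \<in> carrier X" and h: "h \<in> carrier H" and \<omega>: "\<omega> \<in> carrier D'" for x h \<omega>
  proof -
    note ch = comult_H_closed[OF h]
    have ls: "linear_map k ?GX X (slice X evG \<omega>)" by (rule \<omega> mX lin)+
    have "slice X evG \<omega> (?r x h) = sweedler X (comult H h) (\<lambda>h1 h2. E x (lact \<omega> h2 \<bowtie> h1))"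
    proof (rule sweedler_push[OF ls ch])
      fix h1 h2 assume 1: "h1 \<in> carrier H" "h2 \<in> carrier H"
      note lc = lact_closed[OF \<omega> 1(2)] and ac = a(9)[OF x 1(1)]
      note aa = linear_closed[OF \<alpha> ac]
      have "slice X evG \<omega> (sweedler ?GX (\<alpha> (act x h1)) (\<lambda>g y. tens k G X (g \<otimes>\<^bsub>G\<^esub> h2) y)) =
          sweedler X (\<alpha> (act x h1)) (\<lambda>g y. evG (lact \<omega> h2) g \<odot>\<^bsub>X\<^esub> y)"
      proof (rule sweedler_push[OF ls aa])
        fix g y assume gy: "g \<in> carrier G" "y \<in> carrier X"
        have "g \<otimes>\<^bsub>G\<^esub> h2 \<in> carrier G" by (rule gy 1 lin | (rule carrier_G, rule 1))+
        then show "slice X evG \<omega> (tens k G X (g \<otimes>\<^bsub>G\<^esub> h2) y) = evG (lact \<omega> h2) g \<odot>\<^bsub>X\<^esub> y"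
          using gy \<omega> mX by (simp add: GD.slice_tens evG_lact)
      qed (rule carrier_G[OF 1(2)] mX lin | assumption)+
      also have "\<dots> = E x (lact \<omega> h2 \<bowtie> h1)"
        unfolding E_def sweedler_tens[OF lc 1(1) E_bilin[OF x] GD.mV mH mX] rs[OF ac lc] slice_def ..
      finally show "slice X evG \<omega> (sweedler ?GX (\<alpha> (act x h1)) (\<lambda>g y. tens k G X (g \<otimes>\<^bsub>G\<^esub> h2) y)) =
          E x (lact \<omega> h2 \<bowtie> h1)" .
    qed (rule a(1) al x mX lin | assumption | (rule carrier_G, assumption))+
    also have "\<dots> = E x (RU (\<omega> \<bowtie> h))"
      unfolding RU_tens[OF \<omega> h]
      by (rule sweedler_linear[OF E_linear[OF x] ch, symmetric]; (rule \<omega> mX lin | assumption)+)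
    finally show ?thesis .
  qed
  have eq1: "?l x h = ?r x h \<longleftrightarrow> (\<forall>\<omega>\<in>carrier D'.
      dot X ?\<rho> act x (LU (\<omega> \<bowtie> h)) = E x (RU (\<omega> \<bowtie> h)))"
    if x: "x \<in> carrier X" and h: "h \<in> carrier H" for x h
  proof -
    have l: "?l x h \<in> carrier ?GX" by (rule al x h mX lin | assumption | (rule carrier_G, assumption))+
    have r: "?r x h \<in> carrier ?GX" by (rule a(1) al x h mX lin | assumption | (rule carrier_G, assumption))+
    show ?thesis unfolding GD.slice_eq_iff[OF l r mX] by (simp add: left[OF x h] right[OF x h])
  qed
  have eq2: "(\<forall>h\<in>carrier H. \<forall>\<omega>\<in>carrier D'. dot X ?\<rho> act x (LU (\<omega> \<bowtie> h)) = E x (RU (\<omega> \<bowtie> h)))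
      \<longleftrightarrow> (\<forall>h\<in>carrier H. \<forall>\<omega>\<in>carrier D'. ?\<rho> (act x h) \<omega> = dot X ?\<rho> act x (At (\<omega> \<bowtie> h)))"
    (is "?a \<longleftrightarrow> ?b") if x: "x \<in> carrier X" for x
  proof -
    have E_tens: "E x (\<omega> \<bowtie> h) = ?\<rho> (act x h) \<omega>" if "\<omega> \<in> carrier D'" "h \<in> carrier H" for \<omega> h
      unfolding E_def by (rule sweedler_tens[OF that E_bilin[OF x] GD.mV mH mX])
    have l1: "linear_map k V X (\<lambda>d. dot X ?\<rho> act x (LU d))" by (rule lin_comp[OF D_linear[OF x] LU_linear])
    have l2: "linear_map k V X (\<lambda>d. E x (RU d))" by (rule lin_comp[OF E_linear[OF x] RU_linear])
    have l3: "linear_map k V X (\<lambda>d. dot X ?\<rho> act x (At d))" by (rule lin_comp[OF D_linear[OF x] At_linear])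
    have "?a \<longleftrightarrow> (\<forall>d\<in>carrier V. dot X ?\<rho> act x (LU d) = E x (RU d))"
      using linear_ext[OF l1 l2 _ _ GD.mV mH] tens_closed[OF GD.mV mH] by blast
    also have "\<dots> \<longleftrightarrow> (\<forall>d\<in>carrier V. dot X ?\<rho> act x (At (RU d)) = E x (RU d))"
      by (simp add: At_RU)
    also have "\<dots> \<longleftrightarrow> (\<forall>d\<in>carrier V. dot X ?\<rho> act x (At d) = E x d)"
      using RU_surj linear_closed[OF RU_linear] by metis
    also have "\<dots> \<longleftrightarrow> (\<forall>h\<in>carrier H. \<forall>\<omega>\<in>carrier D'. dot X ?\<rho> act x (At (\<omega> \<bowtie> h)) = E x (\<omega> \<bowtie> h))"
      using linear_ext[OF l3 E_linear[OF x] _ _ GD.mV mH] tens_closed[OF GD.mV mH] by blast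
    also have "\<dots> \<longleftrightarrow> ?b" by (auto simp: E_tens)
    finally show ?thesis .
  qed
  show ?thesis unfolding lr yd_condition_def using eq1 eq2 by simp
qed

end

section \<open>Actions of the double\<close>

lemma right_actionI:
  assumes "act \<in> extensional (carrier X)"
    and "\<And>x. x \<in> carrier X \<Longrightarrow> act x \<in> extensional (carrier K)"
    and "\<And>x. x \<in> carrier X \<Longrightarrow> linear_map k K X (act x)"
    and "\<And>a. a \<in> carrier K \<Longrightarrow> linear_map k X X (\<lambda>x. act x a)"
    and "\<And>x. x \<in> carrier X \<Longrightarrow> act x \<one>\<^bsub>K\<^esub> = x"
    and "\<And>x a b. x \<in> carrier X \<Longrightarrow> a \<in> carrier K \<Longrightarrow> b \<in> carrier K \<Longrightarrow>
      act x (a \<otimes>\<^bsub>K\<^esub> b) = act (act x a) b"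
    and "\<And>a. a \<in> carrier K \<Longrightarrow> act \<one>\<^bsub>X\<^esub> a = counit K a \<odot>\<^bsub>X\<^esub> \<one>\<^bsub>X\<^esub>"
    and "\<And>x y a. x \<in> carrier X \<Longrightarrow> y \<in> carrier X \<Longrightarrow> a \<in> carrier K \<Longrightarrow>
      act (x \<otimes>\<^bsub>X\<^esub> y) a = sweedler X (comult K a) (\<lambda>a1 a2. act x a1 \<otimes>\<^bsub>X\<^esub> act y a2)"
  shows "right_action k K X act"
  using assms by (simp add: right_action_def)

context fd_hopf
begin

definition dot_action ::
  "('k, 'x) module \<Rightarrow> ('x \<Rightarrow> ('h \<Rightarrow> 'k) \<Rightarrow> 'x) \<Rightarrow> ('x \<Rightarrow> 'h \<Rightarrow> 'x) \<Rightarrow> 'x \<Rightarrow> ('h \<Rightarrow> 'k, 'h) tens \<Rightarrow> 'x" where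
  "dot_action X \<rho> act = (\<lambda>x\<in>carrier X. \<lambda>d\<in>carrier Vd. dot X \<rho> act x d)"

lemma Vd_linear: "linear_map k Vd A f \<longleftrightarrow> linear_map k V A f"
  using linear_same_space[OF same_Vd same_space_refl] by blast

lemma Vd_linear2: "linear_map k A Vd f \<longleftrightarrow> linear_map k A V f"
  using linear_same_space[OF same_space_refl same_Vd] by blast

lemma lin_mult_double_left: "w \<in> carrier V \<Longrightarrow> linear_map k V V (\<lambda>v. v \<otimes>\<^bsub>Vd\<^esub> w)"
  and lin_mult_double_right: "v \<in> carrier V \<Longrightarrow> linear_map k V V (\<lambda>w. v \<otimes>\<^bsub>Vd\<^esub> w)"
  using DB.lin_mult_V_left DB.lin_mult_V_right by (simp_all add: Vd_linear Vd_linear2 cVd)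

lemma lin_comult_double: "linear_map k V (tensor k V V) (comult Vd)"
  using DB.comult_V_linear linear_same_space[OF same_Vd tensor_same_space[OF same_Vd same_Vd]] by blast

lemma lin_counit_double: "linear_map k V (kmod k) (counit Vd)"
  using DB.counit_V_linear by (simp add: Vd_linear)

text \<open>
  By \<open>mult_double\<close>, acting with \<open>(\<omega> \<bowtie> h)(\<omega>' \<bowtie> h')\<close> is acting with \<open>\<omega>\<close>, then \<open>At(\<omega>' \<bowtie> h)\<close>, then \<open>h'\<close>; the
  Yetter-Drinfeld condition replaces the middle step by \<open>h\<close> followed by \<open>\<omega>'\<close>.  The other clauses
  hold because unit, coproduct and counit of the double are those of a tensor product.
\<close>

lemma dot_action_right_action:
  assumes X: "k_algebra k X" and \<rho>: "right_action k D' X \<rho>" and act: "right_action k H X act"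
    and yd: "yd_condition X \<rho> act"
  shows "right_action k Vd X (dot_action X \<rho> act)"
proof -
  note mX = k_algebra_module[OF X]
  interpret X: k_algebra k X by (rule X)
  note r = right_actionD[OF \<rho>] and a = right_actionD[OF act]
  note dl = dot_linear[OF X \<rho> act] and dt = dot_tens[OF X \<rho> act]
  let ?dot = "dot X \<rho> act"
  have dc: "?dot x d \<in> carrier X" if "x \<in> carrier X" "d \<in> carrier V" for x d
    by (rule linear_closed[OF dl(1)[OF that(1)] that(2)])
  have da: "dot_action X \<rho> act x d = ?dot x d" if "x \<in> carrier X" "d \<in> carrier V" for x d
    using that by (simp add: dot_action_def cVd)
  have one: "?dot x \<one>\<^bsub>Vd\<^esub> = x" if x: "x \<in> carrier X" for x
  proof -
    interpret H: k_algebra k H by (rule algH)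
    show ?thesis unfolding one_double
      by (simp add: dt[OF x GD.one_V H.one_closed] r(3)[OF x] a(3)[OF x])
  qed
  have pure: "?dot x (\<omega> \<bowtie> h \<otimes>\<^bsub>Vd\<^esub> \<omega>' \<bowtie> h') = ?dot (?dot x (\<omega> \<bowtie> h)) (\<omega>' \<bowtie> h')"
    if x: "x \<in> carrier X" and as: "\<omega> \<in> carrier D'" "h \<in> carrier H" "\<omega>' \<in> carrier D'" "h' \<in> carrier H"
    for x \<omega> h \<omega>' h'
  proof -
    let ?d = "At (\<omega>' \<bowtie> h)"
    have d: "?d \<in> carrier V" by (rule as lin)+
    note xw = r(9)[OF x as(1)]
    have la: "linear_map k X X (\<lambda>x. act x h')" by (rule a(2)[OF as(4)])
    have "?dot x (\<omega> \<bowtie> h \<otimes>\<^bsub>Vd\<^esub> \<omega>' \<bowtie> h') =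
        sweedler X ?d (\<lambda>\<omega>2 h2. act (act (\<rho> (\<rho> x \<omega>) \<omega>2) h2) h')"
      unfolding mult_double[OF as]
    proof (rule sweedler_push[OF dl(1)[OF x] d])
      fix \<omega>2 h2 assume 2: "\<omega>2 \<in> carrier D'" "h2 \<in> carrier H"
      have c: "\<omega> \<otimes>\<^bsub>D'\<^esub> \<omega>2 \<in> carrier D'" "h2 \<otimes>\<^bsub>H\<^esub> h' \<in> carrier H" by (rule as 2 algH lin)+
      show "?dot x ((\<omega> \<otimes>\<^bsub>D'\<^esub> \<omega>2) \<bowtie> (h2 \<otimes>\<^bsub>H\<^esub> h')) = act (act (\<rho> (\<rho> x \<omega>) \<omega>2) h2) h'"
        by (simp add: dt[OF x c] r(4)[OF x as(1) 2(1)] a(4)[OF r(9)[OF xw 2(1)] 2(2) as(4)])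
    qed (rule as mX algH lin | assumption)+
    also have "\<dots> = act (?dot (\<rho> x \<omega>) ?d) h'"
      unfolding dot_def by (rule sweedler_linear[OF la d dot_bilin[OF X \<rho> act xw], symmetric]; (rule mX lin)+)
    also have "?dot (\<rho> x \<omega>) ?d = \<rho> (act (\<rho> x \<omega>) h) \<omega>'"
      using yd xw as by (simp add: yd_condition_def)
    finally show ?thesis
      by (simp add: dt[OF x as(1,2)] dt[OF a(9)[OF xw as(2)] as(3,4)])
  qed
  have mult: "?dot x (v \<otimes>\<^bsub>Vd\<^esub> w) = ?dot (?dot x v) w"
    if x: "x \<in> carrier X" and v: "v \<in> carrier V" and w: "w \<in> carrier V" for x v w
  proof (rule linear_ext[OF _ _ _ v GD.mV mH])
    show "linear_map k V X (\<lambda>v. ?dot x (v \<otimes>\<^bsub>Vd\<^esub> w))"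
      by (rule lin_comp[OF dl(1)[OF x] lin_mult_double_left[OF w]])
    show "linear_map k V X (\<lambda>v. ?dot (?dot x v) w)" by (rule lin_comp[OF dl(2)[OF w] dl(1)[OF x]])
    fix \<omega> h assume as: "\<omega> \<in> carrier D'" "h \<in> carrier H"
    have t: "\<omega> \<bowtie> h \<in> carrier V" by (rule as lin)+
    show "?dot x (\<omega> \<bowtie> h \<otimes>\<^bsub>Vd\<^esub> w) = ?dot (?dot x (\<omega> \<bowtie> h)) w"
    proof (rule linear_ext[OF _ _ _ w GD.mV mH])
      show "linear_map k V X (\<lambda>w. ?dot x (\<omega> \<bowtie> h \<otimes>\<^bsub>Vd\<^esub> w))"
        by (rule lin_comp[OF dl(1)[OF x] lin_mult_double_right[OF t]])
      show "linear_map k V X (?dot (?dot x (\<omega> \<bowtie> h)))" by (rule dl(1)[OF dc[OF x t]])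
    qed (rule pure[OF x as])
  qed
  have unit: "?dot \<one>\<^bsub>X\<^esub> d = counit Vd d \<odot>\<^bsub>X\<^esub> \<one>\<^bsub>X\<^esub>" if d: "d \<in> carrier V" for d
  proof (rule linear_ext[OF _ _ _ d GD.mV mH])
    show "linear_map k V X (?dot \<one>\<^bsub>X\<^esub>)" by (rule dl(1)) simp
    show "linear_map k V X (\<lambda>d. counit Vd d \<odot>\<^bsub>X\<^esub> \<one>\<^bsub>X\<^esub>)"
      by (rule lin_smult_left[OF lin_counit_double]) (simp_all add: mX)
    fix \<omega> h assume as: "\<omega> \<in> carrier D'" "h \<in> carrier H"
    note c = GD.counit_V_closed[OF as(1)] HD.counit_K_closed[OF as(2)]
    have "act (counit D' \<omega> \<odot>\<^bsub>X\<^esub> \<one>\<^bsub>X\<^esub>) h = counit D' \<omega> \<odot>\<^bsub>X\<^esub> act \<one>\<^bsub>X\<^esub> h"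
      by (rule linear_smult[OF a(2)[OF as(2)] c(1)]) simp
    then show "?dot \<one>\<^bsub>X\<^esub> (\<omega> \<bowtie> h) = counit Vd (\<omega> \<bowtie> h) \<odot>\<^bsub>X\<^esub> \<one>\<^bsub>X\<^esub>"
      using c as by (simp add: dt counit_double r(5) a(5) X.smult_assoc1)
  qed
  have prod: "?dot (x \<otimes>\<^bsub>X\<^esub> y) d = sweedler X (comult Vd d) (\<lambda>d1 d2. ?dot x d1 \<otimes>\<^bsub>X\<^esub> ?dot y d2)"
    if x: "x \<in> carrier X" and y: "y \<in> carrier X" and d: "d \<in> carrier V" for x y d
  proof (rule linear_ext[OF _ _ _ d GD.mV mH])
    have xy: "x \<otimes>\<^bsub>X\<^esub> y \<in> carrier X" using x y by simp
    have b: "bilin k V V X (\<lambda>d1 d2. ?dot x d1 \<otimes>\<^bsub>X\<^esub> ?dot y d2)"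
      by (rule bilinI lin_mult_left lin_mult_right dl x y dc X | assumption)+
    show "linear_map k V X (?dot (x \<otimes>\<^bsub>X\<^esub> y))" by (rule dl(1)[OF xy])
    show "linear_map k V X (\<lambda>d. sweedler X (comult Vd d) (\<lambda>d1 d2. ?dot x d1 \<otimes>\<^bsub>X\<^esub> ?dot y d2))"
      by (rule lin_sweedler_arg[OF lin_comult_double b VV.mV VV.mV mX])
    have ls: "linear_map k (tensor k V V) X (\<lambda>z. sweedler X z (\<lambda>d1 d2. ?dot x d1 \<otimes>\<^bsub>X\<^esub> ?dot y d2))"
      by (rule b mX lin)+
    fix \<omega> h assume as: "\<omega> \<in> carrier D'" "h \<in> carrier H"
    note cw = GD.comult_V[OF as(1)] and ch = comult_H_closed[OF as(2)]
    note rl = r(1) r(9) a(1) a(9) X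
    have la: "linear_map k X X (\<lambda>u. act u h)" by (rule a(2)[OF as(2)])
    let ?s = "\<lambda>z. sweedler X z (\<lambda>d1 d2. ?dot x d1 \<otimes>\<^bsub>X\<^esub> ?dot y d2)"
    have 1: "act (\<rho> x \<omega>1 \<otimes>\<^bsub>X\<^esub> \<rho> y \<omega>2) h =
        ?s (sweedler (tensor k V V) (comult H h) (\<lambda>h1 h2. tens k V V (\<omega>1 \<bowtie> h1) (\<omega>2 \<bowtie> h2)))"
      if 1: "\<omega>1 \<in> carrier D'" "\<omega>2 \<in> carrier D'" for \<omega>1 \<omega>2
      unfolding a(6)[OF r(9)[OF x 1(1)] r(9)[OF y 1(2)] as(2)]
    proof (rule HOL.sym, rule sweedler_push[OF ls ch])
      fix h1 h2 assume 2: "h1 \<in> carrier H" "h2 \<in> carrier H"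
      have t: "\<omega>1 \<bowtie> h1 \<in> carrier V" "\<omega>2 \<bowtie> h2 \<in> carrier V" by (rule 1 2 lin)+
      show "?s (tens k V V (\<omega>1 \<bowtie> h1) (\<omega>2 \<bowtie> h2)) = act (\<rho> x \<omega>1) h1 \<otimes>\<^bsub>X\<^esub> act (\<rho> y \<omega>2) h2"
        unfolding sweedler_tens[OF t b VV.mV VV.mV mX] by (simp add: dt x y 1 2)
    qed (rule 1 mX lin | assumption)+
    have "?dot (x \<otimes>\<^bsub>X\<^esub> y) (\<omega> \<bowtie> h) = act (sweedler X (comult D' \<omega>) (\<lambda>\<omega>1 \<omega>2. \<rho> x \<omega>1 \<otimes>\<^bsub>X\<^esub> \<rho> y \<omega>2)) h"
      by (simp add: dt[OF xy as] r(6)[OF x y as(1)])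
    also have "\<dots> = sweedler X (comult D' \<omega>) (\<lambda>\<omega>1 \<omega>2. ?s (sweedler (tensor k V V) (comult H h)
        (\<lambda>h1 h2. tens k V V (\<omega>1 \<bowtie> h1) (\<omega>2 \<bowtie> h2))))"
      by (rule sweedler_push[OF la cw]; (rule 1 x y rl mX lin | assumption)+)
    also have "\<dots> = ?s (comult Vd (\<omega> \<bowtie> h))"
      unfolding comult_double[OF as]
      by (rule sweedler_linear[OF ls cw, symmetric]; (rule as mX lin | assumption)+)
    finally show "?dot (x \<otimes>\<^bsub>X\<^esub> y) (\<omega> \<bowtie> h) = ?s (comult Vd (\<omega> \<bowtie> h))" .
  qed
  show ?thesis
  proof (rule right_actionI)
    show "dot_action X \<rho> act \<in> extensional (carrier X)" by (simp add: dot_action_def)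
    show "dot_action X \<rho> act x \<in> extensional (carrier Vd)" if "x \<in> carrier X" for x
      using that by (simp add: dot_action_def)
    show "linear_map k Vd X (dot_action X \<rho> act x)" if x: "x \<in> carrier X" for x
      unfolding Vd_linear by (rule linear_cong[OF dl(1)[OF x] VV.mV]) (simp add: da x)
    show "linear_map k X X (\<lambda>x. dot_action X \<rho> act x d)" if d: "d \<in> carrier Vd" for d
      by (rule linear_cong[OF dl(2) mX]) (use d in \<open>simp_all add: cVd da\<close>)
    show "dot_action X \<rho> act x \<one>\<^bsub>Vd\<^esub> = x" if "x \<in> carrier X" for x
      using that DB.one_V one by (simp add: da cVd)
    show "dot_action X \<rho> act x (v \<otimes>\<^bsub>Vd\<^esub> w) = dot_action X \<rho> act (dot_action X \<rho> act x v) w"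
      if "x \<in> carrier X" "v \<in> carrier Vd" "w \<in> carrier Vd" for x v w
      using that DB.mult_V[of v w] by (simp add: da cVd mult dc)
    show "dot_action X \<rho> act \<one>\<^bsub>X\<^esub> d = counit Vd d \<odot>\<^bsub>X\<^esub> \<one>\<^bsub>X\<^esub>" if "d \<in> carrier Vd" for d
      using that by (simp add: da cVd unit)
    show "dot_action X \<rho> act (x \<otimes>\<^bsub>X\<^esub> y) d =
        sweedler X (comult Vd d) (\<lambda>d1 d2. dot_action X \<rho> act x d1 \<otimes>\<^bsub>X\<^esub> dot_action X \<rho> act y d2)"
      if "x \<in> carrier X" "y \<in> carrier X" "d \<in> carrier Vd" for x y d
    proof -
      have d: "d \<in> carrier V" using that(3) by (simp add: cVd)
      have "sweedler X (comult Vd d) (\<lambda>d1 d2. ?dot x d1 \<otimes>\<^bsub>X\<^esub> ?dot y d2) =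
          sweedler X (comult Vd d) (\<lambda>d1 d2. dot_action X \<rho> act x d1 \<otimes>\<^bsub>X\<^esub> dot_action X \<rho> act y d2)"
        by (rule sweedler_cong[OF VV.mV VV.mV linear_closed[OF lin_comult_double d]]) (simp add: da that(1,2))
      then show ?thesis using that d by (simp add: da prod)
    qed
  qed
qed

text \<open>
Passing to the opposite product leaves the coproduct alone, so that the duals of \<open>H\<close> and of \<open>opp H\<close>
have the same product.
\<close>

lemma mult_D': "\<omega> \<in> carrier D' \<Longrightarrow> \<omega>' \<in> carrier D' \<Longrightarrow> \<omega> \<otimes>\<^bsub>D'\<^esub> \<omega>' = \<omega> \<otimes>\<^bsub>D\<^esub> \<omega>'"
  and one_D': "\<one>\<^bsub>D'\<^esub> = \<one>\<^bsub>D\<^esub>"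
proof -
  have c: "carrier D' = carrier D" using same_D by (simp add: same_space_def)
  have e: "evG = (ev :: ('h \<Rightarrow> 'k) \<Rightarrow> 'h \<Rightarrow> 'k)" by (simp add: fun_eq_iff evG_def ev_def)
  show "\<omega> \<otimes>\<^bsub>D'\<^esub> \<omega>' = \<omega> \<otimes>\<^bsub>D\<^esub> \<omega>'" if "\<omega> \<in> carrier D'" "\<omega>' \<in> carrier D'"
  proof (rule HD.pairing_eqI)
    show "\<omega> \<otimes>\<^bsub>D'\<^esub> \<omega>' \<in> carrier D" using GD.mult_V[OF that] c by simp
    show "\<omega> \<otimes>\<^bsub>D\<^esub> \<omega>' \<in> carrier D" using HD.mult_V that c by simp
    show "ev (\<omega> \<otimes>\<^bsub>D'\<^esub> \<omega>') h = ev (\<omega> \<otimes>\<^bsub>D\<^esub> \<omega>') h" if h: "h \<in> carrier H" for h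
      using GD.P_mult[OF \<open>\<omega> \<in> carrier D'\<close> \<open>\<omega>' \<in> carrier D'\<close>, of h] HD.P_mult[of \<omega> \<omega>' h] that \<open>\<omega> \<in> carrier D'\<close> \<open>\<omega>' \<in> carrier D'\<close>
      by (simp add: e c opp_simps)
  qed
  show "\<one>\<^bsub>D'\<^esub> = \<one>\<^bsub>D\<^esub>"
    by (rule HD.pairing_eqI)
      (use GD.one_V HD.one_V GD.P_one HD.P_one in \<open>simp_all add: c e, simp add: opp_simps\<close>)
qed

lemma unit_D': "\<omega> \<in> carrier D' \<Longrightarrow> \<one>\<^bsub>D'\<^esub> \<otimes>\<^bsub>D'\<^esub> \<omega> = \<omega>" "\<omega> \<in> carrier D' \<Longrightarrow> \<omega> \<otimes>\<^bsub>D'\<^esub> \<one>\<^bsub>D'\<^esub> = \<omega>"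
proof -
  interpret D: k_algebra k D by (rule alg_dual)
  have c: "carrier D' = carrier D" using same_D by (simp add: same_space_def)
  show "\<one>\<^bsub>D'\<^esub> \<otimes>\<^bsub>D'\<^esub> \<omega> = \<omega>" "\<omega> \<otimes>\<^bsub>D'\<^esub> \<one>\<^bsub>D'\<^esub> = \<omega>" if "\<omega> \<in> carrier D'"
    using that GD.one_V by (simp_all add: mult_D', simp_all add: one_D' c)
qed

lemma comult_one_D': "comult D' \<one>\<^bsub>D'\<^esub> = tens k D' D' \<one>\<^bsub>D'\<^esub> \<one>\<^bsub>D'\<^esub>"
proof -
  interpret G2: perfect2 k G D' evG U G D' evG U ..
  interpret G: k_algebra k G by (rule algG)
  interpret k: module k "kmod k" by (rule HD.mk)
  show ?thesis
  proof (rule G2.tensor_pairing_eqI[OF GD.comult_V[OF GD.one_V]])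
    show "tens k D' D' \<one>\<^bsub>D'\<^esub> \<one>\<^bsub>D'\<^esub> \<in> carrier (tensor k D' D')" by (rule lin)+
    fix a b assume ab: "a \<in> carrier G" "b \<in> carrier G"
    have bl: "bilin k D' D' (kmod k) (\<lambda>v w. evG v a \<cdot> evG w b)" by (rule ab lin | assumption)+
    have "counit G (a \<otimes>\<^bsub>G\<^esub> b) = counit G a \<cdot> counit G b"
      using ab HD.counit_K_closed by (simp add: opp_simps counit_mult G.R.m_comm)
    then show "ksw (comult D' \<one>\<^bsub>D'\<^esub>) (\<lambda>v w. evG v a \<cdot> evG w b) =
        ksw (tens k D' D' \<one>\<^bsub>D'\<^esub> \<one>\<^bsub>D'\<^esub>) (\<lambda>v w. evG v a \<cdot> evG w b)"
      unfolding sweedler_tens[OF GD.one_V GD.one_V bl GD.mV GD.mV HD.mk] GD.P_comult[OF GD.one_V ab, symmetric]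
      using ab by (simp add: GD.P_one)
  qed
qed

text \<open>
  Since \<open>At\<close> fixes \<open>\<omega> \<bowtie> 1\<close> and \<open>\<epsilon> \<bowtie> h\<close>, these elements multiply and comultiply as in \<open>D'\<close> and in \<open>H\<close>, so
  that an action of the double restricts to actions of both.  The products of the two kinds of elements
  in either order give the remaining two claims.
\<close>

lemma action_of_double:
  assumes X: "k_algebra k X" and act': "right_action k Vd X act'"
  defines "\<rho> \<equiv> \<lambda>x\<in>carrier X. \<lambda>\<omega>\<in>carrier D'. act' x (\<omega> \<bowtie> \<one>\<^bsub>H\<^esub>)"
    and "act \<equiv> \<lambda>x\<in>carrier X. \<lambda>h\<in>carrier H. act' x (\<one>\<^bsub>D'\<^esub> \<bowtie> h)"
  shows "right_action k D' X \<rho>" "right_action k H X act" "yd_condition X \<rho> act"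
    "dot_action X \<rho> act = act'"
proof -
  note mX = k_algebra_module[OF X]
  interpret X: k_algebra k X by (rule X)
  interpret H: k_algebra k H by (rule algH)
  interpret k: module k "kmod k" by (rule HD.mk)
  note a = right_actionD[OF act', unfolded cVd Vd_linear]
  let ?l = "\<lambda>\<omega>. \<omega> \<bowtie> \<one>\<^bsub>H\<^esub>" and ?r = "\<lambda>h. \<one>\<^bsub>D'\<^esub> \<bowtie> h"
  have l: "linear_map k D' V ?l" and r: "linear_map k H V ?r" by (rule algH lin)+
  note lc = linear_closed[OF l] and rc = linear_closed[OF r]
  have \<rho>: "\<rho> x \<omega> = act' x (?l \<omega>)" if "x \<in> carrier X" "\<omega> \<in> carrier D'" for x \<omega>
    using that by (simp add: \<rho>_def)
  have act: "act x h = act' x (?r h)" if "x \<in> carrier X" "h \<in> carrier H" for x h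
    using that by (simp add: act_def)
  have b: "bilin k D' H V (\<lambda>\<omega>2 h2. (\<omega> \<otimes>\<^bsub>D'\<^esub> \<omega>2) \<bowtie> (h2 \<otimes>\<^bsub>H\<^esub> h'))"
    if "\<omega> \<in> carrier D'" "h' \<in> carrier H" for \<omega> h' by (rule that algH lin | assumption)+
  \<comment> \<open>In \<open>mult_double\<close> the sum over \<open>At\<close> has a single term, except in \<open>rl\<close>.\<close>
  have ll: "?l \<omega> \<otimes>\<^bsub>Vd\<^esub> ?l \<omega>' = ?l (\<omega> \<otimes>\<^bsub>D'\<^esub> \<omega>')" if "\<omega> \<in> carrier D'" "\<omega>' \<in> carrier D'" for \<omega> \<omega>'
    using that by (simp add: mult_double At_left sweedler_tens[OF _ _ b GD.mV mH VV.mV])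
  have rr: "?r h \<otimes>\<^bsub>Vd\<^esub> ?r h' = ?r (h \<otimes>\<^bsub>H\<^esub> h')" if "h \<in> carrier H" "h' \<in> carrier H" for h h'
    using that by (simp add: mult_double At_right GD.one_V sweedler_tens[OF _ _ b GD.mV mH VV.mV] unit_D')
  have lr: "?l \<omega> \<otimes>\<^bsub>Vd\<^esub> ?r h = \<omega> \<bowtie> h" if "\<omega> \<in> carrier D'" "h \<in> carrier H" for \<omega> h
    using that by (simp add: mult_double At_right GD.one_V sweedler_tens[OF _ _ b GD.mV mH VV.mV] unit_D')
  have rl: "?r h \<otimes>\<^bsub>Vd\<^esub> ?l \<omega> = At (\<omega> \<bowtie> h)" if wh: "\<omega> \<in> carrier D'" "h \<in> carrier H" for \<omega> h
  proof -
    have Ac: "At (\<omega> \<bowtie> h) \<in> carrier V" by (rule wh lin)+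
    have "?r h \<otimes>\<^bsub>Vd\<^esub> ?l \<omega> = sweedler V (At (\<omega> \<bowtie> h)) (\<lambda>\<omega>2 h2. (\<one>\<^bsub>D'\<^esub> \<otimes>\<^bsub>D'\<^esub> \<omega>2) \<bowtie> (h2 \<otimes>\<^bsub>H\<^esub> \<one>\<^bsub>H\<^esub>))"
      using wh by (simp add: mult_double GD.one_V)
    also have "\<dots> = sweedler V (At (\<omega> \<bowtie> h)) (tens k D' H)"
      by (rule sweedler_cong[OF GD.mV mH Ac]) (simp add: unit_D')
    finally show ?thesis by (simp add: sweedler_tens_id[OF Ac GD.mV mH])
  qed
  have cl: "comult Vd (?l \<omega>) = sweedler (tensor k V V) (comult D' \<omega>) (\<lambda>\<omega>1 \<omega>2. tens k V V (?l \<omega>1) (?l \<omega>2))"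
    if w: "\<omega> \<in> carrier D'" for \<omega>
    unfolding comult_double[OF w H.one_closed] comult_one
    by (rule sweedler_cong[OF GD.mV GD.mV GD.comult_V[OF w]], rule sweedler_tens; (rule algH lin | assumption)+)
  have cr: "comult Vd (?r h) = sweedler (tensor k V V) (comult H h) (\<lambda>h1 h2. tens k V V (?r h1) (?r h2))"
    if h: "h \<in> carrier H" for h
    unfolding comult_double[OF GD.one_V h] comult_one_D'
    by (rule sweedler_tens; (rule h algH lin | assumption)+)
  have bX: "bilin k V V X (\<lambda>d1 d2. act' x d1 \<otimes>\<^bsub>X\<^esub> act' y d2)" if "x \<in> carrier X" "y \<in> carrier X" for x y
    by (rule bilinI lin_mult_left lin_mult_right a(1,9) that X | assumption)+
  have lX: "linear_map k (tensor k V V) X (\<lambda>z. sweedler X z (\<lambda>d1 d2. act' x d1 \<otimes>\<^bsub>X\<^esub> act' y d2))"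
    if "x \<in> carrier X" "y \<in> carrier X" for x y by (rule bX that mX lin)+
  show R: "right_action k D' X \<rho>"
  proof (rule right_actionI)
    show "\<rho> \<in> extensional (carrier X)" by (simp add: \<rho>_def)
    show "\<rho> x \<in> extensional (carrier D')" if "x \<in> carrier X" for x using that by (simp add: \<rho>_def)
    show "linear_map k D' X (\<rho> x)" if x: "x \<in> carrier X" for x
      by (rule linear_cong[OF lin_comp[OF a(1)[OF x] l] GD.mV]) (simp add: \<rho> x)
    show "linear_map k X X (\<lambda>x. \<rho> x \<omega>)" if w: "\<omega> \<in> carrier D'" for \<omega>
      by (rule linear_cong[OF a(2)[OF lc[OF w]] mX]) (simp add: \<rho> w)
    show "\<rho> x \<one>\<^bsub>D'\<^esub> = x" if "x \<in> carrier X" for x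
      using that a(3) by (simp add: \<rho> GD.one_V one_double)
    show "\<rho> x (\<omega> \<otimes>\<^bsub>D'\<^esub> \<omega>') = \<rho> (\<rho> x \<omega>) \<omega>'"
      if "x \<in> carrier X" "\<omega> \<in> carrier D'" "\<omega>' \<in> carrier D'" for x \<omega> \<omega>'
      using that by (simp add: \<rho> GD.mult_V ll[symmetric] a(4) a(9) lc)
    show "\<rho> \<one>\<^bsub>X\<^esub> \<omega> = counit D' \<omega> \<odot>\<^bsub>X\<^esub> \<one>\<^bsub>X\<^esub>" if "\<omega> \<in> carrier D'" for \<omega>
      using that by (simp add: \<rho> a(5) lc counit_double counit_one GD.counit_V_closed)
    show "\<rho> (x \<otimes>\<^bsub>X\<^esub> y) \<omega> = sweedler X (comult D' \<omega>) (\<lambda>\<omega>1 \<omega>2. \<rho> x \<omega>1 \<otimes>\<^bsub>X\<^esub> \<rho> y \<omega>2)"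
      if x: "x \<in> carrier X" and y: "y \<in> carrier X" and w: "\<omega> \<in> carrier D'" for x y \<omega>
    proof -
      note cw = GD.comult_V[OF w]
      have "sweedler X (comult Vd (?l \<omega>)) (\<lambda>d1 d2. act' x d1 \<otimes>\<^bsub>X\<^esub> act' y d2) =
          sweedler X (comult D' \<omega>) (\<lambda>\<omega>1 \<omega>2. \<rho> x \<omega>1 \<otimes>\<^bsub>X\<^esub> \<rho> y \<omega>2)"
        unfolding cl[OF w] by (rule sweedler_push[OF lX[OF x y] cw])
          ((rule mX algH lin | assumption)+, simp add: sweedler_tens[OF lc lc bX[OF x y] VV.mV VV.mV mX] \<rho> x y)
      then show ?thesis using x y w by (simp add: \<rho> a(6) lc)
    qed
  qed
  show A: "right_action k H X act"
  proof (rule right_actionI)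
    show "act \<in> extensional (carrier X)" by (simp add: act_def)
    show "act x \<in> extensional (carrier H)" if "x \<in> carrier X" for x using that by (simp add: act_def)
    show "linear_map k H X (act x)" if x: "x \<in> carrier X" for x
      by (rule linear_cong[OF lin_comp[OF a(1)[OF x] r] mH]) (simp add: act x)
    show "linear_map k X X (\<lambda>x. act x h)" if w: "h \<in> carrier H" for h
      by (rule linear_cong[OF a(2)[OF rc[OF w]] mX]) (simp add: act w)
    show "act x \<one>\<^bsub>H\<^esub> = x" if "x \<in> carrier X" for x
      using that a(3) by (simp add: act one_double)
    show "act x (h \<otimes>\<^bsub>H\<^esub> h') = act (act x h) h'"
      if "x \<in> carrier X" "h \<in> carrier H" "h' \<in> carrier H" for x h h'
      using that by (simp add: act rr[symmetric] a(4) a(9) rc)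
    show "act \<one>\<^bsub>X\<^esub> h = counit H h \<odot>\<^bsub>X\<^esub> \<one>\<^bsub>X\<^esub>" if h: "h \<in> carrier H" for h
    proof -
      have "counit D' \<one>\<^bsub>D'\<^esub> = \<one>\<^bsub>k\<^esub>"
        using GD.counit_V[OF GD.one_V] GD.P_one[of "\<one>\<^bsub>G\<^esub>"] by (simp add: opp_simps counit_one)
      then show ?thesis using h by (simp add: act a(5) rc counit_double GD.one_V HD.counit_K_closed)
    qed
    show "act (x \<otimes>\<^bsub>X\<^esub> y) h = sweedler X (comult H h) (\<lambda>h1 h2. act x h1 \<otimes>\<^bsub>X\<^esub> act y h2)"
      if x: "x \<in> carrier X" and y: "y \<in> carrier X" and h: "h \<in> carrier H" for x y h
    proof -
      note ch = comult_H_closed[OF h]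
      have "sweedler X (comult Vd (?r h)) (\<lambda>d1 d2. act' x d1 \<otimes>\<^bsub>X\<^esub> act' y d2) =
          sweedler X (comult H h) (\<lambda>h1 h2. act x h1 \<otimes>\<^bsub>X\<^esub> act y h2)"
        unfolding cr[OF h] by (rule sweedler_push[OF lX[OF x y] ch])
          ((rule mX algH lin | assumption)+, simp add: sweedler_tens[OF rc rc bX[OF x y] VV.mV VV.mV mX] act x y)
      then show ?thesis using x y h by (simp add: act a(6) rc)
    qed
  qed
  have dot: "dot X \<rho> act x d = act' x d" if x: "x \<in> carrier X" and d: "d \<in> carrier V" for x d
  proof (rule linear_ext[OF dot_linear(1)[OF X R A x] a(1)[OF x] _ d GD.mV mH])
    fix \<omega> h assume wh: "\<omega> \<in> carrier D'" "h \<in> carrier H"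
    have "act (\<rho> x \<omega>) h = act' x (?l \<omega> \<otimes>\<^bsub>Vd\<^esub> ?r h)"
      using wh x by (simp add: \<rho> act a(4) a(9) lc rc)
    then show "dot X \<rho> act x (\<omega> \<bowtie> h) = act' x (\<omega> \<bowtie> h)"
      by (simp only: lr[OF wh] dot_tens[OF X R A x wh])
  qed
  show "yd_condition X \<rho> act" unfolding yd_condition_def
  proof (intro ballI)
    fix x h \<omega> assume as: "x \<in> carrier X" "h \<in> carrier H" "\<omega> \<in> carrier D'"
    have Ac: "At (\<omega> \<bowtie> h) \<in> carrier V" by (rule as lin)+
    have "\<rho> (act x h) \<omega> = act' x (?r h \<otimes>\<^bsub>Vd\<^esub> ?l \<omega>)"
      using as by (simp add: a(4) a(9) lc rc \<rho> act)
    then show "\<rho> (act x h) \<omega> = dot X \<rho> act x (At (\<omega> \<bowtie> h))"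
      by (simp only: dot[OF as(1) Ac] rl[OF as(3,2)])
  qed
  show "dot_action X \<rho> act = act'"
  proof (intro ext)
    fix x d
    show "dot_action X \<rho> act x d = act' x d"
    proof (cases "x \<in> carrier X")
      case x: True
      then show ?thesis using a(8)[OF x] dot[OF x, of d]
        by (cases "d \<in> carrier V") (auto simp: dot_action_def cVd extensional_def)
    next
      case False
      then show ?thesis using a(7) by (auto simp: dot_action_def extensional_def)
    qed
  qed
qed

lemma dot_action_determines:
  assumes X: "k_algebra k X" and \<rho>: "right_action k D' X \<rho>" and act: "right_action k H X act"
    and x: "x \<in> carrier X"
  shows "\<omega> \<in> carrier D' \<Longrightarrow> dot_action X \<rho> act x (\<omega> \<bowtie> \<one>\<^bsub>H\<^esub>) = \<rho> x \<omega>"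
    and "h \<in> carrier H \<Longrightarrow> dot_action X \<rho> act x (\<one>\<^bsub>D'\<^esub> \<bowtie> h) = act x h"
proof -
  interpret H: k_algebra k H by (rule algH)
  note r = right_actionD[OF \<rho>] and a = right_actionD[OF act]
  show "dot_action X \<rho> act x (\<omega> \<bowtie> \<one>\<^bsub>H\<^esub>) = \<rho> x \<omega>" if "\<omega> \<in> carrier D'"
    using x that tens_closed[OF GD.mV mH that H.one_closed]
    by (simp add: dot_action_def cVd dot_tens[OF X \<rho> act] a(3) r(9))
  show "dot_action X \<rho> act x (\<one>\<^bsub>D'\<^esub> \<bowtie> h) = act x h" if "h \<in> carrier H"
    using x that tens_closed[OF GD.mV mH GD.one_V that]
    by (simp add: dot_action_def cVd dot_tens[OF X \<rho> act] r(3) GD.one_V)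
qed

end

section \<open>Isomorphisms of categories of structured algebras\<close>

lemma algebra_hom_restrict_id:
  assumes "k_algebra k A"
  shows "algebra_hom k A A (\<lambda>x\<in>carrier A. x)"
proof -
  interpret k_algebra k A by fact
  show ?thesis by (auto simp: algebra_hom_def linear_map_def ring_hom_def)
qed

lemma algebra_hom_compose:
  assumes "k_algebra k A" "algebra_hom k A B f" "algebra_hom k B C g"
  shows "algebra_hom k A C (compose (carrier A) g f)"
proof -
  interpret k_algebra k A by fact
  have "linear_map k A C (compose (carrier A) g f)"
    using assms(2,3) by (auto simp: algebra_hom_def compose_def intro!: linear_cong[OF lin_comp[of k B C g A f] k_algebra_module[OF assms(1)]])
  then show ?thesis
    using assms(2,3) by (auto simp: algebra_hom_def ring_hom_def compose_def linear_closed Pi_iff)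
qed

text \<open>
  The conditions under which the compatible algebra homomorphisms form a category.
\<close>

definition closed_structure ::
  "'k ring \<Rightarrow> 'o set \<Rightarrow> ('o \<Rightarrow> ('k, 'x) module) \<Rightarrow> ('o \<Rightarrow> 'o \<Rightarrow> ('x \<Rightarrow> 'x) \<Rightarrow> bool) \<Rightarrow> bool" where
  "closed_structure k Objs alg c \<longleftrightarrow>
    (\<forall>M\<in>Objs. k_algebra k (alg M) \<and> c M M (\<lambda>x\<in>carrier (alg M). x)) \<and>
    (\<forall>M\<in>Objs. \<forall>N\<in>Objs. \<forall>L\<in>Objs. \<forall>f g.
      algebra_hom k (alg M) (alg N) f \<longrightarrow> algebra_hom k (alg N) (alg L) g \<longrightarrow>
      c M N f \<longrightarrow> c N L g \<longrightarrow> c M L (compose (carrier (alg M)) g f))"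

lemma closed_structure_category:
  assumes "closed_structure k Objs alg c"
  shows "category (structured_algebras k Objs alg c)"
proof -
  have alg: "k_algebra k (alg M)" and id: "c M M (\<lambda>x\<in>carrier (alg M). x)" if "M \<in> Objs" for M
    using assms that by (auto simp: closed_structure_def)
  have comp: "c M L (compose (carrier (alg M)) g f)"
    if "M \<in> Objs" "N \<in> Objs" "L \<in> Objs" "algebra_hom k (alg M) (alg N) f"
      "algebra_hom k (alg N) (alg L) g" "c M N f" "c N L g" for M N L f g
    using assms that unfolding closed_structure_def by blast
  have maps: "f x \<in> carrier B" if "algebra_hom k A B f" "x \<in> carrier A" for A B f x
    using that linear_closed by (auto simp: algebra_hom_def)
  show ?thesis
    unfolding category_def structured_algebras_def
    apply (simp del: restrict_apply)
    apply (intro conjI ballI impI allI)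
    subgoal by (simp add: algebra_hom_restrict_id[OF alg])
    subgoal by (simp add: id)
    subgoal by (auto intro: algebra_hom_compose[OF alg])
    subgoal by (auto intro: comp)
    subgoal for x y f by (auto simp: compose_def extensional_def fun_eq_iff)
    subgoal for x y f by (auto simp: compose_def extensional_def fun_eq_iff maps)
    subgoal for w x y z f g h by (auto simp: compose_def extensional_def fun_eq_iff maps)
    done
qed

text \<open>
  A functor that is the identity on algebras and on morphisms, bijective on objects, and neither
  gains nor loses morphisms.  The source inherits from the target that it is a category.
\<close>

locale structure_iso =
  fixes k :: "'k ring"
    and Objs :: "'o set" and alg :: "'o \<Rightarrow> ('k, 'x) module" and c
    and Objs' :: "'p set" and alg' :: "'p \<Rightarrow> ('k, 'x) module" and c'
    and F :: "('o, 'x \<Rightarrow> 'x, 'p, 'x \<Rightarrow> 'x) functor_data"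
  assumes target: "closed_structure k Objs' alg' c'"
    and bij: "bij_betw (omap F) Objs Objs'"
    and alg_eq: "M \<in> Objs \<Longrightarrow> alg' (omap F M) = alg M"
    and compatible: "M \<in> Objs \<Longrightarrow> N \<in> Objs \<Longrightarrow> algebra_hom k (alg M) (alg N) f \<Longrightarrow>
      c M N f \<longleftrightarrow> c' (omap F M) (omap F N) f"
    and mmap: "mmap F = (\<lambda>M N f. f)"
begin

lemma F_in: "M \<in> Objs \<Longrightarrow> omap F M \<in> Objs'" using bij by (auto simp: bij_betw_def)

lemma source: "closed_structure k Objs alg c"
proof -
  have alg: "k_algebra k (alg M)" if "M \<in> Objs" for M
    using target F_in[OF that] alg_eq[OF that] unfolding closed_structure_def by metis
  have id: "c M M (\<lambda>x\<in>carrier (alg M). x)" if M: "M \<in> Objs" for M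
    using target F_in[OF M] alg_eq[OF M] compatible[OF M M algebra_hom_restrict_id[OF alg[OF M]]]
    unfolding closed_structure_def by metis
  have comp: "c M L (compose (carrier (alg M)) g f)"
    if M: "M \<in> Objs" "N \<in> Objs" "L \<in> Objs" and h: "algebra_hom k (alg M) (alg N) f"
      "algebra_hom k (alg N) (alg L) g" and "c M N f" "c N L g" for M N L f g
  proof -
    have "c' (omap F M) (omap F L) (compose (carrier (alg' (omap F M))) g f)"
      using target F_in[OF M(1)] F_in[OF M(2)] F_in[OF M(3)] h that(6,7)
        compatible[OF M(1,2) h(1)] compatible[OF M(2,3) h(2)]
      unfolding closed_structure_def by (metis alg_eq M)
    then show ?thesis
      using compatible[OF M(1,3) algebra_hom_compose[OF alg[OF M(1)] h]] alg_eq[OF M(1)] by simp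
  qed
  show ?thesis unfolding closed_structure_def using alg id comp by blast
qed

lemma equivalence:
  "equivalence_of_categories (structured_algebras k Objs alg c) (structured_algebras k Objs' alg' c') F"
proof -
  let ?C = "structured_algebras k Objs alg c" and ?D = "structured_algebras k Objs' alg' c'"
  let ?G = "\<lparr> omap = inv_into Objs (omap F), mmap = (\<lambda>M N f. f) \<rparr>"
  note cC = closed_structure_category[OF source] and cD = closed_structure_category[OF target]
  have GF: "inv_into Objs (omap F) (omap F M) = M" if "M \<in> Objs" for M
    using bij that by (simp add: bij_betw_def)
  have FG: "omap F (inv_into Objs (omap F) N) = N" and G_in: "inv_into Objs (omap F) N \<in> Objs"
    if "N \<in> Objs'" for N
    using bij that by (auto simp: bij_betw_def f_inv_into_f inv_into_into)
  have hom: "Hom ?D (omap F M) (omap F N) = Hom ?C M N" if "M \<in> Objs" "N \<in> Objs" for M N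
    using that by (auto simp: structured_algebras_def alg_eq compatible)
  have F: "is_functor ?C ?D F"
    unfolding is_functor_def
  proof (intro conjI ballI)
    show "category ?C" "category ?D" by (rule cC cD)+
    show "omap F M \<in> Obj ?D" if "M \<in> Obj ?C" for M
      using that F_in by (simp add: structured_algebras_def)
    show "mmap F M N f \<in> Hom ?D (omap F M) (omap F N)"
      if "M \<in> Obj ?C" "N \<in> Obj ?C" "f \<in> Hom ?C M N" for M N f
      using that hom[of M N] by (simp add: mmap structured_algebras_def)
  qed (simp_all add: mmap structured_algebras_def alg_eq)
  have homG: "Hom ?C (omap ?G M) (omap ?G N) = Hom ?D M N" if "M \<in> Objs'" "N \<in> Objs'" for M N
    using hom[OF G_in[OF that(1)] G_in[OF that(2)]] that by (simp add: FG)
  have algG: "alg (omap ?G N) = alg' N" if "N \<in> Objs'" for N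
    using alg_eq[OF G_in[OF that]] that by (simp add: FG)
  have G: "is_functor ?D ?C ?G"
    unfolding is_functor_def
  proof (intro conjI ballI)
    show "category ?C" "category ?D" by (rule cC cD)+
    show "omap ?G M \<in> Obj ?C" if "M \<in> Obj ?D" for M
      using that G_in by (simp add: structured_algebras_def)
    show "mmap ?G M N f \<in> Hom ?C (omap ?G M) (omap ?G N)"
      if "M \<in> Obj ?D" "N \<in> Obj ?D" "f \<in> Hom ?D M N" for M N f
      using that homG[of M N] by (simp add: structured_algebras_def)
  qed (use algG in \<open>simp_all add: structured_algebras_def\<close>)
  have nat: "naturally_isomorphic C C K id_functor"
    if C: "category C" and K: "\<And>M. M \<in> Obj C \<Longrightarrow> omap K M = M" "mmap K = (\<lambda>M N f. f)"
    for C :: "('r, 's) cat" and K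
    unfolding naturally_isomorphic_def
  proof (rule exI[of _ "Idn C"], intro conjI ballI)
    fix M assume M: "M \<in> Obj C"
    then show "is_iso C (omap K M) (omap id_functor M) (Idn C M)"
      using C unfolding is_iso_def category_def by (auto simp: id_functor_def K)
    fix N f assume N: "N \<in> Obj C" and f: "f \<in> Hom C M N"
    then show "Comp C (omap K M) (omap K N) (omap id_functor N) (Idn C N) (mmap K M N f) =
        Comp C (omap K M) (omap id_functor M) (omap id_functor N) (mmap id_functor M N f) (Idn C M)"
      using C M unfolding category_def by (auto simp: id_functor_def K)
  qed
  have "naturally_isomorphic ?C ?C (comp_functor ?G F) id_functor"
    by (rule nat[OF cC]) (simp_all add: comp_functor_def structured_algebras_def GF mmap)
  moreover have "naturally_isomorphic ?D ?D (comp_functor F ?G) id_functor"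
    by (rule nat[OF cD]) (simp_all add: comp_functor_def structured_algebras_def FG mmap)
  ultimately show ?thesis unfolding equivalence_of_categories_def using F G by blast
qed

end

lemma module_algebras_closed:
  "closed_structure k {(X, act). k_algebra k X \<and> right_action k K X act} fst
    (\<lambda>(X, act) (Y, act') f. commutes_action K X act act' f)"
proof -
  have maps: "f x \<in> carrier B" if "algebra_hom k A B f" "x \<in> carrier A" for A B f x
    using that linear_closed by (auto simp: algebra_hom_def)
  show ?thesis
    unfolding closed_structure_def
    by (auto simp: commutes_action_def compose_def right_actionD(9) maps)
qed

lemma left_coactionD:
  assumes "left_coaction k K X \<gamma>"
  shows "linear_map k X (tensor k K X) \<gamma>" "\<gamma> \<in> extensional (carrier X)"
  using assms by (simp_all add: left_coaction_def algebra_hom_def)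

lemma algebra_hom_linear: "algebra_hom k A B f \<Longrightarrow> linear_map k A B f"
  by (simp add: algebra_hom_def)

context fd_hopf
begin

section \<open>The four functors\<close>

abbreviation "comods \<equiv> {(X, \<gamma>). k_algebra k X \<and> left_coaction k Kc X \<gamma>}"
abbreviation "mods \<equiv> {(X, act). k_algebra k X \<and> right_action k Vd X act}"
abbreviation "lls \<equiv> {(X, \<alpha>, \<beta>). k_algebra k X \<and> left_coaction k G X \<alpha> \<and> left_coaction k D X \<beta> \<and>
  yd_ll_condition k H X \<alpha> \<beta>}"
abbreviation "lrs \<equiv> {(X, act, \<alpha>). k_algebra k X \<and> right_action k H X act \<and> left_coaction k G X \<alpha> \<and>
  yd_lr_condition k H X act \<alpha>}"
abbreviation "ll_maps \<equiv> (\<lambda>(X, \<alpha>, \<beta>) (Y, \<alpha>', \<beta>') f.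
  commutes_coaction k G X Y \<alpha> \<alpha>' f \<and> commutes_coaction k D X Y \<beta> \<beta>' f)"
abbreviation "lr_maps \<equiv> (\<lambda>(X, act, \<alpha>) (Y, act', \<alpha>') f.
  commutes_action H X act act' f \<and> commutes_coaction k G X Y \<alpha> \<alpha>' f)"
abbreviation "comod_maps \<equiv> (\<lambda>(X, \<gamma>) (Y, \<gamma>') f.
  commutes_coaction k Kc X Y \<gamma> \<gamma>' f)"
abbreviation "mod_maps \<equiv> (\<lambda>(X, act) (Y, act') f. commutes_action Vd X act act' f)"
abbreviation "F\<^sub>1 \<equiv> yd_ll_to_comodule k H"
abbreviation "F\<^sub>2 \<equiv> comodule_to_module k H"
abbreviation "F\<^sub>3 \<equiv> yd_ll_to_yd_lr k H"
abbreviation "F\<^sub>4 \<equiv> yd_lr_to_module k H"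

lemma comodule_to_module_iso:
  "structure_iso k comods fst comod_maps
    mods fst mod_maps F\<^sub>2"
proof
  show "closed_structure k mods fst mod_maps"
    by (rule module_algebras_closed)
  have om: "omap F\<^sub>2 = (\<lambda>(X, \<gamma>). (X, induced_action Vd PP X \<gamma>))"
    by (simp add: comodule_to_module_def double_pairing_eq)
  show "bij_betw (omap F\<^sub>2) comods mods"
    unfolding bij_betw_def
  proof
    show "inj_on (omap F\<^sub>2) comods"
      unfolding om by (rule inj_onI) (auto intro: DB.induced_action_inj dest: left_coactionD)
    show "omap F\<^sub>2 ` comods = mods"
    proof (intro equalityI subsetI)
      fix M assume "M \<in> omap F\<^sub>2 ` comods"
      then obtain X \<gamma> where M: "M = (X, induced_action Vd PP X \<gamma>)" and X: "k_algebra k X"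
        and \<gamma>: "left_coaction k Kc X \<gamma>" by (auto simp: om)
      show "M \<in> mods"
        using DB.left_coaction_iff_right_action[OF X left_coactionD(2,1)[OF \<gamma>]] X \<gamma> by (simp add: M)
    next
      fix M assume "M \<in> mods"
      then obtain X act where M: "M = (X, act)" and X: "k_algebra k X" and act: "right_action k Vd X act" by auto
      obtain \<gamma> where "\<gamma> \<in> extensional (carrier X)" "linear_map k X (tensor k Kc X) \<gamma>" "induced_action Vd PP X \<gamma> = act"
        using DB.coaction_of_action[OF X act] by blast
      then have "(X, \<gamma>) \<in> comods" and "M = omap F\<^sub>2 (X, \<gamma>)"
        using DB.left_coaction_iff_right_action[OF X, of \<gamma>] X act by (simp_all add: om M)
      then show "M \<in> omap F\<^sub>2 ` comods" by (rule rev_image_eqI)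
    qed
  qed
  show "fst (omap F\<^sub>2 M) = fst M" if "M \<in> comods" for M
    by (simp add: om split: prod.split)
  show "mmap F\<^sub>2 = (\<lambda>M N f. f)" by (simp add: comodule_to_module_def)
  show "comod_maps M N f \<longleftrightarrow>
      mod_maps (omap F\<^sub>2 M) (omap F\<^sub>2 N) f"
    if M: "M \<in> comods" and N: "N \<in> comods" and f: "algebra_hom k (fst M) (fst N) f" for M N f
  proof -
    obtain X \<gamma> where M': "M = (X, \<gamma>)" by (cases M)
    obtain Y \<gamma>' where N': "N = (Y, \<gamma>')" by (cases N)
    have X: "k_algebra k X" "left_coaction k Kc X \<gamma>" and Y: "k_algebra k Y" "left_coaction k Kc Y \<gamma>'"
      using M N by (auto simp: M' N')
    have "linear_map k X Y f" using algebra_hom_linear[OF f] by (simp add: M' N')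
    from DB.commutes_coaction_iff_action[OF k_algebra_module[OF X(1)] k_algebra_module[OF Y(1)] this
        left_coactionD(1)[OF X(2)] left_coactionD(1)[OF Y(2)]]
    show ?thesis unfolding M' N' om prod.case .
  qed
qed

lemma induced_action_evH: "induced_action H (\<lambda>h \<theta>. \<theta> h) X \<beta> = induced_action H evH X \<beta>"
  by (simp add: lam_ev)

lemma yd_lr_to_module_omap:
  assumes "(X, act, \<alpha>) \<in> lrs"
  shows "omap F\<^sub>4 (X, act, \<alpha>) = (X, dot_action X (induced_action D' evG X \<alpha>) act)"
proof -
  have X: "k_algebra k X" and act: "right_action k H X act" and \<alpha>: "left_coaction k G X \<alpha>"
    using assms by auto
  note mX = k_algebra_module[OF X]
  note a = right_actionD[OF act] and la = left_coactionD(1)[OF \<alpha>]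
  have "sweedler X d (\<lambda>\<omega> h. sweedler X (\<alpha> x) (\<lambda>g y. \<omega> g \<odot>\<^bsub>X\<^esub> act y h)) =
      dot X (induced_action D' evG X \<alpha>) act x d" if x: "x \<in> carrier X" and d: "d \<in> carrier V" for x d
    unfolding dot_def
  proof (rule sweedler_cong[OF GD.mV mH d])
    fix \<omega> h assume wh: "\<omega> \<in> carrier D'" "h \<in> carrier H"
    note ax = linear_closed[OF la x]
    have "act (induced_action D' evG X \<alpha> x \<omega>) h = act (sweedler X (\<alpha> x) (\<lambda>g y. evG \<omega> g \<odot>\<^bsub>X\<^esub> y)) h"
      by (simp add: GD.induced_action_slice[OF x wh(1)] slice_def)
    also have "\<dots> = sweedler X (\<alpha> x) (\<lambda>g y. act (evG \<omega> g \<odot>\<^bsub>X\<^esub> y) h)"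
      by (rule sweedler_linear[OF a(2)[OF wh(2)] ax]; (rule wh mX lin | assumption)+)
    also have "\<dots> = sweedler X (\<alpha> x) (\<lambda>g y. \<omega> g \<odot>\<^bsub>X\<^esub> act y h)"
    proof (rule sweedler_cong[OF GD.mK mX ax])
      fix g y assume gy: "g \<in> carrier G" "y \<in> carrier X"
      show "act (evG \<omega> g \<odot>\<^bsub>X\<^esub> y) h = \<omega> g \<odot>\<^bsub>X\<^esub> act y h"
        using linear_smult[OF a(2)[OF wh(2)] GD.P_closed[OF wh(1) gy(1)] gy(2)] by (simp add: evG_def)
    qed
    finally show "sweedler X (\<alpha> x) (\<lambda>g y. \<omega> g \<odot>\<^bsub>X\<^esub> act y h) = act (induced_action D' evG X \<alpha> x \<omega>) h" by simp
  qed
  then show ?thesis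
    by (auto simp: yd_lr_to_module_def dot_action_def cVd fun_eq_iff restrict_def)
qed

text \<open>
  On objects, a preimage of an action of the double is given by its restrictions to the two
  subalgebras (\<open>action_of_double\<close>); they determine it, as \<open>(\<omega> \<bowtie> 1)(\<epsilon> \<bowtie> h) = \<omega> \<bowtie> h\<close>, and are determined by it.
\<close>

lemma yd_lr_to_module_iso:
  "structure_iso k lrs fst
    lr_maps
    mods fst mod_maps F\<^sub>4"
proof
  let ?\<rho> = "\<lambda>X \<alpha>. induced_action D' evG X \<alpha>"
  note om = yd_lr_to_module_omap
  have obj: "k_algebra k X" "right_action k H X act" "right_action k D' X (?\<rho> X \<alpha>)"
    "yd_condition X (?\<rho> X \<alpha>) act" "linear_map k X (tensor k G X) \<alpha>" "\<alpha> \<in> extensional (carrier X)"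
    if "(X, act, \<alpha>) \<in> lrs" for X act \<alpha>
  proof -
    show X: "k_algebra k X" and act: "right_action k H X act" using that by auto
    have \<alpha>: "left_coaction k G X \<alpha>" using that by auto
    show l: "linear_map k X (tensor k G X) \<alpha>" and e: "\<alpha> \<in> extensional (carrier X)"
      by (rule left_coactionD[OF \<alpha>])+
    show r: "right_action k D' X (?\<rho> X \<alpha>)"
      using GD.left_coaction_iff_right_action[OF X e l] \<alpha> by simp
    show "yd_condition X (?\<rho> X \<alpha>) act" using lr_condition_iff[OF X l r act] that by simp
  qed
  show "closed_structure k mods fst mod_maps"
    by (rule module_algebras_closed)
  show "bij_betw (omap F\<^sub>4) lrs mods"
    unfolding bij_betw_def
  proof
    show "inj_on (omap F\<^sub>4) lrs"
    proof (rule inj_onI)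
      fix M N assume M: "M \<in> lrs" and N: "N \<in> lrs"
        and eq: "omap F\<^sub>4 M = omap F\<^sub>4 N"
      obtain X act \<alpha> where M': "M = (X, act, \<alpha>)" by (cases M)
      obtain Y act' \<alpha>' where N': "N = (Y, act', \<alpha>')" by (cases N)
      note m = obj[OF M[unfolded M']] and n = obj[OF N[unfolded N']]
      have XY: "Y = X" and d: "dot_action X (?\<rho> X \<alpha>) act = dot_action X (?\<rho> X \<alpha>') act'"
        using eq om[OF M[unfolded M']] om[OF N[unfolded N']] by (auto simp: M' N')
      note n = n[unfolded XY]
      have "?\<rho> X \<alpha> x \<omega> = ?\<rho> X \<alpha>' x \<omega>" if "x \<in> carrier X" "\<omega> \<in> carrier D'" for x \<omega>
        using dot_action_determines(1)[OF m(1,3,2) that] dot_action_determines(1)[OF n(1,3,2) that] d by simp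
      then have "?\<rho> X \<alpha> = ?\<rho> X \<alpha>'"
        by (auto simp: induced_action_def fun_eq_iff restrict_def)
      then have "\<alpha> = \<alpha>'" by (rule GD.induced_action_inj[OF m(1,6) n(6) m(5) n(5)])
      moreover have "act = act'"
      proof (rule extensionalityI[OF right_actionD(7)[OF m(2)] right_actionD(7)[OF n(2)]])
        fix x assume x: "x \<in> carrier X"
        show "act x = act' x"
          by (rule extensionalityI[OF right_actionD(8)[OF m(2) x] right_actionD(8)[OF n(2) x]])
            (use dot_action_determines(2)[OF m(1,3,2) x] dot_action_determines(2)[OF n(1,3,2) x] d in simp)
      qed
      ultimately show "M = N" by (simp add: M' N' XY)
    qed
    show "omap F\<^sub>4 ` lrs = mods"
    proof (intro equalityI subsetI)
      fix N assume "N \<in> omap F\<^sub>4 ` lrs"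
      then obtain X act \<alpha> where M: "(X, act, \<alpha>) \<in> lrs" and N: "N = omap F\<^sub>4 (X, act, \<alpha>)" by auto
      note m = obj[OF M]
      show "N \<in> mods" unfolding N om[OF M]
        using m(1) dot_action_right_action[OF m(1,3,2,4)] by simp
    next
      fix N assume "N \<in> mods"
      then obtain X act' where N: "N = (X, act')" and X: "k_algebra k X" and act': "right_action k Vd X act'" by auto
      note ad = action_of_double[OF X act']
      let ?act = "\<lambda>x\<in>carrier X. \<lambda>h\<in>carrier H. act' x (\<one>\<^bsub>D'\<^esub> \<bowtie> h)"
      obtain \<alpha> where \<alpha>: "\<alpha> \<in> extensional (carrier X)" "linear_map k X (tensor k G X) \<alpha>"
        "?\<rho> X \<alpha> = (\<lambda>x\<in>carrier X. \<lambda>\<omega>\<in>carrier D'. act' x (\<omega> \<bowtie> \<one>\<^bsub>H\<^esub>))"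
        using GD.coaction_of_action[OF X ad(1)] by blast
      note ad = ad[folded \<alpha>(3)]
      have "left_coaction k G X \<alpha>"
        by (rule GD.left_coaction_iff_right_action[OF X \<alpha>(1,2), THEN iffD2, OF ad(1)])
      moreover have "yd_lr_condition k H X ?act \<alpha>"
        by (rule lr_condition_iff[OF X \<alpha>(2) ad(1,2), THEN iffD2, OF ad(3)])
      ultimately have M: "(X, ?act, \<alpha>) \<in> lrs" using X ad(2) by blast
      have "N = omap F\<^sub>4 (X, ?act, \<alpha>)" unfolding om[OF M] N ad(4) ..
      then show "N \<in> omap F\<^sub>4 ` lrs" by (rule rev_image_eqI[OF M])
    qed
  qed
  show "fst (omap F\<^sub>4 M) = fst M" if "M \<in> lrs" for M
    by (simp add: yd_lr_to_module_def split: prod.split)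
  show "mmap F\<^sub>4 = (\<lambda>M N f. f)" by (simp add: yd_lr_to_module_def)
  show "lr_maps M N f \<longleftrightarrow>
      mod_maps (omap F\<^sub>4 M) (omap F\<^sub>4 N) f"
    if M: "M \<in> lrs" and N: "N \<in> lrs" and f: "algebra_hom k (fst M) (fst N) f" for M N f
  proof -
    obtain X act \<alpha> where M': "M = (X, act, \<alpha>)" by (cases M)
    obtain Y act' \<alpha>' where N': "N = (Y, act', \<alpha>')" by (cases N)
    note m = obj[OF M[unfolded M']] and n = obj[OF N[unfolded N']]
    have f: "linear_map k X Y f" using f by (simp add: M' N' algebra_hom_def)
    note mX = k_algebra_module[OF m(1)] and mY = k_algebra_module[OF n(1)]
    note dX = dot_linear[OF m(1,3,2)] and dY = dot_linear[OF n(1,3,2)]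
    have "commutes_action H X act act' f \<and> commutes_action D' X (?\<rho> X \<alpha>) (?\<rho> Y \<alpha>') f \<longleftrightarrow>
        commutes_action Vd X (dot_action X (?\<rho> X \<alpha>) act) (dot_action Y (?\<rho> Y \<alpha>') act') f"
      (is "?l \<longleftrightarrow> ?r")
    proof
      assume l: ?l
      have "f (dot X (?\<rho> X \<alpha>) act x d) = dot Y (?\<rho> Y \<alpha>') act' (f x) d"
        if x: "x \<in> carrier X" and d: "d \<in> carrier V" for x d
      proof (rule linear_ext[OF lin_comp[OF f dX(1)[OF x]] dY(1)[OF linear_closed[OF f x]] _ d GD.mV mH])
        fix \<omega> h assume wh: "\<omega> \<in> carrier D'" "h \<in> carrier H"
        show "f (dot X (?\<rho> X \<alpha>) act x (\<omega> \<bowtie> h)) = dot Y (?\<rho> Y \<alpha>') act' (f x) (\<omega> \<bowtie> h)"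
          using l wh x right_actionD(9)[OF m(3) x wh(1)]
          by (simp add: dot_tens[OF m(1,3,2) x] dot_tens[OF n(1,3,2) linear_closed[OF f x]] commutes_action_def)
      qed
      then show ?r by (simp add: commutes_action_def dot_action_def cVd linear_closed[OF f])
    next
      assume r: ?r
      interpret H: k_algebra k H by (rule algH)
      have t: "\<omega> \<bowtie> h \<in> carrier Vd" if "\<omega> \<in> carrier D'" "h \<in> carrier H" for \<omega> h
        unfolding cVd by (rule that lin)+
      show ?l
        using r t[OF GD.one_V] t[OF _ H.one_closed]
        by (auto simp: commutes_action_def dot_action_determines[OF m(1,3,2), symmetric]
            dot_action_determines[OF n(1,3,2) linear_closed[OF f], symmetric])
    qed
    then show ?thesis
      unfolding M' N' om[OF M[unfolded M']] om[OF N[unfolded N']] prod.case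
        GD.commutes_coaction_iff_action[OF mX mY f m(5) n(5)] .
  qed
qed

lemma ll_lr:
  assumes X: "k_algebra k X" and \<alpha>: "left_coaction k G X \<alpha>" and \<beta>: "linear_map k X (tensor k D X) \<beta>"
    and act: "right_action k H X (induced_action H evH X \<beta>)"
  shows "yd_ll_condition k H X \<alpha> \<beta> \<longleftrightarrow> yd_lr_condition k H X (induced_action H evH X \<beta>) \<alpha>"
proof -
  note l = left_coactionD[OF \<alpha>]
  have "right_action k D' X (induced_action D' evG X \<alpha>)"
    using GD.left_coaction_iff_right_action[OF X l(2,1)] \<alpha> by simp
  then show ?thesis using ll_condition_iff[OF X l(1) \<beta>] lr_condition_iff[OF X l(1) _ act] by simp
qed

lemma yd_ll_to_yd_lr_iso:
  "structure_iso k lls fst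
    ll_maps
    lrs fst
    lr_maps
    F\<^sub>3"
proof
  show "closed_structure k lrs fst
    lr_maps"
    by (rule structure_iso.source[OF yd_lr_to_module_iso])
  have om: "omap F\<^sub>3 = (\<lambda>(X, \<alpha>, \<beta>). (X, induced_action H evH X \<beta>, \<alpha>))"
    by (simp add: yd_ll_to_yd_lr_def induced_action_evH)
  show "bij_betw (omap F\<^sub>3) lls lrs"
    unfolding bij_betw_def
  proof
    show "inj_on (omap F\<^sub>3) lls"
      unfolding om by (rule inj_onI) (auto intro: DH.induced_action_inj dest: left_coactionD)
    show "omap F\<^sub>3 ` lls = lrs"
    proof (intro equalityI subsetI)
      fix N assume "N \<in> omap F\<^sub>3 ` lls"
      then obtain X \<alpha> \<beta> where N: "N = (X, induced_action H evH X \<beta>, \<alpha>)" and X: "k_algebra k X"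
        and \<alpha>: "left_coaction k G X \<alpha>" and \<beta>: "left_coaction k D X \<beta>" and yd: "yd_ll_condition k H X \<alpha> \<beta>"
        by (auto simp: om)
      note l = left_coactionD[OF \<beta>]
      have act: "right_action k H X (induced_action H evH X \<beta>)"
        using DH.left_coaction_iff_right_action[OF X l(2,1)] \<beta> by simp
      show "N \<in> lrs" using X \<alpha> act yd ll_lr[OF X \<alpha> l(1) act] by (simp add: N)
    next
      fix N assume "N \<in> lrs"
      then obtain X act \<alpha> where N: "N = (X, act, \<alpha>)" and X: "k_algebra k X"
        and \<alpha>: "left_coaction k G X \<alpha>" and act: "right_action k H X act" and yd: "yd_lr_condition k H X act \<alpha>"
        by auto
      obtain \<beta> where \<beta>: "\<beta> \<in> extensional (carrier X)" "linear_map k X (tensor k D X) \<beta>" "induced_action H evH X \<beta> = act"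
        using DH.coaction_of_action[OF X act] by blast
      have "(X, \<alpha>, \<beta>) \<in> lls"
        using X \<alpha> yd ll_lr[OF X \<alpha> \<beta>(2)] DH.left_coaction_iff_right_action[OF X \<beta>(1,2)] act \<beta>(3) by simp
      moreover have "N = omap F\<^sub>3 (X, \<alpha>, \<beta>)" by (simp add: om \<beta>(3) N)
      ultimately show "N \<in> omap F\<^sub>3 ` lls" by (rule rev_image_eqI)
    qed
  qed
  show "fst (omap F\<^sub>3 M) = fst M" if "M \<in> lls" for M
    by (simp add: om split: prod.split)
  show "mmap F\<^sub>3 = (\<lambda>M N f. f)" by (simp add: yd_ll_to_yd_lr_def)
  show "ll_maps M N f \<longleftrightarrow>
      lr_maps (omap F\<^sub>3 M) (omap F\<^sub>3 N) f"
    if M: "M \<in> lls" and N: "N \<in> lls" and f: "algebra_hom k (fst M) (fst N) f" for M N f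
  proof -
    obtain X \<alpha> \<beta> where M': "M = (X, \<alpha>, \<beta>)" by (cases M)
    obtain Y \<alpha>' \<beta>' where N': "N = (Y, \<alpha>', \<beta>')" by (cases N)
    have X: "k_algebra k X" "left_coaction k D X \<beta>" and Y: "k_algebra k Y" "left_coaction k D Y \<beta>'"
      using M N by (auto simp: M' N')
    have "linear_map k X Y f" using algebra_hom_linear[OF f] by (simp add: M' N')
    note iff = DH.commutes_coaction_iff_action[OF k_algebra_module[OF X(1)] k_algebra_module[OF Y(1)] this
        left_coactionD(1)[OF X(2)] left_coactionD(1)[OF Y(2)]]
    show ?thesis unfolding M' N' om prod.case iff by (rule conj_commute)
  qed
qed

text \<open>
  Both actions of \<open>\<omega> \<bowtie> h\<close> on \<open>x\<close> arise by pairing the coaction \<open>\<alpha>\<close> with \<open>\<omega>\<close> and then \<open>\<beta>\<close> with \<open>h\<close>.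
\<close>

lemma square:
  assumes "M \<in> lls"
  shows "omap F\<^sub>2 (omap F\<^sub>1 M) =
    omap F\<^sub>4 (omap F\<^sub>3 M)"
proof -
  obtain X \<alpha> \<beta> where M: "M = (X, \<alpha>, \<beta>)" and X: "k_algebra k X"
    and \<alpha>: "left_coaction k G X \<alpha>" and \<beta>: "left_coaction k D X \<beta>" using assms by auto
  note l\<alpha> = left_coactionD(1)[OF \<alpha>] and l\<beta> = left_coactionD(1)[OF \<beta>]
  note mX = k_algebra_module[OF X]
  have lr: "omap F\<^sub>3 M \<in> lrs"
    by (rule structure_iso.F_in[OF yd_ll_to_yd_lr_iso assms])
  have o: "omap F\<^sub>3 M = (X, induced_action H evH X \<beta>, \<alpha>)"
    by (simp add: M yd_ll_to_yd_lr_def induced_action_evH)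
  have "induced_action Vd PP X (coact_twice k H X \<alpha> \<beta>) x d =
      dot X (induced_action D' evG X \<alpha>) (induced_action H evH X \<beta>) x d"
    if x: "x \<in> carrier X" and d: "d \<in> carrier V" for x d
  proof -
    have "induced_action Vd PP X (coact_twice k H X \<alpha> \<beta>) x d = slice X PP d (coact_twice k H X \<alpha> \<beta> x)"
      using x d by (simp add: DB.induced_action_slice cVd)
    also have "\<dots> = dot X (induced_action D' evG X \<alpha>) (induced_action H evH X \<beta>) x d"
      unfolding slice_coact_twice[OF X l\<alpha> l\<beta> d x] dot_def
    proof (rule sweedler_cong[OF GD.mV mH d])
      fix \<omega> h assume 3: "\<omega> \<in> carrier D'" "h \<in> carrier H"
      have "slice X evG \<omega> (\<alpha> x) \<in> carrier X" by (rule 3 linear_closed[OF l\<alpha> x] mX lin)+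
      then show "slice X evH h (\<beta> (slice X evG \<omega> (\<alpha> x))) =
          induced_action H evH X \<beta> (induced_action D' evG X \<alpha> x \<omega>) h"
        using 3 x by (simp add: DH.induced_action_slice GD.induced_action_slice)
    qed
    finally show ?thesis .
  qed
  then have "induced_action Vd PP X (coact_twice k H X \<alpha> \<beta>) =
      dot_action X (induced_action D' evG X \<alpha>) (induced_action H evH X \<beta>)"
    by (auto simp: dot_action_def fun_eq_iff restrict_def cVd induced_action_def)
  then show ?thesis
    using yd_lr_to_module_omap[of X "induced_action H evH X \<beta>" \<alpha>] lr
    by (simp add: o) (simp add: M comodule_to_module_def yd_ll_to_comodule_def double_pairing_eq)
qed

text \<open>
  By \<open>square\<close>, the functor \<open>F\<^sub>1\<close> followed by the bijection \<open>F\<^sub>2\<close> is the bijection \<open>F\<^sub>3\<close> followed by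
  \<open>F\<^sub>4\<close>.  That \<open>F\<^sub>1\<close> takes values in comodule algebras is seen on the induced action, which \<open>F\<^sub>4\<close> shows to be
  an action of the double.
\<close>

lemma yd_ll_to_comodule_iso:
  "structure_iso k lls fst
    ll_maps
    comods fst comod_maps F\<^sub>1"
proof -
  interpret F2: structure_iso k comods fst comod_maps
    mods fst mod_maps "F\<^sub>2"
    by (rule comodule_to_module_iso)
  interpret F3: structure_iso k lls fst
    ll_maps
    lrs fst
    lr_maps
    "F\<^sub>3"
    by (rule yd_ll_to_yd_lr_iso)
  interpret F4: structure_iso k lrs fst
    lr_maps
    mods fst mod_maps "F\<^sub>4"
    by (rule yd_lr_to_module_iso)
  have om: "omap F\<^sub>1 = (\<lambda>(X, \<alpha>, \<beta>). (X, coact_twice k H X \<alpha> \<beta>))"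
    by (simp add: yd_ll_to_comodule_def)
  have F1_in: "omap F\<^sub>1 M \<in> comods" if M: "M \<in> lls" for M
  proof -
    obtain X \<alpha> \<beta> where M': "M = (X, \<alpha>, \<beta>)" and X: "k_algebra k X"
      and \<alpha>: "left_coaction k G X \<alpha>" and \<beta>: "left_coaction k D X \<beta>" using M by auto
    have "linear_map k X (tensor k T X) (coact_twice k H X \<alpha> \<beta>)"
      by (rule coact_twice_linear[OF X left_coactionD(1)[OF \<alpha>] left_coactionD(1)[OF \<beta>]])
    then have l: "linear_map k X (tensor k Kc X) (coact_twice k H X \<alpha> \<beta>)"
      using linear_same_space[OF same_space_refl tensor_same_space[OF same_Kc same_space_refl]] by blast
    have "omap F\<^sub>2 (omap F\<^sub>1 M) \<in> mods"
      unfolding square[OF M] by (rule F4.F_in[OF F3.F_in[OF M]])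
    then have "right_action k Vd X (induced_action Vd PP X (coact_twice k H X \<alpha> \<beta>))"
      by (simp add: M' om comodule_to_module_def double_pairing_eq)
    then show ?thesis
      using DB.left_coaction_iff_right_action[OF X _ l] X by (simp add: M' om coact_twice_def)
  qed
  show ?thesis
  proof
    show "closed_structure k comods fst comod_maps"
      by (rule F2.source)
    have eq: "(omap F\<^sub>2 \<circ> omap F\<^sub>1) M =
        (omap F\<^sub>4 \<circ> omap F\<^sub>3) M" if "M \<in> lls" for M
      unfolding o_apply by (rule square[OF that])
    have 1: "bij_betw (omap F\<^sub>2 \<circ> omap F\<^sub>1) lls mods"
      by (rule bij_betw_cong[OF eq, THEN iffD2, OF _ bij_betw_trans[OF F3.bij F4.bij]])
    have 2: "omap F\<^sub>1 ` lls \<subseteq> comods" by (rule image_subsetI) (rule F1_in)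
    show "bij_betw (omap F\<^sub>1) lls comods"
      by (rule bij_betw_comp_iff2[OF F2.bij 2, THEN iffD2, OF 1])
    show "fst (omap F\<^sub>1 M) = fst M" if "M \<in> lls" for M
      by (simp add: om split: prod.split)
    show "mmap F\<^sub>1 = (\<lambda>M N f. f)" by (simp add: yd_ll_to_comodule_def)
    show "ll_maps M N f \<longleftrightarrow>
        comod_maps (omap F\<^sub>1 M) (omap F\<^sub>1 N) f"
      if M: "M \<in> lls" and N: "N \<in> lls" and f: "algebra_hom k (fst M) (fst N) f" for M N f
    proof -
      have fst1: "fst (omap F\<^sub>1 L) = fst L" for L by (simp add: om split: prod.split)
      show ?thesis
        using F3.compatible[OF M N f] F4.compatible[OF F3.F_in[OF M] F3.F_in[OF N], of f]
          F2.compatible[OF F1_in[OF M] F1_in[OF N], of f] f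
        by (simp only: square[OF M] square[OF N] F3.alg_eq[OF M] F3.alg_eq[OF N] fst1)
    qed
  qed
qed

end

theorem proposition5p8:
  fixes k :: "'k ring" and H :: "('k, 'h) bialg"
  assumes "field k" and "hopf_algebra k H" and "finite_dimensional k H"
  shows
    "equivalence_of_categories
       (yd_ll k H :: (('k, 'h, 'x) yd_ll_alg, 'x \<Rightarrow> 'x) cat)
       (comodule_algebras k (codouble k H))
       (yd_ll_to_comodule k H) \<and>
     equivalence_of_categories
       (comodule_algebras k (codouble k H) ::
         (('k, ('h, 'h \<Rightarrow> 'k) tens, 'x) comod_alg, 'x \<Rightarrow> 'x) cat)
       (module_algebras k (double k H))
       (comodule_to_module k H) \<and>
     equivalence_of_categories
       (yd_ll k H :: (('k, 'h, 'x) yd_ll_alg, 'x \<Rightarrow> 'x) cat)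
       (yd_lr k H)
       (yd_ll_to_yd_lr k H) \<and>
     equivalence_of_categories
       (yd_lr k H :: (('k, 'h, 'x) yd_lr_alg, 'x \<Rightarrow> 'x) cat)
       (module_algebras k (double k H))
       (yd_lr_to_module k H) \<and>
     functor_eq (yd_ll k H :: (('k, 'h, 'x) yd_ll_alg, 'x \<Rightarrow> 'x) cat)
       (comp_functor (comodule_to_module k H) (yd_ll_to_comodule k H))
       (comp_functor (yd_lr_to_module k H) (yd_ll_to_yd_lr k H))"
proof -
  interpret fd_hopf k H using assms(2,3) by unfold_locales
  show ?thesis
    unfolding yd_ll_def yd_lr_def comodule_algebras_def module_algebras_def
  proof (intro conjI)
    show "functor_eq (structured_algebras k lls fst
        ll_maps)
      (comp_functor (comodule_to_module k H) (yd_ll_to_comodule k H))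
      (comp_functor (yd_lr_to_module k H) (yd_ll_to_yd_lr k H))"
      unfolding functor_eq_def
    proof (intro conjI ballI)
      fix M assume "M \<in> Obj (structured_algebras k lls fst
        ll_maps)"
      then have M: "M \<in> lls" by (simp add: structured_algebras_def)
      show "omap (comp_functor (comodule_to_module k H) (yd_ll_to_comodule k H)) M =
          omap (comp_functor (yd_lr_to_module k H) (yd_ll_to_yd_lr k H)) M"
        unfolding comp_functor_def functor_data.select_convs by (rule square[OF M])
    qed (simp add: comp_functor_def comodule_to_module_def yd_ll_to_comodule_def
        yd_lr_to_module_def yd_ll_to_yd_lr_def)
  qed (rule structure_iso.equivalence yd_ll_to_comodule_iso comodule_to_module_iso
      yd_ll_to_yd_lr_iso yd_lr_to_module_iso)+
qed

end
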